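(* Let $d\ge 2$ be an integer and $\beta_1,\dots,\beta_d\in\mathbb{C}$, and set $\Delta(s)=\prod_{\nu=1}^d\Gamma(\tfrac{s}{2}+\beta_\nu)$. Let $\phi(s)=\sum_{n\ge1}a(n)\lambda_n^{-s}$ and $\psi(s)=\sum_{n\ge1}b(n)\mu_n^{-s}$ be Dirichlet series, where $(\lambda_n)$ and $(\mu_n)$ are strictly increasing sequences of positive reals tending to $\infty$, $a(n)\ge 0$ for all $n$, $b(n)\in\mathbb{C}$, $\phi$ converges absolutely for $\Re(s)>1$ and $\psi$ converges absolutely in some fixed right half-plane. Assume: (1) $\Delta(s)\phi(s)=\Delta(1-s)\psi(1-s)$ in the following sense: there is a meromorphic function $\chi$ on $\mathbb{C}$ with $\chi(\sigma+it)\to 0$ as $|t|\to\infty$ uniformly for $\sigma$ in every compact interval, such that $\chi(s)=\Delta(s)\phi(s)$ for $\Re(s)>c_1$ and $\chi(s)=\Delta(1-s)\psi(1-s)$ for $\Re(s)<c_2$, for some constants $c_1,c_2$; (2) $\phi$ and $\psi$ continue meromorphically to $\mathbb{C}$ and are holomorphic except for (at most) a simple pole at $s=1$; (3) $\widehat{\delta_1}:=\sup_{Z>0}\frac{1}{Z}\sum_{\mu_n<Z}|b(n)|$ is finite. Let $\delta_1:=\operatorname{Res}_{s=1}\phi(s)$. Then for $X$ such that $X^{\frac{d-1}{d+1}}\delta_1^{\frac{d-1}{d+1}}\widehat{\delta_1}^{\frac{2}{d+1}}$ is bounded by the main term $\delta_1 X$, we have \[ \sum_{\lambda_n<X}a(n)=\delta_1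 X+O\!\left(X^{\frac{d-1}{d+1}}\delta_1^{\frac{d-1}{d+1}}\widehat{\delta_1}^{\frac{2}{d+1}}\right), \] where the implied constant depends only on the functional equation (i.e. on $d$ and the $\beta_\nu$) and on the half-planes of absolute convergence, and not otherwise on $\phi$, $\psi$, or the $a(n)$.
   Context: This is the precise form of the paper's informal "well behaved functional equation of degree $d$" hypothesis, as specified by the paper when deducing this theorem: $\delta=1$, all Gamma-factor parameters $\alpha_\nu=\tfrac12$, $N=d$ Gamma factors, and $\phi,\psi$ holomorphic away from simple poles at $s=1$, with $\widehat{\delta_1}$ finite. *)

theory Defs
  imports "HOL-Complex_Analysis.Complex_Analysis"
begin

definition frequencies :: "(nat \<Rightarrow> real) \<Rightarrow> bool" where
  "frequencies l \<longleftrightarrow>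
     (\<forall>n\<ge>1. 0 < l n) \<and> strict_mono_on {1..} l \<and> filterlim l at_top sequentially"

definition dirichlet_term :: "(nat \<Rightarrow> complex) \<Rightarrow> (nat \<Rightarrow> real) \<Rightarrow> complex \<Rightarrow> nat \<Rightarrow> complex" where
  "dirichlet_term c l s n = c n * of_real (l n) powr (- s)"

definition abs_conv_dirichlet ::
  "(complex \<Rightarrow> complex) \<Rightarrow> (nat \<Rightarrow> complex) \<Rightarrow> (nat \<Rightarrow> real) \<Rightarrow> real \<Rightarrow> bool" where
  "abs_conv_dirichlet F c l \<sigma> \<longleftrightarrow>
     (\<forall>s. Re s > \<sigma> \<longrightarrow>
        (\<lambda>n. norm (dirichlet_term c l s n)) summable_on {1..} \<and>
        F s = (\<Sum>\<^sub>\<infinity>n\<in>{1..}. dirichlet_term c l s n))"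

text \<open>The value of \<open>F\<close> at the point 1 is irrelevant: if \<open>F\<close> has no pole there, meromorphy makes
  the singularity removable (and the residue 0).\<close>

definition at_most_simple_pole_at_1 :: "(complex \<Rightarrow> complex) \<Rightarrow> bool" where
  "at_most_simple_pole_at_1 F \<longleftrightarrow>
     F meromorphic_on UNIV \<and> F holomorphic_on (- {1}) \<and> (is_pole F 1 \<longrightarrow> zorder F 1 = - 1)"

definition gamma_factor :: "nat \<Rightarrow> (nat \<Rightarrow> complex) \<Rightarrow> complex \<Rightarrow> complex" where
  "gamma_factor d \<beta> s = (\<Prod>\<nu>=1..d. Gamma (s / 2 + \<beta> \<nu>))"

text \<open>Since \<open>c1\<close> and \<open>c2\<close> are existentially quantified, they may be taken beyond all poles of the
  Gamma factors, so the convention that \<open>Gamma\<close> vanishes at its poles plays no role.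
  On the reals, \<open>at_infinity\<close> is the filter of \<open>\<bar>t\<bar> \<rightarrow> \<infinity>\<close>.\<close>

definition functional_equation ::
  "nat \<Rightarrow> (nat \<Rightarrow> complex) \<Rightarrow> (complex \<Rightarrow> complex) \<Rightarrow> (complex \<Rightarrow> complex) \<Rightarrow> bool" where
  "functional_equation d \<beta> \<phi> \<psi> \<longleftrightarrow>
     (\<exists>\<xi> c1 c2.
        \<xi> meromorphic_on UNIV \<and>
        (\<forall>u v. uniform_limit {u..v} (\<lambda>t \<sigma>. \<xi> (Complex \<sigma> t)) (\<lambda>_. 0) (at_infinity :: real filter)) \<and>
        (\<forall>s. Re s > c1 \<longrightarrow> \<xi> s = gamma_factor d \<beta> s * \<phi> s) \<and>
        (\<forall>s. Re s < c2 \<longrightarrow> \<xi> s = gamma_factor d \<beta> (1 - s) * \<psi> (1 - s)))"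

definition mean_abs :: "(nat \<Rightarrow> complex) \<Rightarrow> (nat \<Rightarrow> real) \<Rightarrow> real \<Rightarrow> real" where
  "mean_abs b \<mu> Z = (1 / Z) * (\<Sum>n | 1 \<le> n \<and> \<mu> n < Z. norm (b n))"

definition delta_hat :: "(nat \<Rightarrow> complex) \<Rightarrow> (nat \<Rightarrow> real) \<Rightarrow> real" where
  "delta_hat b \<mu> = (SUP Z\<in>{0<..}. mean_abs b \<mu> Z)"

text \<open>The residue below is a nonnegative real number in the intended use, where \<open>\<phi>\<close> is given on
  \<open>Re s > 1\<close> by a Dirichlet series with nonnegative coefficients; \<open>Re\<close> only changes the type.\<close>

definition delta1 :: "(complex \<Rightarrow> complex) \<Rightarrow> real" where
  "delta1 \<phi> = Re (residue \<phi> 1)"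

definition error_term :: "nat \<Rightarrow> real \<Rightarrow> real \<Rightarrow> real \<Rightarrow> real" where
  "error_term d \<delta> \<delta>' X =
     X powr ((real d - 1) / (real d + 1)) * \<delta> powr ((real d - 1) / (real d + 1))
       * \<delta>' powr (2 / (real d + 1))"

end

theory Submission
  imports Defs
begin

text \<open>Put \<open>G(s) = \<Delta>(1 - s) / \<Delta>(s)\<close>, so that \<open>\<phi>(s) = G(s) \<psi>(1 - s)\<close>. The summatory function of \<open>a(n)\<close>,
  smoothed over windows of relative width \<open>1/T\<close>, is a Perron integral. Moving the line of integration
  to \<open>Re s = -\<eta>\<close> produces the main term \<open>\<delta>\<^sub>1 X\<close>, the term \<open>\<phi>(0) = O(D)\<close> with \<open>D\<close> the bound of
  hypothesis (3), and for each \<open>n\<close> an integral of \<open>G(s) (\<mu>\<^sub>n X)\<^sup>s / s\<close> against the smoothing kernel. By Stirling's formula the phase of \<open>G\<close> behaves like \<open>d t ln t\<close>,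
  and van der Corput's estimate bounds the integral by \<open>T\<^bsup>(d-1)/2\<^esup> min (Z\<^bsup>\<eta>\<^esup>) (Z\<^bsup>-\<eta>\<^esup>)\<close> with \<open>Z = \<mu>\<^sub>n X / T\<^sup>d\<close>; summed against
  \<open>b(n)/\<mu>\<^sub>n\<close> this is \<open>O(D T\<^bsup>(d-1)/2\<^esup>)\<close>. Since \<open>a(n) \<ge> 0\<close>, the smoothing costs \<open>O(\<delta>\<^sub>1 X / T)\<close>, and
  \<open>T = (\<delta>\<^sub>1 X / D)\<^bsup>2/(d+1)\<^esup>\<close> balances the two errors.

  Poles of \<open>G\<close> on the imaginary axis away from 0 would destroy the uniformity of this estimate. They are
  cancelled by factors \<open>1 + e\<^bsup>\<tau>s\<^esup>\<close>, which replaces the summatory function \<open>N(y)\<close> of \<open>y = ln X\<close> by a sum of its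
  translates; the estimate for \<open>N\<close> itself follows by inverting these difference operators. If \<open>G\<close> does not vanish at 0,
  then \<open>\<delta>\<^sub>1 = 0\<close>. If \<open>\<delta>\<^sub>1\<close> or \<open>D\<close> vanishes, then all coefficients vanish: for \<open>\<delta>\<^sub>1 = 0\<close>, moving the line
  arbitrarily far to the left shows that the series \<open>\<phi>\<close> converges everywhere, which bounds \<open>\<phi>\<close> on vertical
  lines, whereas \<open>G\<close> is unbounded there and \<open>\<psi>\<close> is dominated by its first nonzero term.\<close>

section \<open>Stirling's formula for the complex Gamma function\<close>

text \<open>The bound must not depend on the size of \<open>\<mu> 1\<close>. On the line
  \<open>Re s = -\<eta>\<close> alone, the terms with \<open>\<mu>\<^sub>n X\<close> far below
  \<open>T\<^sup>d\<close> would cost a power of that ratio; for these the single integral is moved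
  to \<open>Re s = \<eta>\<close>, where the estimate decays in the opposite direction. The move
  crosses the imaginary axis. A pole \<open>i t\<close> of G there, with t different from 0, would
  leave a residue that does not decay in Z for any \<eta>. With \<open>\<tau> = pi / |t|\<close> the
  factor \<open>1 + exp (\<tau> * s)\<close> vanishes at that point, and \<tau> depends on the
  \<beta> only. The point 0 is different: the Perron kernel itself has a pole there, which is
  harmless because a pole of \<open>\<phi>\<close> at 1 forces G to vanish at 0. The condition
  \<open>d \<ge> 2\<close> acts twice. It keeps \<open>d * (1/2 - \<eta>)\<close> above 1/2, so that
  heights near T dominate the oscillatory integral; and it makes the exponent
  \<open>(d - 1) / (d + 1)\<close> positive, so that the errors of the inversion add up like a
  geometric series dominated by its last term. The condition on X provides
  \<open>T \<ge> 1\<close>.\<close>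

lemma Ln_approx_quadratic:
  fixes u :: complex
  assumes "norm u \<le> 1/2"
  shows "norm (Ln (1 + u) - u + u\<^sup>2 / 2) \<le> 2 * norm u ^ 3"
proof -
  define f where "f = (\<lambda>u::complex. Ln (1 + u) - u + u\<^sup>2 / 2)"
  have nz: "1 + z \<notin> \<real>\<^sub>\<le>\<^sub>0" if "z \<in> cball 0 (norm u)" for z :: complex
  proof -
    have "norm z \<le> 1/2" using that assms by simp
    hence "Re (1 + z) > 0" using abs_Re_le_cmod[of z] by (simp add: abs_if split: if_splits)
    thus ?thesis by (auto simp: complex_nonpos_Reals_iff)
  qed
  have "norm (f u - f 0) \<le> (2 * norm u ^ 2) * norm (u - 0)"
  proof (rule field_differentiable_bound[of "cball 0 (norm u)" f "\<lambda>z. z\<^sup>2 / (1 + z)"])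
    fix z :: complex assume z: "z \<in> cball 0 (norm u)"
    hence "1 + z \<noteq> 0" using nz by fastforce
    have e: "1 / (1 + z) - 1 + z = z\<^sup>2 / (1 + z)" 
      using \<open>1 + z \<noteq> 0\<close> by (simp add: field_simps power2_eq_square)
    have "(f has_field_derivative (1 / (1 + z) - 1 + z)) (at z within cball 0 (norm u))"
      unfolding f_def using nz[OF z]
      by (auto intro!: derivative_eq_intros simp: field_simps)
    thus "(f has_field_derivative z\<^sup>2 / (1 + z)) (at z within cball 0 (norm u))" using e by simp
    have zu: "norm z \<le> norm u" using z by simp
    have "norm (1 + z) \<ge> 1/2"
      using norm_triangle_ineq2[of 1 "-z"] zu assms by (simp add: norm_minus_commute)
    hence "norm z ^ 2 / norm (1 + z) \<le> norm u ^ 2 / (1/2)"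
      using zu by (intro frac_le power_mono) auto
    thus "norm (z\<^sup>2 / (1 + z)) \<le> 2 * norm u ^ 2"
      by (simp add: norm_divide norm_power)
  qed auto
  thus ?thesis by (simp add: f_def power2_eq_square power3_eq_cube mult_ac)
qed

text \<open>Off the ray from 0 to minus infinity, \<open>s\<close> and \<open>s + 1\<close> lie on
  the same side of the real axis or are both positive, so their arguments differ by less than pi and
  no multiple of \<open>2 * pi * \<i>\<close> has to be added.\<close>

lemma Ln_add_one_diff:
  fixes s :: complex
  assumes "Im s \<noteq> 0 \<or> Re s > 0"
  shows "Ln (s + 1) - Ln s = Ln (1 + 1 / s)"
proof -
  have nz: "s \<noteq> 0" "s + 1 \<noteq> 0" using assms by (auto simp: complex_eq_iff)
  have a: "\<bar>Im (Ln (s+1)) - Im (Ln s)\<bar> < pi"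
  proof (cases "Im s = 0")
    case True
    hence "Re s > 0" using assms by simp
    hence "Im (Ln s) = 0" "Im (Ln (s + 1)) = 0" using True nz
      by (auto simp: Im_Ln_eq_0)
    thus ?thesis by simp
  next
    case False
    show ?thesis
    proof (cases "Im s > 0")
      case True
      thus ?thesis using Im_Ln_pos_lt_imp[of s] Im_Ln_pos_lt_imp[of "s+1"] by (simp add: abs_if)
    next
      case F: False
      hence "Im s < 0" using False by simp
      hence "0 > Im (Ln s)" "0 > Im (Ln (s+1))"
        using Im_Ln_pos_le[OF nz(1)] Im_Ln_pos_le[OF nz(2)] Im_Ln_le_pi[OF nz(1)] Im_Ln_le_pi[OF nz(2)] by (auto simp: not_less)
      thus ?thesis using mpi_less_Im_Ln[OF nz(1)] mpi_less_Im_Ln[OF nz(2)] by simp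
    qed
  qed
  have "Ln ((s + 1) / s) = Ln (s + 1) - Ln s"
    by (rule Ln_unique) (use nz a in \<open>auto simp: exp_diff\<close>)
  thus ?thesis using nz by (simp add: add_divide_distrib add.commute)
qed

text \<open>Stirling's approximation up to the constant factor \<open>sqrt (2 * pi)\<close>, which
  appears below as an unspecified nonzero limit \<open>c\<close>.\<close>

definition stirling_main :: "complex \<Rightarrow> complex" where
  "stirling_main s = exp ((s - 1/2) * Ln s - s)"

text \<open>A logarithm of the factor by which \<open>Gamma / stirling_main\<close> changes from
  \<open>s\<close> to \<open>s + 1\<close>.\<close>

definition stirling_inc :: "complex \<Rightarrow> complex" where
  "stirling_inc s = 1 - (s + 1/2) * (Ln (s + 1) - Ln s)"

text \<open>With \<open>u = 1 / s\<close>, the half in \<open>s + 1/2\<close> is what cancels the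
  linear terms of \<open>(s + 1/2) * Ln (1 + u)\<close>. What is left is
  \<open>u\<^sup>2 / 4\<close> and \<open>s + 1/2\<close> times a cubic remainder, together at most
  \<open>11/4 * norm u ^ 2\<close>. This makes the increments summable along
  \<open>s, s + 1, ...\<close>.\<close>

lemma norm_stirling_inc_le:
  assumes "Im s \<noteq> 0 \<or> Re s > 0" "norm s \<ge> 2"
  shows "norm (stirling_inc s) \<le> 3 / norm s ^ 2"
proof -
  define u where "u = 1 / s"
  have s0: "s \<noteq> 0" using assms by auto
  have u: "norm u \<le> 1/2" using assms(2) by (simp add: u_def norm_divide divide_simps)
  define E where "E = Ln (1 + u) - u + u\<^sup>2 / 2"
  have E: "norm E \<le> 2 * norm u ^ 3" unfolding E_def by (rule Ln_approx_quadratic[OF u])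
  have su: "s * u = 1" using s0 by (simp add: u_def)
  have "stirling_inc s = 1 - (s + 1/2) * (u - u\<^sup>2/2 + E)"
    unfolding stirling_inc_def Ln_add_one_diff[OF assms(1)] E_def u_def by simp
  also have "\<dots> = u\<^sup>2 / 4 - (s + 1/2) * E"
  proof -
    have "(s + 1/2) * (u - u\<^sup>2/2) = s * u - (s * u) * u / 2 + u / 2 - u\<^sup>2 / 4"
      by (simp add: field_simps power2_eq_square)
    also have "\<dots> = 1 - u\<^sup>2 / 4" by (simp add: su)
    finally have *: "(s + 1/2) * (u - u\<^sup>2/2) = 1 - u\<^sup>2 / 4" .
    show ?thesis unfolding distrib_left[of "s + 1/2"] * by simp
  qed
  finally have "norm (stirling_inc s) \<le> norm (u\<^sup>2 / 4) + norm ((s + 1/2) * E)"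
    by (metis norm_triangle_ineq4)
  also have "norm ((s + 1/2) * E) \<le> (norm s + 1/2) * (2 * norm u ^ 3)"
    unfolding norm_mult using norm_triangle_ineq[of s "1/2"] E by (intro mult_mono) auto
  also have "(norm s + 1/2) * (2 * norm u ^ 3) = 2 * norm (s * u) * norm u ^ 2 + norm u ^ 2 * norm u"
    by (simp add: algebra_simps power2_eq_square power3_eq_cube norm_mult)
  also have "\<dots> \<le> 2 * norm u ^ 2 + norm u ^ 2 * (1/2)"
    unfolding su using u by (intro add_mono mult_left_mono) auto
  finally have "norm (stirling_inc s) * 4 \<le> 11 * norm u ^ 2" 
    by (simp add: norm_power)
  hence "norm (stirling_inc s) \<le> 3 * norm u ^ 2" using zero_le_power2[of "norm u"] by linarith
  thus ?thesis by (simp add: u_def norm_divide power_divide)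
qed

lemma Gamma_stirling_step:
  assumes "Im s \<noteq> 0 \<or> Re s > 0"
  shows "Gamma (s + 1) / stirling_main (s + 1) = Gamma s / stirling_main s * exp (stirling_inc s)"
proof -
  have nz: "s \<noteq> 0" "s + 1 \<noteq> 0" using assms by (auto simp: complex_eq_iff)
  have "s \<notin> \<int>\<^sub>\<le>\<^sub>0" using assms by (auto elim!: nonpos_Ints_cases)
  hence "Gamma (s + 1) = s * Gamma s" by (intro Gamma_plus1)
  moreover have "s * stirling_main s * exp (- stirling_inc s) = stirling_main (s + 1)"
  proof -
    have "s * stirling_main s * exp (- stirling_inc s) =
       exp (Ln s) * stirling_main s * exp (- stirling_inc s)" using nz by simp
    also have "\<dots> = stirling_main (s + 1)"
      unfolding stirling_main_def stirling_inc_def exp_add[symmetric] 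
      by (intro arg_cong[where f = exp]) (simp add: algebra_simps)
    finally show ?thesis .
  qed
  ultimately show ?thesis
    by (simp add: stirling_main_def exp_minus field_simps flip: \<open>_ = stirling_main (s+1)\<close>)
qed

lemma Gamma_stirling_steps:
  assumes "Im s \<noteq> 0 \<or> Re s > 0"
  shows "Gamma (s + of_nat n) / stirling_main (s + of_nat n) = 
           Gamma s / stirling_main s * exp (\<Sum>j<n. stirling_inc (s + of_nat j))"
proof (induction n)
  case (Suc n)
  show ?case 
    using Gamma_stirling_step[of "s + of_nat n"] Suc assms
    by (auto simp: exp_add add_ac)
qed auto

text \<open>Gauss's limit formula for \<open>Gamma_series\<close>, with \<open>pochhammer\<close>
  expressed by values of Gamma.\<close>

lemma tendsto_Gamma_shift:
  fixes s :: complex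
  assumes "s \<notin> \<int>\<^sub>\<le>\<^sub>0"
  shows "(\<lambda>n. Gamma (s + of_nat (Suc n)) / (fact n * exp (s * of_real (ln (real n))))) \<longlonglongrightarrow> 1"
proof -
  have "Gamma s \<noteq> 0" using assms by (simp add: Gamma_eq_zero_iff)
  hence "(\<lambda>n. Gamma s / Gamma_series s n) \<longlonglongrightarrow> Gamma s / Gamma s"
    by (intro tendsto_intros)
  moreover have "Gamma s / Gamma_series s n = Gamma (s + of_nat (Suc n)) / (fact n * exp (s * of_real (ln (real n))))" for n
    using pochhammer_Gamma[OF assms, of "Suc n"] \<open>Gamma s \<noteq> 0\<close>
    by (simp add: Gamma_series_def)
  ultimately show ?thesis using \<open>Gamma s \<noteq> 0\<close> by simp
qed

text \<open>In the exponent everything cancels except \<open>s - N * Ln (1 + s / N)\<close> with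
  \<open>N = Suc n\<close> and terms that vanish in the limit, and \<open>N * Ln (1 + s / N)\<close>
  tends to \<open>s\<close>.\<close>

lemma tendsto_stirling_main_shift:
  fixes s :: complex
  shows "(\<lambda>n. stirling_main (of_nat (Suc n)) * exp (s * of_real (ln (real n))) / stirling_main (s + of_nat (Suc n))) \<longlonglongrightarrow> 1"
proof -
  define E where "E = (\<lambda>n. - (s + of_nat (Suc n) - 1/2) * Ln (1 + s / of_nat (Suc n)) + s + s * of_real (ln (real n) - ln (real (Suc n))))"
  have e: "eventually (\<lambda>n. exp (E n) = stirling_main (of_nat (Suc n)) * exp (s * of_real (ln (real n))) / stirling_main (s + of_nat (Suc n))) sequentially"
    using eventually_gt_at_top[of "nat \<lceil>norm s\<rceil>"]
  proof eventually_elim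
    case (elim n)
    have n: "norm s < real (Suc n)" using elim by linarith
    have nz: "1 + s / of_nat (Suc n) \<noteq> 0"
    proof
      assume "1 + s / of_nat (Suc n) = 0"
      hence "s = - of_nat (Suc n)" by (simp add: field_simps add_eq_0_iff del: of_nat_Suc)
      hence "norm s = real (Suc n)" by (metis norm_minus_cancel norm_of_nat)
      thus False using n by simp
    qed
    have "Ln (s + of_nat (Suc n)) = Ln (of_real (real (Suc n)) * (1 + s / of_nat (Suc n)))"
      by (rule arg_cong[where f = Ln]) (simp add: distrib_left del: of_nat_Suc)
    also have "\<dots> = of_real (ln (real (Suc n))) + Ln (1 + s / of_nat (Suc n))"
      using Ln_times_of_real[of "real (Suc n)" "1 + s / of_nat (Suc n)"] nz Ln_of_real[of "real (Suc n)"]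
      by (simp del: of_nat_Suc)
    finally have 1: "Ln (s + of_nat (Suc n)) = of_real (ln (real (Suc n))) + Ln (1 + s / of_nat (Suc n))" .
    have 2: "Ln (of_nat (Suc n)) = of_real (ln (real (Suc n)))"
      by (metis Ln_of_real of_nat_0_less_iff of_real_of_nat_eq zero_less_Suc)
    show ?case unfolding stirling_main_def 1 2 E_def exp_add[symmetric] exp_diff[symmetric]
      by (intro arg_cong[where f = exp]) (simp add: algebra_simps del: of_nat_Suc)
  qed
  have "E \<longlonglongrightarrow> - s + s + s * of_real 0"
    unfolding E_def
  proof (intro tendsto_intros)
    show "(\<lambda>n. ln (real n) - ln (real (Suc n))) \<longlonglongrightarrow> 0"
    proof -
      have "(\<lambda>n. ln (real n / real (Suc n))) \<longlonglongrightarrow> ln 1"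
        by (intro tendsto_ln LIMSEQ_n_over_Suc_n) auto
      moreover have "eventually (\<lambda>n. ln (real n / real (Suc n)) = ln (real n) - ln (real (Suc n))) sequentially"
        using eventually_gt_at_top[of 0] by eventually_elim (simp add: ln_div)
      ultimately show ?thesis using Lim_transform_eventually by fastforce
    qed
    have L: "(\<lambda>n. of_nat (Suc n) * Ln (1 + s / of_nat (Suc n))) \<longlonglongrightarrow> s"
    proof -
      have b: "eventually (\<lambda>n. norm (of_nat (Suc n) * Ln (1 + s / of_nat (Suc n)) - s) \<le> 2 * norm s ^ 2 / real (Suc n)) sequentially"
        using eventually_gt_at_top[of "nat \<lceil>2 * norm s\<rceil>"]
      proof eventually_elim
        case (elim n)
        define v where "v = s / of_nat (Suc n)"
        have v: "norm v \<le> 1/2" using elim by (simp add: v_def norm_divide field_simps del: of_nat_Suc) linarith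
        have "norm (Ln (1 + v) - v) \<le> norm v ^ 2 / (1 - norm v)"
          using v by (intro Ln_approx_linear) auto
        also have "\<dots> \<le> norm v ^ 2 / (1/2)" using v by (intro divide_left_mono) auto
        finally have "norm (of_nat (Suc n) * (Ln (1 + v) - v)) \<le> real (Suc n) * (2 * norm v ^ 2)"
          unfolding norm_mult by (intro mult_mono) (auto simp del: of_nat_Suc)
        moreover have "of_nat (Suc n) * (Ln (1 + v) - v) = of_nat (Suc n) * Ln (1 + s / of_nat (Suc n)) - s"
          by (simp add: v_def algebra_simps del: of_nat_Suc)
        ultimately show ?case by (simp add: v_def norm_divide power2_eq_square del: of_nat_Suc)
      qed
      have "(\<lambda>n. 2 * norm s ^ 2 / real (Suc n)) \<longlonglongrightarrow> 0"
        using LIMSEQ_Suc[OF lim_const_over_n[of "2 * norm s ^ 2"]] by simp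
      from Lim_null_comparison[OF b this] show ?thesis by (simp add: LIM_zero_iff)
    qed
    have "(\<lambda>n. 1 + s / of_nat (Suc n)) \<longlonglongrightarrow> 1 + 0"
      using LIMSEQ_Suc[OF lim_const_over_n[of s]] by (intro tendsto_add tendsto_const) 
    hence "(\<lambda>n. Ln (1 + s / of_nat (Suc n))) \<longlonglongrightarrow> Ln 1" by (intro tendsto_Ln) auto
    hence "(\<lambda>n. (s - 1/2) * Ln (1 + s / of_nat (Suc n)) + of_nat (Suc n) * Ln (1 + s / of_nat (Suc n))) \<longlonglongrightarrow> (s - 1/2) * 0 + s"
      using L by (intro tendsto_intros) auto
    hence "(\<lambda>n. (s + of_nat (Suc n) - 1/2) * Ln (1 + s / of_nat (Suc n))) \<longlonglongrightarrow> s"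
      by (simp add: algebra_simps del: of_nat_Suc)
    thus "(\<lambda>n. - (s + of_nat (Suc n) - 1/2) * Ln (1 + s / of_nat (Suc n))) \<longlonglongrightarrow> - s"
      unfolding minus_mult_left[symmetric] by (rule tendsto_minus)
  qed
  hence "(\<lambda>n. exp (E n)) \<longlonglongrightarrow> exp 0" by (intro tendsto_exp) simp
  thus ?thesis using Lim_transform_eventually[OF _ e] by simp
qed

text \<open>Convergence is proved along the integers, where the increments are summable. For other
  \<open>s\<close> the quotient at \<open>s + N\<close> is the integer one times two factors tending
  to 1, by Gauss's formula. Hence \<open>c\<close> is the same for all \<open>s\<close> off the real
  axis, which the increments along \<open>s + N\<close> alone would not show.\<close>

lemma Gamma_over_stirling_main_limit:
  "\<exists>c. c \<noteq> 0 \<and> (\<forall>s. Im s \<noteq> 0 \<longrightarrow>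
      (\<lambda>n. Gamma (s + of_nat (Suc n)) / stirling_main (s + of_nat (Suc n))) \<longlonglongrightarrow> c)"
proof -
  \<comment> \<open>The sequence starts at 2 since the bound on the increments asks for norm at
    least 2.\<close>
  have sm: "summable (\<lambda>j. stirling_inc (2 + of_nat j))"
  proof (rule summable_norm_cancel, rule summable_comparison_test')
    show "summable (\<lambda>j. 3 * (1 / real (Suc j) ^ 2))"
      using summable_Suc_iff[of "\<lambda>j. 1 / real j ^ 2"] inverse_power_summable[of 2, where ?'a = real]
      by (intro summable_mult) (simp add: field_simps)
    fix j :: nat
    have n: "norm (2 + of_nat j :: complex) = 2 + real j"
      by (metis of_nat_add of_nat_numeral norm_of_nat)
    have "norm (stirling_inc (2 + of_nat j)) \<le> 3 / norm (2 + of_nat j :: complex) ^ 2"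
      by (rule norm_stirling_inc_le) (auto simp: n)
    also have "\<dots> \<le> 3 * (1 / real (Suc j) ^ 2)"
      unfolding n by (simp add: frac_le power_mono)
    finally show "norm (norm (stirling_inc (2 + of_nat j))) \<le> 3 * (1 / real (Suc j) ^ 2)" by simp
  qed
  define c where "c = Gamma 2 / stirling_main 2 * exp (\<Sum>j. stirling_inc (2 + of_nat j))"
  have "Gamma (2::complex) \<noteq> 0" by (simp add: Gamma_numeral)
  hence c: "c \<noteq> 0" by (auto simp: c_def stirling_main_def)
  have "(\<lambda>n. Gamma 2 / stirling_main 2 * exp (\<Sum>j<n. stirling_inc (2 + of_nat j))) \<longlonglongrightarrow> c"
    unfolding c_def using sm by (intro tendsto_intros summable_LIMSEQ)
  hence "(\<lambda>n. Gamma (2 + of_nat n) / stirling_main (2 + of_nat n)) \<longlonglongrightarrow> c"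
    by (subst Gamma_stirling_steps) auto
  hence "(\<lambda>n. Gamma (of_nat (Suc (Suc n))) / stirling_main (of_nat (Suc (Suc n)))) \<longlonglongrightarrow> c"
    by (simp add: add_ac)
  hence cn: "(\<lambda>n. Gamma (of_nat (Suc n)) / stirling_main (of_nat (Suc n))) \<longlonglongrightarrow> c"
    by (rule LIMSEQ_imp_Suc)
  have "(\<lambda>n. Gamma (s + of_nat (Suc n)) / stirling_main (s + of_nat (Suc n))) \<longlonglongrightarrow> c" if "Im s \<noteq> 0" for s
  proof -
    have s: "s \<notin> \<int>\<^sub>\<le>\<^sub>0" using that by (auto elim!: nonpos_Ints_cases)
    have "(\<lambda>n. (Gamma (of_nat (Suc n)) / stirling_main (of_nat (Suc n))) *
       ((Gamma (s + of_nat (Suc n)) / (fact n * exp (s * of_real (ln (real n))))) *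
       (stirling_main (of_nat (Suc n)) * exp (s * of_real (ln (real n))) / stirling_main (s + of_nat (Suc n)))))
        \<longlonglongrightarrow> c * (1 * 1)"
      by (intro tendsto_mult cn tendsto_Gamma_shift[OF s] tendsto_stirling_main_shift)
    moreover have "(Gamma (of_nat (Suc n)) / stirling_main (of_nat (Suc n))) *
       ((Gamma (s + of_nat (Suc n)) / (fact n * exp (s * of_real (ln (real n))))) *
       (stirling_main (of_nat (Suc n)) * exp (s * of_real (ln (real n))) / stirling_main (s + of_nat (Suc n))))
       = Gamma (s + of_nat (Suc n)) / stirling_main (s + of_nat (Suc n))" for n
    proof -
      have "Gamma (of_nat (Suc n)) = (fact n :: complex)" using Gamma_fact[of n, where ?'a = complex] by (simp add: add_ac)
      moreover have "stirling_main (of_nat (Suc n)) \<noteq> 0" by (simp add: stirling_main_def)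
      ultimately show ?thesis by (simp del: of_nat_Suc)
    qed
    ultimately show ?thesis by simp
  qed
  thus ?thesis using c by blast
qed

text \<open>Telescoping: with \<open>x = real j + t\<close>, each term is at most
  \<open>1 / (x - 1) - 1 / x\<close>.\<close>

lemma sum_inverse_square_shift_le:
  fixes t :: real
  assumes "t \<ge> 2"
  shows "(\<Sum>j<n. 1 / (real j + t)^2) \<le> 2 / t"
proof -
  have "(\<Sum>j<n. 1 / (real j + t)^2) \<le> 1 / (t - 1) - 1 / (real n + t - 1)"
  proof (induction n)
    case (Suc n)
    have "1 / (real n + t)^2 \<le> 1 / ((real n + t - 1) * (real n + t))"
      using assms by (intro divide_left_mono) (auto simp: power2_eq_square intro!: mult_right_mono)
    also have "\<dots> = 1 / (real n + t - 1) - 1 / (real n + t)"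
      using assms by (simp add: field_simps)
    finally show ?case using Suc by (simp add: algebra_simps)
  qed auto
  also have "\<dots> \<le> 1 / (t - 1)" using assms by simp
  also have "\<dots> \<le> 2 / t" using assms by (simp add: field_simps)
  finally show ?thesis .
qed

text \<open>Running the increments from \<open>s\<close> to infinity gives
  \<open>Gamma s = c * stirling_main s * exp (- S)\<close>, and S is O(1/|\<tau>|) because
  \<open>s + j\<close> has norm of the order \<open>j + |\<tau>|\<close>. The logarithm is then
  taken at the purely imaginary point \<open>\<i> * \<tau>\<close>, where its parts are explicit;
  \<open>x\<close> is a bounded displacement in which the estimate is uniform.\<close>

theorem Gamma_stirling:
  "\<exists>c. c \<noteq> 0 \<and> (\<forall>K. \<exists>C R. \<forall>(x::complex) \<tau>. norm x \<le> K \<and> \<bar>\<tau>\<bar> \<ge> R \<longrightarrow>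
      (\<exists>e. norm e \<le> C / \<bar>\<tau>\<bar> \<and> Gamma (x + \<i> * of_real \<tau>) =
          c * exp ((x + \<i> * of_real \<tau> - 1/2) * Ln (\<i> * of_real \<tau>) - \<i> * of_real \<tau> + e)))"
proof -
  obtain c where c: "c \<noteq> 0" and lim: "\<And>s. Im s \<noteq> 0 \<Longrightarrow>
      (\<lambda>n. Gamma (s + of_nat (Suc n)) / stirling_main (s + of_nat (Suc n))) \<longlonglongrightarrow> c"
    using Gamma_over_stirling_main_limit by blast
  have "\<exists>C R. \<forall>(x::complex) \<tau>. norm x \<le> K \<and> \<bar>\<tau>\<bar> \<ge> R \<longrightarrow>
      (\<exists>e. norm e \<le> C / \<bar>\<tau>\<bar> \<and> Gamma (x + \<i> * of_real \<tau>) =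
          c * exp ((x + \<i> * of_real \<tau> - 1/2) * Ln (\<i> * of_real \<tau>) - \<i> * of_real \<tau> + e))" for K
  \<comment> \<open>The three summands of the constant come from
    \<open>(x - 1/2) * Ln (1 + v)\<close>, from \<open>\<i> * \<tau> * (Ln (1 + v) - v)\<close> and
    from the sum of the increments. The threshold for \<tau> makes
    \<open>v = x / (\<i> * \<tau>)\<close> at most 1/4 in norm.\<close>
  proof (rule exI[of _ "(2*K+1)*K + 2 * K^2 + 48"], rule exI[of _ "4 * \<bar>K\<bar> + 4"], intro allI impI)
    fix x :: complex and \<tau> :: real
    assume H: "norm x \<le> K \<and> \<bar>\<tau>\<bar> \<ge> 4 * \<bar>K\<bar> + 4"
    hence K: "K \<ge> 0" and x: "norm x \<le> K" and t: "\<bar>\<tau>\<bar> \<ge> 4 * K + 4"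
      using norm_ge_zero[of x] by linarith+
    define s where "s = x + \<i> * of_real \<tau>"
    have ims: "Im s \<noteq> 0"
      using abs_Im_le_cmod[of x] x t K by (auto simp: s_def)
    have ns: "norm (s + of_nat j) ^ 2 \<ge> (real j + \<bar>\<tau>\<bar>)^2 / 8" "norm (s + of_nat j) \<ge> 2" for j
    proof -
      have a: "norm (of_nat j + \<i> * of_real \<tau>) ^ 2 = real j ^ 2 + \<tau> ^ 2"
        by (simp add: cmod_power2)
      have b: "norm (of_nat j + \<i> * of_real \<tau>) \<ge> \<bar>\<tau>\<bar>"
        using abs_Im_le_cmod[of "of_nat j + \<i> * of_real \<tau>"] by simp
      have "norm (s + of_nat j) \<ge> norm (of_nat j + \<i> * of_real \<tau>) - norm x"
        unfolding s_def by (metis add.assoc add.commute norm_diff_ineq)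
      hence d: "norm (s + of_nat j) \<ge> norm (of_nat j + \<i> * of_real \<tau>) / 2"
        using b x t by linarith
      thus "norm (s + of_nat j) \<ge> 2" using b t K by linarith
      have "(real j + \<bar>\<tau>\<bar>)^2 / 8 \<le> (real j ^ 2 + \<tau> ^ 2) / 4"
        using sum_squares_bound[of "real j" "\<bar>\<tau>\<bar>"] by (simp add: power2_sum)
      also have "\<dots> = (norm (of_nat j + \<i> * of_real \<tau>) / 2) ^ 2"
        using a by (simp add: power_divide)
      also have "\<dots> \<le> norm (s + of_nat j) ^ 2" using d by (intro power_mono) auto
      finally show "norm (s + of_nat j) ^ 2 \<ge> (real j + \<bar>\<tau>\<bar>)^2 / 8" .
    qed
    have si: "norm (stirling_inc (s + of_nat j)) \<le> 24 * (1 / (real j + \<bar>\<tau>\<bar>)^2)" for j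
    proof -
      have "norm (stirling_inc (s + of_nat j)) \<le> 3 / norm (s + of_nat j) ^ 2"
        using ims ns by (intro norm_stirling_inc_le) auto
      also have "\<dots> \<le> 3 / ((real j + \<bar>\<tau>\<bar>)^2 / 8)"
        using ns[of j] t K by (intro divide_left_mono mult_pos_pos) auto
      finally show ?thesis by simp
    qed
    have sp: "norm (\<Sum>j<n. stirling_inc (s + of_nat j)) \<le> 48 / \<bar>\<tau>\<bar>" for n
    proof -
      have "norm (\<Sum>j<n. stirling_inc (s + of_nat j)) \<le> (\<Sum>j<n. 24 * (1 / (real j + \<bar>\<tau>\<bar>)^2))"
        by (intro sum_norm_le si)
      also have "\<dots> = 24 * (\<Sum>j<n. (1 / (real j + \<bar>\<tau>\<bar>)^2))"
        by (rule sum_distrib_left [symmetric])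
      also have "\<dots> \<le> 24 * (2 / \<bar>\<tau>\<bar>)" using t K
        by (intro mult_left_mono sum_inverse_square_shift_le) auto
      finally show ?thesis by simp
    qed
    have "summable (\<lambda>j. norm (stirling_inc (s + of_nat j)))"
    proof (rule summable_comparison_test')
      show "summable (\<lambda>j. 24 * (1 / (real j + \<bar>\<tau>\<bar>)^2))"
      proof (rule summable_mult, rule bounded_imp_summable)
        show "0 \<le> 1 / (real j + \<bar>\<tau>\<bar>)^2" for j by simp
        show "(\<Sum>j\<le>n. 1 / (real j + \<bar>\<tau>\<bar>)^2) \<le> 2 / \<bar>\<tau>\<bar>" for n
          using sum_inverse_square_shift_le[of "\<bar>\<tau>\<bar>" "Suc n"] t K by (simp add: lessThan_Suc_atMost)
      qed
      show "norm (norm (stirling_inc (s + of_nat j))) \<le> 24 * (1 / (real j + \<bar>\<tau>\<bar>)^2)" for j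
        using si by simp
    qed
    hence sm: "summable (\<lambda>j. stirling_inc (s + of_nat j))" by (rule summable_norm_cancel)
    define S where "S = (\<Sum>j. stirling_inc (s + of_nat j))"
    have S: "norm S \<le> 48 / \<bar>\<tau>\<bar>"
      unfolding S_def using summable_LIMSEQ[OF sm] sp
      by (intro tendsto_upperbound[OF tendsto_norm]) auto
    have "(\<lambda>n. Gamma s / stirling_main s * exp (\<Sum>j<n. stirling_inc (s + of_nat j))) \<longlonglongrightarrow> Gamma s / stirling_main s * exp S"
      unfolding S_def using sm by (intro tendsto_intros summable_LIMSEQ)
    hence "(\<lambda>n. Gamma (s + of_nat n) / stirling_main (s + of_nat n)) \<longlonglongrightarrow> Gamma s / stirling_main s * exp S"
      by (subst Gamma_stirling_steps) (use ims in auto)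
    from LIMSEQ_Suc[OF this] have "c = Gamma s / stirling_main s * exp S"
      using lim[OF ims] LIMSEQ_unique by blast
    hence G: "Gamma s = c * stirling_main s * exp (- S)"
      by (simp add: stirling_main_def exp_minus field_simps)
    define v where "v = x / (\<i> * of_real \<tau>)"
    have t0: "\<tau> \<noteq> 0" using t K by auto
    have nv: "norm v = norm x / \<bar>\<tau>\<bar>" by (simp add: v_def norm_divide norm_mult)
    have v: "norm v \<le> K / \<bar>\<tau>\<bar>" unfolding nv using x by (intro divide_right_mono) auto
    also have v4: "K / \<bar>\<tau>\<bar> \<le> 1/4" using t K by (simp add: field_simps)
    finally have v2: "norm v \<le> 1/4" .
    have L1: "norm (Ln (1 + v)) \<le> 2 * norm v" using v2 by (intro norm_Ln_le) auto
    have L2: "norm (Ln (1 + v) - v) \<le> 2 * norm v ^ 2"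
    proof -
      have "norm (Ln (1 + v) - v) \<le> norm v ^ 2 / (1 - norm v)"
        using v2 by (intro Ln_approx_linear) auto
      also have "\<dots> \<le> norm v ^ 2 / (1/2)" using v2 by (intro divide_left_mono) auto
      finally show ?thesis by simp
    qed
    have v1: "1 + v \<noteq> 0"
    proof
      assume "1 + v = 0"
      hence "v = -1" by (simp add: add_eq_0_iff)
      thus False using v2 by simp
    qed
    have Ls: "Ln s = Ln (\<i> * of_real \<tau>) + Ln (1 + v)"
    proof -
      have "s = (\<i> * of_real \<tau>) * (1 + v)" using t0 by (simp add: s_def v_def field_simps)
      moreover have "\<bar>Im (Ln (1 + v))\<bar> \<le> 1/2"
        using abs_Im_le_cmod[of "Ln (1 + v)"] L1 v2 by linarith
      moreover have "\<bar>Im (Ln (\<i> * of_real \<tau>))\<bar> \<le> pi / 2"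
        using t0 Re_Ln_pos_le[of "\<i> * of_real \<tau>"] by simp
      ultimately show ?thesis using t0 v1 pi_ge_two by (simp only:) (rule Ln_times_simple, auto simp: abs_le_iff)
    qed
    \<comment> \<open>The summand \<open>- x\<close> stems from
      \<open>- s = - x - \<i> * \<tau>\<close>; it cancels the first-order part
      \<open>\<i> * \<tau> * v\<close> of \<open>\<i> * \<tau> * Ln (1 + v)\<close>, so that
      \<open>e\<close> tends to 0.\<close>
    define e where "e = (s - 1/2) * Ln (1 + v) - x - S"
    have iv: "\<i> * of_real \<tau> * v = x" using t0 by (simp add: v_def)
    have "e = (x - 1/2) * Ln (1 + v) + \<i> * of_real \<tau> * (Ln (1 + v) - v) - S"
      unfolding e_def s_def using iv by (simp add: algebra_simps)
    hence "norm e \<le> norm ((x - 1/2) * Ln (1 + v)) + norm (\<i> * of_real \<tau> * (Ln (1 + v) - v)) + norm S"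
      by (metis (no_types, opaque_lifting) add_mono_thms_linordered_semiring(3) norm_triangle_ineq norm_triangle_ineq4 order_trans)
    also have "norm ((x - 1/2) * Ln (1 + v)) \<le> (K + 1/2) * (2 * (K / \<bar>\<tau>\<bar>))"
      unfolding norm_mult using norm_triangle_ineq4[of x "1/2"] x L1 v K by (intro mult_mono) auto
    also have "norm (\<i> * of_real \<tau> * (Ln (1 + v) - v)) \<le> \<bar>\<tau>\<bar> * (2 * (K / \<bar>\<tau>\<bar>)^2)"
      unfolding norm_mult using L2 v power_mono[OF v, of 2] by (intro mult_mono) auto
    also have "\<bar>\<tau>\<bar> * (2 * (K / \<bar>\<tau>\<bar>)^2) = 2 * K^2 / \<bar>\<tau>\<bar>"
      using t0 by (simp add: power2_eq_square field_simps)
    also note S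
    also have "(K + 1/2) * (2 * (K / \<bar>\<tau>\<bar>)) + 2 * K^2 / \<bar>\<tau>\<bar> + 48 / \<bar>\<tau>\<bar> = ((2*K+1)*K + 2 * K^2 + 48) / \<bar>\<tau>\<bar>"
      using t0 by (simp add: field_simps)
    finally have "norm e \<le> ((2*K+1)*K + 2 * K^2 + 48) / \<bar>\<tau>\<bar>" by simp
    moreover have "Gamma s = c * exp ((s - 1/2) * Ln (\<i> * of_real \<tau>) - \<i> * of_real \<tau> + e)"
    proof -
      have "Gamma s = c * exp ((s - 1/2) * Ln s - s - S)"
        unfolding G stirling_main_def mult.assoc exp_add[symmetric] by simp
      also have "(s - 1/2) * Ln s - s - S = (s - 1/2) * Ln (\<i> * of_real \<tau>) - \<i> * of_real \<tau> + e"
        unfolding Ls e_def by (simp add: algebra_simps s_def)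
      finally show ?thesis .
    qed
    ultimately show "\<exists>e. norm e \<le> ((2*K+1)*K + 2 * K^2 + 48) / \<bar>\<tau>\<bar> \<and> Gamma (x + \<i> * of_real \<tau>) =
          c * exp ((x + \<i> * of_real \<tau> - 1/2) * Ln (\<i> * of_real \<tau>) - \<i> * of_real \<tau> + e)"
      unfolding s_def by blast
  qed
  thus ?thesis using c by blast
qed

section \<open>Oscillatory integrals\<close>

text \<open>Integration by parts against \<open>e / (\<i> * f)\<close>. The boundary terms cost
  \<open>2 / \<delta>\<close>. Since \<open>f\<close> is decreasing, the derivative of
  \<open>1 / f\<close> has constant sign and its integral is a difference of two values, which costs
  another \<open>2 / \<delta>\<close>.\<close>

lemma van_der_corput_first:
  fixes \<theta> f g :: "real \<Rightarrow> real"
  assumes uv: "u \<le> v" and \<delta>: "\<delta> > 0"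
    and \<theta>: "\<And>t. t \<in> {u..v} \<Longrightarrow> (\<theta> has_real_derivative f t) (at t)"
    and f: "\<And>t. t \<in> {u..v} \<Longrightarrow> (f has_real_derivative g t) (at t)"
    and g: "continuous_on {u..v} g" "\<And>t. t \<in> {u..v} \<Longrightarrow> g t \<le> 0"
    and f\<delta>: "\<And>t. t \<in> {u..v} \<Longrightarrow> \<delta> \<le> \<bar>f t\<bar>"
  shows "norm (integral {u..v} (\<lambda>t. exp (\<i> * of_real (\<theta> t)))) \<le> 4 / \<delta>"
proof -
  define e where "e = (\<lambda>t. exp (\<i> * of_real (\<theta> t)))"
  have f0: "f t \<noteq> 0" if "t \<in> {u..v}" for t using f\<delta>[OF that] \<delta> by auto
  have ne: "norm (e t) = 1" for t by (simp add: e_def)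
  have c\<theta>: "continuous_on {u..v} \<theta>" using \<theta> by (meson DERIV_isCont continuous_at_imp_continuous_on)
  have cf: "continuous_on {u..v} f" using f by (meson DERIV_isCont continuous_at_imp_continuous_on)
  have ce: "continuous_on {u..v} e" unfolding e_def by (intro continuous_intros c\<theta>)
  define H where "H = (\<lambda>t. e t / (\<i> * of_real (f t)))"
  define h where "h = (\<lambda>t. \<i> * e t * of_real (g t) / of_real (f t) ^ 2)"
  have ch: "continuous_on {u..v} h" unfolding h_def by (intro continuous_intros ce cf g) (use f0 in auto)
  have "(H has_vector_derivative (e t + h t)) (at t within {u..v})" if t: "t \<in> {u..v}" for t
  proof -
    have 1: "((\<lambda>t. of_real (f t)) has_vector_derivative of_real (g t)) (at t within {u..v})"
      using f[OF t] by (auto intro!: derivative_eq_intros has_vector_derivative_real_field simp: has_real_derivative_iff_has_vector_derivative intro: has_vector_derivative_at_within)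
    have 2: "((\<lambda>t. of_real (\<theta> t)) has_vector_derivative of_real (f t)) (at t within {u..v})"
      using \<theta>[OF t] by (auto intro!: derivative_eq_intros has_vector_derivative_real_field simp: has_real_derivative_iff_has_vector_derivative intro: has_vector_derivative_at_within)
    have 3: "(e has_vector_derivative (\<i> * of_real (f t) * e t)) (at t within {u..v})"
      unfolding e_def
      by (rule field_vector_diff_chain_within[where g = "\<lambda>z. exp (\<i> * z)", unfolded o_def, THEN has_vector_derivative_eq_rhs, OF 2])
         (auto intro!: derivative_eq_intros)
    have 4: "((\<lambda>t. inverse (\<i> * of_real (f t))) has_vector_derivative (of_real (g t) * (- \<i> / (\<i> * of_real (f t))^2))) (at t within {u..v})"
      by (rule field_vector_diff_chain_within[where g = "\<lambda>z. inverse (\<i> * z)", unfolded o_def, THEN has_vector_derivative_eq_rhs, OF 1])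
         (use f0[OF t] in \<open>auto intro!: derivative_eq_intros simp: field_simps power2_eq_square\<close>)
    have "((\<lambda>t. e t * inverse (\<i> * of_real (f t))) has_vector_derivative (e t + h t)) (at t within {u..v})"
      by (rule has_vector_derivative_eq_rhs[OF has_vector_derivative_mult[OF 3 4]])
         (use f0[OF t] in \<open>simp add: h_def field_simps power2_eq_square\<close>)
    thus ?thesis by (simp add: H_def divide_inverse)
  qed
  hence "((\<lambda>t. e t + h t) has_integral (H v - H u)) {u..v}"
    by (intro fundamental_theorem_of_calculus uv)
  hence "integral {u..v} (\<lambda>t. e t + h t) = H v - H u" by (rule integral_unique)
  moreover have "integral {u..v} (\<lambda>t. e t + h t) = integral {u..v} e + integral {u..v} h"
    by (intro integral_add integrable_continuous_real ce ch)
  ultimately have "integral {u..v} e = H v - H u - integral {u..v} h" by (simp add: algebra_simps)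
  hence "norm (integral {u..v} e) \<le> norm (H v) + norm (H u) + norm (integral {u..v} h)"
    by (metis add_mono_thms_linordered_semiring(3) norm_triangle_ineq4 order_trans)
  moreover have Hb: "norm (H t) \<le> 1 / \<delta>" "\<bar>1 / f t\<bar> \<le> 1 / \<delta>" if "t \<in> {u..v}" for t
    using f\<delta>[OF that] \<delta> unfolding H_def by (simp_all add: norm_divide norm_mult ne frac_le)
  moreover have "norm (integral {u..v} h) \<le> 2 / \<delta>"
  proof -
    have "((\<lambda>t. - g t / f t ^ 2) has_integral (1 / f v - 1 / f u)) {u..v}"
    proof (rule fundamental_theorem_of_calculus[OF uv])
      fix t assume t: "t \<in> {u..v}"
      have "((\<lambda>t. 1 / f t) has_real_derivative (- g t / f t ^ 2)) (at t within {u..v})"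
        using f0[OF t] f[OF t, THEN has_field_derivative_at_within[where s = "{u..v}"]]
        by (auto intro!: derivative_eq_intros simp: power2_eq_square)
      thus "((\<lambda>t. 1 / f t) has_vector_derivative (- g t / f t ^ 2)) (at t within {u..v})"
        by (simp add: has_real_derivative_iff_has_vector_derivative)
    qed
    moreover have "norm (h t) \<le> - g t / f t ^ 2" if "t \<in> {u..v}" for t
      using g(2)[OF that] by (simp add: h_def norm_mult norm_divide norm_power ne)
    ultimately have "norm (integral {u..v} h) \<le> 1 / f v - 1 / f u"
      by (metis (no_types, lifting) has_integral_integrable_integral integral_norm_bound_integral integrable_continuous_real ch)
    also have "\<dots> \<le> 1 / \<delta> + 1 / \<delta>" using uv
      by (intro order_trans[OF diff_mono[OF abs_le_D1[OF Hb(2)] minus_le_iff[THEN iffD1, OF abs_le_D2[OF Hb(2)]]]]) auto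
    finally show ?thesis by simp
  qed
  ultimately have "norm (integral {u..v} e) \<le> 1 / \<delta> + 1 / \<delta> + 2 / \<delta>"
    by (elim order_trans) (intro add_mono Hb(1); use uv in simp)
  also have "\<dots> = 4 / \<delta>" by (simp flip: add_divide_distrib)
  finally show ?thesis by (simp add: e_def)
qed

text \<open>The phase is stationary at \<open>ln t = (c - d) / d\<close>. Where \<open>ln t\<close>
  is at distance at least \<open>\<delta> / d\<close> from this value, the derivative
  \<open>f\<close> is at least \<open>\<delta>\<close> in modulus and the first derivative test
  applies; the remaining interval has length at most \<open>2 * x * \<delta>\<close>. The choice
  \<open>\<delta> = 1 / sqrt x\<close> balances the two and gives 4 + 4 + 2. The bound is free of
  \<open>c\<close>, which later absorbs the variable \<open>y\<close>.\<close>

lemma log_phase_integral_bound: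
  fixes d c R x :: real
  assumes d: "d \<ge> 1" and R: "0 < R" "R \<le> x"
  shows "norm (integral {R..x} (\<lambda>t. exp (\<i> * of_real (c * t - d * t * ln t)))) \<le> 10 * sqrt x"
proof -
  define e where "e = (\<lambda>t. exp (\<i> * complex_of_real (c * t - d * t * ln t)))"
  define f where "f = (\<lambda>t. c - d - d * ln t)"
  have x: "x > 0" using R by simp
  define \<delta> where "\<delta> = 1 / sqrt x"
  have \<delta>: "\<delta> > 0" using x by (simp add: \<delta>_def)
  define m where "m = (c - d) / d"
  \<comment> \<open>The points \<open>p\<close> and \<open>r\<close> are forced into
    \<open>[R, x]\<close>. If \<open>p\<close> is not \<open>R\<close>, then \<open>ln p\<close> is
    at most \<open>m - \<delta> / d\<close>, and dually for \<open>r\<close>; otherwise the outer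
    interval is a single point.\<close>
  define clamp where "clamp = (\<lambda>l. max (ln R) (min (ln x) l))"
  define p where "p = exp (clamp (m - \<delta> / d))"
  define r where "r = exp (clamp (m + \<delta> / d))"
  have lRx: "ln R \<le> ln x" using R by simp
  have \<delta>d: "\<delta> / d > 0" using \<delta> d by simp
  have cl: "clamp (m - \<delta> / d) \<le> clamp (m + \<delta> / d)" "clamp l \<ge> ln R" "clamp l \<le> ln x" for l
    unfolding clamp_def using \<delta>d lRx by (auto simp: max_def min_def)
  have pr: "R \<le> p" "p \<le> r" "r \<le> x"
    unfolding p_def r_def using cl R x by (auto simp: ln_ge_iff ln_le_cancel_iff) (metis exp_le_cancel_iff exp_ln cl)+
  have p0: "p > 0" "r > 0" by (auto simp: p_def r_def)
  have ce: "continuous_on {a..b} e" if "a > 0" for a b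
    unfolding e_def using that by (intro continuous_intros) auto
  have ie: "e integrable_on {a..b}" if "a > 0" for a b
    using that by (intro integrable_continuous_real ce)
  have vdc: "norm (integral {a..b} e) \<le> 4 * sqrt x" if ab: "0 < a" "a \<le> b" and f\<delta>: "\<And>t. t \<in> {a..b} \<Longrightarrow> \<delta> \<le> \<bar>f t\<bar>" for a b
  proof -
    have "norm (integral {a..b} e) \<le> 4 / \<delta>"
      unfolding e_def
    proof (rule van_der_corput_first[of a b \<delta> _ f "\<lambda>t. - d / t"])
      show "((\<lambda>t. c * t - d * t * ln t) has_real_derivative f t) (at t)" if "t \<in> {a..b}" for t
        using that ab unfolding f_def by (auto intro!: derivative_eq_intros simp: algebra_simps)
      show "(f has_real_derivative - d / t) (at t)" if "t \<in> {a..b}" for t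
        using that ab unfolding f_def by (auto intro!: derivative_eq_intros)
      show "continuous_on {a..b} (\<lambda>t. - d / t)" using ab by (intro continuous_intros) auto
    qed (use ab d \<delta> f\<delta> in auto)
    thus ?thesis by (simp add: \<delta>_def)
  qed
  have 1: "norm (integral {R..p} e) \<le> 4 * sqrt x"
  proof (cases "p = R")
    case False
    hence "ln R < clamp (m - \<delta> / d)" using cl(2)[of "m - \<delta>/d"] R unfolding p_def by (metis exp_ln order_le_less)
    hence c1: "clamp (m - \<delta> / d) \<le> m - \<delta> / d" unfolding clamp_def by (auto simp: max_def min_def split: if_splits)
    show ?thesis
    proof (rule vdc)
      fix t assume t: "t \<in> {R..p}"
      have "ln t \<le> ln p" using t R p0 by simp
      also have "\<dots> \<le> m - \<delta> / d" using c1 by (simp add: p_def)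
      finally have "d * ln t \<le> d * m - \<delta>" using d by (simp add: field_simps)
      thus "\<delta> \<le> \<bar>f t\<bar>" using d by (simp add: f_def m_def)
    qed (use R pr in auto)
  qed (use x in auto)
  have 2: "norm (integral {r..x} e) \<le> 4 * sqrt x"
  proof (cases "r = x")
    case False
    hence "clamp (m + \<delta> / d) < ln x" using cl(3)[of "m + \<delta>/d"] x unfolding r_def by (metis exp_ln order_le_less)
    hence c1: "clamp (m + \<delta> / d) \<ge> m + \<delta> / d" unfolding clamp_def by (auto simp: max_def min_def split: if_splits)
    show ?thesis
    proof (rule vdc)
      fix t assume t: "t \<in> {r..x}"
      have "m + \<delta> / d \<le> ln r" using c1 by (simp add: r_def)
      also have "\<dots> \<le> ln t" using t p0 by simp
      finally have "d * ln t \<ge> d * m + \<delta>" using d by (simp add: field_simps)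
      thus "\<delta> \<le> \<bar>f t\<bar>" using d by (simp add: f_def m_def)
    qed (use p0 pr in auto)
  qed (use x in auto)
  have 3: "norm (integral {p..r} e) \<le> 2 * sqrt x"
  proof -
    have "norm (integral {p..r} e) \<le> 1 * (r - p)"
      by (rule integral_bound) (use pr p0 ce in \<open>auto simp: e_def\<close>)
    also have "r - p = r * (1 - exp (- (ln r - ln p)))"
      using p0 by (simp add: exp_diff field_simps)
    also have "\<dots> \<le> r * (ln r - ln p)"
    proof (rule mult_left_mono)
      show "1 - exp (- (ln r - ln p)) \<le> ln r - ln p"
        using exp_ge_add_one_self[of "- (ln r - ln p)"] by linarith
    qed (use p0 in auto)
    also have "\<dots> \<le> x * (2 * \<delta> / d)"
    proof (intro mult_mono)
      have "ln r - ln p \<le> 2 * (\<delta> / d)"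
        unfolding r_def p_def ln_exp clamp_def using \<delta>d lRx by (auto simp: max_def min_def)
      thus "ln r - ln p \<le> 2 * \<delta> / d" by simp
      show "0 \<le> ln r - ln p" using cl(1) by (simp add: r_def p_def)
    qed (use pr x in auto)
    also have "\<dots> \<le> x * (2 * \<delta>)" using d \<delta> x by (intro mult_left_mono) (auto simp: field_simps)
    also have "\<dots> = 2 * (x / sqrt x)" by (simp add: \<delta>_def)
    also have "\<dots> = 2 * sqrt x" using x by (simp only: real_div_sqrt)
    finally show ?thesis by simp
  qed
  have "integral {R..x} e = integral {R..p} e + (integral {p..r} e + integral {r..x} e)"
    using Henstock_Kurzweil_Integration.integral_combine[of R p x e] Henstock_Kurzweil_Integration.integral_combine[of p r x e] pr ie p0 R by simp
  hence "norm (integral {R..x} e) \<le> norm (integral {R..p} e) + (norm (integral {p..r} e) + norm (integral {r..x} e))"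
    by (metis (no_types, opaque_lifting) add_left_mono norm_triangle_ineq order_trans)
  thus ?thesis using 1 2 3 by (simp add: e_def)
qed

text \<open>Integration by parts with \<open>V\<close>, the integral of the pure phase from
  \<open>R\<close>. As \<open>V t\<close> is at most \<open>10 * sqrt t\<close> uniformly in
  \<open>c\<close>, the cost is one boundary term and an integral of
  \<open>norm (A' t) * sqrt t\<close>.\<close>

lemma oscillatory_integral_bound:
  fixes A A' :: "real \<Rightarrow> complex" and d c R x :: real
  assumes d: "d \<ge> 1" and R: "0 < R" "R \<le> x"
    and A: "\<And>t. t \<in> {R..x} \<Longrightarrow> (A has_vector_derivative A' t) (at t within {R..x})"
    and A': "continuous_on {R..x} A'"
  shows "norm (integral {R..x} (\<lambda>t. A t * exp (\<i> * of_real (c * t - d * t * ln t)))) \<le>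
           10 * (sqrt x * norm (A x) + integral {R..x} (\<lambda>t. norm (A' t) * sqrt t))"
proof -
  define e where "e = (\<lambda>t. exp (\<i> * complex_of_real (c * t - d * t * ln t)))"
  have ce: "continuous_on {R..x} e" unfolding e_def using R by (intro continuous_intros) auto
  define V where "V = (\<lambda>t. integral {R..t} e)"
  have V: "(V has_vector_derivative e t) (at t within {R..x})" if "t \<in> {R..x}" for t
    unfolding V_def using integral_has_vector_derivative[OF ce that] .
  have cV: "continuous_on {R..x} V" using V by (rule continuous_on_vector_derivative)
  have cA: "continuous_on {R..x} A" using A by (rule continuous_on_vector_derivative)
  have Vb: "norm (V t) \<le> 10 * sqrt t" if "t \<in> {R..x}" for t
    unfolding V_def e_def using that R by (intro log_phase_integral_bound d) auto
  have "((\<lambda>t. A t * e t + A' t * V t) has_integral (A x * V x - A R * V R)) {R..x}"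
    by (intro fundamental_theorem_of_calculus R has_vector_derivative_mult A V)
  moreover have "V R = 0" by (simp add: V_def)
  ultimately have "integral {R..x} (\<lambda>t. A t * e t + A' t * V t) = A x * V x"
    by (simp add: integral_unique)
  moreover have "integral {R..x} (\<lambda>t. A t * e t + A' t * V t) = integral {R..x} (\<lambda>t. A t * e t) + integral {R..x} (\<lambda>t. A' t * V t)"
    by (intro integral_add integrable_continuous_real continuous_intros cA ce A' cV)
  ultimately have "integral {R..x} (\<lambda>t. A t * e t) = A x * V x - integral {R..x} (\<lambda>t. A' t * V t)"
    by (simp add: algebra_simps)
  hence "norm (integral {R..x} (\<lambda>t. A t * e t)) \<le> norm (A x * V x) + norm (integral {R..x} (\<lambda>t. A' t * V t))"
    by (metis norm_triangle_ineq4)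
  also have "norm (A x * V x) \<le> norm (A x) * (10 * sqrt x)"
    unfolding norm_mult using Vb R by (intro mult_left_mono) auto
  also have "norm (integral {R..x} (\<lambda>t. A' t * V t)) \<le> integral {R..x} (\<lambda>t. 10 * (norm (A' t) * sqrt t))"
  proof (rule integral_norm_bound_integral)
    show "(\<lambda>t. A' t * V t) integrable_on {R..x}" by (intro integrable_continuous_real continuous_intros A' cV)
    show "(\<lambda>t. 10 * (norm (A' t) * sqrt t)) integrable_on {R..x}" by (intro integrable_continuous_real continuous_intros A')
    show "norm (A' t * V t) \<le> 10 * (norm (A' t) * sqrt t)" if "t \<in> {R..x}" for t
      using mult_left_mono[OF Vb[OF that] norm_ge_zero[of "A' t"]] by (simp add: norm_mult mult_ac)
  qed
  also have "integral {R..x} (\<lambda>t. 10 * (norm (A' t) * sqrt t)) = 10 * integral {R..x} (\<lambda>t. norm (A' t) * sqrt t)"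
    by (rule integral_mult_right)
  finally show ?thesis unfolding e_def by (simp only: distrib_left mult_ac)
qed

text \<open>The integrand is extended to the half-line and split at \<open>T\<close>: below, it
  integrates to \<open>T powr \<gamma> / \<gamma>\<close>, above, to
  \<open>T powr \<gamma> / (K - \<gamma>)\<close>. The two conditions on \<gamma> are convergence at
  0 and at infinity.\<close>

lemma truncated_power_integral_le:
  fixes \<gamma> T R x :: real and K :: nat
  assumes \<gamma>: "0 < \<gamma>" "\<gamma> < real K" and T: "T > 0" and R: "0 < R" "R \<le> x"
  shows "integral {R..x} (\<lambda>t. t powr (\<gamma> - 1) * min 1 (T / t) ^ K) \<le> (1 / \<gamma> + 1 / (real K - \<gamma>)) * T powr \<gamma>"
proof -
  define h where "h = (\<lambda>t. if t \<le> T then t powr (\<gamma> - 1) else T ^ K * t powr (\<gamma> - 1 - K))"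
  have "(h has_integral (T powr \<gamma> / \<gamma>)) {0..T}"
    by (rule has_integral_eq[rotated, where f = "\<lambda>t. t powr (\<gamma> - 1)"])
       (use has_integral_powr_from_0[of "\<gamma> - 1" T] \<gamma> T in \<open>auto simp: h_def\<close>)
  moreover have "(h has_integral (T ^ K * (T powr (\<gamma> - K) / (real K - \<gamma>)))) {T..}"
  proof (rule has_integral_spike[of "{T}"])
    show "((\<lambda>t. T ^ K * t powr (\<gamma> - 1 - K)) has_integral (T ^ K * (T powr (\<gamma> - K) / (real K - \<gamma>)))) {T..}"
    proof -
      have e: "\<gamma> - 1 - real K + 1 = - (real K - \<gamma>)" by simp
      have "((\<lambda>t. t powr (\<gamma> - 1 - K)) has_integral (T powr (\<gamma> - K) / (real K - \<gamma>))) {T..}"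
        by (rule has_integral_eq_rhs[OF has_integral_powr_to_inf])
           (use \<gamma> T in \<open>simp_all only: e minus_divide_divide, simp_all\<close>)
      thus ?thesis by (rule has_integral_mult_right)
    qed
  qed (auto simp: h_def)
  ultimately have "(h has_integral (T powr \<gamma> / \<gamma> + T ^ K * (T powr (\<gamma> - K) / (real K - \<gamma>)))) ({0..T} \<union> {T..})"
  proof (rule has_integral_Un)
    have "{0..T} \<inter> {T..} = {T}" using T by auto
    thus "negligible ({0..T} \<inter> {T..})" by simp
  qed
  moreover have "{0..T} \<union> {T..} = {0..}" using T by auto
  moreover have "T powr \<gamma> / \<gamma> + T ^ K * (T powr (\<gamma> - K) / (real K - \<gamma>)) = (1 / \<gamma> + 1 / (real K - \<gamma>)) * T powr \<gamma>"
  proof -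
    have "T ^ K * (T powr (\<gamma> - K) / (real K - \<gamma>)) = T powr \<gamma> / (real K - \<gamma>)"
      using T by (simp add: powr_diff powr_realpow)
    thus ?thesis by (simp add: distrib_right)
  qed
  ultimately have h: "(h has_integral ((1 / \<gamma> + 1 / (real K - \<gamma>)) * T powr \<gamma>)) {0..}" by simp
  have hn: "h t \<ge> 0" for t using T by (simp add: h_def)
  have sub: "{R..x} \<subseteq> {0..}" using R by auto
  have hR: "h integrable_on {R..x}"
    using h integrable_on_subinterval[of h "{0..}" R x] sub by (auto simp: integrable_on_def)
  have "integral {R..x} (\<lambda>t. t powr (\<gamma> - 1) * min 1 (T / t) ^ K) \<le> integral {R..x} h"
  proof (rule integral_le)
    show "(\<lambda>t. t powr (\<gamma> - 1) * min 1 (T / t) ^ K) integrable_on {R..x}"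
      using R by (intro integrable_continuous_real continuous_intros) auto
    fix t assume "t \<in> {R..x}"
    hence t: "t > 0" using R by auto
    show "t powr (\<gamma> - 1) * min 1 (T / t) ^ K \<le> h t"
    proof (cases "t \<le> T")
      case True
      hence "min 1 (T / t) = 1" using t by simp
      thus ?thesis using True by (simp add: h_def)
    next
      case False
      hence "min 1 (T / t) = T / t" using t by (simp add: min_def field_simps)
      moreover have "t powr (\<gamma> - 1 - K) = t powr (\<gamma> - 1) / t ^ K" using t by (simp add: powr_diff powr_realpow)
      ultimately show ?thesis using False by (simp add: h_def power_divide mult.commute)
    qed
  qed (rule hR)
  also have "\<dots> \<le> integral {0..} h"
    using h hn hR sub by (intro integral_subset_le) (auto simp: integrable_on_def)
  finally show ?thesis using h by (simp add: integral_unique)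
qed

text \<open>\<open>mexp\<close> is the Laplace transform of a uniform average; its powers smooth the sharp cutoff.\<close>
definition mexp :: "complex \<Rightarrow> complex" where
  "mexp x = (exp x - 1) / x"

text \<open>Boundedness near 0 comes from the mean value inequality, decay far out from the triangle
  inequality. A factor \<open>mexp (s / T)\<close> thus truncates an integral softly at height
  T.\<close>

lemma norm_mexp_le:
  assumes "\<bar>Re x\<bar> \<le> 1" "x \<noteq> 0"
  shows "norm (mexp x) \<le> 4 * min 1 (1 / norm x)"
proof -
  have e3: "norm (exp z) \<le> 3" if "\<bar>Re z\<bar> \<le> 1" for z
  proof -
    have "exp (Re z) \<le> exp 1" using that by simp
    thus ?thesis using exp_le by (simp only: norm_exp_eq_Re)
  qed
  have "norm (exp x - exp 0) \<le> 3 * norm (x - 0)"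
  proof (rule field_differentiable_bound[of "{z. \<bar>Re z\<bar> \<le> 1}" exp exp])
    have "{z. \<bar>Re z\<bar> \<le> 1} = {z. Re z \<le> 1} \<inter> {z. Re z \<ge> -1}" by auto
    thus "convex {z. \<bar>Re z\<bar> \<le> 1}"
      by (simp add: convex_Int convex_halfspace_Re_le convex_halfspace_Re_ge)
  qed (use assms e3 in \<open>auto intro!: DERIV_subset[OF DERIV_exp]\<close>)
  hence 1: "norm (exp x - 1) \<le> 4 * norm x" using norm_ge_zero[of x] by (simp, linarith)
  have 2: "norm (exp x - 1) \<le> 4" using norm_triangle_ineq4[of "exp x" 1] e3[OF assms(1)] by simp
  have "norm x > 0" using assms by simp
  thus ?thesis using 1 2 by (auto simp: mexp_def norm_divide min_def field_simps)
qed

lemma mexp_has_field_derivative: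
  "x \<noteq> 0 \<Longrightarrow> (mexp has_field_derivative (exp x - mexp x) / x) (at x)"
  unfolding mexp_def by (auto intro!: derivative_eq_intros simp: field_simps power2_eq_square)

lemma norm_mexp_deriv_le:
  assumes "\<bar>Re x\<bar> \<le> 1" "x \<noteq> 0"
  shows "norm ((exp x - mexp x) / x) \<le> 7 / norm x"
proof -
  have "exp (Re x) \<le> exp 1" using assms by simp
  hence "norm (exp x) \<le> 3" using exp_le by (simp only: norm_exp_eq_Re)
  moreover have "norm (mexp x) \<le> 4" using norm_mexp_le[OF assms] by (auto simp: min_def split: if_splits)
  ultimately have "norm (exp x - mexp x) \<le> 7" using norm_triangle_ineq4[of "exp x" "mexp x"] by linarith
  thus ?thesis by (simp add: norm_divide divide_right_mono)
qed

text \<open>Integration by parts as above. Every term in the derivative of the amplitude has one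
  power of \<open>t\<close> less than the amplitude, uniformly in \<open>T\<close>; with the weight
  \<open>sqrt t\<close> this leaves \<open>t powr (\<alpha> - 3/2)\<close>, truncated at
  \<open>T\<close>. The condition \<open>\<alpha> > 1/2\<close> lets the range near \<open>T\<close>
  dominate, and \<open>\<alpha> + 1 \<le> real k\<close> secures convergence although
  differentiation removes one factor \<open>mexp\<close>.\<close>

lemma smoothed_power_integral_bound:
  fixes \<alpha> \<sigma> d R :: real and k :: nat
  assumes \<alpha>: "\<alpha> > 1/2" "\<alpha> + 1 \<le> real k" and \<sigma>: "\<bar>\<sigma>\<bar> \<le> 1" and d: "d \<ge> 1" and R: "R > 0"
  shows "\<exists>C. \<forall>T c x. T \<ge> 1 \<longrightarrow> x \<ge> R \<longrightarrow>
     norm (integral {R..x} (\<lambda>t. of_real (t powr \<alpha>) * mexp (Complex \<sigma> t / of_real T) ^ k / Complex \<sigma> t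
        * exp (\<i> * of_real (c * t - d * t * ln t)))) \<le> C * T powr (\<alpha> - 1/2)"
proof -
  define K where "K = k - 1"
  have k: "k \<ge> 1" "real K = real k - 1" "k = Suc K" using \<alpha> by (auto simp: K_def)
  \<comment> \<open>The three parts of the product rule: the derivative of
    \<open>t powr \<alpha>\<close> contributes \<alpha>, that of \<open>1 / s\<close> contributes 1,
    and each of the k factors \<open>mexp\<close> contributes 7.\<close>
  define M where "M = 4 ^ k * (\<alpha> + 1 + 7 * real k)"
  have M: "M \<ge> 0" using \<alpha> by (simp add: M_def)
  define C where "C = 10 * (4 ^ k + M * (1 / (\<alpha> - 1/2) + 1 / (real K - (\<alpha> - 1/2))))"
  show ?thesis
  proof (rule exI[of _ C], intro allI impI)
    fix T c x :: real
    assume T: "T \<ge> 1" and x: "x \<ge> R"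
    define s where "s = (\<lambda>t. Complex \<sigma> t)"
    define q where "q = (\<lambda>t. mexp (s t / of_real T))"
    define q' where "q' = (\<lambda>t. (exp (s t / of_real T) - mexp (s t / of_real T)) / (s t / of_real T))"
    define A where "A = (\<lambda>t. of_real (t powr \<alpha>) * q t ^ k / s t)"
    define A' where "A' = (\<lambda>t. of_real (\<alpha> * t powr (\<alpha> - 1)) * q t ^ k / s t
         + of_real (t powr \<alpha>) * (of_nat k * q t ^ K * (q' t * (\<i> / of_real T))) / s t
         - of_real (t powr \<alpha>) * q t ^ k * \<i> / s t ^ 2)"
    have s0: "s t \<noteq> 0" if "t > 0" for t using that by (simp add: s_def complex_eq_iff)
    have ns: "norm (s t) \<ge> t" for t using abs_Im_le_cmod[of "s t"] by (simp add: s_def)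
    have s_alt: "s = (\<lambda>t. of_real \<sigma> + \<i> * of_real t)" by (auto simp: s_def complex_eq_iff)
    have re: "\<bar>Re (s t / of_real T)\<bar> \<le> 1" for t
      using \<sigma> T by (simp add: s_def divide_le_eq abs_divide)
    have qb: "norm (q t) \<le> 4 * min 1 (T / t)" if t: "t > 0" for t
    proof -
      have "norm (q t) \<le> 4 * min 1 (1 / norm (s t / of_real T))"
        unfolding q_def using s0[OF t] T by (intro norm_mexp_le re) auto
      also have "1 / norm (s t / of_real T) = T / norm (s t)" using T by (simp add: norm_divide)
      also have "4 * min 1 (T / norm (s t)) \<le> 4 * min 1 (T / t)"
        using ns[of t] t T by (intro mult_left_mono min.mono divide_left_mono mult_pos_pos) auto
      finally show ?thesis .
    qed
    have mn: "0 \<le> min 1 (T / t)" "min 1 (T/t) \<le> 1" if "t > 0" for t using that T by auto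
    have qk: "norm (q t ^ n) \<le> 4 ^ n * min 1 (T / t) ^ n" if t: "t > 0" for t n
      unfolding norm_power power_mult_distrib[symmetric] using qb[OF t] by (intro power_mono) auto
    \<comment> \<open>The chain rule gives a factor \<open>1 / T\<close>, and the derivative of
      \<open>mexp\<close> at \<open>s / T\<close> is at most \<open>7 * T / norm s\<close>, so
      \<open>T\<close> cancels.\<close>
    have q'b: "norm (q' t * (\<i> / of_real T)) \<le> 7 / t" if t: "t > 0" for t
    proof -
      have "norm (q' t) \<le> 7 / norm (s t / of_real T)"
        unfolding q'_def using s0[OF t] T by (intro norm_mexp_deriv_le re) auto
      hence "norm (q' t) / T \<le> 7 / norm (s t / of_real T) / T"
        using T by (intro divide_right_mono) auto
      hence "norm (q' t * (\<i> / of_real T)) \<le> 7 / norm (s t / of_real T) / T"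
        using T by (simp add: norm_mult norm_divide)
      also have "\<dots> = 7 / norm (s t)" using T by (simp add: norm_divide)
      also have "\<dots> \<le> 7 / t" using ns[of t] t by (intro divide_left_mono mult_pos_pos) auto
      finally show ?thesis .
    qed
    have ds: "(s has_vector_derivative \<i>) (at t within X)" for t X
      unfolding s_alt by (auto intro!: derivative_eq_intros simp: has_vector_derivative_def scaleR_conv_of_real fun_eq_iff mult.commute)
    have dq: "(q has_vector_derivative (q' t * (\<i> / of_real T))) (at t within X)" if t: "t > 0" for t X
    proof -
      have "((\<lambda>z. mexp (z / of_real T)) has_field_derivative (q' t * (1 / of_real T))) (at (s t) within s ` X)"
        unfolding q'_def
        by (rule DERIV_chain2[of mexp, OF mexp_has_field_derivative]) (use s0[OF t] T in \<open>auto intro!: derivative_eq_intros\<close>)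
      from field_vector_diff_chain_within[OF ds this] show ?thesis
        by (simp add: q_def o_def mult_ac)
    qed
    have dp: "((\<lambda>t. complex_of_real (t powr \<alpha>)) has_vector_derivative (of_real (\<alpha> * t powr (\<alpha> - 1)))) (at t within X)" if t: "t > 0" for t X
    proof -
      have "((\<lambda>t. t powr \<alpha>) has_real_derivative \<alpha> * t powr (\<alpha> - 1)) (at t within X)"
        using has_real_derivative_powr[OF t, of \<alpha>] by (rule has_field_derivative_at_within)
      thus ?thesis by (rule has_vector_derivative_of_real)
    qed
    have dqk: "((\<lambda>t. q t ^ k) has_vector_derivative (of_nat k * q t ^ K * (q' t * (\<i> / of_real T)))) (at t within X)" if t: "t > 0" for t X
    proof -
      have "((\<lambda>z. z ^ k) has_field_derivative (of_nat k * q t ^ K)) (at (q t) within q ` X)"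
        by (auto intro!: derivative_eq_intros simp: K_def)
      from field_vector_diff_chain_within[OF dq[OF t] this] show ?thesis
        by (simp add: o_def mult_ac)
    qed
    have dis: "((\<lambda>t. inverse (s t)) has_vector_derivative (\<i> * (- (1 / s t ^ 2)))) (at t within X)" if t: "t > 0" for t X
      by (rule field_vector_diff_chain_within[where g = inverse, unfolded o_def, OF ds])
         (use s0[OF t] in \<open>auto intro!: derivative_eq_intros simp: field_simps power2_eq_square\<close>)
    have dA: "(A has_vector_derivative A' t) (at t within X)" if t: "t > 0" for t X
      unfolding A_def divide_inverse
      by (rule has_vector_derivative_eq_rhs[OF has_vector_derivative_mult[OF has_vector_derivative_mult[OF dp[OF t] dqk[OF t]] dis[OF t]]])
         (simp add: A'_def divide_inverse algebra_simps)
    have cs: "continuous_on X s" for X unfolding s_alt by (intro continuous_intros)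
    have cq: "continuous_on {R..x} q" by (rule continuous_on_vector_derivative[OF dq]) (use R in auto)
    have cq': "continuous_on {R..x} q'"
      unfolding q'_def using R T s0 cq[unfolded q_def] by (intro continuous_intros cs) auto
    have b0: "norm (integral {R..x} (\<lambda>t. A t * exp (\<i> * of_real (c * t - d * t * ln t)))) \<le>
           10 * (sqrt x * norm (A x) + integral {R..x} (\<lambda>t. norm (A' t) * sqrt t))"
    proof (rule oscillatory_integral_bound)
      show "continuous_on {R..x} A'" unfolding A'_def using R s0
        by (intro continuous_intros cs cq cq') auto
    qed (use d R x dA in auto)
    have bA: "sqrt x * norm (A x) \<le> 4 ^ k * T powr (\<alpha> - 1/2)"
    proof -
      have x0: "x > 0" using R x by simp
      have "norm (A x) = x powr \<alpha> * norm (q x ^ k) / norm (s x)"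
        by (simp add: A_def norm_divide norm_mult)
      also have "\<dots> \<le> x powr \<alpha> * (4 ^ k * min 1 (T / x) ^ k) / x"
        using qk[OF x0, of k] ns[of x] x0 mn[OF x0] by (intro frac_le mult_left_mono mult_nonneg_nonneg zero_le_power) auto
      finally have "sqrt x * norm (A x) \<le> sqrt x * (x powr \<alpha> * (4 ^ k * min 1 (T / x) ^ k) / x)"
        using x0 by (intro mult_left_mono) auto
      also have "\<dots> = 4 ^ k * (x powr (\<alpha> - 1/2) * min 1 (T / x) ^ k)"
      proof -
        have "x powr (\<alpha> - 1/2) = x powr \<alpha> * sqrt x / x"
        proof -
          have "sqrt x / x = 1 / sqrt x" using x0 by (metis real_div_sqrt inverse_divide inverse_eq_divide less_imp_le)
          hence "x powr \<alpha> * (sqrt x / x) = x powr \<alpha> / sqrt x" by simp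
          thus ?thesis using x0 by (simp add: powr_diff powr_half_sqrt)
        qed
        thus ?thesis by simp
      qed
      also have "x powr (\<alpha> - 1/2) * min 1 (T / x) ^ k \<le> T powr (\<alpha> - 1/2)"
      proof (cases "x \<le> T")
        case True
        hence "x powr (\<alpha> - 1/2) * min 1 (T / x) ^ k \<le> T powr (\<alpha> - 1/2) * 1"
          using x0 \<alpha> mn[OF x0] by (intro mult_mono powr_mono2 power_le_one) auto
        thus ?thesis by simp
      next
        case False
        have "x powr (\<alpha> - 1/2) * min 1 (T / x) ^ k = x powr (\<alpha> - 1/2) * (T / x) powr k"
          using False x0 T by (simp add: min_def powr_realpow)
        also have "\<dots> \<le> x powr (\<alpha> - 1/2) * (T / x) powr (\<alpha> - 1/2)"
          using False x0 T \<alpha> by (intro mult_left_mono powr_mono') auto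
        also have "\<dots> = T powr (\<alpha> - 1/2)" using x0 T by (simp add: powr_divide)
        finally show ?thesis .
      qed
      finally show ?thesis by simp
    qed
    have "integral {R..x} (\<lambda>t. norm (A' t) * sqrt t) \<le> 
        integral {R..x} (\<lambda>t. M * (t powr ((\<alpha> - 1/2) - 1) * min 1 (T / t) ^ K))"
    proof (rule integral_le)
      show "(\<lambda>t. norm (A' t) * sqrt t) integrable_on {R..x}"
        unfolding A'_def using R s0
        by (intro integrable_continuous_real continuous_intros cs cq cq') auto
      show "(\<lambda>t. M * (t powr ((\<alpha> - 1/2) - 1) * min 1 (T / t) ^ K)) integrable_on {R..x}"
        using R by (intro integrable_continuous_real continuous_intros) auto
      fix t assume "t \<in> {R..x}"
      hence t: "t > 0" using R by auto
      define m where "m = min 1 (T / t) ^ K"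
      have m: "m \<ge> 0" "min 1 (T/t) ^ k \<le> m" unfolding m_def k(3)
        using mn[OF t] by (auto simp: mult_left_le_one_le)
      have qkm: "norm (q t ^ k) \<le> 4 ^ k * m" "norm (q t ^ K) \<le> 4 ^ k * m"
      proof -
        show "norm (q t ^ k) \<le> 4 ^ k * m" using qk[OF t, of k] m(2) 
          by (meson mult_left_mono order_trans zero_le_numeral zero_le_power)
        have "norm (q t ^ K) \<le> 4 ^ K * m" using qk[OF t, of K] by (simp add: m_def)
        also have "\<dots> \<le> 4 ^ k * m" using m by (intro mult_right_mono power_increasing) (auto simp: k(3))
        finally show "norm (q t ^ K) \<le> 4 ^ k * m" .
      qed
      have p: "t powr \<alpha> / t ^ 2 = t powr (\<alpha> - 2)" "t powr (\<alpha> - 1) / t = t powr (\<alpha> - 2)"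
        "t powr \<alpha> * (1 / t) / t = t powr (\<alpha> - 2)"
        using t powr_numeral[of t "num.Bit0 num.One"] by (simp_all add: powr_diff power2_eq_square)
      have "norm (of_real (\<alpha> * t powr (\<alpha> - 1)) * q t ^ k / s t) \<le> \<alpha> * t powr (\<alpha> - 1) * (4 ^ k * m) / t"
        unfolding norm_divide norm_mult[of _ "q t ^ k"] norm_of_real using ns[of t] t \<alpha>(1) qkm(1) m(1)
        by (intro frac_le mult_mono mult_nonneg_nonneg) (auto simp: abs_mult)
      also have "\<dots> = \<alpha> * (t powr (\<alpha> - 1) / t) * (4 ^ k * m)" by simp
      also have "\<dots> = \<alpha> * t powr (\<alpha> - 2) * (4 ^ k * m)" unfolding p ..
      finally have b1: "norm (of_real (\<alpha> * t powr (\<alpha> - 1)) * q t ^ k / s t) \<le> \<alpha> * t powr (\<alpha> - 2) * (4 ^ k * m)" .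
      have "norm (of_real (t powr \<alpha>) * (of_nat k * q t ^ K * (q' t * (\<i> / of_real T))) / s t)
          \<le> t powr \<alpha> * (real k * (4 ^ k * m) * (7 / t)) / t"
        unfolding norm_divide norm_mult[of _ "_ * (q' t * _)"] norm_mult[of "_ * _" "q' t * _"] norm_mult[of "of_nat k"]
        using ns[of t] t qkm(2) m(1) q'b[OF t]
        by (intro frac_le mult_mono mult_nonneg_nonneg) auto
      also have "\<dots> = (t powr \<alpha> * (1 / t) / t) * (7 * real k) * (4 ^ k * m)" by simp
      also have "\<dots> = 7 * real k * t powr (\<alpha> - 2) * (4 ^ k * m)" unfolding p by simp
      finally have b2: "norm (of_real (t powr \<alpha>) * (of_nat k * q t ^ K * (q' t * (\<i> / of_real T))) / s t)
          \<le> 7 * real k * t powr (\<alpha> - 2) * (4 ^ k * m)" .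
      have "norm (of_real (t powr \<alpha>) * q t ^ k * \<i> / s t ^ 2) \<le> t powr \<alpha> * (4 ^ k * m) / t ^ 2"
        unfolding norm_divide norm_mult norm_power[of "s t"] norm_ii mult_1_right using ns[of t] t qkm(1) m(1)
        by (intro frac_le mult_mono mult_nonneg_nonneg power_mono) auto
      also have "\<dots> = (t powr \<alpha> / t ^ 2) * (4 ^ k * m)" by simp
      finally have b3: "norm (of_real (t powr \<alpha>) * q t ^ k * \<i> / s t ^ 2) \<le> t powr (\<alpha> - 2) * (4 ^ k * m)" unfolding p .
      have "norm (A' t) \<le> \<alpha> * t powr (\<alpha> - 2) * (4 ^ k * m) + 7 * real k * t powr (\<alpha> - 2) * (4 ^ k * m) + t powr (\<alpha> - 2) * (4 ^ k * m)"
        unfolding A'_def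
        by (rule order_trans[OF norm_triangle_ineq4 add_mono[OF order_trans[OF norm_triangle_ineq add_mono[OF b1 b2]] b3]])
      also have "\<dots> = M * (t powr (\<alpha> - 2) * m)" by (simp add: M_def algebra_simps)
      finally have "norm (A' t) * sqrt t \<le> M * (t powr (\<alpha> - 2) * m) * sqrt t"
        using t by (intro mult_right_mono) auto
      also have "\<dots> = M * (t powr ((\<alpha> - 1/2) - 1) * m)"
      proof -
        have "t powr (\<alpha> - 2) * t powr (1/2) = t powr ((\<alpha> - 1/2) - 1)"
          by (simp add: powr_add[symmetric])
        thus ?thesis using t by (simp add: powr_half_sqrt mult_ac)
      qed
      finally show "norm (A' t) * sqrt t \<le> M * (t powr ((\<alpha> - 1/2) - 1) * min 1 (T / t) ^ K)" by (simp add: m_def)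
    qed
    also have "integral {R..x} (\<lambda>t. M * (t powr ((\<alpha> - 1/2) - 1) * min 1 (T / t) ^ K)) =
       M * integral {R..x} (\<lambda>t. (t powr ((\<alpha> - 1/2) - 1) * min 1 (T / t) ^ K))"
      by (rule integral_mult_right)
    also have "\<dots> \<le> M * ((1 / (\<alpha> - 1/2) + 1 / (real K - (\<alpha> - 1/2))) * T powr (\<alpha> - 1/2))"
    proof (rule mult_left_mono[OF truncated_power_integral_le M])
      show "\<alpha> - 1/2 < real K" using \<alpha>(2) k(2) by linarith
    qed (use \<alpha>(1) T R x in linarith)+
    finally have bA': "integral {R..x} (\<lambda>t. norm (A' t) * sqrt t) \<le> M * ((1 / (\<alpha> - 1/2) + 1 / (real K - (\<alpha> - 1/2))) * T powr (\<alpha> - 1/2))" .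
    have "norm (integral {R..x} (\<lambda>t. A t * exp (\<i> * of_real (c * t - d * t * ln t)))) \<le>
       10 * (4 ^ k * T powr (\<alpha> - 1/2) + M * ((1 / (\<alpha> - 1/2) + 1 / (real K - (\<alpha> - 1/2))) * T powr (\<alpha> - 1/2)))"
      by (rule order_trans[OF b0]) (intro mult_left_mono add_mono bA bA', simp)
    also have "\<dots> = C * T powr (\<alpha> - 1/2)"
    proof -
      have "10 * (u * p + M * (z * p)) = 10 * (u + M * z) * p" for u z p :: real
        by (simp add: algebra_simps)
      thus ?thesis unfolding C_def .
    qed
    finally have "norm (integral {R..x} (\<lambda>t. A t * exp (\<i> * of_real (c * t - d * t * ln t)))) \<le> C * T powr (\<alpha> - 1/2)" .
    thus "norm (integral {R..x} (\<lambda>t. of_real (t powr \<alpha>) * mexp (Complex \<sigma> t / of_real T) ^ k / Complex \<sigma> t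
        * exp (\<i> * of_real (c * t - d * t * ln t)))) \<le> C * T powr (\<alpha> - 1/2)"
      unfolding A_def q_def s_def .
  qed
qed

section \<open>Integrals over vertical lines\<close>

text \<open>Connects the Lebesgue integral over a whole line, suited to series and limits, with
  gauge integrals over intervals, in which contour integrals and oscillatory estimates are
  expressed.\<close>

lemma tendsto_integral_symmetric_intervals:
  fixes h :: "real \<Rightarrow> complex"
  assumes "integrable lborel h"
  shows "(\<lambda>n. integral {- real n..real n} h) \<longlonglongrightarrow> integral\<^sup>L lborel h"
proof -
  have "integral {- real n..real n} h = (LINT t|lborel. indicator {- real n..real n} t *\<^sub>R h t)" for n
    using set_borel_integral_eq_integral(2)[of "{- real n..real n}" h] integrable_mult_indicator[OF _ assms, of "{- real n..real n}"]
    by (simp add: set_lebesgue_integral_def set_integrable_def)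
  moreover have "(\<lambda>n. LINT t|lborel. indicator {- real n..real n} t *\<^sub>R h t) \<longlonglongrightarrow> integral\<^sup>L lborel h"
  proof (rule integral_dominated_convergence)
    show "integrable lborel (\<lambda>t. norm (h t))" using assms by (rule integrable_norm)
    show "AE t in lborel. (\<lambda>n. indicator {- real n..real n} t *\<^sub>R h t) \<longlonglongrightarrow> h t"
    proof
      fix t
      have "eventually (\<lambda>n. indicator {- real n..real n} t *\<^sub>R h t = h t) sequentially"
        using eventually_ge_at_top[of "nat \<lceil>\<bar>t\<bar>\<rceil>"] by eventually_elim (auto simp: indicator_def)
      thus "(\<lambda>n. indicator {- real n..real n} t *\<^sub>R h t) \<longlonglongrightarrow> h t" by (rule tendsto_eventually)
    qed
  qed (use assms in \<open>auto simp: indicator_def\<close>)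
  ultimately show ?thesis by simp
qed

text \<open>The residue theorem on rectangles reaching from height \<open>-R\<close> to
  \<open>R\<close>; each horizontal side contributes at most \<open>g R * (b - a)\<close>. The
  integrals are taken in \<open>t\<close>, so the usual \<open>2 * pi * \<i>\<close> appears as
  \<open>2 * pi\<close>.\<close>

theorem vertical_line_shift:
  fixes f :: "complex \<Rightarrow> complex" and a b :: real
  assumes ab: "a' < a" "a < b" "b < b'"
    and pts: "finite pts" "\<And>p. p \<in> pts \<Longrightarrow> a < Re p \<and> Re p < b"
    and hol: "f holomorphic_on ({s. a' < Re s \<and> Re s < b'} - pts)"
    and int: "integrable lborel (\<lambda>t. f (Complex a t))" "integrable lborel (\<lambda>t. f (Complex b t))"
    and decay: "(g \<longlongrightarrow> 0) at_top" "\<And>\<sigma> t. a \<le> \<sigma> \<Longrightarrow> \<sigma> \<le> b \<Longrightarrow> \<bar>t\<bar> \<ge> Rb \<Longrightarrow> norm (f (Complex \<sigma> t)) \<le> g \<bar>t\<bar>"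
  shows "(LINT t|lborel. f (Complex b t)) = (LINT t|lborel. f (Complex a t)) + 2 * pi * (\<Sum>p\<in>pts. residue f p)"
proof -
  define S where "S = {s. a' < Re s \<and> Re s < b'}"
  have S_alt: "S = {s. Re s > a'} \<inter> {s. Re s < b'}" by (auto simp: S_def)
  have S: "open S" "connected S" "convex S"
    unfolding S_alt by (auto intro!: open_Int open_halfspace_Re_gt open_halfspace_Re_lt convex_connected convex_Int convex_halfspace_Re_gt convex_halfspace_Re_lt)
  have hol: "f holomorphic_on (S - pts)" using hol by (simp add: S_def)
  have cont: "continuous_on (S - pts) f" using hol by (rule holomorphic_on_imp_continuous_on)
  \<comment> \<open>A height from which on \<open>decay\<close> applies and which exceeds that of
    every point of \<open>pts\<close>, so that each has winding number 1.\<close>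
  define M where "M = Max (insert Rb (insert 1 ((\<lambda>p. \<bar>Im p\<bar> + 1) ` pts)))"
  have M: "M \<ge> Rb" "M \<ge> 1" "\<And>p. p \<in> pts \<Longrightarrow> \<bar>Im p\<bar> < M"
  proof -
    show "M \<ge> Rb" unfolding M_def using pts by (intro Max_ge) auto
    show "M \<ge> 1" unfolding M_def using pts by (intro Max_ge) auto
    fix p assume "p \<in> pts"
    hence "\<bar>Im p\<bar> + 1 \<le> M" unfolding M_def using pts by (intro Max_ge) auto
    thus "\<bar>Im p\<bar> < M" by simp
  qed
  define Res where "Res = (\<Sum>p\<in>pts. residue f p)"
  have main: "norm (integral {-R..R} (\<lambda>t. f (Complex b t)) - integral {-R..R} (\<lambda>t. f (Complex a t)) - 2 * pi * Res) \<le> 2 * g R * (b - a)"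
    if R: "R \<ge> M" for R
  proof -
    define a1 a2 a3 a4 where defs: "a1 = Complex a (-R)" "a2 = Complex b (-R)" "a3 = Complex b R" "a4 = Complex a R"
    have R0: "R > 0" using R M by simp
    have rp: "rectpath a1 a3 = linepath a1 a2 +++ linepath a2 a3 +++ linepath a3 a4 +++ linepath a4 a1"
      by (simp add: rectpath_def Let_def defs)
    have av: "p \<notin> path_image (rectpath a1 a3)" if "p \<in> pts" for p
      using pts(2)[OF that] M(3)[OF that] R ab R0
      by (subst path_image_rectpath) (auto simp: defs)
    have inS: "path_image (rectpath a1 a3) \<subseteq> S"
      using ab R0 by (subst path_image_rectpath) (auto simp: defs S_def)
    have sub: "path_image (rectpath a1 a3) \<subseteq> S - pts" using av inS by auto
    have im: "path_image (rectpath a1 a3) = closed_segment a1 a2 \<union> closed_segment a2 a3 \<union> closed_segment a3 a4 \<union> closed_segment a4 a1"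
      by (simp add: rp path_image_join Un_assoc)
    have ci: "f contour_integrable_on linepath x y" if "closed_segment x y \<subseteq> path_image (rectpath a1 a3)" for x y
      using that sub by (intro contour_integrable_continuous_linepath continuous_on_subset[OF cont]) auto
    have ci4: "f contour_integrable_on linepath a1 a2" "f contour_integrable_on linepath a2 a3"
      "f contour_integrable_on linepath a3 a4" "f contour_integrable_on linepath a4 a1"
      by (rule ci, unfold im, blast)+
    have "contour_integral (rectpath a1 a3) f = 2 * pi * \<i> * (\<Sum>p\<in>pts. winding_number (rectpath a1 a3) p * residue f p)"
    proof (rule Residue_theorem[OF S(1,2) pts(1) hol _ _ sub])
      show "\<forall>z. z \<notin> S \<longrightarrow> winding_number (rectpath a1 a3) z = 0"
      proof (intro allI impI)
        fix z assume z: "z \<notin> S"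
        show "winding_number (rectpath a1 a3) z = 0"
        proof (rule winding_number_zero_outside[of _ S])
        qed (use S inS z in auto)
      qed
    qed auto
    also have "(\<Sum>p\<in>pts. winding_number (rectpath a1 a3) p * residue f p) = Res"
      unfolding Res_def
    proof (intro sum.cong refl)
      fix p assume p: "p \<in> pts"
      have "winding_number (rectpath a1 a3) p = 1"
        using pts(2)[OF p] M(3)[OF p] R by (intro winding_number_rectpath) (auto simp: defs in_box_complex_iff)
      thus "winding_number (rectpath a1 a3) p * residue f p = residue f p" by simp
    qed
    also have "contour_integral (rectpath a1 a3) f = contour_integral (linepath a1 a2) f + (contour_integral (linepath a2 a3) f + (contour_integral (linepath a3 a4) f + contour_integral (linepath a4 a1) f))"
      unfolding rp using ci4 by (simp add: contour_integrable_joinI)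
    also have "contour_integral (linepath a2 a3) f = \<i> * integral {-R..R} (\<lambda>t. f (Complex b t))"
      by (subst contour_integral_linepath_same_Re) (use R0 in \<open>auto simp: defs\<close>)
    also have "contour_integral (linepath a4 a1) f = - contour_integral (linepath a1 a4) f"
      by (rule contour_integral_reverse_linepath) (rule continuous_on_subset[OF cont], use sub im in auto)
    also have "contour_integral (linepath a1 a4) f = \<i> * integral {-R..R} (\<lambda>t. f (Complex a t))"
      by (subst contour_integral_linepath_same_Re) (use R0 in \<open>auto simp: defs\<close>)
    finally have eq: "\<i> * (integral {-R..R} (\<lambda>t. f (Complex b t)) - integral {-R..R} (\<lambda>t. f (Complex a t)) - 2 * pi * Res) =
       - contour_integral (linepath a1 a2) f - contour_integral (linepath a3 a4) f"
      by (simp add: algebra_simps)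
    have gb: "norm (f z) \<le> g R" if "Im z = R \<or> Im z = -R" "a \<le> Re z" "Re z \<le> b" for z
      using decay(2)[of "Re z" "Im z"] that R R0 M(1) by auto
    have g0: "g R \<ge> 0" using gb[of a4] ab by (simp add: defs) (meson norm_ge_zero order_trans)
    have seg: "z \<in> closed_segment (Complex x u) (Complex y u) \<Longrightarrow> Im z = u \<and> min x y \<le> Re z \<and> Re z \<le> max x y" for z x y u
      by (auto simp: closed_segment_same_Im closed_segment_eq_real_ivl split: if_splits)
    have b1: "norm (contour_integral (linepath a1 a2) f) \<le> g R * norm (a2 - a1)"
    proof (rule contour_integral_bound_linepath[OF ci4(1) g0])
      fix z assume "z \<in> closed_segment a1 a2"
      thus "norm (f z) \<le> g R" unfolding defs using seg[of z a "-R" b] ab by (intro gb) auto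
    qed
    have b2: "norm (contour_integral (linepath a3 a4) f) \<le> g R * norm (a4 - a3)"
    proof (rule contour_integral_bound_linepath[OF ci4(3) g0])
      fix z assume "z \<in> closed_segment a3 a4"
      thus "norm (f z) \<le> g R" unfolding defs using seg[of z b R a] ab by (intro gb) auto
    qed
    have "a2 - a1 = of_real (b - a)" "a4 - a3 = - of_real (b - a)" by (simp_all add: defs complex_eq_iff)
    hence "norm (a2 - a1) = \<bar>b - a\<bar>" "norm (a4 - a3) = \<bar>b - a\<bar>"
      by (metis norm_minus_cancel norm_of_real)+
    hence nn: "norm (a2 - a1) = b - a" "norm (a4 - a3) = b - a" using ab by auto
    have "norm (\<i> * (integral {-R..R} (\<lambda>t. f (Complex b t)) - integral {-R..R} (\<lambda>t. f (Complex a t)) - 2 * pi * Res))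
       \<le> norm (contour_integral (linepath a1 a2) f) + norm (contour_integral (linepath a3 a4) f)"
      unfolding eq using norm_triangle_ineq4[of "- contour_integral (linepath a1 a2) f" "contour_integral (linepath a3 a4) f"] by simp
    also have "\<dots> \<le> g R * (b - a) + g R * (b - a)" using b1 b2 nn by (intro add_mono) auto
    finally show ?thesis by (simp add: norm_mult)
  qed
  have "(\<lambda>n. integral {-real n..real n} (\<lambda>t. f (Complex b t)) - integral {-real n..real n} (\<lambda>t. f (Complex a t)) - 2 * pi * Res)
     \<longlonglongrightarrow> (LINT t|lborel. f (Complex b t)) - (LINT t|lborel. f (Complex a t)) - 2 * pi * Res"
    by (intro tendsto_intros tendsto_integral_symmetric_intervals int)
  moreover have "(\<lambda>n. integral {-real n..real n} (\<lambda>t. f (Complex b t)) - integral {-real n..real n} (\<lambda>t. f (Complex a t)) - 2 * pi * Res)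
     \<longlonglongrightarrow> 0"
  proof (rule Lim_null_comparison)
    show "eventually (\<lambda>n. norm (integral {-real n..real n} (\<lambda>t. f (Complex b t)) - integral {-real n..real n} (\<lambda>t. f (Complex a t)) - 2 * pi * Res) \<le> 2 * g (real n) * (b - a)) sequentially"
      using eventually_ge_at_top[of "nat \<lceil>M\<rceil>"]
    proof eventually_elim
      case (elim n)
      thus ?case by (intro main) linarith
    qed
    have "(\<lambda>n. 2 * g (real n) * (b - a)) \<longlonglongrightarrow> 2 * 0 * (b - a)"
      by (intro tendsto_intros filterlim_compose[OF decay(1) filterlim_real_sequentially])
    thus "(\<lambda>n. 2 * g (real n) * (b - a)) \<longlonglongrightarrow> 0" by simp
  qed
  ultimately show ?thesis unfolding Res_def using LIMSEQ_unique by (fastforce simp: algebra_simps)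
qed

lemma integrable_inverse_one_plus_square: "integrable lborel (\<lambda>t::real. 1 / (1 + t\<^sup>2))"
proof -
  have "set_integrable lborel (einterval (-\<infinity>) \<infinity>) (\<lambda>x::real. 1 / (1 + x\<^sup>2))"
  proof (rule interval_integral_FTC_nonneg(1)[where F = arctan and A = "-pi/2" and B = "pi/2"])
    show "((arctan \<circ> real_of_ereal) \<longlongrightarrow> - pi / 2) (at_right (- \<infinity>))"
      by (simp add: ereal_tendsto_simps1 tendsto_arctan_at_bot)
    show "((arctan \<circ> real_of_ereal) \<longlongrightarrow> pi / 2) (at_left \<infinity>)"
      by (simp add: ereal_tendsto_simps1 tendsto_arctan_at_top)
  qed (auto intro!: derivative_eq_intros continuous_intros simp: field_simps sum_power2_eq_zero_iff add_nonneg_eq_0_iff)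
  thus ?thesis by (simp add: set_integrable_def einterval_def)
qed

lemma integrable_continuous_quadratic_decay:
  fixes h :: "real \<Rightarrow> complex"
  assumes "continuous_on UNIV h" "\<And>t. norm (h t) \<le> C / (1 + t\<^sup>2)"
  shows "integrable lborel h"
proof (rule Bochner_Integration.integrable_bound)
  show "integrable lborel (\<lambda>t::real. C * (1 / (1 + t\<^sup>2)))"
    by (intro integrable_mult_right integrable_inverse_one_plus_square)
  show "h \<in> borel_measurable lborel" using assms(1) by (simp add: borel_measurable_continuous_onI)
  show "AE t in lborel. norm (h t) \<le> norm (C * (1 / (1 + t\<^sup>2)))"
  proof (rule AE_I2)
    fix t
    have "norm (h t) \<le> C * (1 / (1 + t\<^sup>2))" using assms(2)[of t] by simp
    thus "norm (h t) \<le> norm (C * (1 / (1 + t\<^sup>2)))" unfolding real_norm_def by linarith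
  qed
qed

lemma inverse_norm_power_le:
  fixes s :: complex
  assumes "\<bar>Re s\<bar> \<ge> \<delta>" "0 < \<delta>" "\<delta> \<le> 1" "m \<ge> 1"
  shows "1 / norm s ^ Suc m \<le> (1 / \<delta> ^ Suc m) / (1 + (Im s)\<^sup>2)"
proof -
  have ns: "norm s \<ge> \<delta>" using assms abs_Re_le_cmod[of s] by linarith
  have "\<delta>\<^sup>2 \<le> \<bar>Re s\<bar>\<^sup>2" using assms by (intro power_mono) auto
  moreover have "\<delta>\<^sup>2 \<le> 1" using assms by (simp add: power_le_one)
  ultimately have "\<delta>\<^sup>2 \<le> \<bar>Re s\<bar>\<^sup>2" "\<delta>\<^sup>2 \<le> 1" by auto
  hence "\<delta>\<^sup>2 * (1 + (Im s)\<^sup>2) \<le> norm s ^ 2"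
    using mult_right_mono[of "\<delta>\<^sup>2" 1 "(Im s)\<^sup>2"] by (simp add: cmod_power2 algebra_simps)
  hence "\<delta> ^ (m - 1) * (\<delta>\<^sup>2 * (1 + (Im s)\<^sup>2)) \<le> norm s ^ (m - 1) * norm s ^ 2"
    using ns assms by (intro mult_mono power_mono) auto
  moreover have "\<delta> ^ Suc m = \<delta> ^ (m - 1) * \<delta>\<^sup>2" "norm s ^ Suc m = norm s ^ (m - 1) * norm s ^ 2"
    using assms(4) by (simp_all add: power_add[symmetric] Suc_diff_le)
  ultimately have "\<delta> ^ Suc m * (1 + (Im s)\<^sup>2) \<le> norm s ^ Suc m" by (simp add: mult_ac)
  hence "1 / norm s ^ Suc m \<le> 1 / (\<delta> ^ Suc m * (1 + (Im s)\<^sup>2))"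
  proof (intro divide_left_mono mult_pos_pos)
    show "0 < norm s ^ Suc m" using ns assms by (intro zero_less_power) linarith
    show "0 < 1 + (Im s)\<^sup>2" by (simp add: add_pos_nonneg)
  qed (use assms in auto)
  thus ?thesis by simp
qed

lemma Complex_alt: "Complex \<sigma> t = of_real \<sigma> + \<i> * of_real t"
  by (simp add: complex_eq_iff)

lemma continuous_on_Complex [continuous_intros]: "continuous_on A (\<lambda>t. Complex \<sigma> t)"
  unfolding Complex_alt by (intro continuous_intros)

lemma Complex_ne_0: "\<sigma> \<noteq> 0 \<Longrightarrow> Complex \<sigma> t \<noteq> 0"
  by (simp add: complex_eq_iff)

lemma integrable_exp_over_power:
  assumes "\<sigma> \<noteq> 0" "m \<ge> 1"
  shows "integrable lborel (\<lambda>t. exp (of_real L * Complex \<sigma> t) / Complex \<sigma> t ^ Suc m)"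
proof (rule integrable_continuous_quadratic_decay)
  define \<delta> where "\<delta> = min 1 \<bar>\<sigma>\<bar>"
  show "continuous_on UNIV (\<lambda>t. exp (of_real L * Complex \<sigma> t) / Complex \<sigma> t ^ Suc m)"
    using Complex_ne_0[OF assms(1)] by (intro continuous_intros) auto
  fix t
  show "norm (exp (of_real L * Complex \<sigma> t) / Complex \<sigma> t ^ Suc m) \<le> (exp (L * \<sigma>) * (1 / \<delta> ^ Suc m)) / (1 + t\<^sup>2)"
    using mult_left_mono[OF inverse_norm_power_le[of \<delta> "Complex \<sigma> t" m], of "exp (L * \<sigma>)"] assms
    by (simp add: norm_divide norm_power norm_mult \<delta>_def)
qed

text \<open>For \<open>L < 0\<close> the line is pushed to the right, where
  \<open>exp (L * s)\<close> stays bounded; for \<open>L \<ge> 0\<close> to the left, past the pole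
  at 0 with residue \<open>L ^ m / fact m\<close>. In both directions the power of \<open>s\<close>
  drives the integral to 0. The bound \<open>m \<ge> 1\<close> ensures absolute convergence.\<close>

lemma perron_exp_over_power:
  fixes L c :: real
  assumes c: "c > 0" and m: "m \<ge> 1"
  shows "(LINT t|lborel. exp (of_real L * Complex c t) / Complex c t ^ Suc m) = of_real (2 * pi * (max 0 L ^ m / fact m))"
proof -
  define f :: "complex \<Rightarrow> complex" where "f = (\<lambda>s. exp (of_real L * s) / s ^ Suc m)"
  define I where "I = (\<lambda>\<sigma>. LINT t|lborel. f (Complex \<sigma> t))"
  have int: "integrable lborel (\<lambda>t. f (Complex \<sigma> t))" if "\<sigma> \<noteq> 0" for \<sigma>
    unfolding f_def using that m by (intro integrable_exp_over_power)
  have fb: "norm (f (Complex \<sigma> t)) \<le> exp (\<bar>L\<bar> * B) * (1 / \<bar>t\<bar> ^ Suc m)" if "\<bar>\<sigma>\<bar> \<le> B" "\<bar>t\<bar> \<ge> 1" for \<sigma> t B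
  proof -
    have "norm (f (Complex \<sigma> t)) = exp (L * \<sigma>) * (1 / norm (Complex \<sigma> t) ^ Suc m)"
      by (simp add: f_def norm_divide norm_mult norm_power)
    also have "\<dots> \<le> exp (\<bar>L\<bar> * B) * (1 / \<bar>t\<bar> ^ Suc m)"
    proof (intro mult_mono divide_left_mono power_mono)
      have "L * \<sigma> \<le> \<bar>L\<bar> * \<bar>\<sigma>\<bar>" by (metis abs_ge_self abs_mult)
      also have "\<dots> \<le> \<bar>L\<bar> * B" using that by (intro mult_left_mono) auto
      finally show "exp (L * \<sigma>) \<le> exp (\<bar>L\<bar> * B)" by simp
      show "\<bar>t\<bar> \<le> cmod (Complex \<sigma> t)" using abs_Im_le_cmod[of "Complex \<sigma> t"] by simp
    qed (use that in \<open>auto intro!: mult_pos_pos zero_less_power simp: complex_eq_iff\<close>)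
    finally show ?thesis .
  qed
  have g0: "((\<lambda>t. exp (\<bar>L\<bar> * B) * (1 / t ^ Suc m)) \<longlongrightarrow> 0) at_top" for B
  proof -
    have "((\<lambda>t::real. inverse (t ^ Suc m)) \<longlongrightarrow> 0) at_top"
      by (intro tendsto_inverse_0_at_top filterlim_pow_at_top filterlim_ident) auto
    hence "((\<lambda>t. exp (\<bar>L\<bar> * B) * inverse (t ^ Suc m)) \<longlongrightarrow> exp (\<bar>L\<bar> * B) * 0) at_top"
      by (intro tendsto_intros)
    thus ?thesis by (simp add: inverse_eq_divide)
  qed
  have fhol: "f holomorphic_on A - {0}" for A unfolding f_def by (intro holomorphic_intros) auto
  \<comment> \<open>\<epsilon> is the sign of the direction of the shift;
    \<open>L * \<epsilon> \<le> 0\<close> keeps the exponential at most 1 on all the lines, so that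
    one integrable majorant serves them all.\<close>
  have lim0: "(\<lambda>n. I (\<epsilon> * real (Suc n))) \<longlonglongrightarrow> 0" if \<epsilon>: "\<bar>\<epsilon>\<bar> = 1" "L * \<epsilon> \<le> 0" for \<epsilon> :: real
  proof -
    have "(\<lambda>n. I (\<epsilon> * real (Suc n))) \<longlonglongrightarrow> (LINT t|(lborel :: real measure). (0::complex))"
      unfolding I_def
    proof (rule integral_dominated_convergence[where s = "\<lambda>n t. f (Complex (\<epsilon> * real (Suc n)) t)" and f = "\<lambda>t. 0" and w = "\<lambda>t. 1 / (1 + t\<^sup>2)" and M = lborel])
      have re: "\<bar>Re (Complex (\<epsilon> * real (Suc n)) t)\<bar> = real (Suc n)" for n t using \<epsilon> by (simp add: abs_mult del: of_nat_Suc)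
      have ex: "exp (L * (\<epsilon> * real (Suc n))) \<le> 1" for n
        using \<epsilon>(2) mult_nonpos_nonneg[of "L * \<epsilon>" "real (Suc n)"] by (simp add: mult.assoc del: of_nat_Suc)
      have nf: "norm (f (Complex (\<epsilon> * real (Suc n)) t)) \<le> 1 / norm (Complex (\<epsilon> * real (Suc n)) t) ^ Suc m" for n t
        using mult_right_mono[OF ex[of n], of "1 / norm (Complex (\<epsilon> * real (Suc n)) t) ^ Suc m"]
        by (simp add: f_def norm_divide norm_mult norm_power)
      show "integrable lborel (\<lambda>t::real. 1 / (1 + t\<^sup>2))" by (rule integrable_inverse_one_plus_square)
      show "AE t in lborel. (\<lambda>n. f (Complex (\<epsilon> * real (Suc n)) t)) \<longlonglongrightarrow> 0"
      proof
        fix t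
        show "(\<lambda>n. f (Complex (\<epsilon> * real (Suc n)) t)) \<longlonglongrightarrow> 0"
        proof (rule Lim_null_comparison[OF always_eventually])
          show "\<forall>n. norm (f (Complex (\<epsilon> * real (Suc n)) t)) \<le> 1 / real (Suc n)"
          proof
            fix n
            have n: "real (Suc n) \<le> norm (Complex (\<epsilon> * real (Suc n)) t)"
              using abs_Re_le_cmod[of "Complex (\<epsilon> * real (Suc n)) t"] unfolding re .
            have "norm (f (Complex (\<epsilon> * real (Suc n)) t)) \<le> 1 / norm (Complex (\<epsilon> * real (Suc n)) t) ^ Suc m" by (rule nf)
            also have "\<dots> \<le> 1 / norm (Complex (\<epsilon> * real (Suc n)) t) ^ 1"
              using n by (intro divide_left_mono power_increasing mult_pos_pos zero_less_power) auto
            also have "\<dots> \<le> 1 / real (Suc n)" using n by (simp add: frac_le del: of_nat_Suc)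
            finally show "norm (f (Complex (\<epsilon> * real (Suc n)) t)) \<le> 1 / real (Suc n)" .
          qed
          show "(\<lambda>n. 1 / real (Suc n)) \<longlonglongrightarrow> 0" using LIMSEQ_Suc[OF lim_const_over_n[of "1::real"]] by simp
        qed
      qed
      show "AE t in lborel. norm (f (Complex (\<epsilon> * real (Suc n)) t)) \<le> 1 / (1 + t\<^sup>2)" for n
      proof
        fix t
        have "norm (f (Complex (\<epsilon> * real (Suc n)) t)) \<le> 1 / norm (Complex (\<epsilon> * real (Suc n)) t) ^ Suc m" by (rule nf)
        also have "\<dots> \<le> (1 / 1 ^ Suc m) / (1 + (Im (Complex (\<epsilon> * real (Suc n)) t))\<^sup>2)"
          by (rule inverse_norm_power_le) (use m in \<open>auto simp: re simp del: of_nat_Suc complex.sel\<close>)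
        finally show "norm (f (Complex (\<epsilon> * real (Suc n)) t)) \<le> 1 / (1 + t\<^sup>2)" by simp
      qed
      show "(\<lambda>t. f (Complex (\<epsilon> * real (Suc n)) t)) \<in> borel_measurable lborel" for n
        using int[of "\<epsilon> * real (Suc n)"] \<epsilon> by (intro borel_measurable_integrable) auto
    qed auto
    thus ?thesis by simp
  qed
  show ?thesis
  proof (cases "L \<ge> 0")
    case False
    have Ic: "I (1 * real (Suc n)) = I c" if n: "real (Suc n) > c" for n
    proof -
      have "I (real (Suc n)) = I c + 2 * pi * (\<Sum>p\<in>{}. residue f p)"
        unfolding I_def
      proof (rule vertical_line_shift[where a' = "c / 2" and b' = "real (Suc n) + 1" and Rb = 1 and g = "\<lambda>t. exp (\<bar>L\<bar> * real (Suc n)) * (1 / t ^ Suc m)"])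
        have "f holomorphic_on {s. c / 2 < Re s \<and> Re s < real (Suc n) + 1} - {0}" by (rule fhol)
        moreover have "{s. c / 2 < Re s \<and> Re s < real (Suc n) + 1} - {0} = {s. c / 2 < Re s \<and> Re s < real (Suc n) + 1} - {}" using c by auto
        ultimately show "f holomorphic_on {s. c / 2 < Re s \<and> Re s < real (Suc n) + 1} - {}" by metis
        show "((\<lambda>t. exp (\<bar>L\<bar> * real (Suc n)) * (1 / t ^ Suc m)) \<longlongrightarrow> 0) at_top" by (rule g0)
        show "norm (f (Complex \<sigma> t)) \<le> exp (\<bar>L\<bar> * real (Suc n)) * (1 / \<bar>t\<bar> ^ Suc m)" if "c \<le> \<sigma>" "\<sigma> \<le> real (Suc n)" "1 \<le> \<bar>t\<bar>" for \<sigma> t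
          using that c by (intro fb) auto
      qed (use c n int in auto)
      thus ?thesis by simp
    qed
    have "eventually (\<lambda>n. I (1 * real (Suc n)) = I c) sequentially"
      using eventually_gt_at_top[of "nat \<lceil>c\<rceil>"]
    proof eventually_elim
      case (elim n)
      thus ?case by (intro Ic) linarith
    qed
    hence "(\<lambda>n. I (1 * real (Suc n))) \<longlonglongrightarrow> I c" by (rule tendsto_eventually)
    hence "I c = 0" using lim0[of 1] False LIMSEQ_unique by auto
    thus ?thesis using False m by (simp add: I_def f_def power_0_left max_def)
  next
    case True
    have res: "residue f 0 = of_real (L ^ m / fact m)"
    proof -
      have "residue f 0 = (deriv ^^ m) (\<lambda>s. exp (of_real L * s)) 0 / fact m"
        unfolding f_def by (rule residue_holomorphic_over_power'[of UNIV]) (auto intro!: holomorphic_intros)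
      moreover have "(deriv ^^ n) (\<lambda>s::complex. exp (of_real L * s)) = (\<lambda>s. of_real L ^ n * exp (of_real L * s))" for n
      proof (induction n)
        case (Suc n)
        have "deriv (\<lambda>s::complex. of_real L ^ n * exp (of_real L * s)) = (\<lambda>s. of_real L ^ Suc n * exp (of_real L * s))"
          by (intro ext DERIV_imp_deriv) (auto intro!: derivative_eq_intros)
        thus ?case using Suc by simp
      qed auto
      ultimately show ?thesis by simp
    qed
    have "I c - 2 * pi * residue f 0 = I (- 1 * real (Suc n))" for n
    proof -
      have "I c = I (- real (Suc n)) + 2 * pi * (\<Sum>p\<in>{0}. residue f p)"
        unfolding I_def
      proof (rule vertical_line_shift[where a' = "- real (Suc n) - 1" and b' = "c + 1" and Rb = 1 and g = "\<lambda>t. exp (\<bar>L\<bar> * (real (Suc n) + c)) * (1 / t ^ Suc m)"])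
        show "f holomorphic_on {s. - real (Suc n) - 1 < Re s \<and> Re s < c + 1} - {0}" by (rule fhol)
        show "((\<lambda>t. exp (\<bar>L\<bar> * (real (Suc n) + c)) * (1 / t ^ Suc m)) \<longlongrightarrow> 0) at_top" by (rule g0)
        show "norm (f (Complex \<sigma> t)) \<le> exp (\<bar>L\<bar> * (real (Suc n) + c)) * (1 / \<bar>t\<bar> ^ Suc m)" if "- real (Suc n) \<le> \<sigma>" "\<sigma> \<le> c" "1 \<le> \<bar>t\<bar>" for \<sigma> t
          using that c by (intro fb) auto
      qed (use c int in auto)
      thus ?thesis by (simp add: algebra_simps)
    qed
    hence "(\<lambda>n. I (- 1 * real (Suc n))) \<longlonglongrightarrow> I c - 2 * pi * residue f 0" by simp
    hence "I c - 2 * pi * residue f 0 = 0" by (rule LIMSEQ_unique[OF _ lim0]) (use True in auto)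
    hence "I c = of_real (2 * pi * (L ^ m / fact m))" unfolding res by simp
    thus ?thesis using True by (simp add: I_def f_def)
  qed
qed

section \<open>Finite differences and the smoothed step function\<close>

primrec fwd_diff :: "real \<Rightarrow> nat \<Rightarrow> (real \<Rightarrow> 'a) \<Rightarrow> real \<Rightarrow> 'a :: real_vector" where
  "fwd_diff w 0 f y = f y"
| "fwd_diff w (Suc k) f y = fwd_diff w k f (y + w) - fwd_diff w k f y"

lemma fwd_diff_has_derivative:
  fixes f :: "real \<Rightarrow> real"
  assumes "\<And>x. (f has_real_derivative f' x) (at x)"
  shows "(fwd_diff w k f has_real_derivative fwd_diff w k f' x) (at x)"
proof (induction k arbitrary: x)
  case 0
  have "fwd_diff w 0 f = f" "fwd_diff w 0 f' = f'" by (auto intro!: ext)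
  thus ?case using assms by simp
next
  case (Suc k)
  have "fwd_diff w (Suc k) f = (\<lambda>y. fwd_diff w k f (y + w) - fwd_diff w k f y)" by (auto intro!: ext)
  moreover have "((\<lambda>y. fwd_diff w k f (y + w)) has_real_derivative fwd_diff w k f' (x + w)) (at x)"
    using Suc[of "x + w"] by (simp add: DERIV_shift)
  ultimately show ?case using Suc[of x] by (auto intro!: DERIV_diff)
qed

text \<open>The unit step averaged k times over windows of length \<open>w\<close>, that is, an
  integrated B-spline, written as the k-th difference quotient of the truncated power.\<close>

definition cutoff :: "real \<Rightarrow> nat \<Rightarrow> real \<Rightarrow> real" where
  "cutoff w k x = fwd_diff w k (\<lambda>x. max 0 x ^ k / fact k) x / w ^ k"

text \<open>Differences commute with differentiation, and the truncated power of exponent k + 1 has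
  that of exponent k as its derivative, also at 0 because k is positive. The mean value theorem for
  the outermost difference removes one averaging.\<close>

lemma cutoff_mean_value:
  assumes "w > 0" "k \<ge> 1"
  shows "\<exists>\<xi>. x < \<xi> \<and> \<xi> < x + w \<and> cutoff w (Suc k) x = cutoff w k \<xi>"
proof -
  define f :: "nat \<Rightarrow> real \<Rightarrow> real" where "f = (\<lambda>k x. max 0 x ^ k / fact k)"
  have f0: "f (Suc k) 0 = 0" by (simp add: f_def)
  have d: "(f (Suc k) has_real_derivative f k x) (at x)" for x
  proof -
    consider "x > 0" | "x < 0" | "x = 0" by linarith
    thus ?thesis
    proof cases
      case 1
      have "((\<lambda>x. x ^ Suc k / fact (Suc k)) has_real_derivative f k x) (at x)"
        by (rule DERIV_cong[OF DERIV_cdivide[OF DERIV_pow]]) (use 1 in \<open>simp add: f_def del: of_nat_Suc\<close>)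
      moreover have ev: "eventually (\<lambda>y. y ^ Suc k / fact (Suc k) = f (Suc k) y) (nhds x)"
        using eventually_nhds_in_open[of "{0<..}" x] 1 by (auto elim!: eventually_mono simp: f_def max_def)
      ultimately show ?thesis unfolding DERIV_cong_ev[OF refl ev refl] by simp
    next
      case 2
      have "((\<lambda>x. 0) has_real_derivative f k x) (at x)"
        using 2 assms(2) by (simp add: f_def power_0_left)
      moreover have ev: "eventually (\<lambda>y. 0 = f (Suc k) y) (nhds x)"
        using eventually_nhds_in_open[of "{..<0}" x] 2 by (auto elim!: eventually_mono simp: f_def max_def)
      ultimately show ?thesis unfolding DERIV_cong_ev[OF refl ev refl] by simp
    next
      case 3
      have "((\<lambda>h. (f (Suc k) h - f (Suc k) 0) / h) \<longlongrightarrow> 0) (at 0)"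
      proof (rule Lim_null_comparison)
        show "eventually (\<lambda>h. norm ((f (Suc k) h - f (Suc k) 0) / h) \<le> \<bar>h\<bar> ^ k) (at 0)"
        proof (rule always_eventually, rule allI)
          fix h :: real
          have "\<bar>f (Suc k) h\<bar> \<le> \<bar>h\<bar> ^ Suc k / 1"
            unfolding f_def abs_divide by (intro frac_le) (auto simp: max_def simp del: power_Suc fact_Suc)
          thus "norm ((f (Suc k) h - f (Suc k) 0) / h) \<le> \<bar>h\<bar> ^ k"
          proof (cases "h = 0")
            case False
            have "norm ((f (Suc k) h - f (Suc k) 0) / h) = \<bar>f (Suc k) h\<bar> / \<bar>h\<bar>" by (simp add: f0)
            also have "\<dots> \<le> \<bar>h\<bar> ^ Suc k / \<bar>h\<bar>"
              using \<open>\<bar>f (Suc k) h\<bar> \<le> \<bar>h\<bar> ^ Suc k / 1\<close> by (intro divide_right_mono) auto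
            finally show ?thesis using False by simp
          qed simp
        qed
        have "((\<lambda>h::real. \<bar>h\<bar> ^ k) \<longlongrightarrow> \<bar>0\<bar> ^ k) (at 0)" by (intro tendsto_intros)
        thus "((\<lambda>h::real. \<bar>h\<bar> ^ k) \<longlongrightarrow> 0) (at 0)" using assms(2) by (simp add: power_0_left)
      qed
      thus ?thesis using 3 assms(2) by (simp add: DERIV_def f_def power_0_left)
    qed
  qed
  have "\<exists>\<xi>>x. \<xi> < x + w \<and> fwd_diff w k (f (Suc k)) (x + w) - fwd_diff w k (f (Suc k)) x = (x + w - x) * fwd_diff w k (f k) \<xi>"
    using assms(1) by (intro MVT2 fwd_diff_has_derivative d) auto
  then obtain \<xi> where "x < \<xi>" "\<xi> < x + w" "fwd_diff w (Suc k) (f (Suc k)) x = w * fwd_diff w k (f k) \<xi>" by auto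
  moreover have "cutoff w (Suc k) x = fwd_diff w (Suc k) (f (Suc k)) x / w ^ Suc k" "cutoff w k \<xi> = fwd_diff w k (f k) \<xi> / w ^ k"
    unfolding cutoff_def f_def by (rule refl)+
  ultimately show ?thesis using assms(1) by (intro exI[of _ \<xi>]) (auto simp del: fwd_diff.simps)
qed

text \<open>By induction over k: the value at \<open>x\<close> is a value of the preceding cutoff
  inside \<open>(x, x + w)\<close>, so the range is kept and the transition region grows by one
  \<open>w\<close> to the left.\<close>

lemma cutoff_bounds:
  assumes w: "w > 0" and k: "k \<ge> 1"
  shows "0 \<le> cutoff w k x" "cutoff w k x \<le> 1" 
    "x \<ge> 0 \<Longrightarrow> cutoff w k x = 1" "x \<le> - (real k * w) \<Longrightarrow> cutoff w k x = 0"
proof -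
  have "0 \<le> cutoff w k x \<and> cutoff w k x \<le> 1 \<and> (x \<ge> 0 \<longrightarrow> cutoff w k x = 1) \<and> (x \<le> - (real k * w) \<longrightarrow> cutoff w k x = 0)"
    using k
  proof (induction k arbitrary: x rule: dec_induct)
    case base
    have "cutoff w 1 x = (max 0 (x + w) - max 0 x) / w" by (simp add: cutoff_def)
    thus ?case using w by (auto simp: max_def divide_le_eq)
  next
    case (step k)
    from cutoff_mean_value[OF w step(1), of x] obtain \<xi> where
      \<xi>: "x < \<xi>" "\<xi> < x + w" "cutoff w (Suc k) x = cutoff w k \<xi>" by blast
    show ?case using step.IH[of \<xi>] \<xi> by (auto simp: algebra_simps)
  qed
  thus "0 \<le> cutoff w k x" "cutoff w k x \<le> 1" 
    "x \<ge> 0 \<Longrightarrow> cutoff w k x = 1" "x \<le> - (real k * w) \<Longrightarrow> cutoff w k x = 0" by auto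
qed

section \<open>Sums of translates\<close>

primrec shift_sum :: "real list \<Rightarrow> (real \<Rightarrow> 'a) \<Rightarrow> real \<Rightarrow> 'a :: real_vector" where
  "shift_sum [] f y = f y"
| "shift_sum (\<tau> # \<tau>s) f y = shift_sum \<tau>s f y + shift_sum \<tau>s f (y + \<tau>)"

text \<open>The symbol of \<open>shift_sum\<close>: multiplying the integrand over a vertical line
  by \<open>exp_mult \<tau>s\<close> applies \<open>shift_sum \<tau>s\<close> to the integral as a
  function of the exponent \<open>L\<close>.\<close>

primrec exp_mult :: "real list \<Rightarrow> complex \<Rightarrow> complex" where
  "exp_mult [] s = 1"
| "exp_mult (\<tau> # \<tau>s) s = (exp (of_real \<tau> * s) + 1) * exp_mult \<tau>s s"

lemma fwd_diff_line_integral: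
  fixes H :: "real \<Rightarrow> complex"
  assumes "\<And>L. integrable lborel (\<lambda>t. exp (of_real L * Complex \<sigma> t) * H t)"
  shows "integrable lborel (\<lambda>t. exp (of_real L * Complex \<sigma> t) * ((exp (of_real w * Complex \<sigma> t) - 1) ^ k * H t))"
    and "(LINT t|lborel. exp (of_real L * Complex \<sigma> t) * ((exp (of_real w * Complex \<sigma> t) - 1) ^ k * H t)) =
           fwd_diff w k (\<lambda>L. LINT t|lborel. exp (of_real L * Complex \<sigma> t) * H t) L"
proof (induction k arbitrary: L)
  case (Suc k)
  have eq: "exp (of_real L * Complex \<sigma> t) * ((exp (of_real w * Complex \<sigma> t) - 1) ^ Suc k * H t) =
     exp (of_real (L + w) * Complex \<sigma> t) * ((exp (of_real w * Complex \<sigma> t) - 1) ^ k * H t)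
     - exp (of_real L * Complex \<sigma> t) * ((exp (of_real w * Complex \<sigma> t) - 1) ^ k * H t)" for t L
    by (simp add: exp_add distrib_right algebra_simps)
  {
    case 1 show ?case unfolding eq using Suc.IH(1) by (intro Bochner_Integration.integrable_diff)
  next
    case 2 show ?case unfolding eq using Suc.IH by (simp del: of_real_add)
  }
qed (use assms in auto)

lemma shift_sum_line_integral:
  fixes H :: "real \<Rightarrow> complex"
  assumes "\<And>L. integrable lborel (\<lambda>t. exp (of_real L * Complex \<sigma> t) * H t)"
  shows "integrable lborel (\<lambda>t. exp (of_real L * Complex \<sigma> t) * (exp_mult \<tau>s (Complex \<sigma> t) * H t))"
    and "(LINT t|lborel. exp (of_real L * Complex \<sigma> t) * (exp_mult \<tau>s (Complex \<sigma> t) * H t)) =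
           shift_sum \<tau>s (\<lambda>L. LINT t|lborel. exp (of_real L * Complex \<sigma> t) * H t) L"
proof (induction \<tau>s arbitrary: L)
  case (Cons \<tau> \<tau>s)
  have eq: "exp (of_real L * Complex \<sigma> t) * (exp_mult (\<tau> # \<tau>s) (Complex \<sigma> t) * H t) =
     exp (of_real L * Complex \<sigma> t) * (exp_mult \<tau>s (Complex \<sigma> t) * H t)
     + exp (of_real (L + \<tau>) * Complex \<sigma> t) * (exp_mult \<tau>s (Complex \<sigma> t) * H t)" for t L
    by (simp add: exp_add distrib_right algebra_simps)
  {
    case 1 show ?case unfolding eq using Cons.IH(1) by (intro Bochner_Integration.integrable_add)
  next
    case 2 show ?case unfolding eq using Cons.IH by (simp del: of_real_add)
  }
qed (use assms in auto)

lemma fwd_diff_scale: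
  "fwd_diff w k (\<lambda>x. c * f x) y = (c :: 'a :: real_algebra) * fwd_diff w k f y"
  by (induction k arbitrary: y) (auto simp: algebra_simps)

lemma fwd_diff_of_real:
  "fwd_diff w k (\<lambda>x. complex_of_real (f x)) y = of_real (fwd_diff w k f y)"
  by (induction k arbitrary: y) auto

lemma shift_sum_scale:
  "shift_sum \<tau>s (\<lambda>x. c * f x) y = (c :: 'a :: real_algebra) * shift_sum \<tau>s f y"
  by (induction \<tau>s arbitrary: y) (auto simp: algebra_simps)

lemma shift_sum_of_real:
  "shift_sum \<tau>s (\<lambda>x. complex_of_real (f x)) y = of_real (shift_sum \<tau>s f y)"
  by (induction \<tau>s arbitrary: y) auto

lemma shift_sum_diff:
  "shift_sum \<tau>s (\<lambda>x. f x - g x) y = shift_sum \<tau>s f y - shift_sum \<tau>s g y"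
  by (induction \<tau>s arbitrary: y) auto

lemma shift_sum_mono:
  fixes f g :: "real \<Rightarrow> real"
  assumes "\<And>x. f x \<le> g x"
  shows "shift_sum \<tau>s f y \<le> shift_sum \<tau>s g y"
  using assms by (induction \<tau>s arbitrary: y) (auto intro: add_mono)

lemma shift_sum_nonneg:
  fixes f :: "real \<Rightarrow> real"
  assumes "\<And>x. 0 \<le> f x"
  shows "0 \<le> shift_sum \<tau>s f y"
  using assms by (induction \<tau>s arbitrary: y) auto

text \<open>One of the summands is \<open>f y\<close>. This yields an upper bound for the summatory
  function before any inversion.\<close>

lemma le_shift_sum:
  fixes f :: "real \<Rightarrow> real"
  assumes "\<And>x. 0 \<le> f x"
  shows "f y \<le> shift_sum \<tau>s f y"
  using assms
  by (induction \<tau>s arbitrary: y) (auto intro: order_trans[OF _ add_increasing2] shift_sum_nonneg)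

lemma norm_shift_sum_le:
  "norm (shift_sum \<tau>s f y) \<le> shift_sum \<tau>s (\<lambda>x. norm (f x)) y"
  by (induction \<tau>s arbitrary: y) (auto intro: order_trans[OF norm_triangle_ineq add_mono])

lemma shift_sum_exp:
  "shift_sum \<tau>s (\<lambda>x. exp (a * x)) y = (\<Prod>\<tau>\<leftarrow>\<tau>s. exp (a * \<tau>) + 1) * exp (a * (y :: real))"
  by (induction \<tau>s arbitrary: y) (auto simp: exp_add algebra_simps)

lemma exp_mult_of_real:
  "exp_mult \<tau>s (of_real a) = of_real (\<Prod>\<tau>\<leftarrow>\<tau>s. exp (a * \<tau>) + 1)"
  by (induction \<tau>s) (auto simp: mult.commute simp flip: exp_of_real)

lemma shift_sum_translate: "shift_sum \<tau>s (\<lambda>x. f (x + b)) y = shift_sum \<tau>s f (y + b)"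
  by (induction \<tau>s arbitrary: y) (auto simp: add_ac)

lemma exp_mult_holomorphic [holomorphic_intros]: "exp_mult \<tau>s holomorphic_on A"
proof (induction \<tau>s)
  case Nil
  have "exp_mult [] = (\<lambda>_. 1)" by auto
  thus ?case by simp
next
  case (Cons \<tau> \<tau>s)
  have "exp_mult (\<tau> # \<tau>s) = (\<lambda>s. (exp (of_real \<tau> * s) + 1) * exp_mult \<tau>s s)" by auto
  thus ?case using Cons by (auto intro!: holomorphic_intros)
qed

lemma norm_exp_mult_le: "norm (exp_mult \<tau>s s) \<le> (\<Prod>\<tau>\<leftarrow>\<tau>s. exp (Re s * \<tau>) + 1)"
proof (induction \<tau>s)
  case (Cons \<tau> \<tau>s)
  have "norm (exp (of_real \<tau> * s) + 1) \<le> exp (Re s * \<tau>) + 1"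
    by (rule order_trans[OF norm_triangle_ineq]) (simp add: mult.commute)
  thus ?case using Cons by (auto simp: norm_mult intro!: mult_mono)
qed auto

text \<open>Perron's kernel \<open>1 / s\<close>, damped by the transform of k averagings and
  multiplied by the twist.\<close>

definition smooth_kernel :: "real list \<Rightarrow> real \<Rightarrow> nat \<Rightarrow> complex \<Rightarrow> complex" where
  "smooth_kernel \<tau>s w k s = exp_mult \<tau>s s * (mexp (of_real w * s) ^ k / s)"

lemma mexp_power_over:
  assumes "w > 0"
  shows "mexp (of_real w * s) ^ k / s = 1 / of_real w ^ k * ((exp (of_real w * s) - 1) ^ k * (1 / s ^ Suc k))"
  using assms by (simp add: mexp_def power_divide power_mult_distrib)

text \<open>Each factor \<open>exp (w * s) - 1\<close> takes one difference in \<open>L\<close>. The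
  integral is therefore the k-th difference of the one for \<open>1 / s ^ Suc k\<close>, which is
  \<open>cutoff\<close> up to the factor \<open>w ^ k\<close>, and the twist turns it into a sum of
  translates.\<close>

theorem perron_smooth_kernel:
  assumes c: "c > 0" and w: "w > 0" and k: "k \<ge> 1"
  shows "integrable lborel (\<lambda>t. exp (of_real L * Complex c t) * smooth_kernel \<tau>s w k (Complex c t))"
    and "(LINT t|lborel. exp (of_real L * Complex c t) * smooth_kernel \<tau>s w k (Complex c t)) =
           of_real (2 * pi * shift_sum \<tau>s (cutoff w k) L)"
proof -
  define H where "H = (\<lambda>t. 1 / Complex c t ^ Suc k)"
  have i1: "integrable lborel (\<lambda>t. exp (of_real L * Complex c t) * H t)" for L
    using integrable_exp_over_power[of c k L] c k by (simp add: H_def)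
  define H2 where "H2 = (\<lambda>t. mexp (of_real w * Complex c t) ^ k / Complex c t)"
  have H2: "H2 t = 1 / of_real w ^ k * ((exp (of_real w * Complex c t) - 1) ^ k * H t)" for t
    unfolding H2_def H_def by (rule mexp_power_over[OF w])
  have i2: "integrable lborel (\<lambda>t. exp (of_real L * Complex c t) * H2 t)" for L
    using fwd_diff_line_integral(1)[OF i1, of L w k] unfolding H2 by (simp add: mult.left_commute)
  have e2: "(LINT t|lborel. exp (of_real L * Complex c t) * H2 t) = of_real (2 * pi * cutoff w k L)" for L
  proof -
    have "(LINT t|lborel. exp (of_real L * Complex c t) * H2 t) = 
       1 / of_real w ^ k * (LINT t|lborel. exp (of_real L * Complex c t) * ((exp (of_real w * Complex c t) - 1) ^ k * H t))"
      unfolding H2 by (subst integral_mult_right_zero [symmetric]) (simp add: mult.left_commute)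
    also have "\<dots> = 1 / of_real w ^ k * fwd_diff w k (\<lambda>L. LINT t|lborel. exp (of_real L * Complex c t) * H t) L"
      by (subst fwd_diff_line_integral(2)[OF i1]) (rule refl)
    also have "(\<lambda>L. LINT t|lborel. exp (of_real L * Complex c t) * H t) = (\<lambda>L. of_real (2 * pi) * of_real (max 0 L ^ k / fact k))"
      using perron_exp_over_power[OF c k] by (simp add: H_def)
    also have "fwd_diff w k (\<lambda>L. complex_of_real (2 * pi) * of_real (max 0 L ^ k / fact k)) L = of_real (2 * pi) * of_real (fwd_diff w k (\<lambda>x. max 0 x ^ k / fact k) L)"
      by (subst fwd_diff_scale, subst fwd_diff_of_real) simp
    finally show ?thesis by (simp add: cutoff_def)
  qed
  have sk: "smooth_kernel \<tau>s w k (Complex c t) = exp_mult \<tau>s (Complex c t) * H2 t" for t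
    by (simp add: smooth_kernel_def H2_def)
  show "integrable lborel (\<lambda>t. exp (of_real L * Complex c t) * smooth_kernel \<tau>s w k (Complex c t))"
    unfolding sk by (rule shift_sum_line_integral(1)[OF i2])
  have "(LINT t|lborel. exp (of_real L * Complex c t) * smooth_kernel \<tau>s w k (Complex c t)) = 
     shift_sum \<tau>s (\<lambda>L. of_real (2 * pi) * of_real (cutoff w k L)) L"
    unfolding sk by (subst shift_sum_line_integral(2)[OF i2]) (simp only: e2 of_real_mult)
  also have "\<dots> = of_real (2 * pi * shift_sum \<tau>s (cutoff w k) L)"
    by (subst shift_sum_scale, subst shift_sum_of_real) simp
  finally show "(LINT t|lborel. exp (of_real L * Complex c t) * smooth_kernel \<tau>s w k (Complex c t)) =
           of_real (2 * pi * shift_sum \<tau>s (cutoff w k) L)" .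
qed

section \<open>Generalised Dirichlet series\<close>

text \<open>Exponents of either sign are allowed: with \<open>- ln (l n)\<close> these are Dirichlet
  series in \<open>s\<close>, with \<open>ln (\<mu> n)\<close> they cover the reflected series of
  \<open>\<psi> (1 - s)\<close>.\<close>

definition gds :: "(nat \<Rightarrow> complex) \<Rightarrow> (nat \<Rightarrow> real) \<Rightarrow> complex \<Rightarrow> complex" where
  "gds c e s = (\<Sum>n. c n * exp (of_real (e n) * s))"

lemma gds_holomorphic:
  assumes "\<And>x. x > \<sigma> \<Longrightarrow> summable (\<lambda>n. norm (c n) * exp (e n * x))"
  shows "gds c e holomorphic_on {s. Re s > \<sigma>}"
proof (rule holomorphic_uniform_sequence)
  show "open {s. Re s > \<sigma>}" by (rule open_halfspace_Re_gt)
  show "(\<lambda>s. \<Sum>n<N. c n * exp (of_real (e n) * s)) holomorphic_on {s. Re s > \<sigma>}" for N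
    by (intro holomorphic_intros)
  fix s assume s: "s \<in> {s. Re s > \<sigma>}"
  define d where "d = (Re s - \<sigma>) / 2"
  have d: "d > 0" using s by (simp add: d_def)
  have re: "Re s - d \<le> Re z \<and> Re z \<le> Re s + d" if "z \<in> cball s d" for z
  proof -
    have "\<bar>Re (s - z)\<bar> \<le> d" using that abs_Re_le_cmod[of "s - z"] by (simp add: dist_norm)
    thus ?thesis unfolding minus_complex.sel by linarith
  qed
  have "uniform_limit (cball s d) (\<lambda>N s. \<Sum>n<N. c n * exp (of_real (e n) * s)) (gds c e) sequentially"
    unfolding gds_def
  proof (rule Weierstrass_m_test)
    fix n z assume z: "z \<in> cball s d"
    \<comment> \<open>As the exponent may have either sign, the maximum over the disc sits at its
      left or right end; the sum of both values serves as majorant.\<close>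
    have "exp (e n * Re z) \<le> exp (e n * (Re s - d)) + exp (e n * (Re s + d))"
    proof (cases "e n \<ge> 0")
      case True
      have "exp (e n * Re z) \<le> exp (e n * (Re s + d))" using re[OF z] True by (simp add: mult_left_mono)
      thus ?thesis using exp_ge_zero[of "e n * (Re s - d)"] by linarith
    next
      case False
      have "exp (e n * Re z) \<le> exp (e n * (Re s - d))" using re[OF z] False by (simp add: mult_left_mono_neg)
      thus ?thesis using exp_ge_zero[of "e n * (Re s + d)"] by linarith
    qed
    hence "norm (c n) * exp (e n * Re z) \<le> norm (c n) * (exp (e n * (Re s - d)) + exp (e n * (Re s + d)))"
      by (intro mult_left_mono) auto
    thus "norm (c n * exp (of_real (e n) * z)) \<le> norm (c n) * exp (e n * (Re s - d)) + norm (c n) * exp (e n * (Re s + d))"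
      by (simp add: norm_mult distrib_left)
  next
    show "summable (\<lambda>n. norm (c n) * exp (e n * (Re s - d)) + norm (c n) * exp (e n * (Re s + d)))"
      using s d by (intro summable_add assms) (auto simp: d_def field_simps)
  qed
  moreover have "cball s d \<subseteq> {s. Re s > \<sigma>}" using re d by (force simp: d_def field_simps)
  ultimately show "\<exists>d>0. cball s d \<subseteq> {s. \<sigma> < Re s} \<and> uniform_limit (cball s d) (\<lambda>N s. \<Sum>n<N. c n * exp (of_real (e n) * s)) (gds c e) sequentially"
    using d by blast
qed

text \<open>The identity theorem on the half-plane of absolute convergence without 1, which is
  connected. It carries the representation from the half-plane where it is assumed to the one where
  the series converges absolutely.\<close>

lemma gds_continuation:
  assumes "\<And>x. x > \<sigma> \<Longrightarrow> summable (\<lambda>n. norm (c n) * exp (e n * x))"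
    and "\<And>s. Re s > \<sigma>' \<Longrightarrow> F s = gds c e s"
    and "F holomorphic_on (- {1})" "Re s > \<sigma>" "s \<noteq> 1"
  shows "F s = gds c e s"
proof -
  define S where "S = {s. Re s > \<sigma>} - {1}"
  have "open S" unfolding S_def by (intro open_delete open_halfspace_Re_gt)
  moreover have "connected S"
    unfolding S_def by (intro connected_open_delete open_halfspace_Re_gt convex_connected convex_halfspace_Re_gt) auto
  ultimately have S: "open S" "connected S" .
  define U where "U = {s. Re s > max (max \<sigma> \<sigma>') 1}"
  show ?thesis
  proof (rule analytic_continuation_open[of U S F "gds c e"])
    show "open U" unfolding U_def by (rule open_halfspace_Re_gt)
    have "of_real (max (max \<sigma> \<sigma>') 1 + 1) \<in> U" unfolding U_def mem_Collect_eq complex.sel Re_complex_of_real by linarith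
    thus "U \<noteq> {}" by blast
    show "U \<subseteq> S" by (auto simp: U_def S_def)
    show "F holomorphic_on S" by (rule holomorphic_on_subset[OF assms(3)]) (auto simp: S_def)
    show "gds c e holomorphic_on S" by (rule holomorphic_on_subset[OF gds_holomorphic[OF assms(1)]]) (auto simp: S_def)
    show "F z = gds c e z" if "z \<in> U" for z using that assms(2) by (auto simp: U_def)
    show "s \<in> S" using assms by (simp add: S_def)
  qed (use S in auto)
qed

text \<open>On a fixed line the modulus of \<open>exp (e n * s)\<close> does not depend on
  \<open>t\<close>, so the integrals of the moduli of the terms are summable and termwise
  integration is allowed.\<close>

lemma gds_line_integral:
  fixes H :: "real \<Rightarrow> complex"
  assumes H: "integrable lborel H"
    and c: "summable (\<lambda>n. norm (c n) * exp (e n * \<sigma>))"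
  shows "(\<lambda>n. c n * (LINT t|lborel. exp (of_real (e n) * Complex \<sigma> t) * H t)) sums (LINT t|lborel. gds c e (Complex \<sigma> t) * H t)"
    and "integrable lborel (\<lambda>t. gds c e (Complex \<sigma> t) * H t)"
proof -
  define f where "f = (\<lambda>n t. c n * exp (of_real (e n) * Complex \<sigma> t) * H t)"
  have nf: "norm (f n t) = (norm (c n) * exp (e n * \<sigma>)) * norm (H t)" for n t
    by (simp add: f_def norm_mult)
  have m: "f n \<in> borel_measurable lborel" for n
  proof -
    have "(\<lambda>t. c n * exp (of_real (e n) * Complex \<sigma> t)) \<in> borel_measurable lborel"
      by (simp, intro borel_measurable_continuous_onI continuous_intros)
    thus ?thesis unfolding f_def by (rule borel_measurable_times[OF _ borel_measurable_integrable[OF H]])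
  qed
  have i: "integrable lborel (f n)" for n
  proof (rule Bochner_Integration.integrable_bound[OF _ m])
    show "integrable lborel (\<lambda>t. (norm (c n) * exp (e n * \<sigma>)) * norm (H t))"
      using H by (intro integrable_mult_right integrable_norm)
    show "AE t in lborel. norm (f n t) \<le> norm ((norm (c n) * exp (e n * \<sigma>)) * norm (H t))"
      by (simp add: nf)
  qed
  have s: "(\<lambda>t. \<Sum>n. f n t) = (\<lambda>t. gds c e (Complex \<sigma> t) * H t)"
  proof
    fix t
    have "summable (\<lambda>n. c n * exp (of_real (e n) * Complex \<sigma> t))"
      by (rule summable_norm_cancel) (use c in \<open>simp add: norm_mult\<close>)
    thus "(\<Sum>n. f n t) = gds c e (Complex \<sigma> t) * H t"
      unfolding f_def gds_def by (rule suminf_mult2[symmetric])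
  qed
  have A: "AE t in lborel. summable (\<lambda>n. norm (f n t))"
    unfolding nf using c by (intro AE_I2 summable_mult2)
  have B: "summable (\<lambda>n. LINT t|lborel. norm (f n t))"
    unfolding nf using summable_mult2[OF c, of "LINT t|lborel. norm (H t)"] by simp
  show "integrable lborel (\<lambda>t. gds c e (Complex \<sigma> t) * H t)"
    using integrable_suminf[OF i A B] by (simp add: s)
  have "(\<lambda>n. integral\<^sup>L lborel (f n)) sums (LINT t|lborel. gds c e (Complex \<sigma> t) * H t)"
    using sums_integral[OF i A B] by (simp add: s)
  moreover have "integral\<^sup>L lborel (f n) = c n * (LINT t|lborel. exp (of_real (e n) * Complex \<sigma> t) * H t)" for n
    unfolding f_def by (subst integral_mult_right_zero[symmetric]) (simp add: mult.assoc)
  ultimately show "(\<lambda>n. c n * (LINT t|lborel. exp (of_real (e n) * Complex \<sigma> t) * H t)) sums (LINT t|lborel. gds c e (Complex \<sigma> t) * H t)"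
    by simp
qed

lemma frequencies_pos: "frequencies l \<Longrightarrow> 0 < l (Suc n)"
  by (simp add: frequencies_def)

lemma finite_frequencies_less:
  assumes "frequencies l"
  shows "finite {n. 1 \<le> n \<and> l n < X}"
proof -
  have "eventually (\<lambda>n. X \<le> l n) sequentially"
    using assms by (auto simp: frequencies_def filterlim_at_top)
  then obtain N where "\<And>n. n \<ge> N \<Longrightarrow> X \<le> l n" by (auto simp: eventually_sequentially)
  hence "{n. 1 \<le> n \<and> l n < X} \<subseteq> {..<N}" by (force simp: not_le[symmetric])
  thus ?thesis by (rule finite_subset) auto
qed

text \<open>Translates unconditional sums over \<open>n \<ge> 1\<close> with complex powers into
  ordinary series over \<open>Suc n\<close> with exponentials.\<close>

lemma abs_conv_dirichlet_gds:
  assumes F: "abs_conv_dirichlet F c l \<sigma>" and l: "frequencies l" and s: "Re s > \<sigma>"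
  shows "summable (\<lambda>n. norm (c (Suc n)) * exp (- ln (l (Suc n)) * Re s))"
    and "F s = gds (\<lambda>n. c (Suc n)) (\<lambda>n. - ln (l (Suc n))) s"
proof -
  have term_eq: "dirichlet_term c l s (Suc n) = c (Suc n) * exp (of_real (- ln (l (Suc n))) * s)" for n
    using frequencies_pos[OF l, of n] by (simp add: dirichlet_term_def powr_def Ln_of_real mult.commute)
  have S: "(\<lambda>n. norm (dirichlet_term c l s n)) summable_on {1..}" "F s = (\<Sum>\<^sub>\<infinity>n\<in>{1..}. dirichlet_term c l s n)"
    using F s by (auto simp: abs_conv_dirichlet_def)
  have img: "{1..} = Suc ` UNIV" by (auto simp: image_iff) (metis Suc_le_D)
  have "(\<lambda>n. norm (dirichlet_term c l s (Suc n))) summable_on UNIV"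
    using S(1) unfolding img by (subst (asm) summable_on_reindex) (auto simp: o_def)
  hence 1: "summable (\<lambda>n. norm (dirichlet_term c l s (Suc n)))"
    by (rule summable_on_imp_summable)
  thus "summable (\<lambda>n. norm (c (Suc n)) * exp (- ln (l (Suc n)) * Re s))"
    unfolding term_eq by (simp add: norm_mult)
  have "F s = (\<Sum>\<^sub>\<infinity>n. dirichlet_term c l s (Suc n))"
    unfolding S(2) img by (subst infsum_reindex) (auto simp: o_def)
  also have "\<dots> = (\<Sum>n. dirichlet_term c l s (Suc n))"
    using infsumI[OF norm_summable_imp_has_sum[OF 1 summable_sums[OF summable_norm_cancel[OF 1]]]] .
  finally show "F s = gds (\<lambda>n. c (Suc n)) (\<lambda>n. - ln (l (Suc n))) s"
    by (simp add: gds_def term_eq)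
qed

lemma sum_le_delta_hat:
  assumes \<mu>: "frequencies \<mu>" and bdd: "bdd_above (mean_abs b \<mu> ` {0<..})" and Z: "Z > 0"
  shows "(\<Sum>n<N. if \<mu> (Suc n) < Z then norm (b (Suc n)) else 0) \<le> delta_hat b \<mu> * Z"
proof -
  have "mean_abs b \<mu> Z \<le> delta_hat b \<mu>"
    unfolding delta_hat_def by (rule cSUP_upper) (use bdd Z in auto)
  hence *: "(\<Sum>n | 1 \<le> n \<and> \<mu> n < Z. norm (b n)) \<le> delta_hat b \<mu> * Z"
    using Z by (simp add: mean_abs_def field_simps)
  have "(\<Sum>n<N. if \<mu> (Suc n) < Z then norm (b (Suc n)) else 0) = (\<Sum>n | n < N \<and> \<mu> (Suc n) < Z. norm (b (Suc n)))"
    by (subst sum.inter_filter[symmetric]) (auto simp: conj_commute)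
  also have "\<dots> = (\<Sum>n\<in>Suc ` {n. n < N \<and> \<mu> (Suc n) < Z}. norm (b n))"
    by (subst sum.reindex) (auto simp: o_def)
  also have "\<dots> \<le> (\<Sum>n | 1 \<le> n \<and> \<mu> n < Z. norm (b n))"
    by (intro sum_mono2 finite_frequencies_less \<mu>) auto
  finally show ?thesis using * by simp
qed

lemma delta_hat_nonneg:
  assumes "frequencies \<mu>" "bdd_above (mean_abs b \<mu> ` {0<..})"
  shows "delta_hat b \<mu> \<ge> 0"
  using sum_le_delta_hat[OF assms, of 1 0] by simp

text \<open>Dyadic decomposition of the ratios \<open>m n / Z\<close>. A block around
  \<open>2 ^ i\<close> has mass at most \<open>D * 2 ^ Suc i * Z\<close> by \<open>mean\<close>, and
  its terms carry weight at most \<open>q ^ i / (2 ^ i * Z)\<close> with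
  \<open>q = 2 powr - \<eta>\<close>, so it contributes \<open>2 * D * q ^ i\<close>; a block below
  1 contributes \<open>4 * D * q ^ i\<close>. The geometric series gives the rest. The smallest
  \<open>m n\<close> does not enter the bound, which makes it uniform over all frequencies.\<close>

lemma two_sided_weight_sum_le:
  fixes c m :: "nat \<Rightarrow> real"
  assumes c: "\<And>n. 0 \<le> c n" and m: "\<And>n. 0 < m n" and \<eta>: "\<eta> > 0" and Z: "Z > 0"
    and mean: "\<And>Z N. Z > 0 \<Longrightarrow> (\<Sum>n<N. if m n < Z then c n else 0) \<le> D * Z"
  shows "(\<Sum>n<N. c n / m n * min ((m n / Z) powr \<eta>) ((m n / Z) powr - \<eta>)) \<le> 6 * D / (1 - 2 powr - \<eta>)"
proof -
  define q where "q = 2 powr - \<eta>"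
  have q: "0 < q" "q < 1" using \<eta> by (auto simp: q_def powr_less_one)
  have D: "D \<ge> 0" using mean[of 1 0] by simp
  define r where "r = (\<lambda>n. m n / Z)"
  have r: "r n > 0" for n using m Z by (simp add: r_def)
  \<comment> \<open>Any number of blocks that covers the finitely many ratios with
    \<open>n < N\<close>; it disappears when the geometric sums are bounded by
    \<open>1 / (1 - q)\<close>.\<close>
  define J where "J = Suc (\<Sum>n<N. nat \<lceil>\<bar>log 2 (r n)\<bar>\<rceil>)"
  define W where "W = (\<lambda>x. min (x powr \<eta>) (x powr - \<eta>) / x)"
  \<comment> \<open>Each ratio is charged to a whole initial segment instead of a dyadic block,
    since \<open>mean\<close> controls initial segments only.\<close>
  have W: "W (r n) \<le> (\<Sum>i<J. if r n < 2 ^ Suc i then (1/2) ^ i * q ^ i else 0) + (\<Sum>i<J. if r n < 2 / 2 ^ i then 2 ^ Suc i * q ^ i else 0)"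
    if n: "n < N" for n
  proof -
    have J: "\<bar>log 2 (r n)\<bar> < real J"
    proof -
      have "nat \<lceil>\<bar>log 2 (r n)\<bar>\<rceil> \<le> (\<Sum>n<N. nat \<lceil>\<bar>log 2 (r n)\<bar>\<rceil>)" using n by (intro member_le_sum) auto
      thus ?thesis unfolding J_def by linarith
    qed
    have nn: "0 \<le> (\<Sum>i<J. if r n < 2 ^ Suc i then (1/2) ^ i * q ^ i else 0)" "0 \<le> (\<Sum>i<J. if r n < 2 / 2 ^ i then 2 ^ Suc i * q ^ i else 0)"
      using q by (auto intro!: sum_nonneg)
    show ?thesis
    proof (cases "r n \<ge> 1")
      case True
      define i where "i = nat \<lfloor>log 2 (r n)\<rfloor>"
      have l0: "log 2 (r n) \<ge> 0" using True by simp
      have i: "real i \<le> log 2 (r n)" "log 2 (r n) < real i + 1" using l0 unfolding i_def by linarith+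
      have i1: "2 ^ i \<le> r n" using i(1) r[of n] by (simp add: le_log_iff powr_realpow)
      have i2: "r n < 2 ^ Suc i" using i(2) r[of n] by (simp add: log_less_iff powr_realpow powr_add)
      have iJ: "i < J" using i(1) J by linarith
      have "W (r n) \<le> (r n powr - \<eta>) / r n" unfolding W_def using r[of n] by (intro divide_right_mono) auto
      also have "\<dots> \<le> ((2 ^ i) powr - \<eta>) / 2 ^ i" using i1 \<eta> r[of n] by (intro frac_le powr_mono2') auto
      also have "\<dots> = (1/2) ^ i * q ^ i"
        by (simp add: q_def powr_realpow[symmetric] powr_powr power_divide mult.commute powr_power field_simps)
      also have "\<dots> = (if r n < 2 ^ Suc i then (1/2) ^ i * q ^ i else 0)" using i2 by simp
      also have "\<dots> \<le> (\<Sum>i<J. if r n < 2 ^ Suc i then (1/2) ^ i * q ^ i else 0)"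
        using iJ q by (intro member_le_sum) auto
      finally show ?thesis using nn by linarith
    next
      case False
      define i where "i = nat \<lfloor>- log 2 (r n)\<rfloor>"
      have l0: "log 2 (r n) \<le> 0" using False r[of n] by simp
      have i: "real i \<le> - log 2 (r n)" "- log 2 (r n) < real i + 1" using l0 unfolding i_def by linarith+
      have i1: "r n \<le> 1 / 2 ^ i"
      proof -
        have "log 2 (r n) \<le> - real i" using i by simp
        hence "r n \<le> 2 powr (- real i)" using r[of n] by (simp add: log_le_iff)
        thus ?thesis by (simp add: powr_minus powr_realpow field_simps)
      qed
      have i2: "1 / 2 ^ Suc i < r n"
      proof -
        have "- (real i + 1) < log 2 (r n)" using i by simp
        hence "2 powr (- (real i + 1)) < r n" using r[of n] by (simp add: less_log_iff)
        thus ?thesis by (simp only: powr_minus powr_add powr_realpow) (simp add: powr_realpow field_simps)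
      qed
      have iJ: "i < J" using i(1) J by linarith
      have "W (r n) \<le> (r n powr \<eta>) / r n" unfolding W_def using r[of n] by (intro divide_right_mono) auto
      also have "\<dots> \<le> ((1 / 2 ^ i) powr \<eta>) / (1 / 2 ^ Suc i)" using i1 i2 \<eta> r[of n] by (intro frac_le powr_mono2) auto
      also have "\<dots> = 2 ^ Suc i * q ^ i"
        by (simp add: q_def powr_realpow[symmetric] powr_powr powr_divide powr_minus mult.commute powr_power field_simps)
      also have "\<dots> = (if r n < 2 / 2 ^ i then 2 ^ Suc i * q ^ i else 0)"
      proof -
        have "(1::real) / 2 ^ i < 2 / 2 ^ i" by (simp add: divide_strict_right_mono)
        hence "r n < 2 / 2 ^ i" using i1 by linarith
        thus ?thesis by simp
      qed
      also have "\<dots> \<le> (\<Sum>i<J. if r n < 2 / 2 ^ i then 2 ^ Suc i * q ^ i else 0)"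
        using iJ q by (intro member_le_sum) auto
      finally show ?thesis using nn by linarith
    qed
  qed
  have mean': "(\<Sum>n<N. if r n < y then c n else 0) \<le> D * (y * Z)" if "y > 0" for y
    using mean[of "y * Z" N] that Z by (simp add: r_def pos_divide_less_eq)
  have geo: "(\<Sum>i<J. q ^ i) \<le> 1 / (1 - q)"
  proof -
    have "(\<Sum>i<J. q ^ i) = (1 - q ^ J) / (1 - q)" using q by (simp add: sum_gp_strict)
    also have "\<dots> \<le> 1 / (1 - q)" using q by (intro divide_right_mono) auto
    finally show ?thesis .
  qed
  have eq: "(\<Sum>n<N. c n / m n * min ((m n / Z) powr \<eta>) ((m n / Z) powr - \<eta>)) = (\<Sum>n<N. c n * W (r n)) / Z"
    unfolding sum_divide_distrib W_def r_def using Z m by (intro sum.cong) (auto simp: field_simps)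
  have "(\<Sum>n<N. c n * W (r n)) \<le> (\<Sum>n<N. c n * ((\<Sum>i<J. if r n < 2 ^ Suc i then (1/2) ^ i * q ^ i else 0) + (\<Sum>i<J. if r n < 2 / 2 ^ i then 2 ^ Suc i * q ^ i else 0)))"
    using W c by (intro sum_mono mult_left_mono) auto
  also have "\<dots> = (\<Sum>n<N. \<Sum>i<J. (1/2) ^ i * q ^ i * (if r n < 2 ^ Suc i then c n else 0)) + (\<Sum>n<N. \<Sum>i<J. 2 ^ Suc i * q ^ i * (if r n < 2 / 2 ^ i then c n else 0))"
    unfolding distrib_left sum.distrib sum_distrib_left by (intro arg_cong2[where f = "(+)"] sum.cong refl) auto
  also have "(\<Sum>n<N. \<Sum>i<J. (1/2) ^ i * q ^ i * (if r n < 2 ^ Suc i then c n else 0)) = (\<Sum>i<J. (1/2) ^ i * q ^ i * (\<Sum>n<N. if r n < 2 ^ Suc i then c n else 0))"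
    by (subst sum.swap) (simp add: sum_distrib_left)
  also have "(\<Sum>n<N. \<Sum>i<J. 2 ^ Suc i * q ^ i * (if r n < 2 / 2 ^ i then c n else 0)) = (\<Sum>i<J. 2 ^ Suc i * q ^ i * (\<Sum>n<N. if r n < 2 / 2 ^ i then c n else 0))"
    by (subst sum.swap) (simp add: sum_distrib_left)
  also have "(\<Sum>i<J. (1/2) ^ i * q ^ i * (\<Sum>n<N. if r n < 2 ^ Suc i then c n else 0)) + (\<Sum>i<J. 2 ^ Suc i * q ^ i * (\<Sum>n<N. if r n < 2 / 2 ^ i then c n else 0))
     \<le> (\<Sum>i<J. (1/2) ^ i * q ^ i * (D * (2 ^ Suc i * Z))) + (\<Sum>i<J. 2 ^ Suc i * q ^ i * (D * (2 / 2 ^ i * Z)))"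
    using q by (intro add_mono sum_mono mult_left_mono mean') auto
  also have "\<dots> = (\<Sum>i<J. 2 * D * Z * q ^ i) + (\<Sum>i<J. 4 * D * Z * q ^ i)"
    by (intro arg_cong2[where f = "(+)"] sum.cong) (auto simp: power_divide)
  also have "\<dots> = 6 * D * Z * (\<Sum>i<J. q ^ i)"
    by (simp add: sum_distrib_left[symmetric])
  also have "\<dots> \<le> 6 * D * Z * (1 / (1 - q))" using geo D Z by (intro mult_left_mono) auto
  finally have "(\<Sum>n<N. c n * W (r n)) / Z \<le> 6 * D * Z * (1 / (1 - q)) / Z"
    using Z by (intro divide_right_mono) auto
  thus ?thesis unfolding eq using Z by (simp add: q_def)
qed

section \<open>The quotient of Gamma factors\<close>

definition gamma_quot :: "nat \<Rightarrow> (nat \<Rightarrow> complex) \<Rightarrow> complex \<Rightarrow> complex" where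
  "gamma_quot d \<beta> s = gamma_factor d \<beta> (1 - s) / gamma_factor d \<beta> s"

text \<open>Transfers estimates from \<open>t > 0\<close> to \<open>t < 0\<close> at the price of
  conjugated parameters, so that the asymptotics of the quotient are worked out for
  \<open>t > 0\<close> alone.\<close>

lemma cnj_gamma_quot: "cnj (gamma_quot d \<beta> s) = gamma_quot d (\<lambda>\<nu>. cnj (\<beta> \<nu>)) (cnj s)"
  by (simp add: gamma_quot_def gamma_factor_def cnj_prod cnj_Gamma)

lemma Ln_ii_times_of_real:
  assumes "\<tau> > 0"
  shows "Ln (\<i> * of_real \<tau>) = of_real (ln \<tau>) + \<i> * of_real (pi / 2)"
    and "Ln (\<i> * of_real (- \<tau>)) = of_real (ln \<tau>) - \<i> * of_real (pi / 2)"
proof -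
  have "Ln (of_real \<tau> * \<i>) = Ln (of_real \<tau>) + Ln \<i>"
    using Ln_times_of_real[OF assms, of \<i>] by (simp add: Ln_of_real assms)
  thus "Ln (\<i> * of_real \<tau>) = of_real (ln \<tau>) + \<i> * of_real (pi / 2)"
    by (simp add: Ln_of_real assms mult.commute)
  have "Ln (of_real \<tau> * (-\<i>)) = Ln (of_real \<tau>) + Ln (-\<i>)"
    using Ln_times_of_real[OF assms, of "-\<i>"] by (simp add: Ln_of_real assms)
  thus "Ln (\<i> * of_real (- \<tau>)) = of_real (ln \<tau>) - \<i> * of_real (pi / 2)"
    by (simp add: Ln_of_real assms mult.commute)
qed

text \<open>Numerator and denominator have opposite main imaginary parts \<open>- t / 2\<close> and
  \<open>t / 2\<close>. In the quotient the constant of Stirling's formula and the exponential decay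
  cancel, the power of \<open>t\<close> has the exponent \<open>1/2 - \<sigma>\<close> for every
  \<beta>, and there remain the phase \<open>t - t * ln (t / 2)\<close> and a constant
  factor.\<close>

lemma Gamma_ratio_asymp:
  fixes \<beta> :: complex
  shows "\<exists>C R. R \<ge> 2 \<and> (\<forall>\<sigma> t. \<bar>\<sigma>\<bar> \<le> K \<and> t \<ge> R \<longrightarrow> (\<exists>e. norm e \<le> C / t \<and>
     Gamma ((1 - Complex \<sigma> t) / 2 + \<beta>) / Gamma (Complex \<sigma> t / 2 + \<beta>) =
       exp (- (\<i> * of_real (pi / 2)) * (2 * \<beta> - 1/2) + of_real ((1/2 - \<sigma>) * ln (t / 2)) + \<i> * of_real (t - t * ln (t / 2)) + e)))"
proof -
  obtain c where c: "c \<noteq> 0" and st: "\<And>K. \<exists>C R. \<forall>(x::complex) \<tau>. norm x \<le> K \<and> \<bar>\<tau>\<bar> \<ge> R \<longrightarrow>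
      (\<exists>e. norm e \<le> C / \<bar>\<tau>\<bar> \<and> Gamma (x + \<i> * of_real \<tau>) =
          c * exp ((x + \<i> * of_real \<tau> - 1/2) * Ln (\<i> * of_real \<tau>) - \<i> * of_real \<tau> + e))"
    using Gamma_stirling by metis
  obtain C R where CR: "\<And>x \<tau>. norm x \<le> K + 1 + norm \<beta> \<Longrightarrow> \<bar>\<tau>\<bar> \<ge> R \<Longrightarrow>
      (\<exists>e. norm e \<le> C / \<bar>\<tau>\<bar> \<and> Gamma (x + \<i> * of_real \<tau>) =
          c * exp ((x + \<i> * of_real \<tau> - 1/2) * Ln (\<i> * of_real \<tau>) - \<i> * of_real \<tau> + e))"
    using st[of "K + 1 + norm \<beta>"] by blast
  show ?thesis
  proof (rule exI[of _ "4 * C"], rule exI[of _ "2 * \<bar>R\<bar> + 2"], safe)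
    fix \<sigma> t :: real
    assume \<sigma>: "\<bar>\<sigma>\<bar> \<le> K" and t: "2 * \<bar>R\<bar> + 2 \<le> t"
    define x1 where "x1 = of_real ((1 - \<sigma>) / 2) + \<beta>"
    define x2 where "x2 = of_real (\<sigma> / 2) + \<beta>"
    define \<tau> where "\<tau> = t / 2"
    have \<tau>: "\<tau> > 0" "\<tau> \<ge> R" using t by (auto simp: \<tau>_def)
    have "\<bar>(1 - \<sigma>) / 2\<bar> \<le> K + 1" using \<sigma> by (auto simp: abs_le_iff)
    hence n1: "norm x1 \<le> K + 1 + norm \<beta>" unfolding x1_def
      by (intro order_trans[OF norm_triangle_ineq add_right_mono]) (simp only: norm_of_real)
    have n2: "norm x2 \<le> K + 1 + norm \<beta>" unfolding x2_def
      by (rule order_trans[OF norm_triangle_ineq add_right_mono]) (unfold norm_of_real, insert \<sigma>, linarith)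
    obtain e1 where e1: "norm e1 \<le> C / \<bar>-\<tau>\<bar>" "Gamma (x1 + \<i> * of_real (-\<tau>)) =
          c * exp ((x1 + \<i> * of_real (-\<tau>) - 1/2) * Ln (\<i> * of_real (-\<tau>)) - \<i> * of_real (-\<tau>) + e1)"
      using CR[OF n1, of "-\<tau>"] \<tau> by auto
    obtain e2 where e2: "norm e2 \<le> C / \<bar>\<tau>\<bar>" "Gamma (x2 + \<i> * of_real \<tau>) =
          c * exp ((x2 + \<i> * of_real \<tau> - 1/2) * Ln (\<i> * of_real \<tau>) - \<i> * of_real \<tau> + e2)"
      using CR[OF n2, of "\<tau>"] \<tau> by auto
    have a1: "(1 - Complex \<sigma> t) / 2 + \<beta> = x1 + \<i> * of_real (-\<tau>)"
      by (simp add: x1_def \<tau>_def complex_eq_iff)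
    have a2: "Complex \<sigma> t / 2 + \<beta> = x2 + \<i> * of_real \<tau>"
      by (simp add: x2_def \<tau>_def complex_eq_iff)
    have "Gamma ((1 - Complex \<sigma> t) / 2 + \<beta>) / Gamma (Complex \<sigma> t / 2 + \<beta>) =
       exp (((x1 + \<i> * of_real (-\<tau>) - 1/2) * Ln (\<i> * of_real (-\<tau>)) - \<i> * of_real (-\<tau>) + e1)
          - ((x2 + \<i> * of_real \<tau> - 1/2) * Ln (\<i> * of_real \<tau>) - \<i> * of_real \<tau> + e2))"
      unfolding a1 a2 e1(2) e2(2) exp_diff using c by simp
    also have "((x1 + \<i> * of_real (-\<tau>) - 1/2) * Ln (\<i> * of_real (-\<tau>)) - \<i> * of_real (-\<tau>) + e1)
          - ((x2 + \<i> * of_real \<tau> - 1/2) * Ln (\<i> * of_real \<tau>) - \<i> * of_real \<tau> + e2) =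
       - (\<i> * of_real (pi / 2)) * (2 * \<beta> - 1/2) + of_real ((1/2 - \<sigma>) * ln (t / 2)) + \<i> * of_real (t - t * ln (t / 2)) + (e1 - e2)"
    proof -
      define l where "l = complex_of_real (ln (t / 2))"
      define p where "p = \<i> * of_real (pi / 2)"
      have l: "Ln (\<i> * of_real \<tau>) = l + p" "Ln (\<i> * of_real (- \<tau>)) = l - p"
        unfolding Ln_ii_times_of_real[OF \<tau>(1)] by (simp_all add: l_def p_def \<tau>_def)
      define S where "S = complex_of_real \<sigma>"
      define Tt where "Tt = complex_of_real t"
      have tt: "complex_of_real \<tau> = Tt / 2" "complex_of_real (-\<tau>) = - (Tt / 2)" by (simp_all add: \<tau>_def Tt_def)
      have rr: "of_real ((1/2 - \<sigma>) * ln (t / 2)) = (1/2 - S) * l" "of_real (t - t * ln (t / 2)) = Tt - Tt * l"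
        by (simp_all add: S_def l_def Tt_def)
      have xx: "x1 = (1 - S) / 2 + \<beta>" "x2 = S / 2 + \<beta>" by (simp_all add: x1_def x2_def S_def)
      show ?thesis unfolding l unfolding tt rr xx p_def[symmetric] by (simp add: field_simps)
    qed
    finally have "Gamma ((1 - Complex \<sigma> t) / 2 + \<beta>) / Gamma (Complex \<sigma> t / 2 + \<beta>) =
       exp (- (\<i> * of_real (pi / 2)) * (2 * \<beta> - 1/2) + of_real ((1/2 - \<sigma>) * ln (t / 2)) + \<i> * of_real (t - t * ln (t / 2)) + (e1 - e2))" .
    moreover have "norm (e1 - e2) \<le> 4 * C / t"
    proof -
      have "norm (e1 - e2) \<le> norm e1 + norm e2" by (rule norm_triangle_ineq4)
      also have "\<dots> \<le> C / \<tau> + C / \<tau>" using e1(1) e2(1) \<tau> by (intro add_mono) auto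
      also have "\<dots> = 4 * C / t" by (simp add: \<tau>_def)
      finally show ?thesis .
    qed
    ultimately show "\<exists>e. norm e \<le> 4 * C / t \<and>
     Gamma ((1 - Complex \<sigma> t) / 2 + \<beta>) / Gamma (Complex \<sigma> t / 2 + \<beta>) =
       exp (- (\<i> * of_real (pi / 2)) * (2 * \<beta> - 1/2) + of_real ((1/2 - \<sigma>) * ln (t / 2)) + \<i> * of_real (t - t * ln (t / 2)) + e)"
      by blast
  qed auto
qed

lemma gamma_quot_asymp:
  "\<exists>a. \<forall>K. \<exists>C R. C \<ge> 0 \<and> R \<ge> 2 \<and> (\<forall>\<sigma> t. \<bar>\<sigma>\<bar> \<le> K \<and> t \<ge> R \<longrightarrow> (\<exists>e. norm e \<le> C / t \<and>
     gamma_quot d \<beta> (Complex \<sigma> t) = exp (a + of_real (real d * (1/2 - \<sigma>) * ln (t / 2)) + \<i> * of_real (real d * (t - t * ln (t / 2))) + e)))"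
proof -
  define a where "a = (\<Sum>\<nu>=1..d. - (\<i> * of_real (pi / 2)) * (2 * \<beta> \<nu> - 1/2))"
  show ?thesis
  proof (rule exI[of _ a], rule allI)
    fix K
    have "\<forall>\<nu>. \<exists>C R. R \<ge> 2 \<and> (\<forall>\<sigma> t. \<bar>\<sigma>\<bar> \<le> K \<and> t \<ge> R \<longrightarrow> (\<exists>e. norm e \<le> C / t \<and>
     Gamma ((1 - Complex \<sigma> t) / 2 + \<beta> \<nu>) / Gamma (Complex \<sigma> t / 2 + \<beta> \<nu>) =
       exp (- (\<i> * of_real (pi / 2)) * (2 * \<beta> \<nu> - 1/2) + of_real ((1/2 - \<sigma>) * ln (t / 2)) + \<i> * of_real (t - t * ln (t / 2)) + e)))"
      using Gamma_ratio_asymp by blast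
    then obtain C R where CR: "\<And>\<nu>. R \<nu> \<ge> 2" "\<And>\<nu> \<sigma> t. \<bar>\<sigma>\<bar> \<le> K \<Longrightarrow> t \<ge> R \<nu> \<Longrightarrow> (\<exists>e. norm e \<le> C \<nu> / t \<and>
     Gamma ((1 - Complex \<sigma> t) / 2 + \<beta> \<nu>) / Gamma (Complex \<sigma> t / 2 + \<beta> \<nu>) =
       exp (- (\<i> * of_real (pi / 2)) * (2 * \<beta> \<nu> - 1/2) + of_real ((1/2 - \<sigma>) * ln (t / 2)) + \<i> * of_real (t - t * ln (t / 2)) + e))"
      by metis
    define R' where "R' = 2 + (\<Sum>\<nu>=1..d. R \<nu>)"
    define C' where "C' = (\<Sum>\<nu>=1..d. \<bar>C \<nu>\<bar>)"
    have R': "R \<nu> \<le> R'" if "\<nu> \<in> {1..d}" for \<nu>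
    proof -
      have "R \<nu> \<le> (\<Sum>\<nu>=1..d. R \<nu>)" using that CR(1) by (intro member_le_sum) (auto intro: order_trans[of 0 2])
      thus ?thesis by (simp add: R'_def)
    qed
    show "\<exists>C R. C \<ge> 0 \<and> R \<ge> 2 \<and> (\<forall>\<sigma> t. \<bar>\<sigma>\<bar> \<le> K \<and> t \<ge> R \<longrightarrow> (\<exists>e. norm e \<le> C / t \<and>
     gamma_quot d \<beta> (Complex \<sigma> t) = exp (a + of_real (real d * (1/2 - \<sigma>) * ln (t / 2)) + \<i> * of_real (real d * (t - t * ln (t / 2))) + e)))"
    proof (rule exI[of _ C'], rule exI[of _ R'], safe)
      show "C' \<ge> 0" by (simp add: C'_def sum_nonneg)
      show "R' \<ge> 2" unfolding R'_def using CR(1) by (auto intro!: sum_nonneg intro: order_trans[of 0 2])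
      fix \<sigma> t :: real
      assume \<sigma>: "\<bar>\<sigma>\<bar> \<le> K" and t: "t \<ge> R'"
      have t0: "t > 0" using t \<open>R' \<ge> 2\<close> by linarith
      have "\<forall>\<nu>\<in>{1..d}. \<exists>e. norm e \<le> C \<nu> / t \<and> Gamma ((1 - Complex \<sigma> t) / 2 + \<beta> \<nu>) / Gamma (Complex \<sigma> t / 2 + \<beta> \<nu>) =
       exp (- (\<i> * of_real (pi / 2)) * (2 * \<beta> \<nu> - 1/2) + of_real ((1/2 - \<sigma>) * ln (t / 2)) + \<i> * of_real (t - t * ln (t / 2)) + e)"
        using CR(2)[OF \<sigma>] R' t by (meson order_trans)
      then obtain e where e: "\<And>\<nu>. \<nu> \<in> {1..d} \<Longrightarrow> norm (e \<nu>) \<le> C \<nu> / t"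
        "\<And>\<nu>. \<nu> \<in> {1..d} \<Longrightarrow> Gamma ((1 - Complex \<sigma> t) / 2 + \<beta> \<nu>) / Gamma (Complex \<sigma> t / 2 + \<beta> \<nu>) =
       exp (- (\<i> * of_real (pi / 2)) * (2 * \<beta> \<nu> - 1/2) + of_real ((1/2 - \<sigma>) * ln (t / 2)) + \<i> * of_real (t - t * ln (t / 2)) + e \<nu>)"
        by metis
      have "gamma_quot d \<beta> (Complex \<sigma> t) = (\<Prod>\<nu>=1..d. Gamma ((1 - Complex \<sigma> t) / 2 + \<beta> \<nu>) / Gamma (Complex \<sigma> t / 2 + \<beta> \<nu>))"
        unfolding gamma_quot_def gamma_factor_def by (rule prod_dividef[symmetric])
      also have "\<dots> = (\<Prod>\<nu>=1..d. exp (- (\<i> * of_real (pi / 2)) * (2 * \<beta> \<nu> - 1/2) + of_real ((1/2 - \<sigma>) * ln (t / 2)) + \<i> * of_real (t - t * ln (t / 2)) + e \<nu>))"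
        by (intro prod.cong refl e(2))
      also have "\<dots> = exp (\<Sum>\<nu>=1..d. - (\<i> * of_real (pi / 2)) * (2 * \<beta> \<nu> - 1/2) + of_real ((1/2 - \<sigma>) * ln (t / 2)) + \<i> * of_real (t - t * ln (t / 2)) + e \<nu>)"
        by (rule exp_sum[symmetric]) simp
      also have "(\<Sum>\<nu>=1..d. - (\<i> * of_real (pi / 2)) * (2 * \<beta> \<nu> - 1/2) + of_real ((1/2 - \<sigma>) * ln (t / 2)) + \<i> * of_real (t - t * ln (t / 2)) + e \<nu>)
        = a + of_nat d * of_real ((1/2 - \<sigma>) * ln (t / 2)) + of_nat d * (\<i> * of_real (t - t * ln (t / 2))) + (\<Sum>\<nu>=1..d. e \<nu>)"
        unfolding sum.distrib a_def by simp
      also have "of_nat d * of_real ((1/2 - \<sigma>) * ln (t / 2)) = complex_of_real (real d * (1/2 - \<sigma>) * ln (t / 2))"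
        by simp
      also have "of_nat d * (\<i> * of_real (t - t * ln (t / 2))) = \<i> * complex_of_real (real d * (t - t * ln (t / 2)))"
        by simp
      finally have "gamma_quot d \<beta> (Complex \<sigma> t) = exp (a + of_real (real d * (1/2 - \<sigma>) * ln (t / 2)) + \<i> * of_real (real d * (t - t * ln (t / 2))) + (\<Sum>\<nu>=1..d. e \<nu>))" .
      moreover have "norm (\<Sum>\<nu>=1..d. e \<nu>) \<le> C' / t"
      proof -
        have "norm (\<Sum>\<nu>=1..d. e \<nu>) \<le> (\<Sum>\<nu>=1..d. \<bar>C \<nu>\<bar> / t)"
          using e(1) t0 by (intro sum_norm_le order_trans[OF e(1)] divide_right_mono) auto
        thus ?thesis by (simp add: C'_def sum_divide_distrib)
      qed
      ultimately show "\<exists>e. norm e \<le> C' / t \<and> gamma_quot d \<beta> (Complex \<sigma> t) = exp (a + of_real (real d * (1/2 - \<sigma>) * ln (t / 2)) + \<i> * of_real (real d * (t - t * ln (t / 2))) + e)"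
        by blast
    qed
  qed
qed

text \<open>The upper bound serves integrability and contour shifts; the lower bound serves the case
  of vanishing residue, where \<open>gamma_quot\<close> must be seen to be unbounded.\<close>

lemma norm_gamma_quot_bounds:
  "\<exists>M R. M \<ge> 1 \<and> R \<ge> 2 \<and> (\<forall>\<sigma> t. \<bar>\<sigma>\<bar> \<le> K \<and> \<bar>t\<bar> \<ge> R \<longrightarrow>
     norm (gamma_quot d \<beta> (Complex \<sigma> t)) \<le> M * \<bar>t\<bar> powr (real d * (1/2 - \<sigma>)) \<and>
     \<bar>t\<bar> powr (real d * (1/2 - \<sigma>)) \<le> M * norm (gamma_quot d \<beta> (Complex \<sigma> t)))"
proof -
  have half: "\<exists>M R. M \<ge> 1 \<and> R \<ge> 2 \<and> (\<forall>\<sigma> t. \<bar>\<sigma>\<bar> \<le> K \<and> t \<ge> R \<longrightarrow>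
     norm (gamma_quot d \<beta> (Complex \<sigma> t)) \<le> M * t powr (real d * (1/2 - \<sigma>)) \<and>
     t powr (real d * (1/2 - \<sigma>)) \<le> M * norm (gamma_quot d \<beta> (Complex \<sigma> t)))" for \<beta>
  proof -
    from gamma_quot_asymp[of d \<beta>] obtain a where "\<forall>K. \<exists>C R. C \<ge> 0 \<and> R \<ge> 2 \<and> (\<forall>\<sigma> t. \<bar>\<sigma>\<bar> \<le> K \<and> t \<ge> R \<longrightarrow> (\<exists>e. norm e \<le> C / t \<and>
     gamma_quot d \<beta> (Complex \<sigma> t) = exp (a + of_real (real d * (1/2 - \<sigma>) * ln (t / 2)) + \<i> * of_real (real d * (t - t * ln (t / 2))) + e)))" ..
    then obtain C R where CR: "C \<ge> 0" "R \<ge> 2" "\<And>\<sigma> t. \<bar>\<sigma>\<bar> \<le> K \<Longrightarrow> t \<ge> R \<Longrightarrow> (\<exists>e. norm e \<le> C / t \<and>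
     gamma_quot d \<beta> (Complex \<sigma> t) = exp (a + of_real (real d * (1/2 - \<sigma>) * ln (t / 2)) + \<i> * of_real (real d * (t - t * ln (t / 2))) + e))"
      by blast
    define L where "L = \<bar>Re a\<bar> + real d * (1/2 + \<bar>K\<bar>) * ln 2 + C"
    have L: "L \<ge> 0" unfolding L_def using CR(1) by (intro add_nonneg_nonneg mult_nonneg_nonneg) auto
    show ?thesis
    proof (rule exI[of _ "exp L"], rule exI[of _ R], intro conjI allI impI)
      show "exp L \<ge> 1" using L by simp
      show "R \<ge> 2" by fact
      fix \<sigma> t assume H: "\<bar>\<sigma>\<bar> \<le> K \<and> R \<le> t"
      hence t: "t \<ge> 2" using CR(2) by simp
      obtain e where e: "norm e \<le> C / t" "gamma_quot d \<beta> (Complex \<sigma> t) = exp (a + of_real (real d * (1/2 - \<sigma>) * ln (t / 2)) + \<i> * of_real (real d * (t - t * ln (t / 2))) + e)"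
        using CR(3) H by blast
      have "C / t \<le> C / 1" using t CR(1) by (intro divide_left_mono) auto
      hence re: "\<bar>Re e\<bar> \<le> C" using abs_Re_le_cmod[of e] e(1) by simp
      define z where "z = Re a + Re e - real d * (1/2 - \<sigma>) * ln 2"
      have n: "norm (gamma_quot d \<beta> (Complex \<sigma> t)) = exp z * t powr (real d * (1/2 - \<sigma>))"
        unfolding e(2) norm_exp_eq_Re using t by (simp add: z_def ln_div powr_def exp_add[symmetric] algebra_simps)
      have z: "\<bar>z\<bar> \<le> L"
      proof -
        have "\<bar>real d * (1/2 - \<sigma>) * ln 2\<bar> = real d * \<bar>1/2 - \<sigma>\<bar> * ln 2" by (simp add: abs_mult)
        also have "\<dots> \<le> real d * (1/2 + \<bar>K\<bar>) * ln 2"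
          using H by (intro mult_right_mono mult_left_mono) auto
        finally show ?thesis using re unfolding z_def L_def by linarith
      qed
      show "norm (gamma_quot d \<beta> (Complex \<sigma> t)) \<le> exp L * t powr (real d * (1/2 - \<sigma>))"
        unfolding n using z by (intro mult_right_mono) auto
      have "1 \<le> exp (L + z)" using z by simp
      hence "1 * t powr (real d * (1/2 - \<sigma>)) \<le> exp (L + z) * t powr (real d * (1/2 - \<sigma>))" by (intro mult_right_mono) auto
      thus "t powr (real d * (1/2 - \<sigma>)) \<le> exp L * norm (gamma_quot d \<beta> (Complex \<sigma> t))"
        unfolding n by (simp add: exp_add mult_ac)
    qed
  qed
  obtain M1 R1 where 1: "M1 \<ge> 1" "R1 \<ge> 2" "\<And>\<sigma> t. \<bar>\<sigma>\<bar> \<le> K \<Longrightarrow> t \<ge> R1 \<Longrightarrow>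
     norm (gamma_quot d \<beta> (Complex \<sigma> t)) \<le> M1 * t powr (real d * (1/2 - \<sigma>)) \<and>
     t powr (real d * (1/2 - \<sigma>)) \<le> M1 * norm (gamma_quot d \<beta> (Complex \<sigma> t))" using half[of \<beta>] by blast
  obtain M2 R2 where 2: "M2 \<ge> 1" "R2 \<ge> 2" "\<And>\<sigma> t. \<bar>\<sigma>\<bar> \<le> K \<Longrightarrow> t \<ge> R2 \<Longrightarrow>
     norm (gamma_quot d (\<lambda>\<nu>. cnj (\<beta> \<nu>)) (Complex \<sigma> t)) \<le> M2 * t powr (real d * (1/2 - \<sigma>)) \<and>
     t powr (real d * (1/2 - \<sigma>)) \<le> M2 * norm (gamma_quot d (\<lambda>\<nu>. cnj (\<beta> \<nu>)) (Complex \<sigma> t))" using half[of "\<lambda>\<nu>. cnj (\<beta> \<nu>)"] by blast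
  show ?thesis
  proof (rule exI[of _ "max M1 M2"], rule exI[of _ "max R1 R2"], intro conjI allI impI)
    show "max M1 M2 \<ge> 1" "max R1 R2 \<ge> 2" using 1 2 by auto
    fix \<sigma> t assume H: "\<bar>\<sigma>\<bar> \<le> K \<and> max R1 R2 \<le> \<bar>t\<bar>"
    have *: "norm g \<le> max M1 M2 * p \<and> p \<le> max M1 M2 * norm g" 
      if "norm g \<le> M * p \<and> p \<le> M * norm g" "M \<le> max M1 M2" "p \<ge> 0" for g :: complex and p M :: real
      using that mult_right_mono[OF that(2), of p] mult_right_mono[OF that(2), of "norm g"] by auto
    have "norm (gamma_quot d \<beta> (Complex \<sigma> t)) \<le> max M1 M2 * \<bar>t\<bar> powr (real d * (1/2 - \<sigma>)) \<and>
     \<bar>t\<bar> powr (real d * (1/2 - \<sigma>)) \<le> max M1 M2 * norm (gamma_quot d \<beta> (Complex \<sigma> t))"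
    proof (cases "t \<ge> 0")
      case True
      thus ?thesis using 1(3)[of \<sigma> t] H by (intro *[of _ M1]) auto
    next
      case False
      have "norm (gamma_quot d \<beta> (Complex \<sigma> t)) = norm (cnj (gamma_quot d \<beta> (Complex \<sigma> t)))" by simp
      also have "\<dots> = norm (gamma_quot d (\<lambda>\<nu>. cnj (\<beta> \<nu>)) (Complex \<sigma> \<bar>t\<bar>))"
        unfolding cnj_gamma_quot using False by (simp add: complex_cnj)
      finally have n: "norm (gamma_quot d \<beta> (Complex \<sigma> t)) = norm (gamma_quot d (\<lambda>\<nu>. cnj (\<beta> \<nu>)) (Complex \<sigma> \<bar>t\<bar>))" .
      show ?thesis unfolding n using 2(3)[of \<sigma> "\<bar>t\<bar>"] H by (intro *[of _ M2]) auto
    qed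
    thus "norm (gamma_quot d \<beta> (Complex \<sigma> t)) \<le> max M1 M2 * \<bar>t\<bar> powr (real d * (1/2 - \<sigma>))"
     "\<bar>t\<bar> powr (real d * (1/2 - \<sigma>)) \<le> max M1 M2 * norm (gamma_quot d \<beta> (Complex \<sigma> t))" by auto
  qed
qed

text \<open>Exponential growth is all that is claimed: it passes to \<open>\<phi>\<close> through
  the functional equation and is later beaten by a Gaussian. Its source is the exponential decay of
  Gamma along vertical lines.\<close>

lemma inverse_Gamma_growth:
  fixes \<beta> :: complex
  shows "\<exists>M R. R \<ge> 2 \<and> (\<forall>\<sigma> t. \<bar>\<sigma>\<bar> \<le> K \<and> \<bar>t\<bar> \<ge> R \<longrightarrow> norm (inverse (Gamma (Complex \<sigma> t / 2 + \<beta>))) \<le> exp (M * \<bar>t\<bar>))"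
proof -
  obtain c where c: "c \<noteq> 0" and st: "\<And>K. \<exists>C R. \<forall>(x::complex) \<tau>. norm x \<le> K \<and> \<bar>\<tau>\<bar> \<ge> R \<longrightarrow>
      (\<exists>e. norm e \<le> C / \<bar>\<tau>\<bar> \<and> Gamma (x + \<i> * of_real \<tau>) =
          c * exp ((x + \<i> * of_real \<tau> - 1/2) * Ln (\<i> * of_real \<tau>) - \<i> * of_real \<tau> + e))"
    using Gamma_stirling by metis
  define B where "B = \<bar>K\<bar> + norm \<beta>"
  obtain C R where CR: "\<And>x \<tau>. norm x \<le> B \<Longrightarrow> \<bar>\<tau>\<bar> \<ge> R \<Longrightarrow>
      (\<exists>e. norm e \<le> C / \<bar>\<tau>\<bar> \<and> Gamma (x + \<i> * of_real \<tau>) =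
          c * exp ((x + \<i> * of_real \<tau> - 1/2) * Ln (\<i> * of_real \<tau>) - \<i> * of_real \<tau> + e))"
    using st[of B] by blast
  define M where "M = (B + 1) + 2 * B + 2 + \<bar>C\<bar> + \<bar>ln (norm c)\<bar>"
  have B: "B \<ge> 0" by (simp add: B_def)
  show ?thesis
  proof (rule exI[of _ M], rule exI[of _ "2 * \<bar>R\<bar> + 2"], intro conjI allI impI)
    fix \<sigma> t :: real assume H: "\<bar>\<sigma>\<bar> \<le> K \<and> 2 * \<bar>R\<bar> + 2 \<le> \<bar>t\<bar>"
    define x where "x = of_real (\<sigma> / 2) + \<beta>"
    define \<tau> where "\<tau> = t / 2"
    have \<tau>: "\<bar>\<tau>\<bar> \<ge> R" "\<bar>\<tau>\<bar> \<ge> 1" "\<bar>\<tau>\<bar> > 0" using H by (auto simp: \<tau>_def)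
    have x: "norm x \<le> B" unfolding x_def B_def
      by (rule order_trans[OF norm_triangle_ineq add_right_mono]) (unfold norm_of_real, insert H, linarith)
    obtain e where e: "norm e \<le> C / \<bar>\<tau>\<bar>" "Gamma (x + \<i> * of_real \<tau>) =
          c * exp ((x + \<i> * of_real \<tau> - 1/2) * Ln (\<i> * of_real \<tau>) - \<i> * of_real \<tau> + e)"
      using CR[OF x \<tau>(1)] by blast
    have "C / \<bar>\<tau>\<bar> \<le> \<bar>C\<bar> / 1" using \<tau> by (intro frac_le) auto
    hence re: "\<bar>Re e\<bar> \<le> \<bar>C\<bar>" using abs_Re_le_cmod[of e] e(1) by simp
    have rex: "\<bar>Re x\<bar> \<le> B" "\<bar>Im x\<bar> \<le> B" using abs_Re_le_cmod[of x] abs_Im_le_cmod[of x] x by linarith+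
    have ln\<tau>: "0 \<le> ln \<bar>\<tau>\<bar>" "ln \<bar>\<tau>\<bar> \<le> \<bar>\<tau>\<bar>" using \<tau> ln_le_minus_one[of "\<bar>\<tau>\<bar>"] by auto
    have "Ln (\<i> * of_real \<tau>) = of_real (ln \<bar>\<tau>\<bar>) + \<i> * of_real (sgn \<tau> * (pi / 2))"
      using Ln_ii_times_of_real[OF \<tau>(3)] by (cases "\<tau> > 0") (auto simp: abs_if sgn_if)
    hence "Re ((x + \<i> * of_real \<tau> - 1/2) * Ln (\<i> * of_real \<tau>) - \<i> * of_real \<tau> + e)
       = (Re x - 1/2) * ln \<bar>\<tau>\<bar> - (Im x * sgn \<tau>) * (pi / 2) - (\<tau> * sgn \<tau>) * (pi / 2) + Re e"
      by (simp add: algebra_simps add_divide_distrib diff_divide_distrib)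
    also have "\<tau> * sgn \<tau> = \<bar>\<tau>\<bar>" by (simp add: abs_sgn)
    also have "(Re x - 1/2) * ln \<bar>\<tau>\<bar> \<ge> - ((B + 1) * \<bar>\<tau>\<bar>)"
    proof -
      have "\<bar>(Re x - 1/2) * ln \<bar>\<tau>\<bar>\<bar> \<le> (B + 1) * \<bar>\<tau>\<bar>"
        unfolding abs_mult using rex ln\<tau> by (intro mult_mono) auto
      thus ?thesis by linarith
    qed
    moreover have "Im x * sgn \<tau> * (pi / 2) \<le> B * 2"
    proof -
      have "\<bar>Im x * sgn \<tau> * (pi / 2)\<bar> \<le> B * 1 * 2"
        unfolding abs_mult using rex pi_less_4 B by (intro mult_mono) (auto simp: sgn_if)
      thus ?thesis by linarith
    qed
    moreover have "\<bar>\<tau>\<bar> * (pi / 2) \<le> \<bar>\<tau>\<bar> * 2" using pi_less_4 by (intro mult_left_mono) auto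
    ultimately have re2: "Re ((x + \<i> * of_real \<tau> - 1/2) * Ln (\<i> * of_real \<tau>) - \<i> * of_real \<tau> + e) \<ge> - ((B + 1) * \<bar>\<tau>\<bar> + 2 * B + 2 * \<bar>\<tau>\<bar> + \<bar>C\<bar>)"
      using re by linarith
    have nc: "norm c > 0" using c by simp
    have "norm (Gamma (x + \<i> * of_real \<tau>)) = exp (ln (norm c) + Re ((x + \<i> * of_real \<tau> - 1/2) * Ln (\<i> * of_real \<tau>) - \<i> * of_real \<tau> + e))"
      unfolding e(2) norm_mult norm_exp_eq_Re exp_add[of "ln (norm c)"] exp_ln[OF nc] by (rule refl)
    moreover have "ln (norm c) + Re ((x + \<i> * of_real \<tau> - 1/2) * Ln (\<i> * of_real \<tau>) - \<i> * of_real \<tau> + e) \<ge> - (M * \<bar>t\<bar>)"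
    proof -
      have "(2 * B + \<bar>C\<bar> + \<bar>ln (norm c)\<bar>) * 1 \<le> (2 * B + \<bar>C\<bar> + \<bar>ln (norm c)\<bar>) * \<bar>\<tau>\<bar>"
        using \<tau> B by (intro mult_left_mono) auto
      hence "(B + 1) * \<bar>\<tau>\<bar> + 2 * B + 2 * \<bar>\<tau>\<bar> + \<bar>C\<bar> + \<bar>ln (norm c)\<bar> \<le> M * \<bar>\<tau>\<bar>"
        by (simp add: M_def algebra_simps)
      also have "\<dots> \<le> M * \<bar>t\<bar>" using B by (intro mult_left_mono) (auto simp: M_def \<tau>_def)
      finally show ?thesis using re2 by linarith
    qed
    ultimately have "norm (Gamma (x + \<i> * of_real \<tau>)) \<ge> exp (- (M * \<bar>t\<bar>))" by simp
    hence "inverse (norm (Gamma (x + \<i> * of_real \<tau>))) \<le> inverse (exp (- (M * \<bar>t\<bar>)))"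
      by (intro le_imp_inverse_le) auto
    moreover have "Complex \<sigma> t / 2 + \<beta> = x + \<i> * of_real \<tau>" by (simp add: x_def \<tau>_def complex_eq_iff)
    ultimately show "norm (inverse (Gamma (Complex \<sigma> t / 2 + \<beta>))) \<le> exp (M * \<bar>t\<bar>)"
      by (simp add: norm_inverse exp_minus)
  qed auto
qed

lemma inverse_gamma_factor_growth:
  "\<exists>M R. R \<ge> 2 \<and> (\<forall>\<sigma> t. \<bar>\<sigma>\<bar> \<le> K \<and> \<bar>t\<bar> \<ge> R \<longrightarrow> norm (inverse (gamma_factor d \<beta> (Complex \<sigma> t))) \<le> exp (M * \<bar>t\<bar>))"
proof -
  have "\<forall>\<nu>. \<exists>M R. R \<ge> 2 \<and> (\<forall>\<sigma> t. \<bar>\<sigma>\<bar> \<le> K \<and> \<bar>t\<bar> \<ge> R \<longrightarrow> norm (inverse (Gamma (Complex \<sigma> t / 2 + \<beta> \<nu>))) \<le> exp (M * \<bar>t\<bar>))"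
    using inverse_Gamma_growth by blast
  then obtain M R where MR: "\<And>\<nu>. R \<nu> \<ge> 2" "\<And>\<nu> \<sigma> t. \<bar>\<sigma>\<bar> \<le> K \<Longrightarrow> \<bar>t\<bar> \<ge> R \<nu> \<Longrightarrow> norm (inverse (Gamma (Complex \<sigma> t / 2 + \<beta> \<nu>))) \<le> exp (M \<nu> * \<bar>t\<bar>)"
    by metis
  have Rn: "R \<nu> \<ge> 0" for \<nu> using MR(1)[of \<nu>] by simp
  show ?thesis
  proof (rule exI[of _ "\<Sum>\<nu>=1..d. M \<nu>"], rule exI[of _ "2 + (\<Sum>\<nu>=1..d. R \<nu>)"], intro conjI allI impI)
    show "2 + (\<Sum>\<nu>=1..d. R \<nu>) \<ge> 2" using Rn by (simp add: sum_nonneg)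
    fix \<sigma> t assume H: "\<bar>\<sigma>\<bar> \<le> K \<and> 2 + (\<Sum>\<nu>=1..d. R \<nu>) \<le> \<bar>t\<bar>"
    have Rt: "R \<nu> \<le> \<bar>t\<bar>" if "\<nu> \<in> {1..d}" for \<nu>
      using member_le_sum[of \<nu> "{1..d}" R] that Rn H by auto
    have "norm (inverse (gamma_factor d \<beta> (Complex \<sigma> t))) = (\<Prod>\<nu>=1..d. norm (inverse (Gamma (Complex \<sigma> t / 2 + \<beta> \<nu>))))"
      unfolding gamma_factor_def prod_inversef[symmetric] by (simp only: prod_norm o_def)
    also have "\<dots> \<le> (\<Prod>\<nu>=1..d. exp (M \<nu> * \<bar>t\<bar>))"
      using MR(2) H Rt by (intro prod_mono) auto
    also have "\<dots> = exp ((\<Sum>\<nu>=1..d. M \<nu>) * \<bar>t\<bar>)" by (simp add: exp_sum sum_distrib_right)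
    finally show "norm (inverse (gamma_factor d \<beta> (Complex \<sigma> t))) \<le> exp ((\<Sum>\<nu>=1..d. M \<nu>) * \<bar>t\<bar>)" .
  qed
qed

lemma norm_exp_minus_one_le:
  fixes z :: complex
  assumes "norm z \<le> 1"
  shows "norm (exp z - 1) \<le> 3 * norm z"
proof (cases "z = 0")
  case False
  have "\<bar>Re z\<bar> \<le> 1" using assms abs_Re_le_cmod[of z] by linarith
  have "norm (exp z - exp 0) \<le> 3 * norm (z - 0)"
  proof (rule field_differentiable_bound[of "cball 0 1" exp exp])
    fix w :: complex assume "w \<in> cball 0 1"
    hence "Re w \<le> 1" using complex_Re_le_cmod[of w] by simp
    hence "exp (Re w) \<le> exp 1" by simp
    thus "norm (exp w) \<le> 3" using exp_le by (simp only: norm_exp_eq_Re)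
  qed (use assms in \<open>auto intro!: DERIV_subset[OF DERIV_exp]\<close>)
  thus ?thesis by simp
qed auto

lemma continuous_on_mexp_line:
  assumes "\<And>t. t \<in> X \<Longrightarrow> Complex \<sigma> t \<noteq> 0" "T \<noteq> 0"
  shows "continuous_on X (\<lambda>t. mexp (Complex \<sigma> t / of_real T))"
  unfolding mexp_def using assms by (intro continuous_intros) auto

text \<open>Stirling's formula replaces \<open>gamma_quot\<close> by a constant times a power of
  \<open>t\<close> and a logarithmic phase, to which \<open>smoothed_power_integral_bound\<close>
  applies. The relative error O(1/t) is integrated absolutely: it saves a factor
  \<open>1 / t\<close>, more than the \<open>1 / sqrt t\<close> due to oscillation. Every
  \<open>R \<ge> R0\<close> is allowed in order that both half-lines can be cut at the same
  point.\<close>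

lemma gamma_quot_half_line_bound:
  fixes \<beta> :: "nat \<Rightarrow> complex"
  assumes d: "d \<ge> 1" and \<sigma>: "\<bar>\<sigma>\<bar> \<le> 1" and \<alpha>: "\<alpha> = real d * (1/2 - \<sigma>)" "\<alpha> > 1/2" "\<alpha> + 1 \<le> real k"
    and cont: "continuous_on UNIV (\<lambda>t. gamma_quot d \<beta> (Complex \<sigma> t))"
  shows "\<exists>R0\<ge>2. \<forall>R\<ge>R0. \<exists>C. \<forall>T y x. T \<ge> 1 \<longrightarrow> x \<ge> R \<longrightarrow>
     norm (integral {R..x} (\<lambda>t. exp (of_real y * Complex \<sigma> t) * (gamma_quot d \<beta> (Complex \<sigma> t) * (mexp (Complex \<sigma> t / of_real T) ^ k / Complex \<sigma> t))))
       \<le> C * exp (\<sigma> * y) * T powr (\<alpha> - 1/2)"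
proof -
  from gamma_quot_asymp[of d \<beta>] obtain a where "\<forall>K. \<exists>C R. C \<ge> 0 \<and> R \<ge> 2 \<and> (\<forall>\<sigma> t. \<bar>\<sigma>\<bar> \<le> K \<and> t \<ge> R \<longrightarrow> (\<exists>e. norm e \<le> C / t \<and>
     gamma_quot d \<beta> (Complex \<sigma> t) = exp (a + of_real (real d * (1/2 - \<sigma>) * ln (t / 2)) + \<i> * of_real (real d * (t - t * ln (t / 2))) + e)))" ..
  then obtain C R1 where CR: "C \<ge> 0" "R1 \<ge> 2" "\<And>\<sigma> t. \<bar>\<sigma>\<bar> \<le> 1 \<Longrightarrow> t \<ge> R1 \<Longrightarrow> (\<exists>e. norm e \<le> C / t \<and>
     gamma_quot d \<beta> (Complex \<sigma> t) = exp (a + of_real (real d * (1/2 - \<sigma>) * ln (t / 2)) + \<i> * of_real (real d * (t - t * ln (t / 2))) + e))"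
    by blast
  define b where "b = exp a * of_real ((1/2) powr \<alpha>)"
  define main where "main = (\<lambda>t. b * (of_real (t powr \<alpha>) * exp (\<i> * of_real ((real d + real d * ln 2) * t - real d * t * ln t))))"
  define R0 where "R0 = max R1 (max 2 C)"
  have err: "norm (gamma_quot d \<beta> (Complex \<sigma> t) - main t) \<le> 3 * C * norm b * t powr (\<alpha> - 1)" if t: "t \<ge> R0" for t
  proof -
    have t2: "t \<ge> 2" "t \<ge> R1" "t \<ge> C" using t by (auto simp: R0_def)
    obtain e where e: "norm e \<le> C / t" "gamma_quot d \<beta> (Complex \<sigma> t) = exp (a + of_real (real d * (1/2 - \<sigma>) * ln (t / 2)) + \<i> * of_real (real d * (t - t * ln (t / 2))) + e)"
      using CR(3)[OF \<sigma>] t2 by blast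
    have e1: "norm e \<le> 1" using e(1) t2 by (auto intro: order_trans)
    have "gamma_quot d \<beta> (Complex \<sigma> t) = main t * exp e"
    proof -
      have "exp (complex_of_real (real d * (1/2 - \<sigma>) * ln (t / 2))) = of_real (t powr \<alpha>) * of_real ((1/2) powr \<alpha>)"
      proof -
        have "t powr \<alpha> * (1/2) powr \<alpha> = (t * (1/2)) powr \<alpha>" by (rule powr_mult[symmetric])
        hence "exp (real d * (1/2 - \<sigma>) * ln (t / 2)) = t powr \<alpha> * (1/2) powr \<alpha>" using t2 by (simp add: powr_def \<alpha>(1))
        thus ?thesis by (metis exp_of_real of_real_mult)
      qed
      moreover have "real d * (t - t * ln (t / 2)) = (real d + real d * ln 2) * t - real d * t * ln t"
        using t2 by (simp add: ln_div algebra_simps)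
      ultimately show ?thesis unfolding e(2) exp_add main_def b_def by (simp only: mult_ac)
    qed
    hence "gamma_quot d \<beta> (Complex \<sigma> t) - main t = main t * (exp e - 1)" by (simp add: algebra_simps)
    hence "norm (gamma_quot d \<beta> (Complex \<sigma> t) - main t) = norm (main t) * norm (exp e - 1)" by (simp add: norm_mult)
    also have "\<dots> \<le> norm (main t) * (3 * (C / t))"
      using norm_exp_minus_one_le[OF e1] e(1) by (intro mult_left_mono) auto
    also have "norm (main t) = norm b * t powr \<alpha>" by (simp add: main_def norm_mult)
    also have "norm b * t powr \<alpha> * (3 * (C / t)) = 3 * C * norm b * (t powr \<alpha> / t)" by simp
    also have "t powr \<alpha> / t = t powr (\<alpha> - 1)" using t2 by (simp add: powr_diff)
    finally show ?thesis .
  qed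
  show ?thesis
  proof (rule exI[of _ R0], intro conjI allI impI)
    show "2 \<le> R0" by (simp add: R0_def)
    fix R assume R: "R \<ge> R0"
    have R0: "R > 0" using R \<open>2 \<le> R0\<close> by simp
    obtain C1 where C1: "\<And>T c x. T \<ge> 1 \<Longrightarrow> x \<ge> R \<Longrightarrow>
     norm (integral {R..x} (\<lambda>t. of_real (t powr \<alpha>) * mexp (Complex \<sigma> t / of_real T) ^ k / Complex \<sigma> t
        * exp (\<i> * of_real (c * t - real d * t * ln t)))) \<le> C1 * T powr (\<alpha> - 1/2)"
      using smoothed_power_integral_bound[OF \<alpha>(2,3) \<sigma> _ R0, of "real d"] d by auto
    define C2 where "C2 = 3 * C * norm b * 4 ^ k * (1 / (\<alpha> - 1/2) + 1 / (real k - (\<alpha> - 1/2)))"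
    show "\<exists>C. \<forall>T y x. T \<ge> 1 \<longrightarrow> x \<ge> R \<longrightarrow>
     norm (integral {R..x} (\<lambda>t. exp (of_real y * Complex \<sigma> t) * (gamma_quot d \<beta> (Complex \<sigma> t) * (mexp (Complex \<sigma> t / of_real T) ^ k / Complex \<sigma> t))))
       \<le> C * exp (\<sigma> * y) * T powr (\<alpha> - 1/2)"
    proof (rule exI[of _ "norm b * C1 + C2"], intro allI impI)
      fix T y x :: real assume T: "T \<ge> 1" and x: "x \<ge> R"
      define m where "m = (\<lambda>t. mexp (Complex \<sigma> t / of_real T) ^ k / Complex \<sigma> t)"
      have s0: "Complex \<sigma> t \<noteq> 0" if "t \<ge> R" for t using that R0 by (simp add: complex_eq_iff)
      have cm: "continuous_on {R..x} m" unfolding m_def using s0 T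
        by (intro continuous_intros continuous_on_mexp_line) auto
      have cmain: "continuous_on {R..x} main" unfolding main_def using R0 by (intro continuous_intros) auto
      have ce: "continuous_on {R..x} (\<lambda>t. exp (of_real y * Complex \<sigma> t))" by (intro continuous_intros)
      have cg: "continuous_on {R..x} (\<lambda>t. gamma_quot d \<beta> (Complex \<sigma> t))" by (rule continuous_on_subset[OF cont]) auto
      have eq: "integral {R..x} (\<lambda>t. exp (of_real y * Complex \<sigma> t) * (gamma_quot d \<beta> (Complex \<sigma> t) * m t)) =
         integral {R..x} (\<lambda>t. exp (of_real y * Complex \<sigma> t) * (main t * m t)) +
         integral {R..x} (\<lambda>t. exp (of_real y * Complex \<sigma> t) * ((gamma_quot d \<beta> (Complex \<sigma> t) - main t) * m t))"
        by (subst integral_add[symmetric])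
           (auto intro!: integrable_continuous_real continuous_intros cm cmain ce cg simp: algebra_simps)
      have "integral {R..x} (\<lambda>t. exp (of_real y * Complex \<sigma> t) * (main t * m t)) =
         integral {R..x} (\<lambda>t. (of_real (exp (\<sigma> * y)) * b) * (of_real (t powr \<alpha>) * mexp (Complex \<sigma> t / of_real T) ^ k / Complex \<sigma> t
        * exp (\<i> * of_real ((y + real d + real d * ln 2) * t - real d * t * ln t))))"
      proof (rule integral_cong)
        fix t
        \<comment> \<open>The modulus is \<open>exp (\<sigma> * y)\<close>; the rest of the factor
          merely changes the linear coefficient of the phase, in which the oscillatory bound is
          uniform.\<close>
        have "exp (of_real y * Complex \<sigma> t) = of_real (exp (\<sigma> * y)) * exp (\<i> * of_real (y * t))"
          unfolding Complex_alt by (simp add: exp_of_real[symmetric] exp_add[symmetric] algebra_simps)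
        moreover have "exp (\<i> * of_real ((y + real d + real d * ln 2) * t - real d * t * ln t)) =
          exp (\<i> * of_real (y * t)) * exp (\<i> * of_real ((real d + real d * ln 2) * t - real d * t * ln t))"
          by (simp add: exp_add[symmetric] algebra_simps)
        ultimately show "exp (of_real y * Complex \<sigma> t) * (main t * m t) = (of_real (exp (\<sigma> * y)) * b) * (of_real (t powr \<alpha>) * mexp (Complex \<sigma> t / of_real T) ^ k / Complex \<sigma> t
        * exp (\<i> * of_real ((y + real d + real d * ln 2) * t - real d * t * ln t)))"
          by (simp only: main_def m_def times_divide_eq_left times_divide_eq_right mult_ac)
      qed
      also have "\<dots> = (of_real (exp (\<sigma> * y)) * b) * integral {R..x} (\<lambda>t. of_real (t powr \<alpha>) * mexp (Complex \<sigma> t / of_real T) ^ k / Complex \<sigma> t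
        * exp (\<i> * of_real ((y + real d + real d * ln 2) * t - real d * t * ln t)))"
        by (rule integral_mult_right)
      finally have "norm (integral {R..x} (\<lambda>t. exp (of_real y * Complex \<sigma> t) * (main t * m t))) \<le> (exp (\<sigma> * y) * norm b) * (C1 * T powr (\<alpha> - 1/2))"
        using C1[OF T x, of "y + real d + real d * ln 2"] by (simp add: norm_mult mult_left_mono)
      moreover have "norm (integral {R..x} (\<lambda>t. exp (of_real y * Complex \<sigma> t) * ((gamma_quot d \<beta> (Complex \<sigma> t) - main t) * m t))) \<le> exp (\<sigma> * y) * (C2 * T powr (\<alpha> - 1/2))"
      proof -
        define D where "D = exp (\<sigma> * y) * (3 * C * norm b * 4 ^ k)"
        have D: "D \<ge> 0" using CR(1) by (simp add: D_def)
        have "norm (integral {R..x} (\<lambda>t. exp (of_real y * Complex \<sigma> t) * ((gamma_quot d \<beta> (Complex \<sigma> t) - main t) * m t))) \<le>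
          integral {R..x} (\<lambda>t. D * (t powr ((\<alpha> - 1/2) - 1) * min 1 (T / t) ^ k))"
        proof (rule integral_norm_bound_integral)
          show "(\<lambda>t. exp (of_real y * Complex \<sigma> t) * ((gamma_quot d \<beta> (Complex \<sigma> t) - main t) * m t)) integrable_on {R..x}"
            by (intro integrable_continuous_real continuous_intros cm cmain ce cg)
          show "(\<lambda>t. D * (t powr ((\<alpha> - 1/2) - 1) * min 1 (T / t) ^ k)) integrable_on {R..x}"
            using R0 by (intro integrable_continuous_real continuous_intros) auto
          fix t assume "t \<in> {R..x}"
          hence t: "t \<ge> R" "t > 0" "t \<ge> 1" using R0 R \<open>2 \<le> R0\<close> by auto
          have ns: "norm (Complex \<sigma> t) \<ge> t" using abs_Im_le_cmod[of "Complex \<sigma> t"] by simp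
          have re: "\<bar>Re (Complex \<sigma> t / of_real T)\<bar> \<le> 1"
            using \<sigma> T by (simp add: divide_le_eq abs_divide)
          have "norm (mexp (Complex \<sigma> t / of_real T)) \<le> 4 * min 1 (1 / norm (Complex \<sigma> t / of_real T))"
            using s0[OF t(1)] T by (intro norm_mexp_le re) auto
          also have "1 / norm (Complex \<sigma> t / of_real T) = T / norm (Complex \<sigma> t)" using T by (simp add: norm_divide)
          also have "4 * min 1 (T / norm (Complex \<sigma> t)) \<le> 4 * min 1 (T / t)"
            using ns t T by (intro mult_left_mono min.mono divide_left_mono mult_pos_pos) auto
          finally have mb: "norm (mexp (Complex \<sigma> t / of_real T) ^ k) \<le> 4 ^ k * min 1 (T / t) ^ k"
            unfolding norm_power power_mult_distrib[symmetric] by (intro power_mono) auto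
          have mn: "min 1 (T / t) ^ k \<ge> 0" using T t by simp
          have "norm (m t) \<le> 4 ^ k * min 1 (T / t) ^ k / t"
            unfolding m_def norm_divide using mb ns t mn by (intro frac_le) auto
          hence "norm ((gamma_quot d \<beta> (Complex \<sigma> t) - main t) * m t) \<le> (3 * C * norm b * t powr (\<alpha> - 1)) * (4 ^ k * min 1 (T / t) ^ k / t)"
            unfolding norm_mult using err[of t] t R CR(1) by (intro mult_mono) auto
          hence "exp (\<sigma> * y) * norm ((gamma_quot d \<beta> (Complex \<sigma> t) - main t) * m t) \<le> exp (\<sigma> * y) * ((3 * C * norm b * t powr (\<alpha> - 1)) * (4 ^ k * min 1 (T / t) ^ k / t))"
            by (intro mult_left_mono) auto
          also have "\<dots> = D * ((t powr (\<alpha> - 1) / t) * min 1 (T / t) ^ k)" by (simp add: D_def)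
          also have "\<dots> \<le> D * (t powr ((\<alpha> - 1/2) - 1) * min 1 (T / t) ^ k)"
          proof (intro mult_left_mono mult_right_mono)
            have "t powr (\<alpha> - 1) / t = t powr (\<alpha> - 2)" using t by (simp add: powr_diff powr_numeral power2_eq_square)
            also have "\<dots> \<le> t powr ((\<alpha> - 1/2) - 1)" using t by (intro powr_mono) auto
            finally show "t powr (\<alpha> - 1) / t \<le> t powr ((\<alpha> - 1/2) - 1)" .
          qed (use mn D in auto)
          finally show "norm (exp (of_real y * Complex \<sigma> t) * ((gamma_quot d \<beta> (Complex \<sigma> t) - main t) * m t)) \<le> D * (t powr ((\<alpha> - 1/2) - 1) * min 1 (T / t) ^ k)"
            by (simp add: norm_mult mult.commute[of y])
        qed
        also have "\<dots> = D * integral {R..x} (\<lambda>t. (t powr ((\<alpha> - 1/2) - 1) * min 1 (T / t) ^ k))"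
          by (rule integral_mult_right)
        also have "\<dots> \<le> D * ((1 / (\<alpha> - 1/2) + 1 / (real k - (\<alpha> - 1/2))) * T powr (\<alpha> - 1/2))"
          by (rule mult_left_mono[OF truncated_power_integral_le D]) (use \<alpha>(2,3) T R0 x in linarith)+
        finally show ?thesis by (simp only: D_def C2_def mult_ac)
      qed
      ultimately have "norm (integral {R..x} (\<lambda>t. exp (of_real y * Complex \<sigma> t) * (gamma_quot d \<beta> (Complex \<sigma> t) * m t))) \<le>
         (exp (\<sigma> * y) * norm b) * (C1 * T powr (\<alpha> - 1/2)) + exp (\<sigma> * y) * (C2 * T powr (\<alpha> - 1/2))"
        unfolding eq by (rule order_trans[OF norm_triangle_ineq add_mono])
      also have "\<dots> = (norm b * C1 + C2) * exp (\<sigma> * y) * T powr (\<alpha> - 1/2)"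
      proof -
        have "(u * n) * (c1 * p) + u * (c2 * p) = (n * c1 + c2) * u * p" for u n c1 c2 p :: real
          by (simp add: algebra_simps)
        thus ?thesis .
      qed
      finally show "norm (integral {R..x} (\<lambda>t. exp (of_real y * Complex \<sigma> t) * (gamma_quot d \<beta> (Complex \<sigma> t) * (mexp (Complex \<sigma> t / of_real T) ^ k / Complex \<sigma> t))))
         \<le> (norm b * C1 + C2) * exp (\<sigma> * y) * T powr (\<alpha> - 1/2)" unfolding m_def .
    qed
  qed
qed

lemma integrable_continuous_tail:
  fixes h :: "real \<Rightarrow> complex"
  assumes cont: "continuous_on UNIV h" and tail: "\<And>t. \<bar>t\<bar> \<ge> R \<Longrightarrow> norm (h t) \<le> M / t\<^sup>2"
  shows "integrable lborel h"
proof -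
  define R' where "R' = max 1 R"
  have "compact (h ` {-R'..R'})"
    by (intro compact_continuous_image continuous_on_subset[OF cont]) auto
  then obtain B where B: "\<And>t. t \<in> {-R'..R'} \<Longrightarrow> norm (h t) \<le> B"
    by (meson bounded_iff compact_imp_bounded image_eqI)
  have "norm (h 0) \<le> B" by (rule B) (simp add: R'_def)
  hence B0: "B \<ge> 0" by (rule order_trans[OF norm_ge_zero])
  have M0: "M \<ge> 0"
  proof -
    have "0 \<le> M / (R')\<^sup>2" by (rule order_trans[OF norm_ge_zero tail[of R']]) (simp add: R'_def)
    moreover have "(R')\<^sup>2 > 0" by (simp add: R'_def)
    ultimately show ?thesis by (simp add: zero_le_divide_iff)
  qed
  show ?thesis
  proof (rule integrable_continuous_quadratic_decay[OF cont, of "B * (1 + R'\<^sup>2) + 2 * M"])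
    fix t :: real
    have p: "1 + t\<^sup>2 > 0" by (simp add: add_pos_nonneg)
    show "norm (h t) \<le> (B * (1 + R'\<^sup>2) + 2 * M) / (1 + t\<^sup>2)"
    proof (cases "\<bar>t\<bar> \<le> R'")
      case True
      have "norm (h t) * (1 + t\<^sup>2) \<le> B * (1 + R'\<^sup>2)"
        using B[of t] True B0 power_mono[OF True, of 2] by (intro mult_mono) (auto simp: abs_le_iff)
      hence "norm (h t) * (1 + t\<^sup>2) \<le> B * (1 + R'\<^sup>2) + 2 * M" using M0 by linarith
      thus ?thesis using p by (simp only: pos_le_divide_eq)
    next
      case False
      have t1: "1 \<le> t\<^sup>2" using False power_mono[of 1 "\<bar>t\<bar>" 2] by (simp add: R'_def)
      have "norm (h t) * (1 + t\<^sup>2) \<le> M / t\<^sup>2 * (2 * t\<^sup>2)"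
        using tail[of t] False t1 M0 by (intro mult_mono) (auto simp: R'_def)
      also have "\<dots> = 2 * M" using t1 by (cases "t = 0") (auto simp: field_simps)
      finally have "norm (h t) * (1 + t\<^sup>2) \<le> B * (1 + R'\<^sup>2) + 2 * M"
        using mult_nonneg_nonneg[OF B0, of "1 + R'\<^sup>2"] by (simp add: add_nonneg_nonneg)
      thus ?thesis using p by (simp only: pos_le_divide_eq)
    qed
  qed
qed

lemma cnj_mexp: "cnj (mexp z) = mexp (cnj z)"
  by (simp add: mexp_def exp_cnj)

lemma cnj_integral:
  fixes f :: "real \<Rightarrow> complex"
  assumes "f integrable_on A"
  shows "integral A (\<lambda>t. cnj (f t)) = cnj (integral A f)"
  using integral_linear[OF assms bounded_linear_cnj] by (simp add: o_def)

lemma norm_mexp_line_le: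
  assumes "\<bar>\<sigma>\<bar> \<le> T" "T > 0" "t \<noteq> 0"
  shows "norm (mexp (Complex \<sigma> t / of_real T)) \<le> 4 * T / \<bar>t\<bar>"
proof -
  have s0: "Complex \<sigma> t \<noteq> 0" using assms by (simp add: complex_eq_iff)
  have ns: "norm (Complex \<sigma> t) \<ge> \<bar>t\<bar>" using abs_Im_le_cmod[of "Complex \<sigma> t"] by simp
  have "norm (mexp (Complex \<sigma> t / of_real T)) \<le> 4 * min 1 (1 / norm (Complex \<sigma> t / of_real T))"
    using assms s0 by (intro norm_mexp_le) (auto simp: abs_divide)
  also have "\<dots> \<le> 4 * (T / norm (Complex \<sigma> t))" using assms by (simp add: norm_divide)
  also have "\<dots> \<le> 4 * (T / \<bar>t\<bar>)" using ns assms by (intro mult_left_mono divide_left_mono mult_pos_pos) auto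
  finally show ?thesis by simp
qed

text \<open>With k at least \<open>\<alpha> + 1\<close> the kernel leaves
  \<open>1 / t\<^sup>2\<close>. The growth in \<open>T\<close> is harmless, since only integrability
  and the vanishing of horizontal segments are drawn from this bound.\<close>

lemma kernel_tail_bound:
  assumes g: "norm g \<le> M * \<bar>t\<bar> powr \<alpha>" and \<alpha>: "\<alpha> + 1 \<le> real k" and \<sigma>: "\<bar>\<sigma>\<bar> \<le> T" and T: "T > 0" and t: "\<bar>t\<bar> \<ge> 1" and M: "M \<ge> 0"
  shows "norm (g * (mexp (Complex \<sigma> t / of_real T) ^ k / Complex \<sigma> t)) \<le> M * (4 * T) ^ k / t\<^sup>2"
proof -
  have t0: "t \<noteq> 0" using t by auto
  have ns: "norm (Complex \<sigma> t) \<ge> \<bar>t\<bar>" using abs_Im_le_cmod[of "Complex \<sigma> t"] by simp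
  have "norm (mexp (Complex \<sigma> t / of_real T) ^ k / Complex \<sigma> t) \<le> (4 * T / \<bar>t\<bar>) ^ k / \<bar>t\<bar>"
    unfolding norm_divide norm_power using norm_mexp_line_le[OF \<sigma> T t0] ns t T
    by (intro frac_le power_mono) auto
  hence "norm (g * (mexp (Complex \<sigma> t / of_real T) ^ k / Complex \<sigma> t)) \<le> (M * \<bar>t\<bar> powr \<alpha>) * ((4 * T / \<bar>t\<bar>) ^ k / \<bar>t\<bar>)"
    unfolding norm_mult using g M by (intro mult_mono) auto
  also have "\<dots> = M * (4 * T) ^ k * (\<bar>t\<bar> powr \<alpha> / (\<bar>t\<bar> ^ k * \<bar>t\<bar>))" by (simp add: power_divide)
  also have "\<bar>t\<bar> powr \<alpha> / (\<bar>t\<bar> ^ k * \<bar>t\<bar>) = \<bar>t\<bar> powr (\<alpha> - real k - 1)"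
    using t0 by (simp add: powr_diff powr_realpow)
  also have "M * (4 * T) ^ k * \<bar>t\<bar> powr (\<alpha> - real k - 1) \<le> M * (4 * T) ^ k * \<bar>t\<bar> powr (- 2)"
    using \<alpha> t M T by (intro mult_left_mono powr_mono) auto
  also have "\<bar>t\<bar> powr (- 2) = 1 / t\<^sup>2" using t0 by (simp add: powr_minus powr_numeral inverse_eq_divide)
  finally show ?thesis by simp
qed

text \<open>Two half-lines and a middle part. The lower half-line is the conjugate of an upper one
  for the conjugated parameters. In the middle, \<open>\<sigma> \<noteq> 0\<close> keeps
  \<open>1 / s\<close> bounded, and the resulting constant is covered because
  \<open>T powr (\<alpha> - 1/2) \<ge> 1\<close>.\<close>

theorem gamma_quot_line_bound:
  fixes \<beta> :: "nat \<Rightarrow> complex"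
  assumes d: "d \<ge> 1" and \<sigma>: "\<bar>\<sigma>\<bar> \<le> 1" "\<sigma> \<noteq> 0" and \<alpha>: "\<alpha> = real d * (1/2 - \<sigma>)" "\<alpha> > 1/2" "\<alpha> + 1 \<le> real k"
    and cont: "continuous_on UNIV (\<lambda>t. gamma_quot d \<beta> (Complex \<sigma> t))"
  shows "\<exists>C. \<forall>T y. T \<ge> 1 \<longrightarrow>
     norm (LINT t|lborel. exp (of_real y * Complex \<sigma> t) * (gamma_quot d \<beta> (Complex \<sigma> t) * (mexp (Complex \<sigma> t / of_real T) ^ k / Complex \<sigma> t)))
       \<le> C * exp (\<sigma> * y) * T powr (\<alpha> - 1/2)"
proof -
  define \<beta>' where "\<beta>' = (\<lambda>\<nu>. cnj (\<beta> \<nu>))"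
  have g': "gamma_quot d \<beta> (Complex \<sigma> (-t)) = cnj (gamma_quot d \<beta>' (Complex \<sigma> t))" for t
    unfolding cnj_gamma_quot \<beta>'_def by (simp add: complex_cnj)
  have cont': "continuous_on UNIV (\<lambda>t. gamma_quot d \<beta>' (Complex \<sigma> t))"
  proof -
    have "gamma_quot d \<beta>' (Complex \<sigma> t) = cnj (gamma_quot d \<beta> (Complex \<sigma> (-t)))" for t
      by (simp add: g')
    moreover have "continuous_on UNIV (\<lambda>t. cnj (gamma_quot d \<beta> (Complex \<sigma> (-t))))"
      by (intro continuous_intros continuous_on_compose2[OF cont, of _ uminus]) auto
    ultimately show ?thesis by simp
  qed
  obtain R1 where R1: "R1 \<ge> 2" "\<And>R. R \<ge> R1 \<Longrightarrow> \<exists>C. \<forall>T y x. T \<ge> 1 \<longrightarrow> x \<ge> R \<longrightarrow>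
     norm (integral {R..x} (\<lambda>t. exp (of_real y * Complex \<sigma> t) * (gamma_quot d \<beta> (Complex \<sigma> t) * (mexp (Complex \<sigma> t / of_real T) ^ k / Complex \<sigma> t))))
       \<le> C * exp (\<sigma> * y) * T powr (\<alpha> - 1/2)"
    using gamma_quot_half_line_bound[OF d \<sigma>(1) \<alpha> cont] by blast
  obtain R2 where R2: "R2 \<ge> 2" "\<And>R. R \<ge> R2 \<Longrightarrow> \<exists>C. \<forall>T y x. T \<ge> 1 \<longrightarrow> x \<ge> R \<longrightarrow>
     norm (integral {R..x} (\<lambda>t. exp (of_real y * Complex \<sigma> t) * (gamma_quot d \<beta>' (Complex \<sigma> t) * (mexp (Complex \<sigma> t / of_real T) ^ k / Complex \<sigma> t))))
       \<le> C * exp (\<sigma> * y) * T powr (\<alpha> - 1/2)"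
    using gamma_quot_half_line_bound[OF d \<sigma>(1) \<alpha> cont'] by blast
  obtain M R3 where MR: "M \<ge> 1" "\<And>\<sigma> t. \<bar>\<sigma>\<bar> \<le> 1 \<Longrightarrow> \<bar>t\<bar> \<ge> R3 \<Longrightarrow> norm (gamma_quot d \<beta> (Complex \<sigma> t)) \<le> M * \<bar>t\<bar> powr (real d * (1/2 - \<sigma>))"
    using norm_gamma_quot_bounds[of 1 d \<beta>] by blast
  define R where "R = max R1 R2"
  have R: "R \<ge> 2" "R \<ge> R1" "R \<ge> R2" using R1 by (auto simp: R_def)
  obtain C1 where C1: "\<And>T y x. T \<ge> 1 \<Longrightarrow> x \<ge> R \<Longrightarrow>
     norm (integral {R..x} (\<lambda>t. exp (of_real y * Complex \<sigma> t) * (gamma_quot d \<beta> (Complex \<sigma> t) * (mexp (Complex \<sigma> t / of_real T) ^ k / Complex \<sigma> t))))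
       \<le> C1 * exp (\<sigma> * y) * T powr (\<alpha> - 1/2)" using R1(2)[OF R(2)] by blast
  obtain C2 where C2: "\<And>T y x. T \<ge> 1 \<Longrightarrow> x \<ge> R \<Longrightarrow>
     norm (integral {R..x} (\<lambda>t. exp (of_real y * Complex \<sigma> t) * (gamma_quot d \<beta>' (Complex \<sigma> t) * (mexp (Complex \<sigma> t / of_real T) ^ k / Complex \<sigma> t))))
       \<le> C2 * exp (\<sigma> * y) * T powr (\<alpha> - 1/2)" using R2(2)[OF R(3)] by blast
  have "compact ((\<lambda>t. gamma_quot d \<beta> (Complex \<sigma> t)) ` {-R..R})"
    by (intro compact_continuous_image continuous_on_subset[OF cont]) auto
  then obtain B where B: "\<And>t. t \<in> {-R..R} \<Longrightarrow> norm (gamma_quot d \<beta> (Complex \<sigma> t)) \<le> B"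
    by (meson bounded_iff compact_imp_bounded image_eqI)
  have "norm (gamma_quot d \<beta> (Complex \<sigma> 0)) \<le> B" by (rule B) (use R in simp)
  hence B0: "B \<ge> 0" by (rule order_trans[OF norm_ge_zero])
  define C3 where "C3 = B * (4 ^ k / \<bar>\<sigma>\<bar>) * (2 * R)"
  have C3: "C3 \<ge> 0" using B0 R by (simp add: C3_def)
  show ?thesis
  proof (rule exI[of _ "C2 + C3 + C1"], intro allI impI)
    fix T y :: real assume T: "T \<ge> 1"
    define m where "m = (\<lambda>t. mexp (Complex \<sigma> t / of_real T) ^ k / Complex \<sigma> t)"
    define h where "h = (\<lambda>t. exp (of_real y * Complex \<sigma> t) * (gamma_quot d \<beta> (Complex \<sigma> t) * m t))"
    have cm: "continuous_on X m" for X unfolding m_def using Complex_ne_0[OF \<sigma>(2)] T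
      by (intro continuous_intros continuous_on_mexp_line) auto
    have ch: "continuous_on X h" for X unfolding h_def
      by (intro continuous_intros cm continuous_on_subset[OF cont]) auto
    have int: "integrable lborel h"
    proof (rule integrable_continuous_tail[OF ch, of "max R3 1" "exp (\<sigma> * y) * (M * (4 * T) ^ k)"])
      fix t assume t: "max R3 1 \<le> \<bar>t\<bar>"
      have "norm (gamma_quot d \<beta> (Complex \<sigma> t) * m t) \<le> M * (4 * T) ^ k / t\<^sup>2"
        unfolding m_def using MR(2)[OF \<sigma>(1), of t] \<alpha> t \<sigma> T MR(1) by (intro kernel_tail_bound) auto
      from mult_left_mono[OF this, of "exp (\<sigma> * y)"]
      show "norm (h t) \<le> exp (\<sigma> * y) * (M * (4 * T) ^ k) / t\<^sup>2"
        by (simp add: h_def norm_mult mult.commute[of y])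
    qed
    have Tp: "T powr (\<alpha> - 1/2) \<ge> 1" using T \<alpha>(2) by (intro ge_one_powr_ge_zero) auto
    have b2: "norm (integral {-R..R} h) \<le> C3 * exp (\<sigma> * y) * T powr (\<alpha> - 1/2)"
    proof -
      have "norm (integral {-R..R} h) \<le> (exp (\<sigma> * y) * (B * (4 ^ k / \<bar>\<sigma>\<bar>))) * (R - - R)"
      proof (rule integral_bound)
        fix t assume t: "t \<in> {-R..R}"
        have "norm (mexp (Complex \<sigma> t / of_real T)) \<le> 4 * min 1 (1 / norm (Complex \<sigma> t / of_real T))"
          using Complex_ne_0[OF \<sigma>(2)] T \<sigma> by (intro norm_mexp_le) (auto simp: abs_divide)
        hence "norm (mexp (Complex \<sigma> t / of_real T)) \<le> 4" by (auto simp: min_def split: if_splits)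
        moreover have "\<bar>\<sigma>\<bar> \<le> norm (Complex \<sigma> t)" using abs_Re_le_cmod[of "Complex \<sigma> t"] by simp
        ultimately have "norm (m t) \<le> 4 ^ k / \<bar>\<sigma>\<bar>"
          unfolding m_def norm_divide norm_power using \<sigma> by (intro frac_le power_mono) auto
        hence "exp (\<sigma> * y) * (norm (gamma_quot d \<beta> (Complex \<sigma> t)) * norm (m t)) \<le> exp (\<sigma> * y) * (B * (4 ^ k / \<bar>\<sigma>\<bar>))"
          using B[OF t] B0 by (intro mult_left_mono mult_mono) auto
        thus "norm (h t) \<le> exp (\<sigma> * y) * (B * (4 ^ k / \<bar>\<sigma>\<bar>))"
          by (simp add: h_def norm_mult mult.commute[of y])
      qed (use R ch in auto)
      also have "\<dots> = C3 * exp (\<sigma> * y) * 1" by (simp add: C3_def)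
      also have "\<dots> \<le> C3 * exp (\<sigma> * y) * T powr (\<alpha> - 1/2)" using Tp C3 by (intro mult_left_mono) auto
      finally show ?thesis .
    qed
    have b1: "norm (integral {R..x} h) \<le> C1 * exp (\<sigma> * y) * T powr (\<alpha> - 1/2)" if "x \<ge> R" for x
      using C1[OF T that, of y] by (simp add: h_def m_def)
    have b3: "norm (integral {-x..-R} h) \<le> C2 * exp (\<sigma> * y) * T powr (\<alpha> - 1/2)" if x: "x \<ge> R" for x
    proof -
      define h' where "h' = (\<lambda>t. exp (of_real y * Complex \<sigma> t) * (gamma_quot d \<beta>' (Complex \<sigma> t) * (mexp (Complex \<sigma> t / of_real T) ^ k / Complex \<sigma> t)))"
      have cc: "Complex \<sigma> (-t) = cnj (Complex \<sigma> t)" for t by (simp add: complex_cnj)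
      have hh: "h (-t) = cnj (h' t)" for t
        unfolding h_def m_def h'_def g' unfolding cc by (simp add: exp_cnj cnj_mexp)
      have "integral {-x..-R} h = integral {-x..-R} (\<lambda>t. cnj (h' (- t)))"
        using hh[of "- t" for t] by (intro integral_cong) (metis minus_minus)
      also have "\<dots> = integral {R..x} (\<lambda>t. cnj (h' t))"
        by (rule Henstock_Kurzweil_Integration.integral_reflect_real)
      also have "\<dots> = cnj (integral {R..x} h')"
      proof (rule cnj_integral)
        have "h' = (\<lambda>t. exp (of_real y * Complex \<sigma> t) * (gamma_quot d \<beta>' (Complex \<sigma> t) * m t))"
          by (simp add: h'_def m_def)
        moreover have "continuous_on {R..x} \<dots>"
          by (intro continuous_intros cm continuous_on_subset[OF cont']) auto
        ultimately show "h' integrable_on {R..x}" by (simp add: integrable_continuous_real)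
      qed
      finally show ?thesis using C2[OF T x, of y] by (simp add: h'_def)
    qed
    have "norm (integral\<^sup>L lborel h) \<le> (C2 + C3 + C1) * exp (\<sigma> * y) * T powr (\<alpha> - 1/2)"
    proof (rule tendsto_upperbound[OF tendsto_norm[OF tendsto_integral_symmetric_intervals[OF int]]])
      show "eventually (\<lambda>n. norm (integral {- real n..real n} h) \<le> (C2 + C3 + C1) * exp (\<sigma> * y) * T powr (\<alpha> - 1/2)) sequentially"
        using eventually_ge_at_top[of "nat \<lceil>R\<rceil>"]
      proof eventually_elim
        case (elim n)
        hence n: "real n \<ge> R" by linarith
        have i: "h integrable_on {u..v}" for u v by (intro integrable_continuous_real ch)
        have "integral {-real n..real n} h = integral {-real n..-R} h + (integral {-R..R} h + integral {R..real n} h)"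
          using Henstock_Kurzweil_Integration.integral_combine[of "-real n" "-R" "real n" h] Henstock_Kurzweil_Integration.integral_combine[of "-R" R "real n" h] n R i by simp
        hence "norm (integral {-real n..real n} h) \<le> norm (integral {-real n..-R} h) + (norm (integral {-R..R} h) + norm (integral {R..real n} h))"
          by (simp only:) (intro order_trans[OF norm_triangle_ineq add_left_mono[OF norm_triangle_ineq]])
        also have "\<dots> \<le> C2 * exp (\<sigma> * y) * T powr (\<alpha> - 1/2) + (C3 * exp (\<sigma> * y) * T powr (\<alpha> - 1/2) + C1 * exp (\<sigma> * y) * T powr (\<alpha> - 1/2))"
          by (intro add_mono b1 b2 b3 n)
        also have "\<dots> = (C2 + C3 + C1) * exp (\<sigma> * y) * T powr (\<alpha> - 1/2)" by (simp only: distrib_right add.assoc)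
        finally show ?case .
      qed
    qed auto
    thus "norm (LINT t|lborel. exp (of_real y * Complex \<sigma> t) * (gamma_quot d \<beta> (Complex \<sigma> t) * (mexp (Complex \<sigma> t / of_real T) ^ k / Complex \<sigma> t)))
       \<le> (C2 + C3 + C1) * exp (\<sigma> * y) * T powr (\<alpha> - 1/2)"
      unfolding h_def m_def .
  qed
qed

section \<open>Poles of the Gamma quotient near the imaginary axis\<close>

lemma gamma_quot_alt:
  "gamma_quot d \<beta> s = (\<Prod>\<nu>=1..d. Gamma ((1 - s) / 2 + \<beta> \<nu>) * rGamma (s / 2 + \<beta> \<nu>))"
proof -
  \<comment> \<open>Where a Gamma value in the denominator has a pole, \<open>Gamma\<close> is 0 by
    convention and so is its inverse, in accordance with \<open>rGamma\<close>; only the numerators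
    can be singular.\<close>
  have "inverse (\<Prod>\<nu>=1..d. Gamma (s / 2 + \<beta> \<nu>)) = (\<Prod>\<nu>=1..d. rGamma (s / 2 + \<beta> \<nu>))"
    unfolding rGamma_inverse_Gamma by (rule prod_inversef[symmetric, unfolded o_def])
  thus ?thesis unfolding gamma_quot_def gamma_factor_def divide_inverse prod.distrib by (simp only:)
qed

lemma gamma_quot_holomorphic:
  assumes "\<And>s \<nu>. s \<in> A \<Longrightarrow> \<nu> \<in> {1..d} \<Longrightarrow> (1 - s) / 2 + \<beta> \<nu> \<notin> \<int>\<^sub>\<le>\<^sub>0"
  shows "gamma_quot d \<beta> holomorphic_on A"
proof -
  have "(\<lambda>s. \<Prod>\<nu>=1..d. Gamma ((1 - s) / 2 + \<beta> \<nu>) * rGamma (s / 2 + \<beta> \<nu>)) holomorphic_on A"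
    using assms by (intro holomorphic_intros) auto
  thus ?thesis unfolding gamma_quot_alt[abs_def] .
qed
lemma Re_gamma_quot_pole:
  assumes "(1 - s) / 2 + \<beta> = - of_nat j"
  shows "Re s = 1 + 2 * Re \<beta> + 2 * real j" "Im s = 2 * Im \<beta>"
proof -
  have "Re ((1 - s) / 2 + \<beta>) = Re (- of_nat j)" "Im ((1 - s) / 2 + \<beta>) = Im (- of_nat j)" unfolding assms by (rule refl)+
  hence *: "(1 - Re s) / 2 + Re \<beta> = - real j" "Im s = 2 * Im \<beta>" by simp_all
  show "Re s = 1 + 2 * Re \<beta> + 2 * real j" using *(1) by (simp add: field_simps)
  show "Im s = 2 * Im \<beta>" by (rule *(2))
qed

text \<open>A pole that stems from the index \<nu> has imaginary part
  \<open>2 * Im (\<beta> \<nu>)\<close>. If it lies on the imaginary axis away from 0, the entry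
  makes \<open>exp (\<tau> * s)\<close> equal to -1 there. Every such index has its own entry, so
  coinciding poles are cancelled with multiplicity; on the axis, an index with real \<beta> can only
  produce a pole at 0.\<close>

primrec twist_list :: "(nat \<Rightarrow> complex) \<Rightarrow> nat \<Rightarrow> real list" where
  "twist_list \<beta> 0 = []"
| "twist_list \<beta> (Suc n) = (if Im (\<beta> (Suc n)) \<noteq> 0 then pi / \<bar>2 * Im (\<beta> (Suc n))\<bar> # twist_list \<beta> n else twist_list \<beta> n)"

lemma exp_mult_twist_list:
  "exp_mult (twist_list \<beta> d) s = (\<Prod>\<nu>=1..d. if Im (\<beta> \<nu>) \<noteq> 0 then exp (of_real (pi / \<bar>2 * Im (\<beta> \<nu>)\<bar>) * s) + 1 else 1)"
  by (induction d) auto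

lemma twist_list_pos: "\<tau> \<in> set (twist_list \<beta> d) \<Longrightarrow> \<tau> > 0"
  by (induction d) (auto split: if_splits)

lemma pole_cancel:
  fixes G D Q r :: complex
  assumes "D \<noteq> 0"
  shows "(G * (- D / 2)) * (- 2 * ((Q - 0) / D)) * r = G * r * Q"
proof -
  have 1: "(- D / 2) * (- 2) = D" by simp
  have 2: "D * (Q / D) = Q" using assms by simp
  have "(G * (- D / 2)) * (- 2 * ((Q - 0) / D)) * r = G * r * (((- D / 2) * (- 2)) * (Q / D))"
    by (simp only: mult_ac diff_0_right)
  thus ?thesis unfolding 1 2 .
qed

text \<open>Factor by factor: either the Gamma factor is regular at \<open>p\<close>, or its simple
  pole meets the zero of its own twist factor, and the product converges to the residue times a
  derivative. At 0 this would fail for real \<beta>, whence \<open>p \<noteq> 0\<close>.\<close>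

lemma twisted_gamma_quot_limit:
  assumes p: "Re p = 0" "p \<noteq> 0"
  shows "\<exists>L. ((\<lambda>s. gamma_quot d \<beta> s * exp_mult (twist_list \<beta> d) s) \<longlongrightarrow> L) (at p)"
proof -
  define q where "q = (\<lambda>\<nu> s. if Im (\<beta> \<nu>) \<noteq> 0 then exp (of_real (pi / \<bar>2 * Im (\<beta> \<nu>)\<bar>) * s) + 1 else (1::complex))"
  have cq: "isCont (q \<nu>) s" for \<nu> s unfolding q_def by (cases "Im (\<beta> \<nu>) \<noteq> 0") auto
  have lim: "\<exists>L. ((\<lambda>s. Gamma ((1 - s) / 2 + \<beta> \<nu>) * rGamma (s / 2 + \<beta> \<nu>) * q \<nu> s) \<longlongrightarrow> L) (at p)" for \<nu>
  proof (cases "(1 - p) / 2 + \<beta> \<nu> \<in> \<int>\<^sub>\<le>\<^sub>0")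
    case False
    have "isCont (\<lambda>s. Gamma ((1 - s) / 2 + \<beta> \<nu>) * rGamma (s / 2 + \<beta> \<nu>) * q \<nu> s) p"
      using False cq by (intro continuous_intros) auto
    thus ?thesis by (auto simp: isCont_def)
  next
    case True
    then obtain j where j: "(1 - p) / 2 + \<beta> \<nu> = - of_nat j" by (auto elim!: nonpos_Ints_cases')
    define u where "u = (\<lambda>s. (1 - s) / 2 + \<beta> \<nu>)"
    have up: "u p = - of_nat j" using j by (simp add: u_def)
    have us: "u s + of_nat j = - (s - p) / 2" for s
    proof -
      have "u s + of_nat j = u s - u p" using up by simp
      also have "\<dots> = - (s - p) / 2" by (simp add: u_def diff_divide_distrib)
      finally show ?thesis .
    qed
    have im: "Im p = 2 * Im (\<beta> \<nu>)" using Re_gamma_quot_pole[OF j] by simp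
    hence imp: "Im (\<beta> \<nu>) \<noteq> 0" using p by (auto simp: complex_eq_iff)
    define \<tau> where "\<tau> = pi / \<bar>2 * Im (\<beta> \<nu>)\<bar>"
    have qe: "q \<nu> = (\<lambda>s. exp (of_real \<tau> * s) + 1)" using imp by (auto simp: q_def \<tau>_def)
    have q0: "q \<nu> p = 0"
    proof -
      have e: "of_real \<tau> * p = \<i> * of_real (\<tau> * Im p)" using p by (simp add: complex_eq_iff)
      have "\<tau> * Im p = pi \<or> \<tau> * Im p = - pi"
        unfolding \<tau>_def im[symmetric] using imp im by (cases "Im p > 0") (auto simp: field_simps)
      hence "exp (\<i> * of_real (\<tau> * Im p)) = -1"
        by (elim disjE) (simp_all only: exp_pi_i' of_real_minus mult_minus_right exp_minus, simp)
      thus ?thesis unfolding qe e by simp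
    qed
    have fl: "filterlim u (at (- of_nat j)) (at p)"
    proof (rule filterlim_atI)
      have "isCont u p" unfolding u_def by (intro continuous_intros) auto
      thus "u \<midarrow>p\<rightarrow> - of_nat j" using up by (simp add: isCont_def)
      show "eventually (\<lambda>s. u s \<noteq> - of_nat j) (at p)"
      proof (rule eventually_mono[OF eventually_neq_at_within[of p]])
        fix s assume "s \<noteq> p"
        hence "u s + of_nat j \<noteq> 0" unfolding us by simp
        thus "u s \<noteq> - of_nat j" by auto
      qed
    qed
    have l1: "((\<lambda>s. Gamma (u s) * (u s + of_nat j)) \<longlongrightarrow> (-1) ^ j / fact j) (at p)"
      by (rule filterlim_compose[OF Gamma_residues fl])
    have "(q \<nu> has_field_derivative of_real \<tau> * exp (of_real \<tau> * p)) (at p)"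
      unfolding qe by (auto intro!: derivative_eq_intros)
    hence l2: "((\<lambda>s. (q \<nu> s - q \<nu> p) / (s - p)) \<longlongrightarrow> of_real \<tau> * exp (of_real \<tau> * p)) (at p)"
      by (simp add: has_field_derivative_iff)
    have l3: "((\<lambda>s. rGamma (s / 2 + \<beta> \<nu>)) \<longlongrightarrow> rGamma (p / 2 + \<beta> \<nu>)) (at p)"
      by (rule isContD) (intro continuous_intros, auto)
    have "((\<lambda>s. (Gamma (u s) * (u s + of_nat j)) * (- 2 * ((q \<nu> s - q \<nu> p) / (s - p))) * rGamma (s / 2 + \<beta> \<nu>)) \<longlongrightarrow>
       ((-1) ^ j / fact j) * (- 2 * (of_real \<tau> * exp (of_real \<tau> * p))) * rGamma (p / 2 + \<beta> \<nu>)) (at p)"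
      by (intro tendsto_intros l1 l2 l3)
    moreover have "eventually (\<lambda>s. (Gamma (u s) * (u s + of_nat j)) * (- 2 * ((q \<nu> s - q \<nu> p) / (s - p))) * rGamma (s / 2 + \<beta> \<nu>) =
        Gamma ((1 - s) / 2 + \<beta> \<nu>) * rGamma (s / 2 + \<beta> \<nu>) * q \<nu> s) (at p)"
      using eventually_neq_at_within[of p]
    proof eventually_elim
      case (elim s)
      hence D: "s - p \<noteq> 0" by simp
      show ?case
        using pole_cancel[OF D, of "Gamma ((1 - s) / 2 + \<beta> \<nu>)" "q \<nu> s" "rGamma (s / 2 + \<beta> \<nu>)"]
        unfolding us q0 unfolding u_def .
    qed
    ultimately show ?thesis by (intro exI) (rule Lim_transform_eventually)
  qed
  have "\<exists>L. \<forall>\<nu>. ((\<lambda>s. Gamma ((1 - s) / 2 + \<beta> \<nu>) * rGamma (s / 2 + \<beta> \<nu>) * q \<nu> s) \<longlongrightarrow> L \<nu>) (at p)"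
    by (rule choice, rule allI, rule lim)
  then obtain L where L: "\<And>\<nu>. ((\<lambda>s. Gamma ((1 - s) / 2 + \<beta> \<nu>) * rGamma (s / 2 + \<beta> \<nu>) * q \<nu> s) \<longlongrightarrow> L \<nu>) (at p)" by blast
  have eq: "(\<Prod>\<nu>=1..d. Gamma ((1 - s) / 2 + \<beta> \<nu>) * rGamma (s / 2 + \<beta> \<nu>) * q \<nu> s) = gamma_quot d \<beta> s * exp_mult (twist_list \<beta> d) s" for s
    unfolding gamma_quot_alt exp_mult_twist_list q_def by (rule prod.distrib)
  have "((\<lambda>s. \<Prod>\<nu>=1..d. Gamma ((1 - s) / 2 + \<beta> \<nu>) * rGamma (s / 2 + \<beta> \<nu>) * q \<nu> s) \<longlongrightarrow> (\<Prod>\<nu>=1..d. L \<nu>)) (at p)"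
    by (intro tendsto_prod L)
  thus ?thesis unfolding eq by (rule exI)
qed

text \<open>The poles of each factor have real parts in an arithmetic progression of step 2, of
  which only finitely many terms are near 0. Half the least nonzero modulus, capped at 1, will
  do.\<close>

lemma gamma_quot_pole_free_strip:
  fixes \<beta> :: "nat \<Rightarrow> complex"
  shows "\<exists>\<eta>>0. \<forall>\<nu>\<in>{1..d}. \<forall>s. (1 - s) / 2 + \<beta> \<nu> \<in> \<int>\<^sub>\<le>\<^sub>0 \<longrightarrow> Re s = 0 \<or> \<bar>Re s\<bar> > \<eta>"
proof -
  have one: "\<exists>\<eta>>0. \<forall>j::nat. x + 2 * real j = 0 \<or> \<bar>x + 2 * real j\<bar> > \<eta>" for x :: real
  proof -
    define N where "N = nat \<lceil>\<bar>x\<bar>\<rceil> + 1"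
    define S where "S = insert 1 ((\<lambda>j. \<bar>x + 2 * real j\<bar>) ` {..N} - {0})"
    have fin: "finite S" and ne: "S \<noteq> {}" by (auto simp: S_def)
    have pos: "Min S > 0" using fin ne by (subst Min_gr_iff) (auto simp: S_def)
    show ?thesis
    proof (rule exI[of _ "Min S / 2"], intro conjI allI)
      show "Min S / 2 > 0" using pos by simp
      fix j :: nat
      show "x + 2 * real j = 0 \<or> \<bar>x + 2 * real j\<bar> > Min S / 2"
      proof (cases "j \<le> N")
        case True
        show ?thesis
        proof (cases "x + 2 * real j = 0")
          case False
          hence "\<bar>x + 2 * real j\<bar> \<in> S" using True by (auto simp: S_def)
          hence "Min S \<le> \<bar>x + 2 * real j\<bar>" using fin by simp
          thus ?thesis using pos by simp
        qed auto
      next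
        case False
        hence "real j > \<bar>x\<bar>" by (simp add: N_def) linarith
        moreover have "real j \<ge> 1" using False by (simp add: N_def)
        ultimately have "\<bar>x + 2 * real j\<bar> \<ge> 1" by linarith
        moreover have "Min S \<le> 1" using fin by (simp add: S_def)
        ultimately show ?thesis by linarith
      qed
    qed
  qed
  have "\<forall>\<nu>. \<exists>\<eta>>0. \<forall>j::nat. 1 + 2 * Re (\<beta> \<nu>) + 2 * real j = 0 \<or> \<bar>1 + 2 * Re (\<beta> \<nu>) + 2 * real j\<bar> > \<eta>"
    using one by blast
  then obtain \<eta> where \<eta>: "\<And>\<nu>. \<eta> \<nu> > 0" "\<And>\<nu> j. 1 + 2 * Re (\<beta> \<nu>) + 2 * real j = 0 \<or> \<bar>1 + 2 * Re (\<beta> \<nu>) + 2 * real j\<bar> > \<eta> \<nu>" by metis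
  define \<eta>0 where "\<eta>0 = Min (insert 1 (\<eta> ` {1..d}))"
  show ?thesis
  proof (rule exI[of _ \<eta>0], intro conjI ballI allI impI)
    show "\<eta>0 > 0" unfolding \<eta>0_def using \<eta>(1) by (intro Min_gr_iff[THEN iffD2]) auto
    fix \<nu> s assume \<nu>: "\<nu> \<in> {1..d}" and s: "(1 - s) / 2 + \<beta> \<nu> \<in> \<int>\<^sub>\<le>\<^sub>0"
    then obtain j where "(1 - s) / 2 + \<beta> \<nu> = - of_nat j" by (auto elim!: nonpos_Ints_cases')
    hence "Re s = 1 + 2 * Re (\<beta> \<nu>) + 2 * real j" by (rule Re_gamma_quot_pole)
    moreover have "\<eta>0 \<le> \<eta> \<nu>" unfolding \<eta>0_def using \<nu> by (intro Min_le) auto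
    ultimately show "Re s = 0 \<or> \<bar>Re s\<bar> > \<eta>0" using \<eta>(2)[of \<nu> j] by auto
  qed
qed

lemma mexp_tendsto_1: "((\<lambda>s. mexp (of_real w * s)) \<longlongrightarrow> 1) (at 0)" if "w \<noteq> 0" for w :: real
proof -
  have "((\<lambda>s::complex. exp (of_real w * s)) has_field_derivative of_real w) (at 0)"
    by (auto intro!: derivative_eq_intros)
  hence "((\<lambda>s::complex. (exp (of_real w * s) - 1) / s) \<longlongrightarrow> of_real w) (at 0)"
    by (simp add: has_field_derivative_iff)
  hence "((\<lambda>s::complex. (exp (of_real w * s) - 1) / s / of_real w) \<longlongrightarrow> of_real w / of_real w) (at 0)"
    using that by (intro tendsto_intros) auto
  thus ?thesis using that by (simp add: mexp_def mult.commute)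
qed

lemma mexp_holomorphic [holomorphic_intros]:
  assumes "f holomorphic_on A" "\<And>s. s \<in> A \<Longrightarrow> f s \<noteq> 0"
  shows "(\<lambda>s. mexp (f s)) holomorphic_on A"
  unfolding mexp_def using assms by (intro holomorphic_intros) auto

lemma continuous_on_exp_mult [continuous_intros]:
  assumes "continuous_on A f"
  shows "continuous_on A (\<lambda>x. exp_mult \<tau>s (f x))"
  by (rule continuous_on_compose2[OF holomorphic_on_imp_continuous_on[OF exp_mult_holomorphic[of _ UNIV]] assms]) auto

lemma isCont_exp_mult: "isCont (exp_mult \<tau>s) s"
  using continuous_on_exp_mult[of UNIV "\<lambda>x. x" \<tau>s] by (simp add: continuous_on_eq_continuous_at)

text \<open>Between the two lines, singularities lie on the imaginary axis only, and every residue
  vanishes: at 0 the zero of \<open>gamma_quot\<close> cancels the factor \<open>1 / s\<close>,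
  elsewhere the twist leaves a finite limit. So the smoothed integral has the same value on both
  lines.\<close>

theorem gamma_quot_line_shift:
  fixes y T :: real
  assumes d: "d \<ge> 1" and \<eta>: "0 < \<eta>" "\<eta> < \<eta>'" "\<eta> \<le> 1" and k: "real d * (1/2 + \<eta>) + 1 \<le> real k"
    and poles: "\<And>\<nu> s. \<nu> \<in> {1..d} \<Longrightarrow> (1 - s) / 2 + \<beta> \<nu> \<in> \<int>\<^sub>\<le>\<^sub>0 \<Longrightarrow> Re s = 0 \<or> \<bar>Re s\<bar> > \<eta>'"
    and zero: "(gamma_quot d \<beta> \<longlongrightarrow> 0) (at 0)" and T: "T \<ge> 1"
  defines "f \<equiv> (\<lambda>s. exp (of_real y * s) * (exp_mult (twist_list \<beta> d) s * (gamma_quot d \<beta> s * (mexp (s / of_real T) ^ k / s))))"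
  shows "integrable lborel (\<lambda>t. f (Complex \<eta> t))" "integrable lborel (\<lambda>t. f (Complex (-\<eta>) t))"
    "(LINT t|lborel. f (Complex \<eta> t)) = (LINT t|lborel. f (Complex (-\<eta>) t))"
proof -
  define \<tau>s where "\<tau>s = twist_list \<beta> d"
  \<comment> \<open>Candidates for the singularities in the strip; a point of \<open>P\<close> at
    which \<open>f\<close> is regular does no harm.\<close>
  define P where "P = insert 0 ((\<lambda>\<nu>. \<i> * of_real (2 * Im (\<beta> \<nu>))) ` {1..d})"
  have P: "finite P" "\<And>p. p \<in> P \<Longrightarrow> Re p = 0" by (auto simp: P_def)
  define S where "S = {s. -\<eta>' < Re s \<and> Re s < \<eta>'}"
  have S_alt: "S = {s. Re s > -\<eta>'} \<inter> {s. Re s < \<eta>'}" by (auto simp: S_def)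
  have oS: "open S" unfolding S_alt by (intro open_Int open_halfspace_Re_gt open_halfspace_Re_lt)
  have np: "(1 - s) / 2 + \<beta> \<nu> \<notin> \<int>\<^sub>\<le>\<^sub>0" if "s \<in> S - P" "\<nu> \<in> {1..d}" for s \<nu>
  proof
    assume *: "(1 - s) / 2 + \<beta> \<nu> \<in> \<int>\<^sub>\<le>\<^sub>0"
    hence "Re s = 0" using poles[OF that(2) *] that(1) by (auto simp: S_def)
    moreover from * obtain j where "(1 - s) / 2 + \<beta> \<nu> = - of_nat j" by (auto elim!: nonpos_Ints_cases')
    hence "Im s = 2 * Im (\<beta> \<nu>)" by (rule Re_gamma_quot_pole)
    ultimately have "s = \<i> * of_real (2 * Im (\<beta> \<nu>))" by (simp add: complex_eq_iff)
    thus False using that by (auto simp: P_def)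
  qed
  have gh: "gamma_quot d \<beta> holomorphic_on (S - P)" using np by (rule gamma_quot_holomorphic)
  have f_alt: "f = (\<lambda>s. exp (of_real y * s) * (exp_mult \<tau>s s * (gamma_quot d \<beta> s * (mexp (s / of_real T) ^ k / s))))"
    by (simp add: f_def \<tau>s_def)
  have fh: "f holomorphic_on (S - P)"
    unfolding f_alt using T by (intro holomorphic_intros gh) (auto simp: P_def)
  obtain M R where MR: "M \<ge> 1" "R \<ge> 2" "\<And>\<sigma> t. \<bar>\<sigma>\<bar> \<le> 1 \<Longrightarrow> \<bar>t\<bar> \<ge> R \<Longrightarrow> norm (gamma_quot d \<beta> (Complex \<sigma> t)) \<le> M * \<bar>t\<bar> powr (real d * (1/2 - \<sigma>))"
    using norm_gamma_quot_bounds[of 1 d \<beta>] by blast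
  define Q where "Q = (\<Prod>\<tau>\<leftarrow>\<tau>s. exp \<tau> + 1)"
  have Q: "norm (exp_mult \<tau>s s) \<le> Q" if "\<bar>Re s\<bar> \<le> 1" for s
  proof -
    have "(\<Prod>\<tau>\<leftarrow>us. exp (Re s * \<tau>) + 1) \<le> (\<Prod>\<tau>\<leftarrow>us. exp \<tau> + 1) \<and> 0 \<le> (\<Prod>\<tau>\<leftarrow>us. exp (Re s * \<tau>) + 1)" if "\<forall>\<tau>\<in>set us. \<tau> > 0" for us
      using that
    proof (induction us)
      case (Cons u us)
      have "Re s * u \<le> 1 * u" using \<open>\<bar>Re s\<bar> \<le> 1\<close> Cons.prems by (intro mult_right_mono) auto
      thus ?case using Cons by (auto intro!: mult_mono add_nonneg_nonneg)
    qed auto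
    hence "(\<Prod>\<tau>\<leftarrow>\<tau>s. exp (Re s * \<tau>) + 1) \<le> Q" using twist_list_pos[of _ \<beta> d] by (simp add: Q_def \<tau>s_def)
    thus ?thesis using norm_exp_mult_le[of \<tau>s s] by linarith
  qed
  define W where "W = exp \<bar>y\<bar> * (Q * (M * (4 * T) ^ k))"
  have Q0: "Q \<ge> 0" by (rule order_trans[OF norm_ge_zero Q[of 0]]) simp
  have fb: "norm (f (Complex \<sigma> t)) \<le> W / t\<^sup>2" if \<sigma>: "\<bar>\<sigma>\<bar> \<le> \<eta>" and t: "\<bar>t\<bar> \<ge> R" for \<sigma> t
  proof -
    have \<sigma>1: "\<bar>\<sigma>\<bar> \<le> 1" using \<sigma> \<eta> by simp
    have "real d * (1/2 - \<sigma>) \<le> real d * (1/2 + \<eta>)" using \<sigma> by (intro mult_left_mono) auto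
    hence "norm (gamma_quot d \<beta> (Complex \<sigma> t) * (mexp (Complex \<sigma> t / of_real T) ^ k / Complex \<sigma> t)) \<le> M * (4 * T) ^ k / t\<^sup>2"
      using MR(3)[OF \<sigma>1 t] k \<sigma>1 T t MR by (intro kernel_tail_bound[where \<alpha> = "real d * (1/2 - \<sigma>)"]) auto
    moreover have "norm (exp_mult \<tau>s (Complex \<sigma> t)) \<le> Q" by (rule Q) (use \<sigma>1 in simp)
    moreover have "norm (exp (of_real y * Complex \<sigma> t)) \<le> exp \<bar>y\<bar>"
    proof -
      have "y * \<sigma> \<le> \<bar>y\<bar> * \<bar>\<sigma>\<bar>" by (metis abs_ge_self abs_mult)
      also have "\<dots> \<le> \<bar>y\<bar> * 1" using \<sigma>1 by (intro mult_left_mono) auto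
      finally show ?thesis by simp
    qed
    ultimately have "norm (f (Complex \<sigma> t)) \<le> exp \<bar>y\<bar> * (Q * (M * (4 * T) ^ k / t\<^sup>2))"
      unfolding f_alt norm_mult using Q0 by (intro mult_mono mult_nonneg_nonneg) auto
    thus ?thesis by (simp add: W_def)
  qed
  have cf: "continuous_on UNIV (\<lambda>t. f (Complex \<sigma> t))" if "\<sigma> = \<eta> \<or> \<sigma> = - \<eta>" for \<sigma>
  proof (rule continuous_on_compose2[OF holomorphic_on_imp_continuous_on[OF fh]])
    show "(\<lambda>t. Complex \<sigma> t) ` UNIV \<subseteq> S - P" using that P(2) \<eta> by (force simp: S_def)
  qed (intro continuous_intros)
  show i1: "integrable lborel (\<lambda>t. f (Complex \<eta> t))"
    by (rule integrable_continuous_tail[OF cf fb]) (use \<eta> in auto)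
  show i2: "integrable lborel (\<lambda>t. f (Complex (-\<eta>) t))"
    by (rule integrable_continuous_tail[OF cf fb]) (use \<eta> in auto)
  have "(LINT t|lborel. f (Complex \<eta> t)) = (LINT t|lborel. f (Complex (-\<eta>) t)) + 2 * pi * (\<Sum>p\<in>P. residue f p)"
  proof (rule vertical_line_shift[where a' = "-\<eta>'" and b' = \<eta>' and Rb = R and g = "\<lambda>t. W / t\<^sup>2"])
    show "f holomorphic_on {s. - \<eta>' < Re s \<and> Re s < \<eta>'} - P" using fh by (simp add: S_def)
    show "((\<lambda>t. W / t\<^sup>2) \<longlongrightarrow> 0) at_top"
      by (intro tendsto_divide_0[OF tendsto_const] filterlim_at_top_imp_at_infinity filterlim_pow_at_top filterlim_ident) auto
    show "norm (f (Complex \<sigma> t)) \<le> W / \<bar>t\<bar>\<^sup>2" if "- \<eta> \<le> \<sigma>" "\<sigma> \<le> \<eta>" "R \<le> \<bar>t\<bar>" for \<sigma> t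
      using fb[of \<sigma> t] that by (simp add: abs_le_iff)
  qed (use \<eta> P i1 i2 in auto)
  also have "(\<Sum>p\<in>P. residue f p) = 0"
  proof (rule sum.neutral, rule ballI)
    fix p assume p: "p \<in> P"
    show "residue f p = 0"
    proof (rule residue_simple'[of "S - (P - {p})"])
      show "open (S - (P - {p}))" using oS P(1) by (intro open_Diff finite_imp_closed) auto
      show "p \<in> S - (P - {p})" using p P(2)[OF p] \<eta> by (auto simp: S_def)
      show "f holomorphic_on (S - (P - {p}) - {p})" by (rule holomorphic_on_subset[OF fh]) auto
      show "((\<lambda>w. f w * (w - p)) \<longlongrightarrow> 0) (at p)"
      proof (cases "p = 0")
        case True
        have "((\<lambda>s. exp (of_real y * s) * (exp_mult \<tau>s s * (gamma_quot d \<beta> s * mexp (of_real (1 / T) * s) ^ k))) \<longlongrightarrow>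
           exp (of_real y * 0) * (exp_mult \<tau>s 0 * (0 * 1 ^ k))) (at 0)"
          using T isCont_exp_mult[where \<tau>s = \<tau>s and s = 0] by (intro tendsto_intros zero mexp_tendsto_1) (auto simp: isCont_def)
        moreover have "eventually (\<lambda>s. exp (of_real y * s) * (exp_mult \<tau>s s * (gamma_quot d \<beta> s * mexp (of_real (1 / T) * s) ^ k)) = f s * (s - 0)) (at 0)"
          using eventually_neq_at_within[of 0] by eventually_elim (simp add: f_alt)
        ultimately show ?thesis using True by (auto dest: Lim_transform_eventually)
      next
        case False
        obtain L where L: "((\<lambda>s. gamma_quot d \<beta> s * exp_mult \<tau>s s) \<longlongrightarrow> L) (at p)"
          using twisted_gamma_quot_limit[OF P(2)[OF p] False, of d \<beta>] unfolding \<tau>s_def by blast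
        have "isCont (\<lambda>s. exp (of_real y * s) * (mexp (s / of_real T) ^ k / s)) p"
          unfolding mexp_def using False T by (intro continuous_intros) auto
        hence isc: "((\<lambda>s. exp (of_real y * s) * (mexp (s / of_real T) ^ k / s)) \<longlongrightarrow> exp (of_real y * p) * (mexp (p / of_real T) ^ k / p)) (at p)"
          by (simp only: isCont_def)
        have "((\<lambda>s. (gamma_quot d \<beta> s * exp_mult \<tau>s s) * (exp (of_real y * s) * (mexp (s / of_real T) ^ k / s)) * (s - p)) \<longlongrightarrow>
           L * (exp (of_real y * p) * (mexp (p / of_real T) ^ k / p)) * (p - p)) (at p)"
          by (rule tendsto_mult[OF tendsto_mult[OF L isc] tendsto_diff[OF tendsto_ident_at tendsto_const]])
        thus ?thesis by (simp add: f_alt mult_ac)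
      qed
    qed
  qed
  finally show "(LINT t|lborel. f (Complex \<eta> t)) = (LINT t|lborel. f (Complex (-\<eta>) t))" by simp
qed

text \<open>On the line \<open>Re s = \<sigma>\<close> the bound is
  \<open>exp (\<sigma> * y) * T powr (\<alpha> - 1/2)\<close> with
  \<open>\<alpha> = d * (1/2 - \<sigma>)\<close>, which equals \<open>T powr ((d - 1) / 2)\<close>
  times the power \<sigma> of \<open>exp y / T ^ d\<close>. The integral has the same value for both
  signs of \<eta>, so the smaller of the two bounds holds.\<close>

theorem twisted_kernel_bound:
  assumes d: "d \<ge> 2" and \<eta>: "0 < \<eta>" "\<eta> < \<eta>'" "\<eta> \<le> 1 / (4 * real d)" and k: "real d * (1/2 + \<eta>) + 1 \<le> real k"
    and poles: "\<And>\<nu> s. \<nu> \<in> {1..d} \<Longrightarrow> (1 - s) / 2 + \<beta> \<nu> \<in> \<int>\<^sub>\<le>\<^sub>0 \<Longrightarrow> Re s = 0 \<or> \<bar>Re s\<bar> > \<eta>'"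
    and zero: "(gamma_quot d \<beta> \<longlongrightarrow> 0) (at 0)"
  shows "\<exists>C\<ge>0. \<forall>T y. T \<ge> 1 \<longrightarrow>
    norm (LINT t|lborel. exp (of_real y * Complex (-\<eta>) t) * (exp_mult (twist_list \<beta> d) (Complex (-\<eta>) t) * (gamma_quot d \<beta> (Complex (-\<eta>) t) * (mexp (Complex (-\<eta>) t / of_real T) ^ k / Complex (-\<eta>) t))))
      \<le> C * T powr ((real d - 1) / 2) * min (exp (\<eta> * (y - real d * ln T))) (exp (- \<eta> * (y - real d * ln T)))"
proof -
  define \<tau>s where "\<tau>s = twist_list \<beta> d"
  have \<eta>1: "\<eta> \<le> 1" 
  proof -
    have "1 / (4 * real d) \<le> 1 / 1" using d by (intro divide_left_mono) auto
    thus ?thesis using \<eta>(3) by simp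
  qed
  \<comment> \<open>The upper bound on \<eta> keeps \<alpha> within 1/4 of \<open>d / 2\<close>,
    hence above 1/2 for \<open>d \<ge> 2\<close>.\<close>
  have d\<eta>: "real d * \<eta> \<le> 1/4" using \<eta>(3) d by (simp add: field_simps)
  have cont: "continuous_on UNIV (\<lambda>t. gamma_quot d \<beta> (Complex \<sigma> t))" if \<sigma>: "\<sigma> = \<eta> \<or> \<sigma> = - \<eta>" for \<sigma>
  proof (rule continuous_on_compose2[OF holomorphic_on_imp_continuous_on[OF gamma_quot_holomorphic]])
    show "(\<lambda>t. Complex \<sigma> t) ` UNIV \<subseteq> {s. \<bar>Re s\<bar> = \<eta>}" using \<sigma> \<eta> by auto
    fix s \<nu> assume "s \<in> {s. \<bar>Re s\<bar> = \<eta>}" "\<nu> \<in> {1..d}"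
    thus "(1 - s) / 2 + \<beta> \<nu> \<notin> \<int>\<^sub>\<le>\<^sub>0" using poles[of \<nu> s] \<eta> by auto
  qed (intro continuous_intros)
  have one: "\<exists>C\<ge>0. \<forall>T y. T \<ge> 1 \<longrightarrow>
    norm (LINT t|lborel. exp (of_real y * Complex \<sigma> t) * (exp_mult \<tau>s (Complex \<sigma> t) * (gamma_quot d \<beta> (Complex \<sigma> t) * (mexp (Complex \<sigma> t / of_real T) ^ k / Complex \<sigma> t))))
      \<le> C * T powr ((real d - 1) / 2) * exp (\<sigma> * (y - real d * ln T))" if \<sigma>: "\<sigma> = \<eta> \<or> \<sigma> = - \<eta>" for \<sigma>
  proof -
    define \<alpha> where "\<alpha> = real d * (1/2 - \<sigma>)"
    have \<sigma>1: "\<bar>\<sigma>\<bar> \<le> 1" "\<sigma> \<noteq> 0" using \<sigma> \<eta> \<eta>1 by auto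
    have ds: "\<bar>real d * \<sigma>\<bar> \<le> 1/4" "\<bar>real d * \<sigma>\<bar> = real d * \<eta>" using \<sigma> d\<eta> \<eta> by (auto simp: abs_mult)
    have \<alpha>: "\<alpha> > 1/2" "\<alpha> + 1 \<le> real k"
      using ds d k unfolding \<alpha>_def by (auto simp: algebra_simps abs_le_iff abs_if split: if_splits)
    obtain C where C: "\<And>T y. T \<ge> 1 \<Longrightarrow>
     norm (LINT t|lborel. exp (of_real y * Complex \<sigma> t) * (gamma_quot d \<beta> (Complex \<sigma> t) * (mexp (Complex \<sigma> t / of_real T) ^ k / Complex \<sigma> t)))
       \<le> C * exp (\<sigma> * y) * T powr (\<alpha> - 1/2)"
      using gamma_quot_line_bound[OF _ \<sigma>1 \<alpha>_def \<alpha> cont[OF \<sigma>]] d by auto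
    define Q where "Q = (\<Prod>\<tau>\<leftarrow>\<tau>s. exp (\<sigma> * \<tau>) + 1)"
    have "0 \<le> (\<Prod>\<tau>\<leftarrow>us. exp (\<sigma> * \<tau>) + 1)" for us by (induction us) (auto intro!: mult_nonneg_nonneg add_nonneg_nonneg)
    hence Q: "Q \<ge> 0" by (simp add: Q_def)
    obtain M R where MR: "M \<ge> 1" "R \<ge> 2" "\<And>\<sigma> t. \<bar>\<sigma>\<bar> \<le> 1 \<Longrightarrow> \<bar>t\<bar> \<ge> R \<Longrightarrow> norm (gamma_quot d \<beta> (Complex \<sigma> t)) \<le> M * \<bar>t\<bar> powr (real d * (1/2 - \<sigma>))"
      using norm_gamma_quot_bounds[of 1 d \<beta>] by blast
    show ?thesis
    proof (rule exI[of _ "\<bar>C\<bar> * Q"], intro conjI allI impI)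
      show "0 \<le> \<bar>C\<bar> * Q" using Q by simp
      fix T y :: real assume T: "T \<ge> 1"
      define H where "H = (\<lambda>t. gamma_quot d \<beta> (Complex \<sigma> t) * (mexp (Complex \<sigma> t / of_real T) ^ k / Complex \<sigma> t))"
      have iH: "integrable lborel (\<lambda>t. exp (of_real L * Complex \<sigma> t) * H t)" for L
      proof (rule integrable_continuous_tail)
        show "continuous_on UNIV (\<lambda>t. exp (of_real L * Complex \<sigma> t) * H t)"
          unfolding H_def using Complex_ne_0[OF \<sigma>1(2)] T
          by (intro continuous_intros cont[OF \<sigma>] continuous_on_mexp_line) auto
        fix t assume t: "R \<le> \<bar>t\<bar>"
        have "norm (H t) \<le> M * (4 * T) ^ k / t\<^sup>2"
          unfolding H_def using MR(3)[OF \<sigma>1(1) t] \<alpha> \<sigma>1 T t MR by (intro kernel_tail_bound) (auto simp: \<alpha>_def)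
        from mult_left_mono[OF this, of "exp (L * \<sigma>)"]
        show "norm (exp (of_real L * Complex \<sigma> t) * H t) \<le> exp (L * \<sigma>) * (M * (4 * T) ^ k) / t\<^sup>2"
          by (simp add: norm_mult)
      qed
      \<comment> \<open>The estimate without twist is applied at the finitely many translates of
        \<open>y\<close>; this only costs the factor \<open>Q\<close>, which depends on the twist
        and on \<sigma>.\<close>
      have "norm (LINT t|lborel. exp (of_real y * Complex \<sigma> t) * (exp_mult \<tau>s (Complex \<sigma> t) * H t)) =
         norm (shift_sum \<tau>s (\<lambda>L. LINT t|lborel. exp (of_real L * Complex \<sigma> t) * H t) y)"
        by (subst shift_sum_line_integral(2)[OF iH]) (rule refl)
      also have "\<dots> \<le> shift_sum \<tau>s (\<lambda>L. norm (LINT t|lborel. exp (of_real L * Complex \<sigma> t) * H t)) y"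
        by (rule norm_shift_sum_le)
      also have "\<dots> \<le> shift_sum \<tau>s (\<lambda>L. (\<bar>C\<bar> * T powr (\<alpha> - 1/2)) * exp (\<sigma> * L)) y"
      proof (rule shift_sum_mono)
        fix L
        have "norm (LINT t|lborel. exp (of_real L * Complex \<sigma> t) * H t) \<le> C * exp (\<sigma> * L) * T powr (\<alpha> - 1/2)"
          unfolding H_def by (rule C[OF T])
        also have "\<dots> \<le> \<bar>C\<bar> * exp (\<sigma> * L) * T powr (\<alpha> - 1/2)" by (intro mult_right_mono) auto
        finally show "norm (LINT t|lborel. exp (of_real L * Complex \<sigma> t) * H t) \<le> (\<bar>C\<bar> * T powr (\<alpha> - 1/2)) * exp (\<sigma> * L)"
          by (simp only: mult_ac)
      qed
      also have "\<dots> = (\<bar>C\<bar> * Q) * (T powr (\<alpha> - 1/2) * exp (\<sigma> * y))"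
        unfolding shift_sum_scale shift_sum_exp Q_def by (simp only: mult_ac)
      also have "T powr (\<alpha> - 1/2) * exp (\<sigma> * y) = T powr ((real d - 1) / 2) * exp (\<sigma> * (y - real d * ln T))"
      proof -
        have "(\<alpha> - 1/2) * ln T + \<sigma> * y = (real d - 1) / 2 * ln T + \<sigma> * (y - real d * ln T)"
          by (simp add: \<alpha>_def field_simps)
        thus ?thesis using T by (simp add: powr_def exp_add[symmetric])
      qed
      finally show "norm (LINT t|lborel. exp (of_real y * Complex \<sigma> t) * (exp_mult \<tau>s (Complex \<sigma> t) * (gamma_quot d \<beta> (Complex \<sigma> t) * (mexp (Complex \<sigma> t / of_real T) ^ k / Complex \<sigma> t))))
        \<le> \<bar>C\<bar> * Q * T powr ((real d - 1) / 2) * exp (\<sigma> * (y - real d * ln T))"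
        unfolding H_def by (simp only: mult_ac)
    qed
  qed
  obtain C1 where C1: "C1 \<ge> 0" "\<And>T y. T \<ge> 1 \<Longrightarrow>
    norm (LINT t|lborel. exp (of_real y * Complex \<eta> t) * (exp_mult \<tau>s (Complex \<eta> t) * (gamma_quot d \<beta> (Complex \<eta> t) * (mexp (Complex \<eta> t / of_real T) ^ k / Complex \<eta> t))))
      \<le> C1 * T powr ((real d - 1) / 2) * exp (\<eta> * (y - real d * ln T))" using one[of \<eta>] by auto
  obtain C2 where C2: "C2 \<ge> 0" "\<And>T y. T \<ge> 1 \<Longrightarrow>
    norm (LINT t|lborel. exp (of_real y * Complex (-\<eta>) t) * (exp_mult \<tau>s (Complex (-\<eta>) t) * (gamma_quot d \<beta> (Complex (-\<eta>) t) * (mexp (Complex (-\<eta>) t / of_real T) ^ k / Complex (-\<eta>) t))))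
      \<le> C2 * T powr ((real d - 1) / 2) * exp (-\<eta> * (y - real d * ln T))" using one[of "-\<eta>"] by blast
  show ?thesis
  proof (rule exI[of _ "max C1 C2"], intro conjI allI impI)
    show "0 \<le> max C1 C2" using C1 by simp
    fix T y :: real assume T: "T \<ge> 1"
    define I where "I = norm (LINT t|lborel. exp (of_real y * Complex (-\<eta>) t) * (exp_mult \<tau>s (Complex (-\<eta>) t) * (gamma_quot d \<beta> (Complex (-\<eta>) t) * (mexp (Complex (-\<eta>) t / of_real T) ^ k / Complex (-\<eta>) t))))"
    have "(LINT t|lborel. exp (of_real y * Complex \<eta> t) * (exp_mult \<tau>s (Complex \<eta> t) * (gamma_quot d \<beta> (Complex \<eta> t) * (mexp (Complex \<eta> t / of_real T) ^ k / Complex \<eta> t)))) =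
       (LINT t|lborel. exp (of_real y * Complex (-\<eta>) t) * (exp_mult \<tau>s (Complex (-\<eta>) t) * (gamma_quot d \<beta> (Complex (-\<eta>) t) * (mexp (Complex (-\<eta>) t / of_real T) ^ k / Complex (-\<eta>) t))))"
      unfolding \<tau>s_def
      by (rule gamma_quot_line_shift(3)[where \<eta>' = \<eta>', OF _ \<eta>(1,2) \<eta>1 k poles zero T]) (use d in auto)
    hence b1: "I \<le> C1 * T powr ((real d - 1) / 2) * exp (\<eta> * (y - real d * ln T))"
      using C1(2)[OF T, of y] by (simp add: I_def)
    have b2: "I \<le> C2 * T powr ((real d - 1) / 2) * exp (-\<eta> * (y - real d * ln T))"
      unfolding I_def by (rule C2(2)[OF T])
    have "I \<le> max C1 C2 * T powr ((real d - 1) / 2) * exp (\<eta> * (y - real d * ln T))"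
      by (rule order_trans[OF b1]) (intro mult_right_mono, auto)
    moreover have "I \<le> max C1 C2 * T powr ((real d - 1) / 2) * exp (-\<eta> * (y - real d * ln T))"
      by (rule order_trans[OF b2]) (intro mult_right_mono, auto)
    ultimately show "norm (LINT t|lborel. exp (of_real y * Complex (-\<eta>) t) * (exp_mult (twist_list \<beta> d) (Complex (-\<eta>) t) * (gamma_quot d \<beta> (Complex (-\<eta>) t) * (mexp (Complex (-\<eta>) t / of_real T) ^ k / Complex (-\<eta>) t))))
      \<le> max C1 C2 * T powr ((real d - 1) / 2) * min (exp (\<eta> * (y - real d * ln T))) (exp (- \<eta> * (y - real d * ln T)))"
      unfolding I_def[symmetric, unfolded \<tau>s_def] by (simp add: min_def)
  qed
qed

section \<open>The functional equation\<close>

text \<open>A meromorphic function on the plane vanishes near every point or is nonzero near every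
  point. Its values at isolated points are arbitrary, so the conclusion concerns punctured
  neighbourhoods.\<close>

lemma meromorphic_zero_on_open:
  assumes "f meromorphic_on UNIV" "open U" "z0 \<in> U" "\<And>z. z \<in> U \<Longrightarrow> f z = 0"
  shows "eventually (\<lambda>z. f z = 0) (at x)"
proof -
  have "eventually (\<lambda>z. f z = 0) (cosparse UNIV) \<or> eventually (\<lambda>z. f z \<noteq> 0) (cosparse UNIV)"
    by (intro meromorphic_imp_constant_or_avoid assms) auto
  thus ?thesis
  proof
    assume "eventually (\<lambda>z. f z = 0) (cosparse UNIV)"
    thus ?thesis by (simp add: eventually_cosparse_open_eq)
  next
    assume "eventually (\<lambda>z. f z \<noteq> 0) (cosparse UNIV)"
    hence "eventually (\<lambda>z. f z \<noteq> 0) (at z0)" by (simp add: eventually_cosparse_open_eq)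
    moreover have "eventually (\<lambda>z. f z = 0) (at z0)"
      using eventually_at_in_open'[OF assms(2,3)] by eventually_elim (rule assms(4))
    ultimately have "eventually (\<lambda>z. False) (at z0)" by eventually_elim simp
    thus ?thesis by simp
  qed
qed

lemma gamma_factor_nonzero:
  assumes "\<And>\<nu>. \<nu> \<in> {1..d} \<Longrightarrow> s / 2 + \<beta> \<nu> \<notin> \<int>\<^sub>\<le>\<^sub>0"
  shows "gamma_factor d \<beta> s \<noteq> 0"
  using assms by (simp add: gamma_factor_def Gamma_eq_zero_iff)

lemma not_nonpos_Ints_Re_pos: "Re z > 0 \<Longrightarrow> z \<notin> \<int>\<^sub>\<le>\<^sub>0"
  by (auto elim!: nonpos_Ints_cases')

lemma gamma_factor_nonzero_right:
  assumes "Re s > 2 * (\<Sum>\<nu>=1..d. norm (\<beta> \<nu>))"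
  shows "gamma_factor d \<beta> s \<noteq> 0"
proof (rule gamma_factor_nonzero, rule not_nonpos_Ints_Re_pos)
  fix \<nu> assume "\<nu> \<in> {1..d}"
  hence "norm (\<beta> \<nu>) \<le> (\<Sum>\<nu>=1..d. norm (\<beta> \<nu>))" by (intro member_le_sum) auto
  moreover have "- Re (\<beta> \<nu>) \<le> norm (\<beta> \<nu>)" using abs_Re_le_cmod[of "\<beta> \<nu>"] by linarith
  ultimately show "Re (s / 2 + \<beta> \<nu>) > 0" using assms by simp
qed

lemma inverse_gamma_factor_holomorphic [holomorphic_intros]:
  assumes "f holomorphic_on A"
  shows "(\<lambda>s. inverse (gamma_factor d \<beta> (f s))) holomorphic_on A"
proof -
  have "inverse (gamma_factor d \<beta> z) = (\<Prod>\<nu>=1..d. rGamma (z / 2 + \<beta> \<nu>))" for z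
    unfolding gamma_factor_def rGamma_inverse_Gamma by (rule prod_inversef[symmetric, unfolded o_def])
  thus ?thesis using assms by (simp only:) (intro holomorphic_intros, auto)
qed

text \<open>Written with the entire functions \<open>1 / gamma_factor\<close>, both formulas for
  \<xi> extend by the identity theorem to a punctured neighbourhood of every point. Eliminating
  \<xi> gives the first claim there, and continuity gives it at the point. For the second claim,
  \<xi> is bounded at large height and the reciprocal Gamma factor grows at most
  exponentially.\<close>

theorem functional_equation_everywhere:
  assumes FE: "functional_equation d \<beta> \<phi> \<psi>"
    and \<phi>: "at_most_simple_pole_at_1 \<phi>" and \<psi>: "at_most_simple_pole_at_1 \<psi>"
  shows "\<And>s. s \<noteq> 0 \<Longrightarrow> s \<noteq> 1 \<Longrightarrow> \<phi> s * inverse (gamma_factor d \<beta> (1 - s)) = \<psi> (1 - s) * inverse (gamma_factor d \<beta> s)"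
    and "\<exists>M R. \<forall>\<sigma> t. \<bar>\<sigma>\<bar> \<le> K \<and> \<bar>t\<bar> \<ge> R \<longrightarrow> norm (\<phi> (Complex \<sigma> t)) \<le> exp (M * \<bar>t\<bar>)"
proof -
  obtain \<xi> c1 c2 where \<xi>: "\<xi> meromorphic_on UNIV"
    "\<And>u v. uniform_limit {u..v} (\<lambda>t \<sigma>. \<xi> (Complex \<sigma> t)) (\<lambda>_. 0) (at_infinity :: real filter)"
    "\<And>s. Re s > c1 \<Longrightarrow> \<xi> s = gamma_factor d \<beta> s * \<phi> s"
    "\<And>s. Re s < c2 \<Longrightarrow> \<xi> s = gamma_factor d \<beta> (1 - s) * \<psi> (1 - s)"
    using FE unfolding functional_equation_def by blast
  define R where "R = (\<lambda>s. inverse (gamma_factor d \<beta> s))"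
  have Rh: "R holomorphic_on A" for A unfolding R_def by (intro holomorphic_intros)
  have Rh': "(\<lambda>s. R (1 - s)) holomorphic_on A" for A unfolding R_def by (intro holomorphic_intros)
  have \<phi>m: "\<phi> meromorphic_on UNIV" "\<phi> holomorphic_on - {1}" using \<phi> by (auto simp: at_most_simple_pole_at_1_def)
  have \<psi>m: "\<psi> meromorphic_on UNIV" "\<psi> holomorphic_on - {1}" using \<psi> by (auto simp: at_most_simple_pole_at_1_def)
  have Rm: "R meromorphic_on UNIV" "(\<lambda>s. R (1 - s)) meromorphic_on UNIV"
    using Rh Rh' by (auto intro!: analytic_on_imp_meromorphic_on simp: analytic_on_open)
  have \<psi>m': "(\<lambda>s. \<psi> (1 - s)) meromorphic_on UNIV"
    by (rule meromorphic_on_compose[OF \<psi>m(1)]) (auto intro!: analytic_intros)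
  define B where "B = 2 * (\<Sum>\<nu>=1..d. norm (\<beta> \<nu>))"
  have ev1: "eventually (\<lambda>s. \<xi> s * R s - \<phi> s = 0) (at x)" for x
  proof (rule meromorphic_zero_on_open[where U = "{s. Re s > max c1 B}" and ?z0.0 = "of_real (max c1 B + 1)"])
    show "(\<lambda>s. \<xi> s * R s - \<phi> s) meromorphic_on UNIV" by (intro meromorphic_intros \<xi> Rm \<phi>m)
    fix z assume "z \<in> {s. Re s > max c1 B}"
    hence "\<xi> z = gamma_factor d \<beta> z * \<phi> z" "gamma_factor d \<beta> z \<noteq> 0"
      using \<xi>(3) gamma_factor_nonzero_right by (auto simp: B_def)
    thus "\<xi> z * R z - \<phi> z = 0" by (simp add: R_def)
  next
    show "complex_of_real (max c1 B + 1) \<in> {s. Re s > max c1 B}"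
      unfolding mem_Collect_eq Re_complex_of_real by linarith
  qed (rule open_halfspace_Re_gt)
  have ev2: "eventually (\<lambda>s. \<xi> s * R (1 - s) - \<psi> (1 - s) = 0) (at x)" for x
  proof (rule meromorphic_zero_on_open[where U = "{s. Re s < min c2 (1 - B)}" and ?z0.0 = "of_real (min c2 (1 - B) - 1)"])
    show "(\<lambda>s. \<xi> s * R (1 - s) - \<psi> (1 - s)) meromorphic_on UNIV" by (intro meromorphic_intros \<xi> Rm \<psi>m')
    fix z assume "z \<in> {s. Re s < min c2 (1 - B)}"
    hence "\<xi> z = gamma_factor d \<beta> (1 - z) * \<psi> (1 - z)" "gamma_factor d \<beta> (1 - z) \<noteq> 0"
      using \<xi>(4) gamma_factor_nonzero_right[where d = d and \<beta> = \<beta> and s = "1 - z"] by (auto simp: B_def)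
    thus "\<xi> z * R (1 - z) - \<psi> (1 - z) = 0" by (simp add: R_def)
  next
    show "complex_of_real (min c2 (1 - B) - 1) \<in> {s. Re s < min c2 (1 - B)}"
      unfolding mem_Collect_eq Re_complex_of_real by linarith
  qed (rule open_halfspace_Re_lt)
  show "\<phi> s * inverse (gamma_factor d \<beta> (1 - s)) = \<psi> (1 - s) * inverse (gamma_factor d \<beta> s)" if s: "s \<noteq> 0" "s \<noteq> 1" for s
  proof -
    define h where "h = (\<lambda>s. \<phi> s * R (1 - s) - \<psi> (1 - s) * R s)"
    have "h holomorphic_on - {0, 1}" unfolding h_def
    proof (intro holomorphic_intros Rh Rh')
      show "\<phi> holomorphic_on - {0, 1}" by (rule holomorphic_on_subset[OF \<phi>m(2)]) auto
      have "(\<psi> \<circ> (\<lambda>s. 1 - s)) holomorphic_on - {0, 1}"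
        by (rule holomorphic_on_compose_gen[OF _ \<psi>m(2)]) (auto intro!: holomorphic_intros)
      thus "(\<lambda>s. \<psi> (1 - s)) holomorphic_on - {0, 1}" by (simp add: o_def)
    qed
    hence "isCont h s" using s
      by (intro continuous_on_interior[OF holomorphic_on_imp_continuous_on]) (auto simp: interior_open open_Compl finite_imp_closed)
    hence "(h \<longlongrightarrow> h s) (at s)" by (simp add: isCont_def)
    moreover have "eventually (\<lambda>z. h z = 0) (at s)"
      using ev1[of s] ev2[of s]
    proof eventually_elim
      case (elim z)
      have "\<phi> z = \<xi> z * R z" "\<psi> (1 - z) = \<xi> z * R (1 - z)" using elim by auto
      thus ?case unfolding h_def by (simp only:) (simp add: mult_ac)
    qed
    hence "(h \<longlongrightarrow> 0) (at s)" by (rule tendsto_eventually)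
    ultimately have "h s = 0" using LIM_unique by blast
    thus ?thesis by (simp add: h_def R_def)
  qed
  show "\<exists>M R. \<forall>\<sigma> t. \<bar>\<sigma>\<bar> \<le> K \<and> \<bar>t\<bar> \<ge> R \<longrightarrow> norm (\<phi> (Complex \<sigma> t)) \<le> exp (M * \<bar>t\<bar>)"
  proof -
    obtain M R1 where MR: "\<And>\<sigma> t. \<bar>\<sigma>\<bar> \<le> K \<Longrightarrow> \<bar>t\<bar> \<ge> R1 \<Longrightarrow> norm (R (Complex \<sigma> t)) \<le> exp (M * \<bar>t\<bar>)"
      using inverse_gamma_factor_growth[of K d \<beta>] unfolding R_def by blast
    \<comment> \<open>The strip is wider by 1 because the relation between \<open>\<phi>\<close> and
      \<xi> is known only in a punctured disc about the point; the bound reaches its centre by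
      continuity.\<close>
    have "eventually (\<lambda>t. \<forall>\<sigma>\<in>{-K-1..K+1}. dist (\<xi> (Complex \<sigma> t)) 0 < 1) at_infinity"
      by (rule uniform_limitD[OF \<xi>(2)]) simp
    then obtain b where b: "\<And>t \<sigma>. \<bar>t\<bar> \<ge> b \<Longrightarrow> \<bar>\<sigma>\<bar> \<le> K + 1 \<Longrightarrow> norm (\<xi> (Complex \<sigma> t)) < 1"
      unfolding eventually_at_infinity by (force simp: abs_le_iff)
    show ?thesis
    proof (rule exI[of _ M], rule exI[of _ "max R1 (\<bar>b\<bar> + 2)"], intro allI impI)
      fix \<sigma> t assume H: "\<bar>\<sigma>\<bar> \<le> K \<and> max R1 (\<bar>b\<bar> + 2) \<le> \<bar>t\<bar>"
      define s where "s = Complex \<sigma> t"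
      have s1: "s \<noteq> 1" using H by (auto simp: s_def complex_eq_iff)
      have "eventually (\<lambda>w. w \<in> ball s 1) (at s)" by (rule eventually_at_in_open') auto
      with ev1[of s] have "eventually (\<lambda>w. norm (\<phi> w) \<le> norm (R w)) (at s)"
      proof eventually_elim
        case (elim w)
        have "norm (w - s) < 1" using elim(2) by (simp add: dist_norm norm_minus_commute)
        hence re: "\<bar>Re w - \<sigma>\<bar> < 1" and im: "\<bar>Im w - t\<bar> < 1"
          using abs_Re_le_cmod[of "w - s"] abs_Im_le_cmod[of "w - s"] by (auto simp: s_def)
        have "norm (\<xi> (Complex (Re w) (Im w))) < 1" using H re im by (intro b) linarith+
        hence "norm (\<xi> w) * norm (R w) \<le> 1 * norm (R w)" by (intro mult_right_mono) auto
        moreover have "\<phi> w = \<xi> w * R w" using elim(1) by simp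
        ultimately show ?case by (simp add: norm_mult)
      qed
      moreover have "isCont \<phi> s"
        by (rule continuous_on_interior[OF holomorphic_on_imp_continuous_on[OF \<phi>m(2)]]) (use s1 in \<open>simp add: interior_open open_Compl\<close>)
      moreover have "isCont R s"
        by (rule continuous_on_interior[OF holomorphic_on_imp_continuous_on[OF Rh[of UNIV]]]) simp
      ultimately have "norm (\<phi> s) \<le> norm (R s)"
        by (intro tendsto_le[OF _ tendsto_norm tendsto_norm, of "at s"]) (auto simp: isCont_def)
      also have "\<dots> \<le> exp (M * \<bar>t\<bar>)" unfolding s_def using H by (intro MR) auto
      finally show "norm (\<phi> (Complex \<sigma> t)) \<le> exp (M * \<bar>t\<bar>)" by (simp add: s_def)
    qed
  qed
qed

lemma gamma_quot_functional_equation: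
  assumes "functional_equation d \<beta> \<phi> \<psi>" "at_most_simple_pole_at_1 \<phi>" "at_most_simple_pole_at_1 \<psi>"
    and "s \<noteq> 0" "s \<noteq> 1" and "gamma_factor d \<beta> (1 - s) \<noteq> 0"
  shows "\<phi> s = gamma_quot d \<beta> s * \<psi> (1 - s)"
proof -
  have "\<phi> s = \<phi> s * inverse (gamma_factor d \<beta> (1 - s)) * gamma_factor d \<beta> (1 - s)"
    using assms(6) by simp
  also have "\<dots> = gamma_quot d \<beta> s * \<psi> (1 - s)"
    unfolding functional_equation_everywhere(1)[OF assms(1-5)] gamma_quot_def divide_inverse by (simp only: mult_ac)
  finally show ?thesis .
qed

text \<open>For a simple pole the limit is read off from \<open>zor_poly\<close>. Without a pole
  \<open>\<phi>\<close> has a finite limit at 1, and both sides are 0.\<close>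

lemma residue_limit_at_1:
  assumes "at_most_simple_pole_at_1 \<phi>"
  shows "((\<lambda>s. \<phi> s * (s - 1)) \<longlongrightarrow> residue \<phi> 1) (at 1)"
proof -
  have m: "\<phi> meromorphic_on {1}" and h: "\<phi> holomorphic_on UNIV - {1}" and z: "is_pole \<phi> 1 \<Longrightarrow> zorder \<phi> 1 = -1"
    using assms by (auto simp: at_most_simple_pole_at_1_def Compl_eq_Diff_UNIV intro: meromorphic_on_subset)
  have "\<exists>c. ((\<lambda>s. \<phi> s * (s - 1)) \<longlongrightarrow> c) (at 1)"
  proof (cases "is_pole \<phi> 1")
    case True
    have iso: "isolated_singularity_at \<phi> 1" using m by (rule meromorphic_on_isolated_singularity)
    obtain r where r: "r > 0" "zor_poly \<phi> 1 holomorphic_on cball 1 r"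
      using zorder_exist_pole[OF h open_UNIV UNIV_I True] by blast
    have "continuous_on (ball 1 r) (zor_poly \<phi> 1)"
      by (rule holomorphic_on_imp_continuous_on[OF holomorphic_on_subset[OF r(2)]]) auto
    hence "isCont (zor_poly \<phi> 1) 1" using r(1) by (simp add: continuous_on_eq_continuous_at)
    hence "(zor_poly \<phi> 1 \<longlongrightarrow> zor_poly \<phi> 1 1) (at 1)" by (simp add: isCont_def)
    moreover have "eventually (\<lambda>w. zor_poly \<phi> 1 w = \<phi> w * (w - 1)) (at 1)"
      using zor_poly_pole_eq[OF iso True] z[OF True] by simp
    ultimately have "((\<lambda>w. \<phi> w * (w - 1)) \<longlongrightarrow> zor_poly \<phi> 1 1) (at 1)" by (rule Lim_transform_eventually)
    thus ?thesis by blast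
  next
    case False
    have "not_essential \<phi> 1" using m by (rule meromorphic_on_not_essential)
    then obtain L where "(\<phi> \<longlongrightarrow> L) (at 1)" using False by (auto simp: not_essential_def)
    hence "((\<lambda>s. \<phi> s * (s - 1)) \<longlongrightarrow> L * (1 - 1)) (at 1)" by (intro tendsto_intros)
    thus ?thesis by blast
  qed
  then obtain c where c: "((\<lambda>s. \<phi> s * (s - 1)) \<longlongrightarrow> c) (at 1)" ..
  have "residue \<phi> 1 = c" by (rule residue_simple'[OF open_UNIV UNIV_I h c])
  thus ?thesis using c by simp
qed

lemma norm_mexp_crude_le:
  assumes "w > 0" "s \<noteq> 0"
  shows "norm (mexp (of_real w * s)) \<le> (exp (w * \<bar>Re s\<bar>) + 1) / (w * norm s)"
proof -
  have "norm (exp (of_real w * s) - 1) \<le> norm (exp (of_real w * s)) + norm (1 :: complex)" by (rule norm_triangle_ineq4)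
  also have "\<dots> \<le> exp (w * \<bar>Re s\<bar>) + 1" using assms by simp
  finally show ?thesis using assms by (simp add: mexp_def norm_divide norm_mult divide_right_mono)
qed

lemma prod_list_exp_add_1_nonneg: "0 \<le> (\<Prod>\<tau>\<leftarrow>\<tau>s. exp (f \<tau>) + 1 :: real)"
  by (induction \<tau>s) (auto intro!: mult_nonneg_nonneg add_nonneg_nonneg)

lemma prod_list_exp_add_1_mono:
  assumes "\<And>\<tau>. f \<tau> \<le> g \<tau>"
  shows "(\<Prod>\<tau>\<leftarrow>\<tau>s. exp (f \<tau>) + 1 :: real) \<le> (\<Prod>\<tau>\<leftarrow>\<tau>s. exp (g \<tau>) + 1)"
proof (induction \<tau>s)
  case (Cons a \<tau>s)
  have "(exp (f a) + 1) * (\<Prod>\<tau>\<leftarrow>\<tau>s. exp (f \<tau>) + 1) \<le> (exp (g a) + 1) * (\<Prod>\<tau>\<leftarrow>\<tau>s. exp (g \<tau>) + 1)"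
    using Cons assms[of a] prod_list_exp_add_1_nonneg by (intro mult_mono add_right_mono) (auto intro: add_nonneg_nonneg)
  thus ?case by simp
qed auto

text \<open>Uniform on a strip, with a constant that may depend on everything else: it serves
  convergence and the horizontal segments, not the final estimate.\<close>

lemma smooth_kernel_decay:
  assumes w: "w > 0"
  shows "\<exists>W\<ge>0. \<forall>\<sigma> t. \<bar>\<sigma>\<bar> \<le> S \<longrightarrow> t \<noteq> 0 \<longrightarrow> norm (exp (of_real y * Complex \<sigma> t) * smooth_kernel \<tau>s w k (Complex \<sigma> t)) \<le> W / \<bar>t\<bar> ^ Suc k"
proof -
  define Q where "Q = (\<Prod>\<tau>\<leftarrow>\<tau>s. exp (S * \<bar>\<tau>\<bar>) + 1)"
  have Q: "Q \<ge> 0" unfolding Q_def by (rule prod_list_exp_add_1_nonneg)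
  define W where "W = exp (\<bar>y\<bar> * S) * (Q * ((exp (w * S) + 1) / w) ^ k)"
  show ?thesis
  proof (rule exI[of _ W], intro conjI allI impI)
    show "W \<ge> 0" unfolding W_def using Q w by (intro mult_nonneg_nonneg zero_le_power divide_nonneg_pos add_nonneg_nonneg) auto
    fix \<sigma> t :: real assume \<sigma>: "\<bar>\<sigma>\<bar> \<le> S" and t: "t \<noteq> 0"
    define s where "s = Complex \<sigma> t"
    have s: "s \<noteq> 0" "norm s \<ge> \<bar>t\<bar>" "Re s = \<sigma>" using t abs_Im_le_cmod[of s] by (auto simp: s_def complex_eq_iff)
    have b: "a * \<sigma> \<le> \<bar>a\<bar> * S" for a
    proof -
      have "a * \<sigma> \<le> \<bar>a\<bar> * \<bar>\<sigma>\<bar>" by (metis abs_ge_self abs_mult)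
      also have "\<dots> \<le> \<bar>a\<bar> * S" using \<sigma> by (intro mult_left_mono) auto
      finally show ?thesis .
    qed
    have 1: "norm (exp (of_real y * s)) \<le> exp (\<bar>y\<bar> * S)" using b[of y] s by simp
    have "norm (exp_mult \<tau>s s) \<le> (\<Prod>\<tau>\<leftarrow>\<tau>s. exp (Re s * \<tau>) + 1)" by (rule norm_exp_mult_le)
    also have "\<dots> \<le> Q" unfolding Q_def using b s by (intro prod_list_exp_add_1_mono) (simp add: mult.commute)
    finally have 2: "norm (exp_mult \<tau>s s) \<le> Q" .
    have "norm (mexp (of_real w * s)) \<le> (exp (w * \<bar>Re s\<bar>) + 1) / (w * norm s)" by (rule norm_mexp_crude_le[OF w s(1)])
    also have "\<dots> \<le> (exp (w * S) + 1) / (w * \<bar>t\<bar>)"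
      using \<sigma> s w t by (intro frac_le add_mono mult_mono) (auto intro: add_nonneg_nonneg)
    finally have "norm (mexp (of_real w * s)) \<le> (exp (w * S) + 1) / w / \<bar>t\<bar>" by simp
    hence "norm (mexp (of_real w * s) ^ k / s) \<le> ((exp (w * S) + 1) / w / \<bar>t\<bar>) ^ k / \<bar>t\<bar>"
      unfolding norm_divide norm_power using s t w
      by (intro frac_le power_mono zero_le_power divide_nonneg_nonneg add_nonneg_nonneg) auto
    hence 3: "norm (mexp (of_real w * s) ^ k / s) \<le> ((exp (w * S) + 1) / w) ^ k / \<bar>t\<bar> ^ Suc k"
      by (simp add: power_divide power_mult_distrib mult_ac)
    have "norm (exp (of_real y * s) * smooth_kernel \<tau>s w k s) \<le> exp (\<bar>y\<bar> * S) * (Q * (((exp (w * S) + 1) / w) ^ k / \<bar>t\<bar> ^ Suc k))"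
      unfolding smooth_kernel_def norm_mult by (intro mult_mono mult_nonneg_nonneg 1 2 3 Q) auto
    thus "norm (exp (of_real y * Complex \<sigma> t) * smooth_kernel \<tau>s w k (Complex \<sigma> t)) \<le> W / \<bar>t\<bar> ^ Suc k"
      by (simp add: W_def s_def)
  qed
qed

lemma smooth_kernel_holomorphic [holomorphic_intros]:
  assumes "w > 0" "0 \<notin> A"
  shows "smooth_kernel \<tau>s w k holomorphic_on A"
  unfolding smooth_kernel_def using assms by (intro holomorphic_intros) auto

lemma gaussian_decay:
  assumes \<epsilon>: "(\<epsilon>::real) > 0"
  shows "((\<lambda>t. D * exp (M * t) * exp (\<epsilon> * (B - t\<^sup>2))) \<longlongrightarrow> 0) at_top"
proof (rule Lim_null_comparison)
  show "eventually (\<lambda>t. norm (D * exp (M * t) * exp (\<epsilon> * (B - t\<^sup>2))) \<le> \<bar>D\<bar> * exp (\<epsilon> * B) * exp (- t)) at_top"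
    using eventually_ge_at_top[of "max 0 ((M + 1) / \<epsilon>)"]
  proof eventually_elim
    case (elim t)
    hence "M + 1 \<le> \<epsilon> * t" using \<epsilon> by (simp add: field_simps)
    hence "(M + 1) * t \<le> \<epsilon> * t * t" using elim by (intro mult_right_mono) auto
    hence "M * t + \<epsilon> * (B - t\<^sup>2) \<le> \<epsilon> * B + - t" by (simp add: algebra_simps power2_eq_square)
    hence "exp (M * t) * exp (\<epsilon> * (B - t\<^sup>2)) \<le> exp (\<epsilon> * B) * exp (- t)" unfolding exp_add[symmetric] by simp
    hence "\<bar>D\<bar> * (exp (M * t) * exp (\<epsilon> * (B - t\<^sup>2))) \<le> \<bar>D\<bar> * (exp (\<epsilon> * B) * exp (- t))" by (intro mult_left_mono) auto
    thus ?case by (simp add: abs_mult mult.assoc)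
  qed
  have "((\<lambda>t::real. exp (- t)) \<longlongrightarrow> 0) at_top"
    by (rule filterlim_compose[OF exp_at_bot filterlim_uminus_at_bot_at_top])
  hence "((\<lambda>t. \<bar>D\<bar> * exp (\<epsilon> * B) * exp (- t)) \<longlongrightarrow> \<bar>D\<bar> * exp (\<epsilon> * B) * 0) at_top" by (intro tendsto_intros)
  thus "((\<lambda>t. \<bar>D\<bar> * exp (\<epsilon> * B) * exp (- t)) \<longlongrightarrow> 0) at_top" by simp
qed

text \<open>The growth of \<open>\<phi>\<close> inside the strip is only known to be at most exponential; a Gaussian factor
  \<open>exp (\<epsilon> s\<^sup>2)\<close> makes the horizontal segments negligible, and \<open>\<epsilon>\<close> then tends to 0 on the two lines, where the
  integrals converge absolutely.\<close>

theorem dirichlet_contour_shift: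
  fixes \<phi> :: "complex \<Rightarrow> complex" and y :: real and \<tau>s :: "real list"
  assumes hol: "\<phi> holomorphic_on - {1}" and lim: "((\<lambda>s. \<phi> s * (s - 1)) \<longlongrightarrow> c) (at 1)"
    and growth: "\<And>\<sigma> t. \<bar>\<sigma>\<bar> \<le> A + 2 \<Longrightarrow> \<bar>t\<bar> \<ge> R \<Longrightarrow> norm (\<phi> (Complex \<sigma> t)) \<le> exp (M * \<bar>t\<bar>)"
    and right: "\<And>t. norm (\<phi> (Complex 2 t)) \<le> B"
    and left: "\<And>t. \<bar>t\<bar> \<ge> R1 \<Longrightarrow> norm (\<phi> (Complex (-A) t)) \<le> M1 * \<bar>t\<bar> powr \<alpha>"
    and k: "\<alpha> + 1 \<le> real k" "k \<ge> 1" and w: "w > 0" and A: "A > 0"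
  defines "F \<equiv> (\<lambda>s. exp (of_real y * s) * smooth_kernel \<tau>s w k s)"
  shows "integrable lborel (\<lambda>t. F (Complex 2 t))" "integrable lborel (\<lambda>t. F (Complex (-A) t))"
    "integrable lborel (\<lambda>t. \<phi> (Complex (-A) t) * F (Complex (-A) t))"
    "(LINT t|lborel. \<phi> (Complex 2 t) * F (Complex 2 t)) = (LINT t|lborel. \<phi> (Complex (-A) t) * F (Complex (-A) t))
        + 2 * pi * (\<phi> 0 * exp_mult \<tau>s 0 + c * F 1)"
proof -
  define S where "S = A + 2"
  obtain W where W: "W \<ge> 0" "\<And>\<sigma> t. \<bar>\<sigma>\<bar> \<le> S \<Longrightarrow> t \<noteq> 0 \<Longrightarrow> norm (F (Complex \<sigma> t)) \<le> W / \<bar>t\<bar> ^ Suc k"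
    using smooth_kernel_decay[OF w, of S y \<tau>s k] unfolding F_def by blast
  have Fh: "F holomorphic_on X" if "0 \<notin> X" for X unfolding F_def using w that by (intro holomorphic_intros)
  have lc: "continuous_on UNIV (\<lambda>t. h (Complex \<sigma> t))" if "h holomorphic_on - {0, 1}" "\<sigma> = 2 \<or> \<sigma> = - A" for h \<sigma>
    by (rule continuous_on_compose2[OF holomorphic_on_imp_continuous_on[OF that(1)]])
       (use that(2) A in \<open>auto intro!: continuous_intros simp: complex_eq_iff\<close>)
  have \<phi>h: "\<phi> holomorphic_on - {0, 1}" by (rule holomorphic_on_subset[OF hol]) auto
  have Fh': "F holomorphic_on - {0, 1}" by (rule Fh) auto
  have pk: "W / \<bar>t\<bar> ^ Suc k \<le> W / t\<^sup>2" if "\<bar>t\<bar> \<ge> 1" for t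
    using W(1) that k(2) power_increasing[of 2 "Suc k" "\<bar>t\<bar>"] by (intro divide_left_mono mult_pos_pos) auto
  have Fb: "norm (F (Complex \<sigma> t)) \<le> W / t\<^sup>2" if "\<bar>\<sigma>\<bar> \<le> S" "1 \<le> \<bar>t\<bar>" for \<sigma> t
    by (rule order_trans[OF W(2)[OF that(1)] pk[OF that(2)]]) (use that in auto)
  show iF2: "integrable lborel (\<lambda>t. F (Complex 2 t))"
    by (rule integrable_continuous_tail[OF lc[OF Fh'], of _ 1 W])
       (use A in \<open>auto simp: S_def intro!: Fb\<close>)
  show iFA: "integrable lborel (\<lambda>t. F (Complex (-A) t))"
    by (rule integrable_continuous_tail[OF lc[OF Fh'], of _ 1 W])
       (use A in \<open>auto simp: S_def intro!: Fb\<close>)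
  have \<phi>Fh: "(\<lambda>s. \<phi> s * F s) holomorphic_on - {0, 1}" by (intro holomorphic_intros \<phi>h Fh')
  have B0: "B \<ge> 0" using right[of 0] norm_ge_zero[of "\<phi> (Complex 2 0)"] by linarith
  have i2: "integrable lborel (\<lambda>t. \<phi> (Complex 2 t) * F (Complex 2 t))"
  proof (rule integrable_continuous_tail[OF lc[OF \<phi>Fh], of _ 1 "B * W"])
    fix t :: real assume t: "1 \<le> \<bar>t\<bar>"
    have "norm (F (Complex 2 t)) \<le> W / t\<^sup>2" by (rule Fb[OF _ t]) (use A in \<open>simp add: S_def\<close>)
    hence "norm (\<phi> (Complex 2 t)) * norm (F (Complex 2 t)) \<le> B * (W / t\<^sup>2)" using right B0 by (intro mult_mono) auto
    thus "norm (\<phi> (Complex 2 t) * F (Complex 2 t)) \<le> B * W / t\<^sup>2" by (simp add: norm_mult)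
  qed auto
  show iA: "integrable lborel (\<lambda>t. \<phi> (Complex (-A) t) * F (Complex (-A) t))"
  proof (rule integrable_continuous_tail[OF lc[OF \<phi>Fh], of _ "max 1 R1" "\<bar>M1\<bar> * W"])
    fix t :: real assume t: "max 1 R1 \<le> \<bar>t\<bar>"
    have "norm (\<phi> (Complex (-A) t)) \<le> M1 * \<bar>t\<bar> powr \<alpha>" using t by (intro left) auto
    also have "\<dots> \<le> \<bar>M1\<bar> * \<bar>t\<bar> powr \<alpha>" by (intro mult_right_mono) auto
    finally have 1: "norm (\<phi> (Complex (-A) t)) \<le> \<bar>M1\<bar> * \<bar>t\<bar> powr \<alpha>" .
    have 2: "norm (F (Complex (-A) t)) \<le> W / \<bar>t\<bar> ^ Suc k" using t A by (intro W(2)) (auto simp: S_def)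
    have "norm (\<phi> (Complex (-A) t)) * norm (F (Complex (-A) t)) \<le> (\<bar>M1\<bar> * \<bar>t\<bar> powr \<alpha>) * (W / \<bar>t\<bar> ^ Suc k)"
      by (intro mult_mono 1 2) auto
    also have "\<dots> = \<bar>M1\<bar> * W * (\<bar>t\<bar> powr \<alpha> / \<bar>t\<bar> ^ Suc k)" by simp
    also have "\<bar>t\<bar> powr \<alpha> / \<bar>t\<bar> ^ Suc k = \<bar>t\<bar> powr (\<alpha> - real (Suc k))"
    proof -
      have "t \<noteq> 0" using t by auto
      thus ?thesis using powr_realpow[of "\<bar>t\<bar>" "Suc k"] by (simp add: powr_diff del: of_nat_Suc power_Suc)
    qed
    also have "\<bar>M1\<bar> * W * \<bar>t\<bar> powr (\<alpha> - real (Suc k)) \<le> \<bar>M1\<bar> * W * \<bar>t\<bar> powr (- 2)"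
      using k t W(1) by (intro mult_left_mono powr_mono) auto
    also have "\<bar>t\<bar> powr (- 2) = 1 / t\<^sup>2" using t by (simp add: powr_minus powr_numeral inverse_eq_divide)
    finally show "norm (\<phi> (Complex (-A) t) * F (Complex (-A) t)) \<le> \<bar>M1\<bar> * W / t\<^sup>2" by (simp add: norm_mult)
  qed auto
  define G where "G = (\<lambda>\<epsilon> s. exp (of_real \<epsilon> * s\<^sup>2) :: complex)"
  have nG: "norm (G \<epsilon> (Complex \<sigma> t)) = exp (\<epsilon> * (\<sigma>\<^sup>2 - t\<^sup>2))" for \<epsilon> \<sigma> t by (simp add: G_def power2_eq_square)
  have Gb: "norm (G \<epsilon> (Complex \<sigma> t)) \<le> exp (S\<^sup>2)" if "0 \<le> \<epsilon>" "\<epsilon> \<le> 1" "\<bar>\<sigma>\<bar> \<le> S" for \<epsilon> \<sigma> t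
  proof -
    have "\<bar>\<sigma>\<bar>\<^sup>2 \<le> S\<^sup>2" using that by (intro power_mono) auto
    hence "\<sigma>\<^sup>2 - t\<^sup>2 \<le> S\<^sup>2" using zero_le_power2[of t] unfolding power2_abs by linarith
    hence "\<epsilon> * (\<sigma>\<^sup>2 - t\<^sup>2) \<le> \<epsilon> * S\<^sup>2" using that by (intro mult_left_mono) auto
    also have "\<dots> \<le> 1 * S\<^sup>2" using that by (intro mult_right_mono) auto
    finally show ?thesis by (simp add: nG)
  qed
  have intG: "integrable lborel (\<lambda>t. G \<epsilon> (Complex \<sigma> t) * (\<phi> (Complex \<sigma> t) * F (Complex \<sigma> t)))"
    and boundG: "norm (G \<epsilon> (Complex \<sigma> t) * (\<phi> (Complex \<sigma> t) * F (Complex \<sigma> t))) \<le> exp (S\<^sup>2) * norm (\<phi> (Complex \<sigma> t) * F (Complex \<sigma> t))"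
    if "0 \<le> \<epsilon>" "\<epsilon> \<le> 1" "\<sigma> = 2 \<or> \<sigma> = - A" for \<epsilon> \<sigma> t
  proof -
    have \<sigma>: "\<bar>\<sigma>\<bar> \<le> S" using that(3) A by (auto simp: S_def)
    have bd: "norm (G \<epsilon> (Complex \<sigma> t) * (\<phi> (Complex \<sigma> t) * F (Complex \<sigma> t))) \<le> exp (S\<^sup>2) * norm (\<phi> (Complex \<sigma> t) * F (Complex \<sigma> t))" for t
      unfolding norm_mult[of "G _ _"] using Gb[OF that(1,2) \<sigma>] by (intro mult_right_mono) auto
    thus "norm (G \<epsilon> (Complex \<sigma> t) * (\<phi> (Complex \<sigma> t) * F (Complex \<sigma> t))) \<le> exp (S\<^sup>2) * norm (\<phi> (Complex \<sigma> t) * F (Complex \<sigma> t))" .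
    have "integrable lborel (\<lambda>t. \<phi> (Complex \<sigma> t) * F (Complex \<sigma> t))" using that(3) i2 iA by auto
    hence "integrable lborel (\<lambda>t. exp (S\<^sup>2) * norm (\<phi> (Complex \<sigma> t) * F (Complex \<sigma> t)))"
      by (intro integrable_mult_right integrable_norm)
    thus "integrable lborel (\<lambda>t. G \<epsilon> (Complex \<sigma> t) * (\<phi> (Complex \<sigma> t) * F (Complex \<sigma> t)))"
    proof (rule Bochner_Integration.integrable_bound)
      have "(\<lambda>s. G \<epsilon> s * (\<phi> s * F s)) holomorphic_on - {0, 1}" unfolding G_def by (intro holomorphic_intros \<phi>Fh)
      from borel_measurable_continuous_onI[OF lc[OF this that(3)]]
      show "(\<lambda>t. G \<epsilon> (Complex \<sigma> t) * (\<phi> (Complex \<sigma> t) * F (Complex \<sigma> t))) \<in> borel_measurable lborel"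
        by simp
      show "AE t in lborel. norm (G \<epsilon> (Complex \<sigma> t) * (\<phi> (Complex \<sigma> t) * F (Complex \<sigma> t))) \<le> norm (exp (S\<^sup>2) * norm (\<phi> (Complex \<sigma> t) * F (Complex \<sigma> t)))"
      proof (rule AE_I2)
        fix t show "norm (G \<epsilon> (Complex \<sigma> t) * (\<phi> (Complex \<sigma> t) * F (Complex \<sigma> t))) \<le> norm (exp (S\<^sup>2) * norm (\<phi> (Complex \<sigma> t) * F (Complex \<sigma> t)))"
          using bd[of t] by simp
      qed
    qed
  qed
  have shift: "(LINT t|lborel. G \<epsilon> (Complex 2 t) * (\<phi> (Complex 2 t) * F (Complex 2 t))) =
      (LINT t|lborel. G \<epsilon> (Complex (-A) t) * (\<phi> (Complex (-A) t) * F (Complex (-A) t)))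
        + 2 * pi * (\<phi> 0 * exp_mult \<tau>s 0 + exp (of_real \<epsilon>) * (c * F 1))" if \<epsilon>: "0 < \<epsilon>" "\<epsilon> \<le> 1" for \<epsilon>
  proof -
    define f where "f = (\<lambda>s. G \<epsilon> s * (\<phi> s * F s))"
    have fh: "f holomorphic_on - {0, 1}" unfolding f_def G_def by (intro holomorphic_intros \<phi>Fh)
    have "(LINT t|lborel. f (Complex 2 t)) = (LINT t|lborel. f (Complex (-A) t)) + 2 * pi * (\<Sum>p\<in>{0,1}. residue f p)"
    proof (rule vertical_line_shift[where a' = "-A-1" and b' = 3 and Rb = "max 1 R" and g = "\<lambda>t. W * exp (M * t) * exp (\<epsilon> * (S\<^sup>2 - t\<^sup>2))"])
      show "f holomorphic_on {s. - A - 1 < Re s \<and> Re s < 3} - {0, 1}" by (rule holomorphic_on_subset[OF fh]) auto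
      show "((\<lambda>t. W * exp (M * t) * exp (\<epsilon> * (S\<^sup>2 - t\<^sup>2))) \<longlongrightarrow> 0) at_top" by (rule gaussian_decay[OF \<epsilon>(1)])
      fix \<sigma> t :: real assume H: "- A \<le> \<sigma>" "\<sigma> \<le> 2" "max 1 R \<le> \<bar>t\<bar>"
      have \<sigma>: "\<bar>\<sigma>\<bar> \<le> S" using H A by (auto simp: S_def)
      have "\<bar>\<sigma>\<bar>\<^sup>2 \<le> S\<^sup>2" using \<sigma> by (intro power_mono) auto
      hence g1: "norm (G \<epsilon> (Complex \<sigma> t)) \<le> exp (\<epsilon> * (S\<^sup>2 - t\<^sup>2))" using \<epsilon> by (simp add: nG)
      have g2: "norm (\<phi> (Complex \<sigma> t)) \<le> exp (M * \<bar>t\<bar>)" using \<sigma> H by (intro growth) (auto simp: S_def)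
      have t0: "t \<noteq> 0" using H by auto
      have "norm (F (Complex \<sigma> t)) \<le> W / \<bar>t\<bar> ^ Suc k" by (rule W(2)[OF \<sigma> t0])
      also have "\<dots> \<le> W / 1" using W(1) H by (intro divide_left_mono one_le_power) auto
      finally have g3: "norm (F (Complex \<sigma> t)) \<le> W" by simp
      have "norm (f (Complex \<sigma> t)) \<le> exp (\<epsilon> * (S\<^sup>2 - t\<^sup>2)) * (exp (M * \<bar>t\<bar>) * W)"
        unfolding f_def norm_mult by (intro mult_mono g1 g2 g3) auto
      thus "norm (f (Complex \<sigma> t)) \<le> W * exp (M * \<bar>t\<bar>) * exp (\<epsilon> * (S\<^sup>2 - \<bar>t\<bar>\<^sup>2))" by (simp add: mult_ac)
    qed (use A intG[of \<epsilon>] \<epsilon> in \<open>auto simp: f_def\<close>)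
    also have "(\<Sum>p\<in>{0,1}. residue f p) = residue f 0 + residue f 1" by simp
    \<comment> \<open>At 0 the Gaussian, the exponential and \<open>mexp\<close> all tend to 1,
      which leaves \<open>\<phi> 0\<close> and the twist.\<close>
    also have "residue f 0 = \<phi> 0 * exp_mult \<tau>s 0"
    proof (rule residue_simple'[of "- {1}"])
      show "f holomorphic_on - {1} - {0}" by (rule holomorphic_on_subset[OF fh]) auto
      have "isCont \<phi> 0"
        by (rule continuous_on_interior[OF holomorphic_on_imp_continuous_on[OF hol]]) (simp add: interior_open open_Compl)
      hence "(\<phi> \<longlongrightarrow> \<phi> 0) (at 0)" by (simp add: isCont_def)
      moreover have "(exp_mult \<tau>s \<longlongrightarrow> exp_mult \<tau>s 0) (at 0)" using isCont_exp_mult[where s = 0 and \<tau>s = \<tau>s] by (simp add: isCont_def)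
      ultimately have "((\<lambda>s. exp (of_real \<epsilon> * s\<^sup>2) * (\<phi> s * (exp (of_real y * s) * (exp_mult \<tau>s s * mexp (of_real w * s) ^ k)))) \<longlongrightarrow>
         exp (of_real \<epsilon> * 0\<^sup>2) * (\<phi> 0 * (exp (of_real y * 0) * (exp_mult \<tau>s 0 * 1 ^ k)))) (at 0)"
        using w by (intro tendsto_intros mexp_tendsto_1) auto
      hence L: "((\<lambda>s. exp (of_real \<epsilon> * s\<^sup>2) * (\<phi> s * (exp (of_real y * s) * (exp_mult \<tau>s s * mexp (of_real w * s) ^ k)))) \<longlongrightarrow>
         \<phi> 0 * exp_mult \<tau>s 0) (at 0)" by simp
      have "eventually (\<lambda>s. exp (of_real \<epsilon> * s\<^sup>2) * (\<phi> s * (exp (of_real y * s) * (exp_mult \<tau>s s * mexp (of_real w * s) ^ k))) = f s * (s - 0)) (at 0)"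
        using eventually_neq_at_within[of 0] by eventually_elim (simp add: f_def G_def F_def smooth_kernel_def)
      thus "((\<lambda>w. f w * (w - 0)) \<longlongrightarrow> \<phi> 0 * exp_mult \<tau>s 0) (at 0)" by (rule Lim_transform_eventually[OF L])
    qed (auto simp: open_Compl)
    also have "residue f 1 = exp (of_real \<epsilon>) * (c * F 1)"
    proof (rule residue_simple'[of "- {0}"])
      show "f holomorphic_on - {0} - {1}" by (rule holomorphic_on_subset[OF fh]) auto
      have "isCont (\<lambda>s. G \<epsilon> s * F s) 1"
        by (rule continuous_on_interior[OF holomorphic_on_imp_continuous_on, of _ "- {0}"])
           (auto simp: interior_open open_Compl G_def intro!: holomorphic_intros Fh)
      hence "((\<lambda>s. G \<epsilon> s * F s) \<longlongrightarrow> G \<epsilon> 1 * F 1) (at 1)" by (simp add: isCont_def)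
      from tendsto_mult[OF this lim]
      show "((\<lambda>w. f w * (w - 1)) \<longlongrightarrow> exp (of_real \<epsilon>) * (c * F 1)) (at 1)" by (simp add: f_def G_def mult_ac)
    qed (auto simp: open_Compl)
    finally show ?thesis by (simp add: f_def)
  qed
  define \<epsilon> where "\<epsilon> = (\<lambda>n. 1 / real (Suc n))"
  have \<epsilon>: "0 < \<epsilon> n" "\<epsilon> n \<le> 1" for n by (auto simp: \<epsilon>_def)
  have \<epsilon>0: "\<epsilon> \<longlonglongrightarrow> 0" unfolding \<epsilon>_def using LIMSEQ_Suc[OF lim_const_over_n[of "1::real"]] by simp
  have limG: "(\<lambda>n. LINT t|lborel. G (\<epsilon> n) (Complex \<sigma> t) * (\<phi> (Complex \<sigma> t) * F (Complex \<sigma> t))) \<longlonglongrightarrow> (LINT t|lborel. \<phi> (Complex \<sigma> t) * F (Complex \<sigma> t))"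
    if \<sigma>: "\<sigma> = 2 \<or> \<sigma> = - A" for \<sigma>
  proof (rule integral_dominated_convergence[where w = "\<lambda>t. exp (S\<^sup>2) * norm (\<phi> (Complex \<sigma> t) * F (Complex \<sigma> t))"])
    have i: "integrable lborel (\<lambda>t. \<phi> (Complex \<sigma> t) * F (Complex \<sigma> t))" using \<sigma> i2 iA by auto
    show "(\<lambda>t. \<phi> (Complex \<sigma> t) * F (Complex \<sigma> t)) \<in> borel_measurable lborel" using i by (rule borel_measurable_integrable)
    show "(\<lambda>t. G (\<epsilon> n) (Complex \<sigma> t) * (\<phi> (Complex \<sigma> t) * F (Complex \<sigma> t))) \<in> borel_measurable lborel" for n
      using intG[of "\<epsilon> n" \<sigma>] \<epsilon>[of n] \<sigma> by (intro borel_measurable_integrable) auto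
    show "integrable lborel (\<lambda>t. exp (S\<^sup>2) * norm (\<phi> (Complex \<sigma> t) * F (Complex \<sigma> t)))"
      using i by (intro integrable_mult_right integrable_norm)
    show "AE t in lborel. norm (G (\<epsilon> n) (Complex \<sigma> t) * (\<phi> (Complex \<sigma> t) * F (Complex \<sigma> t))) \<le> exp (S\<^sup>2) * norm (\<phi> (Complex \<sigma> t) * F (Complex \<sigma> t))" for n
      using boundG[of "\<epsilon> n" \<sigma>] \<epsilon>[of n] \<sigma> by (intro AE_I2) auto
    show "AE t in lborel. (\<lambda>n. G (\<epsilon> n) (Complex \<sigma> t) * (\<phi> (Complex \<sigma> t) * F (Complex \<sigma> t))) \<longlonglongrightarrow> \<phi> (Complex \<sigma> t) * F (Complex \<sigma> t)"
    proof (rule AE_I2)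
      fix t
      have "(\<lambda>n. exp (of_real (\<epsilon> n) * (Complex \<sigma> t)\<^sup>2) * (\<phi> (Complex \<sigma> t) * F (Complex \<sigma> t))) \<longlonglongrightarrow> exp (of_real 0 * (Complex \<sigma> t)\<^sup>2) * (\<phi> (Complex \<sigma> t) * F (Complex \<sigma> t))"
        by (intro tendsto_intros \<epsilon>0)
      thus "(\<lambda>n. G (\<epsilon> n) (Complex \<sigma> t) * (\<phi> (Complex \<sigma> t) * F (Complex \<sigma> t))) \<longlonglongrightarrow> \<phi> (Complex \<sigma> t) * F (Complex \<sigma> t)"
        by (simp add: G_def)
    qed
  qed
  have "(\<lambda>n. (LINT t|lborel. G (\<epsilon> n) (Complex (-A) t) * (\<phi> (Complex (-A) t) * F (Complex (-A) t)))
        + 2 * pi * (\<phi> 0 * exp_mult \<tau>s 0 + exp (of_real (\<epsilon> n)) * (c * F 1))) \<longlonglongrightarrow>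
      (LINT t|lborel. \<phi> (Complex (-A) t) * F (Complex (-A) t)) + 2 * pi * (\<phi> 0 * exp_mult \<tau>s 0 + exp (of_real 0) * (c * F 1))"
    by (intro tendsto_intros limG \<epsilon>0) auto
  hence "(\<lambda>n. LINT t|lborel. G (\<epsilon> n) (Complex 2 t) * (\<phi> (Complex 2 t) * F (Complex 2 t))) \<longlonglongrightarrow>
      (LINT t|lborel. \<phi> (Complex (-A) t) * F (Complex (-A) t)) + 2 * pi * (\<phi> 0 * exp_mult \<tau>s 0 + exp (of_real 0) * (c * F 1))"
    unfolding shift[OF \<epsilon>] .
  from LIMSEQ_unique[OF limG[of 2] this]
  show "(LINT t|lborel. \<phi> (Complex 2 t) * F (Complex 2 t)) = (LINT t|lborel. \<phi> (Complex (-A) t) * F (Complex (-A) t))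
        + 2 * pi * (\<phi> 0 * exp_mult \<tau>s 0 + c * F 1)" by simp
qed

section \<open>The smoothed summatory function\<close>

text \<open>Once the singularity at 0 is removed, \<open>gamma_quot\<close> is differentiable there
  with value 0. This zero compensates the possible growth of \<open>\<psi> (1 + \<epsilon>)\<close>
  like \<open>1 / \<epsilon>\<close> in the bound for \<open>\<phi> 0\<close>.\<close>

lemma gamma_quot_near_0:
  fixes \<beta> :: "nat \<Rightarrow> complex"
  assumes zero: "(gamma_quot d \<beta> \<longlongrightarrow> 0) (at 0)"
  shows "\<exists>C. eventually (\<lambda>s. norm (gamma_quot d \<beta> s) \<le> C * norm s) (at 0)"
proof -
  obtain \<eta> where \<eta>: "\<eta> > 0" "\<And>\<nu> s. \<nu> \<in> {1..d} \<Longrightarrow> (1 - s) / 2 + \<beta> \<nu> \<in> \<int>\<^sub>\<le>\<^sub>0 \<Longrightarrow> Re s = 0 \<or> \<bar>Re s\<bar> > \<eta>"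
    using gamma_quot_pole_free_strip[of d \<beta>] by blast
  define P where "P = (\<lambda>\<nu>. \<i> * of_real (2 * Im (\<beta> \<nu>))) ` {1..d} - {0}"
  define S where "S = ball 0 \<eta> - P"
  have S: "open S" "0 \<in> S" using \<eta>(1) by (auto simp: S_def P_def intro!: open_Diff finite_imp_closed)
  have "gamma_quot d \<beta> holomorphic_on (S - {0})"
  proof (rule gamma_quot_holomorphic)
    fix s \<nu> assume s: "s \<in> S - {0}" and \<nu>: "\<nu> \<in> {1..d}"
    show "(1 - s) / 2 + \<beta> \<nu> \<notin> \<int>\<^sub>\<le>\<^sub>0"
    proof
      assume *: "(1 - s) / 2 + \<beta> \<nu> \<in> \<int>\<^sub>\<le>\<^sub>0"
      then obtain j where "(1 - s) / 2 + \<beta> \<nu> = - of_nat j" by (auto elim!: nonpos_Ints_cases')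
      hence "Im s = 2 * Im (\<beta> \<nu>)" by (rule Re_gamma_quot_pole)
      moreover have "\<bar>Re s\<bar> < \<eta>" using s abs_Re_le_cmod[of s] by (simp add: S_def)
      hence "Re s = 0" using \<eta>(2)[OF \<nu> *] by auto
      ultimately have "s = \<i> * of_real (2 * Im (\<beta> \<nu>))" by (simp add: complex_eq_iff)
      thus False using s \<nu> by (auto simp: S_def P_def)
    qed
  qed
  hence h: "(\<lambda>s. if s = 0 then 0 else gamma_quot d \<beta> s) holomorphic_on (S - {0})"
    by (rule holomorphic_transform) auto
  have "(\<lambda>s. if s = 0 then 0 else gamma_quot d \<beta> s) holomorphic_on S"
  proof (rule no_isolated_singularity'[OF _ h S(1)])
    fix z assume "z \<in> {0::complex}"
    have "eventually (\<lambda>s. gamma_quot d \<beta> s = (if s = 0 then 0 else gamma_quot d \<beta> s)) (at 0)"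
      using eventually_neq_at_within[of 0] by eventually_elim simp
    from Lim_transform_eventually[OF zero this]
    show "((\<lambda>s. if s = 0 then 0 else gamma_quot d \<beta> s) \<longlongrightarrow> (if z = 0 then 0 else gamma_quot d \<beta> z)) (at z within S)"
      using \<open>z \<in> {0}\<close> by (auto intro: tendsto_within_subset)
  qed auto
  then obtain D where "((\<lambda>s. if s = 0 then 0 else gamma_quot d \<beta> s) has_field_derivative D) (at 0)"
    using S by (meson holomorphic_on_open field_differentiable_def holomorphic_on_imp_differentiable_at)
  hence "((\<lambda>s. ((if s = 0 then 0 else gamma_quot d \<beta> s) - 0) / (s - 0)) \<longlongrightarrow> D) (at 0)"
    by (simp add: has_field_derivative_iff)
  hence "((\<lambda>s. norm (((if s = 0 then 0 else gamma_quot d \<beta> s) - 0) / (s - 0))) \<longlongrightarrow> norm D) (at 0)"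
    by (rule tendsto_norm)
  hence "eventually (\<lambda>s. norm (((if s = 0 then 0 else gamma_quot d \<beta> s) - 0) / (s - 0)) < norm D + 1) (at 0)"
    by (rule order_tendstoD) simp
  hence "eventually (\<lambda>s. norm (gamma_quot d \<beta> s) \<le> (norm D + 1) * norm s) (at 0)"
    using eventually_neq_at_within[of 0] by eventually_elim (auto simp: norm_divide divide_less_eq less_imp_le)
  thus ?thesis by blast
qed

text \<open>One pair of series. Constants that have to be uniform over all pairs are constructed
  outside, from d and \<beta>, and enter the theorems of the locale as hypotheses.\<close>

locale dirichlet_pair =
  fixes d :: nat and \<beta> :: "nat \<Rightarrow> complex" and \<sigma>\<psi> :: real
    and a :: "nat \<Rightarrow> real" and b :: "nat \<Rightarrow> complex" and l \<mu> :: "nat \<Rightarrow> real" and \<phi> \<psi> :: "complex \<Rightarrow> complex"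
  assumes l: "frequencies l" and \<mu>: "frequencies \<mu>" and a: "\<And>n. n \<ge> 1 \<Longrightarrow> 0 \<le> a n"
    and \<phi>: "abs_conv_dirichlet \<phi> (\<lambda>n. of_real (a n)) l 1"
    and \<psi>: "abs_conv_dirichlet \<psi> b \<mu> \<sigma>\<psi>"
    and FE: "functional_equation d \<beta> \<phi> \<psi>"
    and p\<phi>: "at_most_simple_pole_at_1 \<phi>" and p\<psi>: "at_most_simple_pole_at_1 \<psi>"
    and bdd: "bdd_above (mean_abs b \<mu> ` {0<..})"
begin

abbreviation "dhat \<equiv> delta_hat b \<mu>"

text \<open>In the variable \<open>y = ln X\<close> the dilations of X produced by the twist are
  translations.\<close>

definition count :: "real \<Rightarrow> real" where
  "count y = (\<Sum>n | 1 \<le> n \<and> l n < exp y. a n)"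

lemma l_pos: "0 < l (Suc n)" using frequencies_pos[OF l] .
lemma \<mu>_pos: "0 < \<mu> (Suc n)" using frequencies_pos[OF \<mu>] .
lemma dhat_nonneg: "0 \<le> dhat" using delta_hat_nonneg[OF \<mu> bdd] .

lemma weight_sum_le:
  assumes "\<eta> > 0" "Z > 0"
  shows "(\<Sum>n<N. norm (b (Suc n)) / \<mu> (Suc n) * min ((\<mu> (Suc n) / Z) powr \<eta>) ((\<mu> (Suc n) / Z) powr - \<eta>)) \<le> 6 * dhat / (1 - 2 powr - \<eta>)"
  by (rule two_sided_weight_sum_le[where m = "\<lambda>n. \<mu> (Suc n)", OF norm_ge_zero \<mu>_pos assms sum_le_delta_hat[OF \<mu> bdd]])

lemma \<mu>_mono: "\<mu> 1 \<le> \<mu> (Suc n)"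
proof (cases n)
  case (Suc m)
  have "strict_mono_on {1..} \<mu>" using \<mu> by (simp add: frequencies_def)
  from strict_mono_onD[OF this, of 1 "Suc n"] show ?thesis using Suc by simp
qed simp

text \<open>The weights of \<open>weight_sum_le\<close> with \<open>Z = \<mu> 1\<close>: all ratios
  are then at least 1 and the minimum is the decaying power. Thus bounded means of \<open>b\<close>
  yield absolute convergence for real part above 1.\<close>

lemma \<psi>_partial_sum_le:
  assumes "\<epsilon> > 0"
  shows "(\<Sum>n<N. norm (b (Suc n)) * exp (- ln (\<mu> (Suc n)) * (1 + \<epsilon>))) \<le> \<mu> 1 powr - \<epsilon> * (6 * dhat / (1 - 2 powr - \<epsilon>))"
proof -
  have m1: "\<mu> 1 > 0" using \<mu>_pos[of 0] by simp
  have eq: "norm (b (Suc n)) * exp (- ln (\<mu> (Suc n)) * (1 + \<epsilon>)) = \<mu> 1 powr - \<epsilon> * (norm (b (Suc n)) / \<mu> (Suc n) * min ((\<mu> (Suc n) / \<mu> 1) powr \<epsilon>) ((\<mu> (Suc n) / \<mu> 1) powr - \<epsilon>))" for n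
  proof -
    define r where "r = \<mu> (Suc n) / \<mu> 1"
    have r: "r \<ge> 1" using \<mu>_mono[of n] m1 by (simp add: r_def)
    have "r powr - \<epsilon> \<le> r powr \<epsilon>" using r assms by (intro powr_mono) auto
    hence "min (r powr \<epsilon>) (r powr - \<epsilon>) = r powr - \<epsilon>" by simp
    also have "\<dots> = \<mu> (Suc n) powr - \<epsilon> / \<mu> 1 powr - \<epsilon>" unfolding r_def using m1 \<mu>_pos by (simp add: powr_divide)
    finally have "\<mu> 1 powr - \<epsilon> * min (r powr \<epsilon>) (r powr - \<epsilon>) = \<mu> (Suc n) powr - \<epsilon>" using m1 by simp
    moreover have "exp (- ln (\<mu> (Suc n)) * (1 + \<epsilon>)) = \<mu> (Suc n) powr - \<epsilon> / \<mu> (Suc n)"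
    proof -
      have "- ln (\<mu> (Suc n)) * (1 + \<epsilon>) = - \<epsilon> * ln (\<mu> (Suc n)) - ln (\<mu> (Suc n))" by (simp add: algebra_simps)
      thus ?thesis using \<mu>_pos[of n] by (simp add: powr_def exp_diff)
    qed
    ultimately have "norm (b (Suc n)) * exp (- ln (\<mu> (Suc n)) * (1 + \<epsilon>)) =
        norm (b (Suc n)) * (\<mu> 1 powr - \<epsilon> * min (r powr \<epsilon>) (r powr - \<epsilon>) / \<mu> (Suc n))" by simp
    thus ?thesis unfolding r_def by (simp add: mult_ac)
  qed
  show ?thesis unfolding eq sum_distrib_left[symmetric]
    by (intro mult_left_mono weight_sum_le assms m1) auto
qed

lemma \<psi>_summable:
  assumes "x > 1"
  shows "summable (\<lambda>n. norm (b (Suc n)) * exp (- ln (\<mu> (Suc n)) * x))"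
proof (rule bounded_imp_summable)
  show "(\<Sum>n\<le>N. norm (b (Suc n)) * exp (- ln (\<mu> (Suc n)) * x)) \<le> \<mu> 1 powr - (x - 1) * (6 * dhat / (1 - 2 powr - (x - 1)))" for N
    using \<psi>_partial_sum_le[of "x - 1" "Suc N"] assms by (simp add: lessThan_Suc_atMost)
qed auto

text \<open>Continuation of the identity from the assumed half-plane to the half-plane of absolute
  convergence just found.\<close>

lemma \<psi>_eq: "Re s > 1 \<Longrightarrow> \<psi> s = gds (\<lambda>n. b (Suc n)) (\<lambda>n. - ln (\<mu> (Suc n))) s"
proof (rule gds_continuation[OF \<psi>_summable abs_conv_dirichlet_gds(2)[OF \<psi> \<mu>]])
  show "\<psi> holomorphic_on - {1}" using p\<psi> by (simp add: at_most_simple_pole_at_1_def)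
qed auto

lemma \<phi>_summable: "x > 1 \<Longrightarrow> summable (\<lambda>n. a (Suc n) * exp (- ln (l (Suc n)) * x))"
  using abs_conv_dirichlet_gds(1)[OF \<phi> l, of "of_real x"] a[of "Suc n" for n] by simp

lemma \<phi>_eq: "Re s > 1 \<Longrightarrow> \<phi> s = gds (\<lambda>n. of_real (a (Suc n))) (\<lambda>n. - ln (l (Suc n))) s"
  by (rule abs_conv_dirichlet_gds(2)[OF \<phi> l])

lemma \<phi>_bound: "norm (\<phi> (Complex 2 t)) \<le> (\<Sum>n. a (Suc n) * exp (- ln (l (Suc n)) * 2))"
proof -
  have "norm (gds (\<lambda>n. of_real (a (Suc n))) (\<lambda>n. - ln (l (Suc n))) (Complex 2 t)) \<le> (\<Sum>n. norm (complex_of_real (a (Suc n)) * exp (of_real (- ln (l (Suc n))) * Complex 2 t)))"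
    unfolding gds_def by (rule summable_norm) (use \<phi>_summable[of 2] a in \<open>simp add: norm_mult\<close>)
  also have "\<dots> = (\<Sum>n. a (Suc n) * exp (- ln (l (Suc n)) * 2))" using a by (simp add: norm_mult)
  finally show ?thesis by (simp add: \<phi>_eq)
qed

lemma \<phi>_hol: "\<phi> holomorphic_on - {1}" using p\<phi> by (simp add: at_most_simple_pole_at_1_def)

text \<open>The limit of \<open>\<phi> s * (s - 1)\<close> is taken along real points to the right
  of 1, where the series has nonnegative real terms.\<close>

lemma residue_real: "residue \<phi> 1 = of_real (delta1 \<phi>)" and delta1_nonneg: "delta1 \<phi> \<ge> 0"
proof -
  define s where "s = (\<lambda>n. complex_of_real (1 + 1 / real (Suc n)))"
  have s1: "filterlim s (at 1) sequentially"
  proof (rule filterlim_atI)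
    have "(\<lambda>n. complex_of_real (1 + 1 / real (Suc n))) \<longlonglongrightarrow> of_real (1 + 0)"
      using LIMSEQ_Suc[OF lim_const_over_n[of "1::real"]] by (intro tendsto_intros)
    thus "s \<longlonglongrightarrow> 1" by (simp add: s_def)
    show "eventually (\<lambda>n. s n \<noteq> 1) sequentially" by (rule always_eventually) (simp add: s_def del: of_nat_Suc)
  qed
  have L: "(\<lambda>n. \<phi> (s n) * (s n - 1)) \<longlonglongrightarrow> residue \<phi> 1"
    by (rule filterlim_compose[OF residue_limit_at_1[OF p\<phi>] s1])
  have v: "\<phi> (s n) * (s n - 1) = of_real ((\<Sum>m. a (Suc m) * exp (- ln (l (Suc m)) * (1 + 1 / real (Suc n)))) * (1 / real (Suc n)))" for n
  proof -
    have "\<phi> (s n) = (\<Sum>m. of_real (a (Suc m) * exp (- ln (l (Suc m)) * (1 + 1 / real (Suc n)))))"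
      by (subst \<phi>_eq) (simp_all add: s_def gds_def exp_of_real[symmetric] del: of_nat_Suc)
    also have "\<dots> = of_real (\<Sum>m. a (Suc m) * exp (- ln (l (Suc m)) * (1 + 1 / real (Suc n))))"
      by (rule suminf_of_real[symmetric], rule \<phi>_summable) (simp del: of_nat_Suc)
    finally show ?thesis by (simp add: s_def del: of_nat_Suc)
  qed
  have "(\<lambda>n. Im (\<phi> (s n) * (s n - 1))) \<longlonglongrightarrow> Im (residue \<phi> 1)" by (rule tendsto_Im[OF L])
  hence "Im (residue \<phi> 1) = 0" unfolding v by (simp add: LIMSEQ_const_iff)
  thus "residue \<phi> 1 = of_real (delta1 \<phi>)" by (simp add: delta1_def complex_eq_iff)
  have "(\<lambda>n. Re (\<phi> (s n) * (s n - 1))) \<longlonglongrightarrow> Re (residue \<phi> 1)" by (rule tendsto_Re[OF L])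
  thus "delta1 \<phi> \<ge> 0" unfolding delta1_def
  proof (rule tendsto_lowerbound)
    show "eventually (\<lambda>n. 0 \<le> Re (\<phi> (s n) * (s n - 1))) sequentially"
    proof (rule always_eventually, rule allI)
      fix n
      have "0 \<le> (\<Sum>m. a (Suc m) * exp (- ln (l (Suc m)) * (1 + 1 / real (Suc n))))"
        by (rule suminf_nonneg[OF \<phi>_summable]) (use a in \<open>simp_all del: of_nat_Suc\<close>)
      thus "0 \<le> Re (\<phi> (s n) * (s n - 1))" unfolding v Re_complex_of_real by (intro mult_nonneg_nonneg) auto
    qed
  qed simp
qed

lemma count_nonneg: "0 \<le> count y" unfolding count_def using a by (auto intro: sum_nonneg)

lemma count_mono: "x \<le> y \<Longrightarrow> count x \<le> count y"
  unfolding count_def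
proof (rule sum_mono2[OF finite_frequencies_less[OF l]])
  assume "x \<le> y"
  hence e: "exp x \<le> exp y" by simp
  show "{n. 1 \<le> n \<and> l n < exp x} \<subseteq> {n. 1 \<le> n \<and> l n < exp y}"
    by (auto intro: less_le_trans[OF _ e])
  fix n assume "n \<in> {n. 1 \<le> n \<and> l n < exp y} - {n. 1 \<le> n \<and> l n < exp x}"
  thus "0 \<le> a n" by (intro a) auto
qed

definition smooth_count :: "real \<Rightarrow> nat \<Rightarrow> real \<Rightarrow> real" where
  "smooth_count w k y = (\<Sum>n. a (Suc n) * cutoff w k (y - ln (l (Suc n))))"

text \<open>\<open>cutoff\<close> is 1 wherever the sharp step is 1 and vanishes below
  \<open>- k * w\<close>; with nonnegative coefficients this places the smoothed sum, which is
  finite, between two values of \<open>count\<close>.\<close>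

lemma
  assumes w: "w > 0" and k: "k \<ge> 1"
  shows smooth_count_summable: "summable (\<lambda>n. a (Suc n) * cutoff w k (y - ln (l (Suc n))))"
    and count_le_smooth_count: "count y \<le> smooth_count w k y"
    and smooth_count_le_count: "smooth_count w k y \<le> count (y + real k * w)"
proof -
  define X where "X = exp (y + real k * w)"
  define N where "N = {n. l (Suc n) < X}"
  have img: "Suc ` {n. l (Suc n) < Y} = {n. 1 \<le> n \<and> l n < Y}" for Y
  proof (rule set_eqI)
    fix n show "n \<in> Suc ` {n. l (Suc n) < Y} \<longleftrightarrow> n \<in> {n. 1 \<le> n \<and> l n < Y}" by (cases n) auto
  qed
  have fin: "finite {n. l (Suc n) < Y}" for Y
    using finite_frequencies_less[OF l, of Y] unfolding img[symmetric] by (rule finite_imageD) auto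
  have sumS: "(\<Sum>n | 1 \<le> n \<and> l n < Y. a n) = (\<Sum>n | l (Suc n) < Y. a (Suc n))" for Y
    unfolding img[symmetric] by (subst sum.reindex) auto
  have z: "a (Suc n) * cutoff w k (y - ln (l (Suc n))) = 0" if "n \<notin> N" for n
  proof -
    have "X \<le> l (Suc n)" using that by (simp add: N_def)
    hence "ln X \<le> ln (l (Suc n))" by (subst ln_le_cancel_iff) (auto simp: X_def l_pos)
    hence "y - ln (l (Suc n)) \<le> - (real k * w)" by (simp add: X_def)
    thus ?thesis using cutoff_bounds(4)[OF w k] by simp
  qed
  have fN: "finite N" unfolding N_def by (rule fin)
  show "summable (\<lambda>n. a (Suc n) * cutoff w k (y - ln (l (Suc n))))"
    by (rule summable_finite[OF fN z])
  have sc: "smooth_count w k y = (\<Sum>n\<in>N. a (Suc n) * cutoff w k (y - ln (l (Suc n))))"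
    unfolding smooth_count_def by (rule suminf_finite[OF fN z])
  have "smooth_count w k y \<le> (\<Sum>n\<in>N. a (Suc n) * 1)"
    unfolding sc using cutoff_bounds(2)[OF w k] a by (intro sum_mono mult_left_mono) auto
  thus "smooth_count w k y \<le> count (y + real k * w)"
    unfolding count_def sumS N_def X_def by simp
  have "count y = (\<Sum>n | l (Suc n) < exp y. a (Suc n) * 1)" unfolding count_def sumS by simp
  also have "\<dots> = (\<Sum>n | l (Suc n) < exp y. a (Suc n) * cutoff w k (y - ln (l (Suc n))))"
  proof (intro sum.cong refl)
    fix n assume "n \<in> {n. l (Suc n) < exp y}"
    hence "ln (l (Suc n)) < ln (exp y)" by (subst ln_less_cancel_iff) (auto simp: l_pos)
    thus "a (Suc n) * 1 = a (Suc n) * cutoff w k (y - ln (l (Suc n)))"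
      by (subst cutoff_bounds(3)[OF w k]) auto
  qed
  also have "\<dots> \<le> smooth_count w k y"
    unfolding sc
  proof (rule sum_mono2[OF fN])
    have "exp y \<le> X" using w by (simp add: X_def)
    thus "{n. l (Suc n) < exp y} \<subseteq> N" by (auto simp: N_def)
    show "0 \<le> a (Suc n) * cutoff w k (y - ln (l (Suc n)))" for n
      using a cutoff_bounds(1)[OF w k] by simp
  qed
  finally show "count y \<le> smooth_count w k y" .
qed

lemma shift_sum_smooth_count:
  assumes w: "w > 0" and k: "k \<ge> 1"
  shows "(\<lambda>n. a (Suc n) * shift_sum \<tau>s (cutoff w k) (y - ln (l (Suc n)))) sums shift_sum \<tau>s (smooth_count w k) y"
proof (induction \<tau>s arbitrary: y)
  case Nil
  show ?case unfolding shift_sum.simps smooth_count_def by (rule summable_sums[OF smooth_count_summable[OF w k]])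
next
  case (Cons \<tau> \<tau>s)
  from sums_add[OF Cons[of y] Cons[of "y + \<tau>"]]
  show ?case by (simp add: distrib_left algebra_simps)
qed

text \<open>On \<open>Re s = 2\<close> the series of \<open>\<phi>\<close> may be integrated
  termwise, and each term is a Perron integral with \<open>L = y - ln (l n)\<close>.\<close>

theorem right_line_integral:
  assumes w: "w > 0" and k: "k \<ge> 1"
  shows "(LINT t|lborel. \<phi> (Complex 2 t) * (exp (of_real y * Complex 2 t) * smooth_kernel \<tau>s w k (Complex 2 t)))
     = of_real (2 * pi * shift_sum \<tau>s (smooth_count w k) y)"
proof -
  define K where "K = (\<lambda>t. smooth_kernel \<tau>s w k (Complex 2 t))"
  have per: "integrable lborel (\<lambda>t. exp (of_real L * Complex 2 t) * K t)"
    "(LINT t|lborel. exp (of_real L * Complex 2 t) * K t) = of_real (2 * pi * shift_sum \<tau>s (cutoff w k) L)" for L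
    unfolding K_def using perron_smooth_kernel[OF _ w k, of 2] by auto
  have "(\<lambda>n. of_real (a (Suc n)) * (LINT t|lborel. exp (of_real (- ln (l (Suc n))) * Complex 2 t) * (exp (of_real y * Complex 2 t) * K t))) sums
     (LINT t|lborel. gds (\<lambda>n. of_real (a (Suc n))) (\<lambda>n. - ln (l (Suc n))) (Complex 2 t) * (exp (of_real y * Complex 2 t) * K t))"
    by (rule gds_line_integral(1)[OF per(1)]) (use \<phi>_summable[of 2] a in simp)
  moreover have "of_real (a (Suc n)) * (LINT t|lborel. exp (of_real (- ln (l (Suc n))) * Complex 2 t) * (exp (of_real y * Complex 2 t) * K t))
     = complex_of_real (2 * pi * (a (Suc n) * shift_sum \<tau>s (cutoff w k) (y - ln (l (Suc n)))))" for n
  proof -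
    have "exp (of_real (- ln (l (Suc n))) * Complex 2 t) * (exp (of_real y * Complex 2 t) * K t) = exp (of_real (y - ln (l (Suc n))) * Complex 2 t) * K t" for t
      unfolding mult.assoc[symmetric] exp_add[symmetric] distrib_right[symmetric] of_real_add[symmetric] by simp
    thus ?thesis by (simp only: per(2)) (simp add: mult_ac)
  qed
  ultimately have 1: "(\<lambda>n. complex_of_real (2 * pi * (a (Suc n) * shift_sum \<tau>s (cutoff w k) (y - ln (l (Suc n)))))) sums
     (LINT t|lborel. gds (\<lambda>n. of_real (a (Suc n))) (\<lambda>n. - ln (l (Suc n))) (Complex 2 t) * (exp (of_real y * Complex 2 t) * K t))"
    by (simp only:)
  have 2: "(\<lambda>n. complex_of_real (2 * pi * (a (Suc n) * shift_sum \<tau>s (cutoff w k) (y - ln (l (Suc n)))))) sums of_real (2 * pi * shift_sum \<tau>s (smooth_count w k) y)"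
    by (intro sums_of_real sums_mult shift_sum_smooth_count w k)
  have "(LINT t|lborel. \<phi> (Complex 2 t) * (exp (of_real y * Complex 2 t) * K t)) =
     (LINT t|lborel. gds (\<lambda>n. of_real (a (Suc n))) (\<lambda>n. - ln (l (Suc n))) (Complex 2 t) * (exp (of_real y * Complex 2 t) * K t))"
    by (simp add: \<phi>_eq)
  also have "\<dots> = of_real (2 * pi * shift_sum \<tau>s (smooth_count w k) y)" by (rule sums_unique2[OF 1 2])
  finally show ?thesis by (simp add: K_def)
qed

end

text \<open>Bounds the constant \<open>1 / (1 - 2 powr - \<epsilon>)\<close> of the dyadic estimate
  by \<open>4 / \<epsilon>\<close>, in view of the limit \<epsilon> to 0 in
  \<open>\<phi>_0_le\<close>.\<close>

lemma one_minus_two_powr_ge: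
  assumes "0 < \<epsilon>" "\<epsilon> \<le> 1"
  shows "\<epsilon> / 4 \<le> 1 - 2 powr - (\<epsilon> :: real)"
proof -
  define u where "u = \<epsilon> * ln 2"
  have "1 / 2 \<le> ln (2 :: real)" using ln2_ge_two_thirds by simp
  hence u1: "\<epsilon> / 2 \<le> u" using mult_left_mono[of "1/2" "ln 2" \<epsilon>] assms by (simp add: u_def)
  have "ln (2 :: real) \<le> 1" using ln_le_minus_one[of "2 :: real"] by simp
  hence u2: "u \<le> 1" using mult_mono[of \<epsilon> 1 "ln 2" 1] assms by (simp add: u_def)
  have "exp (- u) \<le> 1 / (1 + u)" 
  proof -
    have "exp (- u) * (1 + u) \<le> exp (- u) * exp u" by (rule mult_left_mono) (auto intro: exp_ge_add_one_self)
    also have "exp (- u) * exp u = 1" by (simp flip: exp_add)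
    finally show ?thesis by (subst pos_le_divide_eq) (use u1 assms in linarith)+
  qed
  moreover have "1 / (1 + u) \<le> 1 - u / 2"
  proof -
    have "0 \<le> u * (1 - u)" using u1 u2 assms by simp
    hence "1 \<le> (1 - u / 2) * (1 + u)" by (simp add: algebra_simps)
    thus ?thesis by (subst pos_divide_le_eq) (use u1 assms in linarith)+
  qed
  moreover have "2 powr - \<epsilon> = exp (- u)" by (simp add: powr_def u_def)
  ultimately show ?thesis using u1 by simp
qed

lemma norm_sums_le:
  fixes f :: "nat \<Rightarrow> 'a :: real_normed_vector"
  assumes "f sums S" "\<And>N. (\<Sum>n<N. norm (f n)) \<le> B"
  shows "norm S \<le> B"
proof (rule tendsto_upperbound[OF tendsto_norm[OF assms(1)[unfolded sums_def]]])
  show "eventually (\<lambda>N. norm (\<Sum>n<N. f n) \<le> B) sequentially"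
    by (intro always_eventually allI order_trans[OF norm_sum assms(2)])
qed simp

context dirichlet_pair
begin

text \<open>The functional equation at \<open>1 - z\<close> says in essence
  \<open>gamma_quot d \<beta> z * \<phi> (1 - z) = \<psi> z\<close>. A pole of \<open>\<phi>\<close>
  at 1 makes the second factor grow like \<open>1 / z\<close>, while \<open>\<psi>\<close> is
  regular at 0.\<close>

lemma gamma_quot_tendsto_0:
  assumes "delta1 \<phi> \<noteq> 0"
  shows "(gamma_quot d \<beta> \<longlongrightarrow> 0) (at 0)"
proof -
  define c where "c = \<bar>delta1 \<phi>\<bar>"
  have c: "c > 0" using assms by (simp add: c_def)
  have "((\<lambda>z. 1 - z) \<longlongrightarrow> 1 - 0) (at (0::complex))" by (intro tendsto_intros)
  hence f: "filterlim (\<lambda>z. 1 - z) (at 1) (at (0::complex))"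
    by (intro filterlim_atI) (auto simp: eventually_at_filter)
  have "((\<lambda>z. norm (\<phi> (1 - z) * ((1 - z) - 1))) \<longlongrightarrow> norm (residue \<phi> 1)) (at 0)"
    by (intro tendsto_norm filterlim_compose[OF residue_limit_at_1[OF p\<phi>] f])
  hence "eventually (\<lambda>z. norm (\<phi> (1 - z) * ((1 - z) - 1)) > c / 2) (at 0)"
    by (rule order_tendstoD) (use c in \<open>simp add: residue_real c_def\<close>)
  moreover have "eventually (\<lambda>z. z \<noteq> 0) (at (0::complex))" by (rule eventually_neq_at_within)
  moreover have "eventually (\<lambda>z. z \<noteq> 1) (at (0::complex))" by (rule eventually_neq_at_within)
  ultimately have ev: "eventually (\<lambda>z. norm (gamma_quot d \<beta> z) \<le> 2 / c * norm (\<psi> z * z)) (at 0)"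
  proof eventually_elim
    case (elim z)
    have FE': "\<phi> (1 - z) * inverse (gamma_factor d \<beta> z) = \<psi> z * inverse (gamma_factor d \<beta> (1 - z))"
      using functional_equation_everywhere(1)[OF FE p\<phi> p\<psi>, of "1 - z"] elim by simp
    have "norm (gamma_quot d \<beta> z) * norm (\<phi> (1 - z)) \<le> norm (\<psi> z)"
    \<comment> \<open>A value 0 arises from the convention at poles of Gamma; then
      \<open>gamma_quot\<close> is 0 as well and the inequality is trivial.\<close>
    proof (cases "gamma_factor d \<beta> (1 - z) = 0")
      case False
      have "gamma_quot d \<beta> z * \<phi> (1 - z) = gamma_factor d \<beta> (1 - z) * (\<phi> (1 - z) * inverse (gamma_factor d \<beta> z))"
        by (simp add: gamma_quot_def divide_inverse mult_ac)
      also have "\<dots> = \<psi> z" unfolding FE' using False by simp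
      finally show ?thesis by (simp flip: norm_mult)
    qed (simp add: gamma_quot_def)
    hence "norm (gamma_quot d \<beta> z) * norm (\<phi> (1 - z)) * norm z \<le> norm (\<psi> z) * norm z" by (rule mult_right_mono) simp
    hence "norm (gamma_quot d \<beta> z) * norm (\<phi> (1 - z) * ((1 - z) - 1)) \<le> norm (\<psi> z * z)" by (simp add: norm_mult mult_ac)
    moreover have "norm (gamma_quot d \<beta> z) * (c / 2) \<le> norm (gamma_quot d \<beta> z) * norm (\<phi> (1 - z) * ((1 - z) - 1))"
      using elim by (intro mult_left_mono) auto
    ultimately have "norm (gamma_quot d \<beta> z) * (c / 2) \<le> norm (\<psi> z * z)" by linarith
    thus ?case using c by (simp add: field_simps)
  qed
  have "\<psi> holomorphic_on - {1}" using p\<psi> by (simp add: at_most_simple_pole_at_1_def)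
  hence "continuous_on (- {1}) \<psi>" by (rule holomorphic_on_imp_continuous_on)
  hence "isCont \<psi> 0" by (simp add: continuous_on_eq_continuous_at open_Compl)
  hence "((\<lambda>z. 2 / c * norm (\<psi> z * z)) \<longlongrightarrow> 2 / c * norm (\<psi> 0 * 0)) (at 0)"
    by (intro tendsto_intros) (simp add: isCont_def)
  hence "((\<lambda>z. 2 / c * norm (\<psi> z * z)) \<longlongrightarrow> 0) (at 0)" by simp
  thus ?thesis by (rule Lim_null_comparison[OF ev])
qed

lemma norm_\<psi>_le:
  assumes "\<epsilon> > 0"
  shows "norm (\<psi> (Complex (1 + \<epsilon>) t)) \<le> \<mu> 1 powr - \<epsilon> * (6 * dhat / (1 - 2 powr - \<epsilon>))"
proof (rule norm_sums_le)
  have *: "norm (b (Suc n) * exp (of_real (- ln (\<mu> (Suc n))) * Complex (1 + \<epsilon>) t)) = norm (b (Suc n)) * exp (- ln (\<mu> (Suc n)) * (1 + \<epsilon>))" for n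
    by (simp add: norm_mult)
  have "summable (\<lambda>n. b (Suc n) * exp (of_real (- ln (\<mu> (Suc n))) * Complex (1 + \<epsilon>) t))"
    by (rule summable_norm_cancel, unfold *, rule \<psi>_summable) (use assms in simp)
  hence "(\<lambda>n. b (Suc n) * exp (of_real (- ln (\<mu> (Suc n))) * Complex (1 + \<epsilon>) t)) sums gds (\<lambda>n. b (Suc n)) (\<lambda>n. - ln (\<mu> (Suc n))) (Complex (1 + \<epsilon>) t)"
    unfolding gds_def by (rule summable_sums)
  thus "(\<lambda>n. b (Suc n) * exp (of_real (- ln (\<mu> (Suc n))) * Complex (1 + \<epsilon>) t)) sums \<psi> (Complex (1 + \<epsilon>) t)"
    by (subst \<psi>_eq) (use assms in simp_all)
  show "(\<Sum>n<N. norm (b (Suc n) * exp (of_real (- ln (\<mu> (Suc n))) * Complex (1 + \<epsilon>) t))) \<le> \<mu> 1 powr - \<epsilon> * (6 * dhat / (1 - 2 powr - \<epsilon>))" for N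
    unfolding * by (rule \<psi>_partial_sum_le[OF assms])
qed

lemma \<phi>_eq_left:
  assumes poles: "\<And>\<nu> s. \<nu> \<in> {1..d} \<Longrightarrow> (1 - s) / 2 + \<beta> \<nu> \<in> \<int>\<^sub>\<le>\<^sub>0 \<Longrightarrow> Re s = 0 \<or> \<bar>Re s\<bar> > \<eta>'"
    and "0 < \<eta>" "\<eta> < \<eta>'" "Re s = - \<eta>"
  shows "\<phi> s = gamma_quot d \<beta> s * \<psi> (1 - s)"
proof (rule gamma_quot_functional_equation[OF FE p\<phi> p\<psi>])
  show "gamma_factor d \<beta> (1 - s) \<noteq> 0"
    by (rule gamma_factor_nonzero) (use poles[of _ s] assms(2-4) in auto)
qed (use assms(2,4) in auto)

text \<open>Let \<epsilon> tend to 0 in \<open>\<phi> (-\<epsilon>) = gamma_quot d \<beta>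
  (-\<epsilon>) * \<psi> (1 + \<epsilon>)\<close>. The first factor is at most
  \<open>|C| * \<epsilon>\<close>, the second at most
  \<open>\<mu> 1 powr - \<epsilon> * 24 * dhat / \<epsilon>\<close>, and the power of
  \<open>\<mu> 1\<close> tends to 1, so that no dependence on the frequencies remains.\<close>

lemma \<phi>_0_le:
  assumes near: "eventually (\<lambda>s. norm (gamma_quot d \<beta> s) \<le> C * norm s) (at 0)"
    and \<eta>': "\<eta>' > 0"
    and poles: "\<And>\<nu> s. \<nu> \<in> {1..d} \<Longrightarrow> (1 - s) / 2 + \<beta> \<nu> \<in> \<int>\<^sub>\<le>\<^sub>0 \<Longrightarrow> Re s = 0 \<or> \<bar>Re s\<bar> > \<eta>'"
  shows "norm (\<phi> 0) \<le> 24 * \<bar>C\<bar> * dhat"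
proof -
  have "continuous_on (- {1}) \<phi>" using \<phi>_hol by (rule holomorphic_on_imp_continuous_on)
  hence c\<phi>: "(\<phi> \<longlongrightarrow> \<phi> 0) (at 0)" by (simp add: continuous_on_eq_continuous_at open_Compl isCont_def)
  have z: "((\<lambda>\<epsilon>::real. complex_of_real (- \<epsilon>)) \<longlongrightarrow> of_real (- 0)) (at_right 0)" by (intro tendsto_intros)
  have pos: "eventually (\<lambda>\<epsilon>::real. 0 < \<epsilon>) (at_right 0)" by (simp add: eventually_at_right_less)
  have f: "filterlim (\<lambda>\<epsilon>::real. complex_of_real (- \<epsilon>)) (at 0) (at_right 0)"
    using z by (intro filterlim_atI eventually_mono[OF pos]) auto
  have L: "((\<lambda>\<epsilon>. norm (\<phi> (of_real (- \<epsilon>)))) \<longlongrightarrow> norm (\<phi> 0)) (at_right 0)"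
    by (intro tendsto_norm filterlim_compose[OF c\<phi> f])
  have m1: "\<mu> 1 > 0" using \<mu>_pos[of 0] by simp
  have "((\<lambda>\<epsilon>. 24 * \<bar>C\<bar> * dhat * \<mu> 1 powr - \<epsilon>) \<longlongrightarrow> 24 * \<bar>C\<bar> * dhat * \<mu> 1 powr - 0) (at_right 0)"
    by (intro tendsto_intros) (use m1 in auto)
  hence U: "((\<lambda>\<epsilon>. 24 * \<bar>C\<bar> * dhat * \<mu> 1 powr - \<epsilon>) \<longlongrightarrow> 24 * \<bar>C\<bar> * dhat) (at_right 0)" using m1 by simp
  have e1: "eventually (\<lambda>\<epsilon>::real. \<epsilon> < min 1 \<eta>') (at_right 0)"
    using \<eta>' by (intro order_tendstoD[OF tendsto_ident_at]) auto
  have e2: "eventually (\<lambda>\<epsilon>. norm (gamma_quot d \<beta> (of_real (- \<epsilon>))) \<le> C * norm (complex_of_real (- \<epsilon>))) (at_right 0)"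
    by (rule eventually_compose_filterlim[OF near f])
  show ?thesis
  proof (rule tendsto_le[OF _ U L])
    show "eventually (\<lambda>\<epsilon>. norm (\<phi> (of_real (- \<epsilon>))) \<le> 24 * \<bar>C\<bar> * dhat * \<mu> 1 powr - \<epsilon>) (at_right 0)"
      using pos e1 e2
    proof eventually_elim
      case (elim \<epsilon>)
      have "norm (\<phi> (of_real (- \<epsilon>))) = norm (gamma_quot d \<beta> (of_real (- \<epsilon>))) * norm (\<psi> (Complex (1 + \<epsilon>) 0))"
      proof -
        have "\<phi> (of_real (- \<epsilon>)) = gamma_quot d \<beta> (of_real (- \<epsilon>)) * \<psi> (1 - of_real (- \<epsilon>))"
          by (rule \<phi>_eq_left[OF poles, where \<eta> = \<epsilon>]) (use elim in simp_all)
        moreover have "1 - complex_of_real (- \<epsilon>) = Complex (1 + \<epsilon>) 0" by (simp add: complex_eq_iff)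
        ultimately show ?thesis by (simp only: norm_mult)
      qed
      also have "\<dots> \<le> (\<bar>C\<bar> * \<epsilon>) * (\<mu> 1 powr - \<epsilon> * (6 * dhat / (\<epsilon> / 4)))"
      proof (intro mult_mono)
        have "norm (gamma_quot d \<beta> (of_real (- \<epsilon>))) \<le> C * \<epsilon>" using elim by simp
        also have "\<dots> \<le> \<bar>C\<bar> * \<epsilon>" using elim by (intro mult_right_mono) auto
        finally show "norm (gamma_quot d \<beta> (of_real (- \<epsilon>))) \<le> \<bar>C\<bar> * \<epsilon>" .
        have "6 * dhat / (1 - 2 powr - \<epsilon>) \<le> 6 * dhat / (\<epsilon> / 4)"
          using elim dhat_nonneg one_minus_two_powr_ge[of \<epsilon>] by (intro divide_left_mono mult_pos_pos) auto
        hence "\<mu> 1 powr - \<epsilon> * (6 * dhat / (1 - 2 powr - \<epsilon>)) \<le> \<mu> 1 powr - \<epsilon> * (6 * dhat / (\<epsilon> / 4))"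
          by (rule mult_left_mono) simp
        thus "norm (\<psi> (Complex (1 + \<epsilon>) 0)) \<le> \<mu> 1 powr - \<epsilon> * (6 * dhat / (\<epsilon> / 4))"
          using norm_\<psi>_le[OF elim(1), of 0] by (rule order_trans[rotated])
      qed (use elim in auto)
      also have "\<dots> = 24 * \<bar>C\<bar> * dhat * \<mu> 1 powr - \<epsilon>" using elim by simp
      finally show ?case .
    qed
  qed simp
qed

text \<open>The Perron integral is moved to \<open>Re s = -\<eta>\<close>, where
  \<open>\<phi>\<close> is \<open>gamma_quot\<close> times the absolutely convergent series of
  \<open>\<psi> (1 - s)\<close>; termwise integration, the hypothesis on \<open>C1\<close> and the
  dyadic sum bound the result. The last factor of the main term is \<open>mexp (1 / T) ^ k\<close>,
  the damping at the pole \<open>s = 1\<close>.\<close>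

theorem smoothed_estimate:
  assumes d: "d \<ge> 2" and \<eta>: "0 < \<eta>" "\<eta> < \<eta>'" "\<eta> \<le> 1" and k: "real d * (1/2 + \<eta>) + 1 \<le> real k"
    and poles: "\<And>\<nu> s. \<nu> \<in> {1..d} \<Longrightarrow> (1 - s) / 2 + \<beta> \<nu> \<in> \<int>\<^sub>\<le>\<^sub>0 \<Longrightarrow> Re s = 0 \<or> \<bar>Re s\<bar> > \<eta>'"
    and zero: "(gamma_quot d \<beta> \<longlongrightarrow> 0) (at 0)"
    and near: "eventually (\<lambda>s. norm (gamma_quot d \<beta> s) \<le> C0 * norm s) (at 0)"
    and C1: "C1 \<ge> 0" "\<And>T y. T \<ge> 1 \<Longrightarrow>
      norm (LINT t|lborel. exp (of_real y * Complex (-\<eta>) t) * (exp_mult (twist_list \<beta> d) (Complex (-\<eta>) t) * (gamma_quot d \<beta> (Complex (-\<eta>) t) * (mexp (Complex (-\<eta>) t / of_real T) ^ k / Complex (-\<eta>) t))))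
        \<le> C1 * T powr ((real d - 1) / 2) * min (exp (\<eta> * (y - real d * ln T))) (exp (- \<eta> * (y - real d * ln T)))"
    and T: "T \<ge> 1"
  defines "\<tau>s \<equiv> twist_list \<beta> d"
  shows "\<bar>shift_sum \<tau>s (smooth_count (1 / T) k) y - delta1 \<phi> * exp y * (\<Prod>\<tau>\<leftarrow>\<tau>s. exp \<tau> + 1) * ((exp (1 / T) - 1) * T) ^ k\<bar>
    \<le> (6 * C1 / (1 - 2 powr - \<eta>) + 24 * \<bar>C0\<bar> * 2 ^ length \<tau>s) * dhat * T powr ((real d - 1) / 2)"
proof -
  define Q where "Q = T powr ((real d - 1) / 2)"
  have Q: "Q \<ge> 1" unfolding Q_def by (rule ge_one_powr_ge_zero) (use T d in auto)
  define w where "w = 1 / T"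
  have w: "w > 0" using T by (simp add: w_def)
  have "real d * (1/2 + \<eta>) \<ge> 0" using \<eta> by simp
  hence "real k \<ge> 1" using k by linarith
  hence k1: "k \<ge> 1" by simp
  define s where "s = (\<lambda>t. Complex (-\<eta>) t)"
  define F where "F = (\<lambda>s. exp (of_real y * s) * smooth_kernel \<tau>s w k s)"
  define h where "h = (\<lambda>L t. exp (of_real L * s t) * (exp_mult \<tau>s (s t) * (gamma_quot d \<beta> (s t) * (mexp (s t / of_real T) ^ k / s t))))"
  \<comment> \<open>In \<open>\<psi> (1 - s)\<close> the power
    \<open>\<mu>\<^sub>n powr (s - 1)\<close> is split into \<open>1 / \<mu>\<^sub>n\<close>, put
    into the coefficient, and an exponential with exponent \<open>ln \<mu>\<^sub>n\<close>.\<close>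
  define c where "c = (\<lambda>n. b (Suc n) / of_real (\<mu> (Suc n)))"
  define e where "e = (\<lambda>n. ln (\<mu> (Suc n)))"
  have h_int: "integrable lborel (h L)" for L
    unfolding h_def s_def \<tau>s_def using gamma_quot_line_shift(2)[OF _ \<eta> k poles zero T, where y = L] d by simp
  have nc: "norm (c n) * exp (e n * (-\<eta>)) = norm (b (Suc n)) * exp (- ln (\<mu> (Suc n)) * (1 + \<eta>))" for n
  proof -
    have "- ln (\<mu> (Suc n)) * (1 + \<eta>) = - ln (\<mu> (Suc n)) + e n * (-\<eta>)" by (simp add: e_def algebra_simps)
    hence "exp (- ln (\<mu> (Suc n)) * (1 + \<eta>)) = inverse (\<mu> (Suc n)) * exp (e n * (-\<eta>))"
      using \<mu>_pos[of n] by (simp only: exp_add) (simp add: exp_minus)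
    moreover have "norm (c n) = norm (b (Suc n)) * inverse (\<mu> (Suc n))"
      using \<mu>_pos[of n] by (simp add: c_def norm_divide) (simp add: divide_inverse)
    ultimately show ?thesis by (simp only: mult.assoc)
  qed
  have csum: "summable (\<lambda>n. norm (c n) * exp (e n * (-\<eta>)))"
    unfolding nc by (rule \<psi>_summable) (use \<eta> in simp)
  have \<psi>c: "\<psi> (1 - s t) = gds c e (s t)" for t
  proof -
    have "b (Suc n) * exp (of_real (- ln (\<mu> (Suc n))) * (1 - s t)) = c n * exp (of_real (e n) * s t)" for n
    proof -
      have "exp (of_real (- ln (\<mu> (Suc n))) * (1 - s t)) = exp (- of_real (ln (\<mu> (Suc n)))) * exp (of_real (e n) * s t)"
        unfolding exp_add[symmetric] e_def by (simp add: algebra_simps)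
      also have "exp (- complex_of_real (ln (\<mu> (Suc n)))) = inverse (of_real (\<mu> (Suc n)))"
        using \<mu>_pos[of n] by (simp add: exp_minus exp_of_real)
      finally show ?thesis by (simp add: c_def divide_inverse)
    qed
    thus ?thesis by (subst \<psi>_eq) (use \<eta> in \<open>simp_all add: s_def gds_def\<close>)
  qed
  have \<phi>s: "\<phi> (s t) = gamma_quot d \<beta> (s t) * \<psi> (1 - s t)" for t
    by (rule \<phi>_eq_left[OF poles \<eta>(1,2)]) (auto simp: s_def)
  have \<phi>F: "\<phi> (s t) * F (s t) = gds c e (s t) * h y t" for t
    by (simp add: \<phi>s \<psi>c F_def h_def smooth_kernel_def w_def)
  have bound: "norm (LINT t|lborel. \<phi> (s t) * F (s t)) \<le> C1 * Q * (6 * dhat / (1 - 2 powr - \<eta>))"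
  proof (rule norm_sums_le)
    show "(\<lambda>n. c n * (LINT t|lborel. exp (of_real (e n) * s t) * h y t)) sums (LINT t|lborel. \<phi> (s t) * F (s t))"
      unfolding \<phi>F using gds_line_integral(1)[OF h_int[of y] csum] by (simp add: s_def)
    fix N
    \<comment> \<open>This is \<open>T ^ d / X\<close> in the variable \<open>y\<close>, so that the
      kernel bound depends on \<open>\<mu>\<^sub>n / Z\<close> only.\<close>
    define Z where "Z = exp (real d * ln T - y)"
    have Z: "Z > 0" by (simp add: Z_def)
    have "norm (c n * (LINT t|lborel. exp (of_real (e n) * s t) * h y t)) \<le>
        C1 * Q * (norm (b (Suc n)) / \<mu> (Suc n) * min ((\<mu> (Suc n) / Z) powr \<eta>) ((\<mu> (Suc n) / Z) powr - \<eta>))" for n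
    proof -
      have "exp (of_real (e n) * s t) * h y t = h (y + e n) t" for t
        unfolding h_def mult.assoc[symmetric] exp_add[symmetric] of_real_add distrib_right by (simp add: add.commute)
      hence "norm (LINT t|lborel. exp (of_real (e n) * s t) * h y t) = norm (LINT t|lborel. h (y + e n) t)" by simp
      also have "\<dots> \<le> C1 * Q * min (exp (\<eta> * (y + e n - real d * ln T))) (exp (- \<eta> * (y + e n - real d * ln T)))"
        unfolding h_def s_def \<tau>s_def Q_def by (rule C1(2)[OF T])
      also have "y + e n - real d * ln T = ln (\<mu> (Suc n) / Z)"
        using \<mu>_pos[of n] by (simp add: ln_div Z e_def) (simp add: Z_def)
      also have "exp (\<eta> * ln (\<mu> (Suc n) / Z)) = (\<mu> (Suc n) / Z) powr \<eta>" using \<mu>_pos[of n] Z by (simp add: powr_def)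
      also have "exp (- \<eta> * ln (\<mu> (Suc n) / Z)) = (\<mu> (Suc n) / Z) powr - \<eta>" using \<mu>_pos[of n] Z by (simp add: powr_def)
      finally have *: "norm (LINT t|lborel. exp (of_real (e n) * s t) * h y t) \<le> C1 * Q * min ((\<mu> (Suc n) / Z) powr \<eta>) ((\<mu> (Suc n) / Z) powr - \<eta>)" .
      have "norm (c n) = norm (b (Suc n)) / \<mu> (Suc n)" using \<mu>_pos[of n] by (simp add: c_def norm_divide)
      thus ?thesis using mult_left_mono[OF * norm_ge_zero[of "c n"]] by (simp add: norm_mult mult_ac)
    qed
    hence "(\<Sum>n<N. norm (c n * (LINT t|lborel. exp (of_real (e n) * s t) * h y t))) \<le>
        (\<Sum>n<N. C1 * Q * (norm (b (Suc n)) / \<mu> (Suc n) * min ((\<mu> (Suc n) / Z) powr \<eta>) ((\<mu> (Suc n) / Z) powr - \<eta>)))"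
      by (rule sum_mono)
    also have "\<dots> \<le> C1 * Q * (6 * dhat / (1 - 2 powr - \<eta>))"
      unfolding sum_distrib_left[symmetric] using C1(1) Q \<eta> Z by (intro mult_left_mono weight_sum_le) auto
    finally show "(\<Sum>n<N. norm (c n * (LINT t|lborel. exp (of_real (e n) * s t) * h y t))) \<le> C1 * Q * (6 * dhat / (1 - 2 powr - \<eta>))" .
  qed
  obtain M R where MR: "M \<ge> 1" "R \<ge> 2" "\<And>\<sigma> t. \<bar>\<sigma>\<bar> \<le> \<eta> \<Longrightarrow> \<bar>t\<bar> \<ge> R \<Longrightarrow> norm (gamma_quot d \<beta> (Complex \<sigma> t)) \<le> M * \<bar>t\<bar> powr (real d * (1/2 - \<sigma>))"
    using norm_gamma_quot_bounds[of \<eta> d \<beta>] by blast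
  define B where "B = \<mu> 1 powr - \<eta> * (6 * dhat / (1 - 2 powr - \<eta>))"
  have B: "norm (\<psi> (1 - s t)) \<le> B" for t
  proof -
    have "1 - s t = Complex (1 + \<eta>) (- t)" by (simp add: s_def complex_eq_iff)
    thus ?thesis unfolding B_def using norm_\<psi>_le[OF \<eta>(1), of "- t"] by simp
  qed
  have left: "norm (\<phi> (Complex (-\<eta>) t)) \<le> (M * B) * \<bar>t\<bar> powr (real d * (1/2 + \<eta>))" if "\<bar>t\<bar> \<ge> R" for t
  proof -
    have "norm (\<phi> (s t)) \<le> (M * \<bar>t\<bar> powr (real d * (1/2 - - \<eta>))) * B"
      unfolding \<phi>s norm_mult s_def[symmetric]
      by (intro mult_mono B) (use MR(3)[of "-\<eta>" t] MR(1) that \<eta> in \<open>auto simp: s_def\<close>)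
    thus ?thesis by (simp add: s_def mult_ac)
  qed
  obtain M' R' where growth: "\<And>\<sigma> t. \<bar>\<sigma>\<bar> \<le> \<eta> + 2 \<Longrightarrow> \<bar>t\<bar> \<ge> R' \<Longrightarrow> norm (\<phi> (Complex \<sigma> t)) \<le> exp (M' * \<bar>t\<bar>)"
    using functional_equation_everywhere(2)[OF FE p\<phi> p\<psi>, of "\<eta> + 2"] by blast
  have "(LINT t|lborel. \<phi> (Complex 2 t) * F (Complex 2 t)) = (LINT t|lborel. \<phi> (s t) * F (s t))
        + 2 * pi * (\<phi> 0 * exp_mult \<tau>s 0 + of_real (delta1 \<phi>) * F 1)"
    unfolding F_def s_def
    by (rule dirichlet_contour_shift(4)[OF \<phi>_hol residue_limit_at_1[OF p\<phi>, unfolded residue_real] growth \<phi>_bound left k k1 w \<eta>(1)])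
  also have "(LINT t|lborel. \<phi> (Complex 2 t) * F (Complex 2 t)) = of_real (2 * pi * shift_sum \<tau>s (smooth_count w k) y)"
    unfolding F_def by (rule right_line_integral[OF w k1])
  finally have main: "of_real (2 * pi * shift_sum \<tau>s (smooth_count w k) y) = (LINT t|lborel. \<phi> (s t) * F (s t))
        + 2 * pi * (\<phi> 0 * exp_mult \<tau>s 0 + of_real (delta1 \<phi>) * F 1)" .
  define V where "V = delta1 \<phi> * exp y * (\<Prod>\<tau>\<leftarrow>\<tau>s. exp \<tau> + 1) * ((exp (1 / T) - 1) * T) ^ k"
  have P0: "exp_mult \<tau>s 0 = 2 ^ length \<tau>s" for \<tau>s by (induction \<tau>s) auto
  have "exp_mult \<tau>s 1 = of_real (\<Prod>\<tau>\<leftarrow>\<tau>s. exp \<tau> + 1)" using exp_mult_of_real[of \<tau>s 1] by simp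
  moreover have "mexp (complex_of_real w * 1) = of_real ((exp (1 / T) - 1) * T)"
    using T by (simp add: mexp_def w_def exp_of_real[symmetric])
  ultimately have "complex_of_real (delta1 \<phi>) * F 1 = of_real V"
    by (simp add: F_def smooth_kernel_def V_def exp_of_real mult_ac)
  with main have "(LINT t|lborel. \<phi> (s t) * F (s t)) + 2 * pi * (\<phi> 0 * 2 ^ length \<tau>s)
     = of_real (2 * pi * (shift_sum \<tau>s (smooth_count w k) y - V))"
    by (simp add: P0 algebra_simps)
  hence "2 * pi * \<bar>shift_sum \<tau>s (smooth_count w k) y - V\<bar> = norm ((LINT t|lborel. \<phi> (s t) * F (s t)) + 2 * pi * (\<phi> 0 * 2 ^ length \<tau>s))"
    by (simp only: norm_of_real) (simp add: abs_mult)
  also have "\<dots> \<le> C1 * Q * (6 * dhat / (1 - 2 powr - \<eta>)) + 2 * pi * (24 * \<bar>C0\<bar> * dhat * 2 ^ length \<tau>s)"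
  proof (rule order_trans[OF norm_triangle_ineq add_mono[OF bound]])
    have "\<eta>' > 0" using \<eta> by simp
    have "norm (2 * pi * (\<phi> 0 * 2 ^ length \<tau>s)) = 2 * pi * (norm (\<phi> 0) * 2 ^ length \<tau>s)"
      by (simp add: norm_mult norm_power)
    also have "\<dots> \<le> 2 * pi * (24 * \<bar>C0\<bar> * dhat * 2 ^ length \<tau>s)"
      by (intro mult_left_mono mult_right_mono \<phi>_0_le[OF near \<open>\<eta>' > 0\<close> poles]) auto
    finally show "norm (2 * pi * (\<phi> 0 * 2 ^ length \<tau>s)) \<le> 2 * pi * (24 * \<bar>C0\<bar> * dhat * 2 ^ length \<tau>s)" .
  qed
  \<comment> \<open>Both parts are brought to the form \<open>2 * pi * dhat * Q\<close> up to
    constants, by \<open>2 * pi \<ge> 1\<close> and \<open>Q \<ge> 1\<close>, so that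
    \<open>2 * pi\<close> can be cancelled.\<close>
  also have "\<dots> \<le> 2 * pi * (C1 * Q * (6 * dhat / (1 - 2 powr - \<eta>))) + 2 * pi * (24 * \<bar>C0\<bar> * dhat * 2 ^ length \<tau>s * Q)"
  proof (rule add_mono)
    have "2 powr - \<eta> \<le> (1::real)" using powr_mono[of "-\<eta>" 0 "2::real"] \<eta> by simp
    hence "0 \<le> C1 * Q * (6 * dhat / (1 - 2 powr - \<eta>))" using C1(1) Q dhat_nonneg by simp
    thus "C1 * Q * (6 * dhat / (1 - 2 powr - \<eta>)) \<le> 2 * pi * (C1 * Q * (6 * dhat / (1 - 2 powr - \<eta>)))"
      using mult_right_mono[of 1 "2 * pi"] pi_gt3 by fastforce
    have "0 \<le> 24 * \<bar>C0\<bar> * dhat * 2 ^ length \<tau>s" using dhat_nonneg by simp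
    from mult_left_mono[OF Q this]
    show "2 * pi * (24 * \<bar>C0\<bar> * dhat * 2 ^ length \<tau>s) \<le> 2 * pi * (24 * \<bar>C0\<bar> * dhat * 2 ^ length \<tau>s * Q)"
      by simp
  qed
  also have "\<dots> = 2 * pi * ((6 * C1 / (1 - 2 powr - \<eta>) + 24 * \<bar>C0\<bar> * 2 ^ length \<tau>s) * dhat * Q)"
    by (simp add: algebra_simps)
  finally show ?thesis unfolding V_def Q_def w_def by simp
qed

end

section \<open>Inverting sums of translates\<close>

text \<open>Induction over intervals of length \<tau>. Passing from \<open>y\<close> to
  \<open>y + \<tau>\<close> adds \<open>C\<close> to the constant in the bound, which is absorbed
  because the comparison function grows by the factor
  \<open>exp (\<kappa> * \<tau>) > 1\<close>.\<close>

lemma alternating_growth_bound: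
  fixes H :: "real \<Rightarrow> real"
  assumes \<tau>: "\<tau> > 0" and \<kappa>: "\<kappa> > 0" and D: "D \<ge> 0" and B: "B \<ge> 0" and C: "C \<ge> 0"
    and base: "\<And>y. y0 \<le> y \<Longrightarrow> y < y0 + \<tau> \<Longrightarrow> \<bar>H y\<bar> \<le> B * D"
    and step: "\<And>y. y0 \<le> y \<Longrightarrow> \<bar>H y + H (y + \<tau>)\<bar> \<le> C * (D * exp (\<kappa> * (y - y0)))"
    and y: "y0 \<le> y"
  shows "\<bar>H y\<bar> \<le> (B + C / (exp (\<kappa> * \<tau>) - 1)) * (D * exp (\<kappa> * (y - y0)))"
proof -
  define q where "q = exp (\<kappa> * \<tau>) - 1"
  have q: "q > 0" using \<kappa> \<tau> by (simp add: q_def)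
  \<comment> \<open>Chosen such that \<open>K + C \<le> K * exp (\<kappa> * \<tau>)\<close>; then
    \<open>K\<close> is preserved from one interval to the next.\<close>
  define K where "K = B + C / q"
  have K: "B \<le> K" "K \<ge> 0" using B C q by (auto simp: K_def)
  have Kq: "K + C \<le> K * exp (\<kappa> * \<tau>)"
  proof -
    have "C \<le> K * q" using B q by (simp add: K_def distrib_right)
    thus ?thesis by (simp add: q_def right_diff_distrib)
  qed
  have "y0 \<le> y \<longrightarrow> y < y0 + real (Suc n) * \<tau> \<longrightarrow> \<bar>H y\<bar> \<le> K * (D * exp (\<kappa> * (y - y0)))" for n y
  proof (induction n arbitrary: y)
    case 0
    show ?case
    proof (intro impI)
      assume y: "y0 \<le> y" "y < y0 + real (Suc 0) * \<tau>"
      have "\<bar>H y\<bar> \<le> B * D" using base[of y] y by simp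
      also have "\<dots> \<le> K * (D * exp (\<kappa> * (y - y0)))"
      proof (intro mult_mono)
        have "1 \<le> exp (\<kappa> * (y - y0))" using \<kappa> y by simp
        from mult_left_mono[OF this D] show "D \<le> D * exp (\<kappa> * (y - y0))" by simp
      qed (use K D in auto)
      finally show "\<bar>H y\<bar> \<le> K * (D * exp (\<kappa> * (y - y0)))" .
    qed
  next
    case (Suc n)
    show ?case
    proof (intro impI)
      assume y: "y0 \<le> y" "y < y0 + real (Suc (Suc n)) * \<tau>"
      show "\<bar>H y\<bar> \<le> K * (D * exp (\<kappa> * (y - y0)))"
      proof (cases "y < y0 + \<tau>")
        case True
        have "y0 + \<tau> \<le> y0 + real (Suc n) * \<tau>" using \<tau> by simp
        with True have "y < y0 + real (Suc n) * \<tau>" by linarith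
        thus ?thesis using Suc[of y] y by blast
      next
        case False
        define z where "z = y - \<tau>"
        have z: "y0 \<le> z" "z < y0 + real (Suc n) * \<tau>" using False y by (auto simp: z_def algebra_simps)
        define E where "E = D * exp (\<kappa> * (z - y0))"
        have E: "E \<ge> 0" using D by (simp add: E_def)
        have "\<bar>H z\<bar> \<le> K * E" "\<bar>H z + H (z + \<tau>)\<bar> \<le> C * E"
          unfolding E_def using Suc[of z] z step[OF z(1)] by blast+
        hence "\<bar>H (z + \<tau>)\<bar> \<le> (K + C) * E" by (simp add: distrib_right)
        also have "\<dots> \<le> (K * exp (\<kappa> * \<tau>)) * E" by (rule mult_right_mono[OF Kq E])
        also have "\<dots> = K * (D * exp (\<kappa> * (y - y0)))"
        proof -
          have "\<kappa> * (y - y0) = \<kappa> * \<tau> + \<kappa> * (z - y0)" by (simp add: z_def algebra_simps)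
          thus ?thesis unfolding E_def by (simp only: exp_add) (simp add: mult_ac)
        qed
        finally show ?thesis by (simp add: z_def)
      qed
    qed
  qed
  moreover obtain n :: nat where "(y - y0) / \<tau> < real n" using reals_Archimedean2 by blast
  hence "y < y0 + real (Suc n) * \<tau>" using \<tau> by (simp add: divide_less_eq algebra_simps)
  ultimately have "\<bar>H y\<bar> \<le> K * (D * exp (\<kappa> * (y - y0)))" using y by blast
  thus ?thesis by (simp only: K_def q_def)
qed

text \<open>Carries a crude bound on \<open>g\<close> over to its sums of translates; this starts
  the inversion on the first interval.\<close>

lemma shift_sum_growth:
  fixes g :: "real \<Rightarrow> real"
  assumes "\<And>\<tau>. \<tau> \<in> set \<tau>s \<Longrightarrow> \<tau> > 0"
    and "\<And>y. y0 \<le> y \<Longrightarrow> \<bar>g y\<bar> \<le> A * exp (y - y0)" and "y0 \<le> y"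
  shows "\<bar>shift_sum \<tau>s g y\<bar> \<le> A * (\<Prod>\<tau>\<leftarrow>\<tau>s. exp \<tau> + 1) * exp (y - y0)"
  using assms(1,3)
proof (induction \<tau>s arbitrary: y)
  case Nil
  thus ?case using assms(2)[of y] by simp
next
  case (Cons \<tau> \<tau>s)
  define p where "p = (\<Prod>\<tau>\<leftarrow>\<tau>s. exp \<tau> + 1)"
  have \<tau>: "\<tau> > 0" using Cons by simp
  have y: "y0 \<le> y + \<tau>" using \<tau> Cons.prems(2) by linarith
  have "\<bar>shift_sum \<tau>s g y\<bar> \<le> A * p * exp (y - y0)"
    unfolding p_def by (rule Cons.IH) (use Cons.prems in auto)
  moreover have "\<bar>shift_sum \<tau>s g (y + \<tau>)\<bar> \<le> A * p * exp (y + \<tau> - y0)"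
    unfolding p_def by (rule Cons.IH) (use Cons.prems(1) y in auto)
  ultimately have "\<bar>shift_sum \<tau>s g y + shift_sum \<tau>s g (y + \<tau>)\<bar> \<le> A * p * exp (y - y0) + A * p * exp (y + \<tau> - y0)"
    by linarith
  also have "exp (y + \<tau> - y0) = exp \<tau> * exp (y - y0)" unfolding exp_add[symmetric] by simp
  also have "A * p * exp (y - y0) + A * p * (exp \<tau> * exp (y - y0)) = A * ((exp \<tau> + 1) * p) * exp (y - y0)" by (simp add: algebra_simps)
  finally show ?case by (simp add: p_def)
qed

text \<open>A factor \<open>1 + e\<^bsup>\<tau>s\<^esup>\<close> is inverted by solving \<open>H y + H (y + \<tau>) = h y\<close> forwards in \<open>y\<close>; the
  geometric growth of the error term dominates the accumulated errors.\<close>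

lemma shift_sum_inversion:
  fixes \<kappa> A C :: real
  assumes \<tau>s: "\<forall>\<tau>\<in>set \<tau>s. \<tau> > 0" and \<kappa>: "\<kappa> > 0" and A: "A \<ge> 0" and C: "C \<ge> 0"
  shows "\<exists>K\<ge>0. \<forall>(g :: real \<Rightarrow> real) y0 D. D \<ge> 0 \<longrightarrow> (\<forall>y\<ge>y0. \<bar>g y\<bar> \<le> A * D * exp (y - y0)) \<longrightarrow>
      (\<forall>y\<ge>y0. \<bar>shift_sum \<tau>s g y\<bar> \<le> C * (D * exp (\<kappa> * (y - y0)))) \<longrightarrow> (\<forall>y\<ge>y0. \<bar>g y\<bar> \<le> K * (D * exp (\<kappa> * (y - y0))))"
  using \<tau>s C
proof (induction \<tau>s arbitrary: C)
  case Nil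
  thus ?case by (intro exI[of _ C]) simp
next
  case (Cons \<tau> \<tau>s)
  have \<tau>: "\<tau> > 0" using Cons by simp
  define p where "p = (\<Prod>\<tau>\<leftarrow>\<tau>s. exp \<tau> + 1)"
  have p: "p \<ge> 0" unfolding p_def by (rule prod_list_nonneg) auto
  \<comment> \<open>Bounds the remaining sum of translates on \<open>[y0, y0 + \<tau>)\<close> by
    the crude estimate; \<open>exp \<tau>\<close> accounts for \<open>exp (y - y0)\<close>
    there.\<close>
  define B where "B = A * p * exp \<tau>"
  have B: "B \<ge> 0" using A p by (simp add: B_def)
  define C' where "C' = B + C / (exp (\<kappa> * \<tau>) - 1)"
  have "exp (\<kappa> * \<tau>) > 1" using \<tau> \<kappa> by simp
  hence "C' \<ge> 0" using B Cons.prems(2) by (simp add: C'_def)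
  then obtain K where K: "K \<ge> 0" "\<And>(g :: real \<Rightarrow> real) y0 D. D \<ge> 0 \<Longrightarrow> (\<forall>y\<ge>y0. \<bar>g y\<bar> \<le> A * D * exp (y - y0)) \<Longrightarrow>
      (\<forall>y\<ge>y0. \<bar>shift_sum \<tau>s g y\<bar> \<le> C' * (D * exp (\<kappa> * (y - y0)))) \<Longrightarrow> (\<forall>y\<ge>y0. \<bar>g y\<bar> \<le> K * (D * exp (\<kappa> * (y - y0))))"
    using Cons.IH[of C'] Cons.prems(1) by auto
  show ?case
  proof (intro exI[of _ K] conjI K(1) allI impI)
    fix g :: "real \<Rightarrow> real" and y0 D y
    assume D: "D \<ge> 0" and lin: "\<forall>y\<ge>y0. \<bar>g y\<bar> \<le> A * D * exp (y - y0)"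
      and step: "\<forall>y\<ge>y0. \<bar>shift_sum (\<tau> # \<tau>s) g y\<bar> \<le> C * (D * exp (\<kappa> * (y - y0)))" and y: "y0 \<le> y"
    have "\<bar>shift_sum \<tau>s g y\<bar> \<le> C' * (D * exp (\<kappa> * (y - y0)))" if y: "y0 \<le> y" for y
      unfolding C'_def
    proof (rule alternating_growth_bound[OF \<tau> \<kappa> D B Cons.prems(2) _ _ y])
      fix y assume y: "y0 \<le> y" "y < y0 + \<tau>"
      have "\<bar>shift_sum \<tau>s g y\<bar> \<le> (A * D) * p * exp (y - y0)"
        unfolding p_def by (rule shift_sum_growth) (use Cons.prems(1) lin y in auto)
      also have "\<dots> \<le> (A * D) * p * exp \<tau>" using y A D p by (intro mult_left_mono) auto
      finally show "\<bar>shift_sum \<tau>s g y\<bar> \<le> B * D" by (simp add: B_def mult_ac)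
    qed (use step in auto)
    with K(2)[OF D lin] y show "\<bar>g y\<bar> \<le> K * (D * exp (\<kappa> * (y - y0)))" by blast
  qed
qed

lemma exp_minus_one_le:
  assumes "0 \<le> (x :: real)"
  shows "exp x - 1 \<le> x * exp x"
proof -
  have "(1 - x) * exp x \<le> exp (- x) * exp x"
    using exp_ge_add_one_self[of "-x"] by (intro mult_right_mono) auto
  thus ?thesis by (simp add: exp_minus algebra_simps)
qed

context dirichlet_pair
begin

text \<open>As \<open>shift_sum\<close> is monotone, the sum of translates of \<open>count\<close>
  at \<open>y\<close> lies between the smoothed ones at \<open>y - k * w\<close> and
  \<open>y\<close>. The displacement by \<open>k * w\<close> and the factor \<open>m ^ k\<close>,
  with \<open>m\<close> between 1 and \<open>exp w\<close>, change the main term by a relative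
  O(1/T).\<close>

theorem unsmoothed_estimate:
  assumes T: "T \<ge> 1" and k: "k \<ge> 1" and \<tau>s: "p = (\<Prod>\<tau>\<leftarrow>\<tau>s. exp \<tau> + 1)"
    and est: "\<And>y. \<bar>shift_sum \<tau>s (smooth_count (1 / T) k) y - delta1 \<phi> * exp y * p * ((exp (1 / T) - 1) * T) ^ k\<bar> \<le> E"
  shows "\<bar>shift_sum \<tau>s count y - p * (delta1 \<phi> * exp y)\<bar> \<le> p * real k * exp (real k) * (delta1 \<phi> * exp y / T) + E"
proof -
  define w where "w = 1 / T"
  have w: "w > 0" "w \<le> 1" using T by (auto simp: w_def)
  define m where "m = (exp w - 1) * T"
  define V where "V = p * (delta1 \<phi> * exp y)"
  have p: "p \<ge> 0" unfolding \<tau>s by (rule prod_list_nonneg) auto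
  hence V: "V \<ge> 0" using delta1_nonneg by (simp add: V_def)
  have m1: "m \<ge> 1"
  proof -
    have "w \<le> exp w - 1" using exp_ge_add_one_self[of w] by linarith
    hence "w * T \<le> (exp w - 1) * T" using T by (intro mult_right_mono) auto
    thus ?thesis using T by (simp add: m_def w_def)
  qed
  have m2: "m \<le> exp w"
  proof -
    have "(exp w - 1) * T \<le> (w * exp w) * T" using exp_minus_one_le[of w] w T by (intro mult_right_mono) auto
    thus ?thesis using T by (simp add: m_def w_def)
  qed
  have mk: "1 \<le> m ^ k" using m1 by (rule one_le_power)
  have "m ^ k \<le> exp w ^ k" using m1 m2 by (intro power_mono) auto
  also have "\<dots> = exp (real k * w)" by (simp add: exp_of_nat_mult)
  also have "\<dots> \<le> 1 + real k * w * exp (real k * w)" using exp_minus_one_le[of "real k * w"] w by simp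
  also have "\<dots> \<le> 1 + real k * w * exp (real k)" using w by (intro add_left_mono mult_left_mono) (auto simp: mult_left_le)
  finally have mk2: "m ^ k \<le> 1 + real k * w * exp (real k)" .
  have est': "\<bar>shift_sum \<tau>s (smooth_count w k) z - delta1 \<phi> * exp z * p * m ^ k\<bar> \<le> E" for z
    using est[of z] by (simp add: w_def m_def)
  have "shift_sum \<tau>s count y \<le> shift_sum \<tau>s (smooth_count w k) y"
    by (intro shift_sum_mono count_le_smooth_count w k)
  also have "\<dots> \<le> V * m ^ k + E" using est'[of y] by (simp add: V_def mult_ac abs_le_iff)
  also have "V * m ^ k \<le> V * (1 + real k * w * exp (real k))" by (rule mult_left_mono[OF mk2 V])
  finally have upper: "shift_sum \<tau>s count y - V \<le> V * (real k * w * exp (real k)) + E" by (simp add: distrib_left)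
  have "shift_sum \<tau>s (smooth_count w k) (y - real k * w) \<le> shift_sum \<tau>s (\<lambda>x. count (x + real k * w)) (y - real k * w)"
    by (intro shift_sum_mono smooth_count_le_count w k)
  also have "\<dots> = shift_sum \<tau>s count y" by (simp add: shift_sum_translate)
  finally have l1: "shift_sum \<tau>s (smooth_count w k) (y - real k * w) \<le> shift_sum \<tau>s count y" .
  have "V * exp (- (real k * w)) * m ^ k - E \<le> shift_sum \<tau>s (smooth_count w k) (y - real k * w)"
  proof -
    have "exp (y - real k * w) = exp y * exp (- (real k * w))" by (simp flip: exp_add)
    hence "delta1 \<phi> * exp (y - real k * w) * p * m ^ k = V * exp (- (real k * w)) * m ^ k" by (simp add: V_def mult_ac)
    with est'[of "y - real k * w"] show ?thesis by (simp add: abs_le_iff)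
  qed
  moreover have "V * (1 - real k * w) \<le> V * exp (- (real k * w)) * m ^ k"
  proof -
    have "V * (1 - real k * w) \<le> V * exp (- (real k * w))" using exp_ge_add_one_self[of "- (real k * w)"] V by (intro mult_left_mono) auto
    also have "\<dots> \<le> V * exp (- (real k * w)) * m ^ k" using mult_left_mono[OF mk, of "V * exp (- (real k * w))"] V by simp
    finally show ?thesis .
  qed
  moreover have "V * (real k * w) \<le> V * (real k * w * exp (real k))"
  proof (rule mult_left_mono[OF _ V])
    show "real k * w \<le> real k * w * exp (real k)" using mult_left_mono[of 1 "exp (real k)" "real k * w"] w by simp
  qed
  ultimately have lower: "V - shift_sum \<tau>s count y \<le> V * (real k * w * exp (real k)) + E"
    using l1 by (simp add: right_diff_distrib)
  have "V * (real k * w * exp (real k)) = p * real k * exp (real k) * (delta1 \<phi> * exp y / T)"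
    by (simp add: V_def w_def)
  with upper lower show ?thesis unfolding V_def[symmetric] by (simp add: abs_le_iff)
qed

text \<open>After normalisation by \<open>y0\<close>, main term and error are
  \<open>dhat * exp (y - y0)\<close> and \<open>dhat * exp (\<kappa> * (y - y0))\<close>. The
  smoothing costs \<open>dhat * exp (y - y0) / T\<close> and the dual sum costs
  \<open>dhat * T powr ((d - 1) / 2)\<close>, up to constants; both equal the error for
  \<open>T = exp (2 / (d + 1) * (y - y0))\<close>. The hypothesis on \<open>K\<close> then inverts
  the sum of translates.\<close>

theorem count_estimate:
  assumes d: "d \<ge> 1" and k: "k \<ge> 1" and \<tau>s: "p = (\<Prod>\<tau>\<leftarrow>\<tau>s. exp \<tau> + 1)"
    and C: "C \<ge> 0"
    and est: "\<And>T y. T \<ge> 1 \<Longrightarrow> \<bar>shift_sum \<tau>s (smooth_count (1 / T) k) y - delta1 \<phi> * exp y * p * ((exp (1 / T) - 1) * T) ^ k\<bar>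
        \<le> C * dhat * T powr ((real d - 1) / 2)"
    and \<kappa>: "\<kappa> = (real d - 1) / (real d + 1)"
    and C': "C' = p * real k * exp (real k) + C"
    and K: "\<forall>(g :: real \<Rightarrow> real) y0 D. D \<ge> 0 \<longrightarrow> (\<forall>y\<ge>y0. \<bar>g y\<bar> \<le> (p + C' + 1) * D * exp (y - y0)) \<longrightarrow>
      (\<forall>y\<ge>y0. \<bar>shift_sum \<tau>s g y\<bar> \<le> C' * (D * exp (\<kappa> * (y - y0)))) \<longrightarrow> (\<forall>y\<ge>y0. \<bar>g y\<bar> \<le> K * (D * exp (\<kappa> * (y - y0))))"
    and pos: "delta1 \<phi> > 0" "dhat > 0"
    and X: "X > 0" "error_term d (delta1 \<phi>) dhat X \<le> delta1 \<phi> * X"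
  shows "\<bar>(\<Sum>n | 1 \<le> n \<and> l n < X. a n) - delta1 \<phi> * X\<bar> \<le> K * error_term d (delta1 \<phi>) dhat X"
proof -
  \<comment> \<open>The point at which main term and error coincide; to the right of it the choice
    of \<open>T\<close> below satisfies \<open>T \<ge> 1\<close>.\<close>
  define y0 where "y0 = ln (dhat / delta1 \<phi>)"
  have main: "delta1 \<phi> * exp y = dhat * exp (y - y0)" for y
    using pos by (simp add: y0_def exp_diff)
  have p: "p \<ge> 0" unfolding \<tau>s by (rule prod_list_nonneg) auto
  have \<kappa>01: "0 \<le> \<kappa>" "\<kappa> < 1" "1 - \<kappa> = 2 / (real d + 1)" using d by (auto simp: \<kappa> divide_simps)
  have err: "error_term d (delta1 \<phi>) dhat (exp y) = dhat * exp (\<kappa> * (y - y0))" for y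
  proof -
    have "error_term d (delta1 \<phi>) dhat (exp y) = (exp y * delta1 \<phi>) powr \<kappa> * dhat powr (1 - \<kappa>)"
      using pos by (simp add: error_term_def powr_mult \<kappa>01(3) flip: \<kappa>)
    also have "exp y * delta1 \<phi> = dhat * exp (y - y0)" using main[of y] by (simp add: mult.commute)
    also have "(dhat * exp (y - y0)) powr \<kappa> = dhat powr \<kappa> * exp (\<kappa> * (y - y0))"
      using pos by (simp add: powr_mult) (simp add: powr_def)
    also have "dhat powr \<kappa> * exp (\<kappa> * (y - y0)) * dhat powr (1 - \<kappa>) = (dhat powr \<kappa> * dhat powr (1 - \<kappa>)) * exp (\<kappa> * (y - y0))" by simp
    also have "dhat powr \<kappa> * dhat powr (1 - \<kappa>) = dhat" using pos by (simp flip: powr_add)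
    finally show ?thesis .
  qed
  have shift_est: "\<bar>shift_sum \<tau>s count y - p * (delta1 \<phi> * exp y)\<bar> \<le> C' * (dhat * exp (\<kappa> * (y - y0)))" if y: "y0 \<le> y" for y
  proof -
    define T where "T = exp (2 / (real d + 1) * (y - y0))"
    have T: "T \<ge> 1" using y by (simp add: T_def)
    have "\<bar>shift_sum \<tau>s count y - p * (delta1 \<phi> * exp y)\<bar> \<le> p * real k * exp (real k) * (delta1 \<phi> * exp y / T) + C * dhat * T powr ((real d - 1) / 2)"
      by (rule unsmoothed_estimate[OF T k \<tau>s est[OF T]])
    also have "delta1 \<phi> * exp y / T = dhat * exp (\<kappa> * (y - y0))"
    proof -
      have "(y - y0) - 2 / (real d + 1) * (y - y0) = \<kappa> * (y - y0)"
        unfolding \<kappa>01(3)[symmetric] by (simp add: algebra_simps)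
      thus ?thesis unfolding main T_def times_divide_eq_right[symmetric] exp_diff[symmetric] by simp
    qed
    also have "T powr ((real d - 1) / 2) = exp (\<kappa> * (y - y0))"
    proof -
      have "u / 2 * (2 / v * z) = u / v * z" for u v z :: real by simp
      thus ?thesis unfolding T_def powr_def \<kappa> by (simp only: ln_exp exp_not_eq_zero if_False)
    qed
    also have "p * real k * exp (real k) * (dhat * exp (\<kappa> * (y - y0))) + C * dhat * exp (\<kappa> * (y - y0)) = C' * (dhat * exp (\<kappa> * (y - y0)))"
      by (simp add: C' distrib_right)
    finally show ?thesis .
  qed
  have C'0: "C' \<ge> 0" using p C by (simp add: C')
  define g where "g = (\<lambda>y. count y - delta1 \<phi> * exp y)"
  have sg: "shift_sum \<tau>s g y = shift_sum \<tau>s count y - p * (delta1 \<phi> * exp y)" for y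
    unfolding g_def shift_sum_diff shift_sum_scale using shift_sum_exp[of \<tau>s 1 y] by (simp add: \<tau>s)
  \<comment> \<open>A bound of the order of the main term, with which the inversion starts. It uses
    that \<open>count\<close>, being nonnegative, is at most its own sum of translates.\<close>
  have lin: "\<bar>g y\<bar> \<le> (p + C' + 1) * dhat * exp (y - y0)" if y: "y0 \<le> y" for y
  proof -
    have "\<kappa> * (y - y0) \<le> 1 * (y - y0)" using \<kappa>01 y by (intro mult_right_mono) auto
    hence "C' * (dhat * exp (\<kappa> * (y - y0))) \<le> C' * (dhat * exp (y - y0))" using C'0 pos by (intro mult_left_mono) auto
    moreover have "count y \<le> shift_sum \<tau>s count y" by (rule le_shift_sum[OF count_nonneg])
    moreover have "p * (delta1 \<phi> * exp y) = p * (dhat * exp (y - y0))" by (simp add: main)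
    ultimately have "count y \<le> (p + C') * (dhat * exp (y - y0))" using shift_est[OF y] unfolding distrib_right by linarith
    moreover have "0 \<le> dhat * exp (y - y0)" "0 \<le> count y" using pos count_nonneg by auto
    ultimately have "\<bar>count y - dhat * exp (y - y0)\<bar> \<le> (p + C') * (dhat * exp (y - y0)) + dhat * exp (y - y0)" by linarith
    thus ?thesis by (simp add: g_def main algebra_simps)
  qed
  \<comment> \<open>The condition on X says that the error is at most the main term; left of
    \<open>y0\<close> the order is reversed because \<open>\<kappa> < 1\<close>.\<close>
  have y: "y0 \<le> ln X"
  proof (rule ccontr)
    assume "\<not> y0 \<le> ln X"
    hence "1 * (ln X - y0) < \<kappa> * (ln X - y0)" using \<kappa>01 by (intro mult_strict_right_mono_neg) auto
    hence "dhat * exp (ln X - y0) < dhat * exp (\<kappa> * (ln X - y0))" using pos by simp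
    thus False using X err[of "ln X"] main[of "ln X"] by simp
  qed
  have "\<bar>g (ln X)\<bar> \<le> K * (dhat * exp (\<kappa> * (ln X - y0)))"
    by (rule K[rule_format]) (use lin shift_est pos y in \<open>auto simp: sg\<close>)
  thus ?thesis using X(1) err[of "ln X"] by (simp add: g_def count_def)
qed

end

section \<open>Vanishing residue\<close>

context dirichlet_pair
begin

text \<open>At the real point 2 the series consists of nonnegative terms, so a vanishing sum kills
  each of them.\<close>

lemma a_zero_if_\<phi>_zero:
  assumes "\<phi> 2 = 0"
  shows "a (Suc n) = 0"
proof -
  have s: "summable (\<lambda>n. a (Suc n) * exp (- ln (l (Suc n)) * 2))" by (rule \<phi>_summable) simp
  have "\<phi> 2 = (\<Sum>n. of_real (a (Suc n) * exp (- ln (l (Suc n)) * 2)))"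
    by (subst \<phi>_eq) (simp_all add: gds_def exp_of_real[symmetric])
  also have "\<dots> = of_real (\<Sum>n. a (Suc n) * exp (- ln (l (Suc n)) * 2))"
    by (rule suminf_of_real[symmetric, OF s])
  finally have "(\<Sum>n. a (Suc n) * exp (- ln (l (Suc n)) * 2)) = 0" using assms by simp
  hence "a (Suc n) * exp (- ln (l (Suc n)) * 2) = 0"
    using suminf_eq_zero_iff[OF s] a by simp
  thus ?thesis by simp
qed

text \<open>\<open>\<psi>\<close> vanishes on its half-plane of convergence, hence
  \<open>\<phi>\<close> far to the left by the functional equation, and then everywhere off 1 by the
  identity theorem.\<close>

lemma vanishing_if_b_zero:
  assumes b: "\<And>n. b (Suc n) = 0"
  shows "a (Suc n) = 0" "delta1 \<phi> = 0"
proof -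
  define B where "B = 2 * (\<Sum>\<nu>=1..d. norm (\<beta> \<nu>))"
  have "B \<ge> 0" by (simp add: B_def sum_nonneg)
  have \<psi>0: "\<psi> s = 0" if "Re s > 1" for s using \<psi>_eq[OF that] by (simp add: gds_def b)
  have "open {s. Re s < - B}" by (rule open_halfspace_Re_lt)
  moreover have "open (- {1 :: complex})" by (rule open_Compl) simp
  moreover have "{s. Re s < - B} \<noteq> {}"
  proof -
    have "of_real (- B - 1) \<in> {s. Re s < - B}" by simp
    thus ?thesis by blast
  qed
  moreover have "connected (- {1 :: complex})" by (rule connected_punctured_universe) simp
  moreover have "{s. Re s < - B} \<subseteq> - {1}" using \<open>B \<ge> 0\<close> by auto
  moreover have "\<phi> s = 0" if s: "s \<in> {s. Re s < - B}" for s
  proof -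
    have "gamma_factor d \<beta> (1 - s) \<noteq> 0"
      by (rule gamma_factor_nonzero_right) (use s in \<open>simp add: B_def\<close>)
    moreover have "\<psi> (1 - s) = 0" by (rule \<psi>0) (use s \<open>B \<ge> 0\<close> in simp)
    moreover have "s \<noteq> 0" "s \<noteq> 1" using s \<open>B \<ge> 0\<close> by auto
    ultimately show ?thesis using gamma_quot_functional_equation[OF FE p\<phi> p\<psi>, of s] by simp
  qed
  ultimately have \<phi>0: "\<phi> s = 0" if "s \<in> - {1}" for s
    using analytic_continuation_open[of "{s. Re s < - B}" "- {1}" \<phi> "\<lambda>_. 0" s] \<phi>_hol that by auto
  show "a (Suc n) = 0" by (rule a_zero_if_\<phi>_zero, rule \<phi>0) simp
  have "eventually (\<lambda>s. 0 = \<phi> s * (s - 1)) (at 1)"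
    using eventually_neq_at_within[of 1] by eventually_elim (simp add: \<phi>0)
  hence "((\<lambda>s. \<phi> s * (s - 1)) \<longlongrightarrow> 0) (at 1)" by (rule Lim_transform_eventually[OF tendsto_const])
  hence "residue \<phi> 1 = 0" using tendsto_unique[OF _ residue_limit_at_1[OF p\<phi>]] by simp
  thus "delta1 \<phi> = 0" by (simp add: delta1_def)
qed

lemma b_zero_if_dhat_zero:
  assumes "dhat = 0"
  shows "b (Suc n) = 0"
proof -
  have "(\<Sum>m<Suc n. if \<mu> (Suc m) < \<mu> (Suc n) + 1 then norm (b (Suc m)) else 0) \<le> dhat * (\<mu> (Suc n) + 1)"
    by (rule sum_le_delta_hat[OF \<mu> bdd]) (use \<mu>_pos[of n] in simp)
  hence "(\<Sum>m<n. if \<mu> (Suc m) < \<mu> (Suc n) + 1 then norm (b (Suc m)) else 0) + norm (b (Suc n)) \<le> 0"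
    by (simp add: assms)
  moreover have "0 \<le> (\<Sum>m<n. if \<mu> (Suc m) < \<mu> (Suc n) + 1 then norm (b (Suc m)) else 0)"
    by (rule sum_nonneg) simp
  ultimately have "norm (b (Suc n)) \<le> 0" by linarith
  thus ?thesis by simp
qed

text \<open>Without a residue at 1, moving the line to \<open>Re s = -A\<close> leaves
  \<open>\<phi> 0\<close> alone, and the integral there is O(exp (- A * y)). Uniformity is no issue:
  the window has width 1, the twist is empty, and k and C may depend on the pair and on A. The
  second condition on A puts the line to the left of all poles of the Gamma quotient.\<close>

lemma smooth_count_asymp:
  assumes \<delta>: "delta1 \<phi> = 0" and A: "A > 0" "1 + A > 2 * (\<Sum>\<nu>=1..d. norm (\<beta> \<nu>))"
  shows "\<exists>k\<ge>1. \<exists>C\<ge>0. \<forall>y. \<bar>smooth_count 1 k y - Re (\<phi> 0)\<bar> \<le> C * exp (- A * y)"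
proof -
  define s where "s = (\<lambda>t. Complex (-A) t)"
  obtain k :: nat where k0: "max (real d * (1/2 + A) + 1) 1 \<le> real k" using real_arch_simple by blast
  have k: "real d * (1/2 + A) + 1 \<le> real k" "k \<ge> 1" using k0 by auto
  have \<phi>s: "\<phi> (s t) = gamma_quot d \<beta> (s t) * \<psi> (1 - s t)" for t
  proof (rule gamma_quot_functional_equation[OF FE p\<phi> p\<psi>])
    show "gamma_factor d \<beta> (1 - s t) \<noteq> 0"
      by (rule gamma_factor_nonzero_right) (use A in \<open>simp add: s_def\<close>)
    have "Re (s t) < 0" using A by (simp add: s_def)
    thus "s t \<noteq> 0" "s t \<noteq> 1" by auto
  qed
  obtain M R where MR: "M \<ge> 1" "R \<ge> 2" "\<And>\<sigma> t. \<bar>\<sigma>\<bar> \<le> A \<Longrightarrow> \<bar>t\<bar> \<ge> R \<Longrightarrow> norm (gamma_quot d \<beta> (Complex \<sigma> t)) \<le> M * \<bar>t\<bar> powr (real d * (1/2 - \<sigma>))"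
    using norm_gamma_quot_bounds[of A d \<beta>] by blast
  define B where "B = \<mu> 1 powr - A * (6 * dhat / (1 - 2 powr - A))"
  have B: "norm (\<psi> (1 - s t)) \<le> B" for t
  proof -
    have "1 - s t = Complex (1 + A) (- t)" by (simp add: s_def complex_eq_iff)
    thus ?thesis unfolding B_def using norm_\<psi>_le[OF A(1), of "- t"] by simp
  qed
  have left: "norm (\<phi> (Complex (-A) t)) \<le> (M * B) * \<bar>t\<bar> powr (real d * (1/2 + A))" if "\<bar>t\<bar> \<ge> R" for t
  proof -
    have "norm (\<phi> (s t)) \<le> (M * \<bar>t\<bar> powr (real d * (1/2 - - A))) * B"
      unfolding \<phi>s norm_mult s_def[symmetric]
      by (intro mult_mono B) (use MR(3)[of "-A" t] MR(1) that A in \<open>auto simp: s_def\<close>)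
    thus ?thesis by (simp add: s_def mult_ac)
  qed
  obtain M' R' where growth: "\<And>\<sigma> t. \<bar>\<sigma>\<bar> \<le> A + 2 \<Longrightarrow> \<bar>t\<bar> \<ge> R' \<Longrightarrow> norm (\<phi> (Complex \<sigma> t)) \<le> exp (M' * \<bar>t\<bar>)"
    using functional_equation_everywhere(2)[OF FE p\<phi> p\<psi>, of "A + 2"] by blast
  have lim: "((\<lambda>s. \<phi> s * (s - 1)) \<longlongrightarrow> 0) (at 1)"
    using residue_limit_at_1[OF p\<phi>] by (simp add: residue_real \<delta>)
  define C where "C = (LINT t|lborel. norm (\<phi> (s t) * smooth_kernel [] 1 k (s t)))"
  have "C \<ge> 0" by (simp add: C_def)
  have "\<bar>smooth_count 1 k y - Re (\<phi> 0)\<bar> \<le> C * exp (- A * y)" for y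
  proof -
    define J where "J = (LINT t|lborel. \<phi> (s t) * (exp (of_real y * s t) * smooth_kernel [] 1 k (s t)))"
    have "of_real (2 * pi * shift_sum [] (smooth_count 1 k) y) = J + 2 * pi * (\<phi> 0 * exp_mult [] 0 + 0 * (exp (of_real y * 1) * smooth_kernel [] 1 k 1))"
      unfolding J_def s_def using dirichlet_contour_shift(4)[OF \<phi>_hol lim growth \<phi>_bound left k zero_less_one A(1), where y = y and \<tau>s = "[]"]
      unfolding right_line_integral[OF zero_less_one k(2)] by simp
    hence "J = of_real (2 * pi) * (of_real (smooth_count 1 k y) - \<phi> 0)" by (simp add: algebra_simps)
    hence "norm J = 2 * pi * norm (of_real (smooth_count 1 k y) - \<phi> 0)" by (simp add: norm_mult)
    moreover have "\<bar>smooth_count 1 k y - Re (\<phi> 0)\<bar> \<le> norm (of_real (smooth_count 1 k y) - \<phi> 0)"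
      using abs_Re_le_cmod[of "of_real (smooth_count 1 k y) - \<phi> 0"] by simp
    moreover have "norm (of_real (smooth_count 1 k y) - \<phi> 0) \<le> 2 * pi * norm (of_real (smooth_count 1 k y) - \<phi> 0)"
      using mult_right_mono[of 1 "2 * pi" "norm (of_real (smooth_count 1 k y) - \<phi> 0)"] pi_gt3 by simp
    ultimately have "\<bar>smooth_count 1 k y - Re (\<phi> 0)\<bar> \<le> norm J" by linarith
    also have "\<dots> \<le> (LINT t|lborel. norm (\<phi> (s t) * (exp (of_real y * s t) * smooth_kernel [] 1 k (s t))))"
      unfolding J_def by (rule integral_norm_bound)
    also have "\<dots> = (LINT t|lborel. norm (\<phi> (s t) * smooth_kernel [] 1 k (s t)) * exp (- A * y))"
      by (intro Bochner_Integration.integral_cong refl) (simp add: norm_mult s_def mult_ac)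
    also have "\<dots> = C * exp (- A * y)" unfolding C_def by simp
    finally show ?thesis .
  qed
  with k(2) \<open>C \<ge> 0\<close> show ?thesis by blast
qed

text \<open>\<open>count\<close> is monotone and at most \<open>smooth_count\<close>, which tends to
  \<open>Re (\<phi> 0)\<close>; from below it is compared with the smoothed sum at
  \<open>y - k\<close>. Thus \<open>Re (\<phi> 0)\<close> acts as the sum of all coefficients, with
  rapidly decaying tails.\<close>

lemma count_tail:
  assumes \<delta>: "delta1 \<phi> = 0" and A: "A > 0" "1 + A > 2 * (\<Sum>\<nu>=1..d. norm (\<beta> \<nu>))"
  shows "count y \<le> Re (\<phi> 0)" "\<exists>C\<ge>0. \<forall>y. Re (\<phi> 0) - count y \<le> C * exp (- A * y)"
proof -
  obtain k C where k: "k \<ge> 1" and C: "C \<ge> 0" "\<And>y. \<bar>smooth_count 1 k y - Re (\<phi> 0)\<bar> \<le> C * exp (- A * y)"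
    using smooth_count_asymp[OF assms] by blast
  have "((\<lambda>z. Re (\<phi> 0) + C * exp (- A * z)) \<longlongrightarrow> Re (\<phi> 0) + C * 0) at_top"
  proof (intro tendsto_intros filterlim_compose[OF exp_at_bot])
    show "filterlim (\<lambda>z. - A * z) at_bot at_top"
      by (rule filterlim_tendsto_neg_mult_at_bot[OF tendsto_const _ filterlim_ident]) (use A in simp)
  qed
  hence "((\<lambda>z. Re (\<phi> 0) + C * exp (- A * z)) \<longlongrightarrow> Re (\<phi> 0)) at_top" by simp
  thus "count y \<le> Re (\<phi> 0)"
  proof (rule tendsto_lowerbound)
    show "eventually (\<lambda>z. count y \<le> Re (\<phi> 0) + C * exp (- A * z)) at_top"
      using eventually_ge_at_top[of y]
    proof eventually_elim
      case (elim z)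
      have "count y \<le> count z" by (rule count_mono[OF elim])
      also have "\<dots> \<le> smooth_count 1 k z" by (rule count_le_smooth_count) (use k in auto)
      also have "\<dots> \<le> Re (\<phi> 0) + C * exp (- A * z)" using C(2)[of z] by linarith
      finally show ?case .
    qed
  qed simp
  have "Re (\<phi> 0) - count y \<le> (C * exp (A * real k)) * exp (- A * y)" for y
  proof -
    have "smooth_count 1 k (y - real k) \<le> count y" using smooth_count_le_count[of 1 k "y - real k"] k by simp
    hence "Re (\<phi> 0) - count y \<le> C * exp (- A * (y - real k))" using C(2)[of "y - real k"] by linarith
    also have "- A * (y - real k) = A * real k + - A * y" by (simp add: algebra_simps)
    finally show ?thesis by (simp only: exp_add mult.assoc)
  qed
  thus "\<exists>C\<ge>0. \<forall>y. Re (\<phi> 0) - count y \<le> C * exp (- A * y)"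
    using C(1) by (intro exI[of _ "C * exp (A * real k)"]) simp
qed

text \<open>With the tails \<open>r n\<close> of the series, \<open>a n \<le> r n - r (n + 1)\<close> and \<open>\<lambda>\<^sub>n\<^sup>B \<le> (C / r n)\<^bsup>1/2\<^esup>\<close>,
  so that the weighted series is dominated by the telescoping one of \<open>sqrt (r n)\<close>.\<close>

lemma \<phi>_summable_left:
  assumes \<delta>: "delta1 \<phi> = 0" and B: "B > 0" "1 + 2 * B > 2 * (\<Sum>\<nu>=1..d. norm (\<beta> \<nu>))"
  shows "summable (\<lambda>n. a (Suc n) * exp (- ln (l (Suc n)) * (- B)))"
proof -
  \<comment> \<open>The tails are taken with the exponent \<open>2 * B\<close>, since passing to
    square roots halves the decay.\<close>
  have A: "2 * B > 0" using B by simp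
  note tail = count_tail[OF \<delta> A B(2)]
  obtain C where C: "C \<ge> 0" "\<And>y. Re (\<phi> 0) - count y \<le> C * exp (- (2 * B) * y)" using tail(2) by blast
  define r where "r = (\<lambda>n. Re (\<phi> 0) - count (ln (l (Suc n))))"
  have r0: "r n \<ge> 0" for n using tail(1) by (simp add: r_def)
  have ar: "a (Suc n) \<le> r n - r (Suc n)" for n
  proof -
    have lt: "l (Suc n) < l (Suc (Suc n))"
      using l strict_mono_onD[of "{1..}" l "Suc n" "Suc (Suc n)"] by (simp add: frequencies_def)
    define U where "U = (\<lambda>n. {m. 1 \<le> m \<and> l m < l (Suc n)})"
    have fin: "finite (U n)" for n unfolding U_def by (rule finite_frequencies_less[OF l])
    have c: "count (ln (l (Suc n))) = sum a (U n)" for n using l_pos[of n] by (simp add: count_def U_def)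
    have "sum a (U n) + a (Suc n) = sum a (insert (Suc n) (U n))"
      using fin by (subst sum.insert) (auto simp: U_def)
    also have "\<dots> \<le> sum a (U (Suc n))"
    proof (rule sum_mono2[OF fin])
      show "insert (Suc n) (U n) \<subseteq> U (Suc n)" using lt by (auto simp: U_def)
    qed (use a in \<open>auto simp: U_def\<close>)
    finally show ?thesis by (simp add: r_def c)
  qed
  have bound: "a (Suc n) * exp (- ln (l (Suc n)) * (- B)) \<le> 2 * sqrt C * (sqrt (r n) - sqrt (r (Suc n)))" for n
  proof (cases "r n = 0")
    case True
    hence "a (Suc n) = 0" "r (Suc n) = 0" using ar[of n] r0[of "Suc n"] a[of "Suc n"] by auto
    thus ?thesis using True by simp
  next
    case False
    define x where "x = exp (- ln (l (Suc n)) * (- B))"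
    define p where "p = sqrt (r n)"
    define q where "q = sqrt (r (Suc n))"
    have p: "p > 0" using False r0[of n] by (simp add: p_def)
    have q: "q \<ge> 0" using r0 by (simp add: q_def)
    have sq: "r n = p * p" "r (Suc n) = q * q" using r0 by (simp_all add: p_def q_def)
    have "q \<le> p" unfolding p_def q_def using ar[of n] a[of "Suc n"] by simp
    have "x * p \<le> sqrt C"
    proof (rule real_le_rsqrt)
      have "(x * p)\<^sup>2 = exp (2 * B * ln (l (Suc n))) * r n"
        unfolding x_def power2_eq_square sq by (simp add: mult_ac flip: exp_add)
      also have "\<dots> \<le> exp (2 * B * ln (l (Suc n))) * (C * exp (- (2 * B) * ln (l (Suc n))))"
        unfolding r_def by (intro mult_left_mono C) simp
      also have "\<dots> = C" by (simp add: exp_minus)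
      finally show "(x * p)\<^sup>2 \<le> C" .
    qed
    have "a (Suc n) \<le> (p - q) * (p + q)" using ar[of n] unfolding sq by (simp add: algebra_simps)
    also have "\<dots> \<le> (p - q) * (2 * p)" using \<open>q \<le> p\<close> by (intro mult_left_mono) auto
    finally have "a (Suc n) * (x * p) \<le> (p - q) * (2 * p) * sqrt C"
      using \<open>x * p \<le> sqrt C\<close> a[of "Suc n"] p C(1) \<open>q \<le> p\<close>
      by (intro mult_mono) (auto simp: x_def)
    hence "(a (Suc n) * x) * p \<le> (2 * sqrt C * (p - q)) * p" by (simp add: mult_ac)
    thus ?thesis using p unfolding x_def[symmetric] p_def[symmetric] q_def[symmetric] by (simp only: mult_le_cancel_right_pos)
  qed
  show ?thesis
  proof (rule bounded_imp_summable)
    show "0 \<le> a (Suc n) * exp (- ln (l (Suc n)) * (- B))" for n using a by simp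
    fix N
    have "(\<Sum>n\<le>N. a (Suc n) * exp (- ln (l (Suc n)) * (- B))) \<le> (\<Sum>n\<le>N. 2 * sqrt C * (sqrt (r n) - sqrt (r (Suc n))))"
      by (intro sum_mono bound)
    also have "\<dots> = 2 * sqrt C * (sqrt (r 0) - sqrt (r (Suc N)))"
      unfolding sum_distrib_left[symmetric] using sum_telescope[of "\<lambda>n. sqrt (r n)" N] by simp
    also have "\<dots> \<le> 2 * sqrt C * sqrt (r 0)" using C(1) r0 by (intro mult_left_mono) auto
    finally show "(\<Sum>n\<le>N. a (Suc n) * exp (- ln (l (Suc n)) * (- B))) \<le> 2 * sqrt C * sqrt (r 0)" .
  qed
qed

text \<open>The series represents \<open>\<phi>\<close> also on this line, and the moduli of its
  terms do not depend on \<open>t\<close>.\<close>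

lemma \<phi>_bounded_left:
  assumes \<delta>: "delta1 \<phi> = 0" and B: "B > 0" "1 + 2 * B > 2 * (\<Sum>\<nu>=1..d. norm (\<beta> \<nu>))"
  shows "\<exists>S. \<forall>t. norm (\<phi> (Complex (- B) t)) \<le> S"
proof -
  have sum: "summable (\<lambda>n. norm (complex_of_real (a (Suc n))) * exp (- ln (l (Suc n)) * x))" if x: "x > - B - 1" for x
  proof -
    \<comment> \<open>One unit further to the left than the line itself, because the continuation
      lemma works in an open half-plane of convergence.\<close>
    have 1: "summable (\<lambda>n. a (Suc n) * exp (- ln (l (Suc n)) * (- (B + 1))))"
      by (rule \<phi>_summable_left[OF \<delta>]) (use B in auto)
    define y where "y = max x 2"
    have 2: "summable (\<lambda>n. a (Suc n) * exp (- ln (l (Suc n)) * y))" by (rule \<phi>_summable) (simp add: y_def)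
    show ?thesis
    proof (rule summable_comparison_test'[OF summable_add[OF 1 2]])
      fix n
      define L where "L = ln (l (Suc n))"
      have "exp (- L * x) \<le> exp (- L * (- (B + 1))) + exp (- L * y)"
      proof (cases "L \<ge> 0")
        case True
        have "L * (- (B + 1)) \<le> L * x" using True x by (intro mult_left_mono) auto
        hence "exp (- L * x) \<le> exp (- L * (- (B + 1)))" by simp
        thus ?thesis using exp_gt_zero[of "- L * y"] by linarith
      next
        case False
        have "L * y \<le> L * x" using False by (intro mult_left_mono_neg) (auto simp: y_def)
        hence "exp (- L * x) \<le> exp (- L * y)" by simp
        thus ?thesis using exp_gt_zero[of "- L * (- (B + 1))"] by linarith
      qed
      from mult_left_mono[OF this, of "a (Suc n)"] a
      show "norm (norm (complex_of_real (a (Suc n))) * exp (- ln (l (Suc n)) * x)) \<le>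
          a (Suc n) * exp (- ln (l (Suc n)) * (- (B + 1))) + a (Suc n) * exp (- ln (l (Suc n)) * y)"
        by (simp add: L_def distrib_left)
    qed
  qed
  have "norm (\<phi> (Complex (- B) t)) \<le> (\<Sum>n. norm (complex_of_real (a (Suc n))) * exp (- ln (l (Suc n)) * (- B)))" for t
  proof -
    have "\<phi> (Complex (- B) t) = gds (\<lambda>n. of_real (a (Suc n))) (\<lambda>n. - ln (l (Suc n))) (Complex (- B) t)"
      by (rule gds_continuation[OF sum \<phi>_eq \<phi>_hol]) (use B in \<open>auto simp: complex_eq_iff\<close>)
    also have "norm \<dots> \<le> (\<Sum>n. norm (complex_of_real (a (Suc n)) * exp (of_real (- ln (l (Suc n))) * Complex (- B) t)))"
      unfolding gds_def by (rule summable_norm) (use sum[of "- B"] in \<open>simp add: norm_mult\<close>)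
    finally show ?thesis by (simp add: norm_mult)
  qed
  thus ?thesis by blast
qed

text \<open>All frequencies after the first nonzero term are at least \<open>exp v\<close> with
  \<open>v > u\<close>. Compared with abscissa 2, the later terms gain the factor
  \<open>exp (- v * (x - 2))\<close> and the leading one \<open>exp (- u * (x - 2))\<close>, so the
  leading term wins for large x.\<close>

lemma \<psi>_lower_bound:
  assumes m: "b (Suc m) \<noteq> 0" "\<And>n. n < m \<Longrightarrow> b (Suc n) = 0"
  shows "\<exists>x0. \<forall>x\<ge>x0. \<exists>c>0. \<forall>t. c \<le> norm (\<psi> (Complex x t))"
proof -
  define u where "u = ln (\<mu> (Suc m))"
  define v where "v = ln (\<mu> (Suc (Suc m)))"
  have sm: "strict_mono_on {1..} \<mu>" using \<mu> by (simp add: frequencies_def)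
  have "\<mu> (Suc m) < \<mu> (Suc (Suc m))" using strict_mono_onD[OF sm, of "Suc m" "Suc (Suc m)"] by simp
  hence uv: "u < v" using \<mu>_pos by (simp add: u_def v_def)
  define q where "q = (\<lambda>n. norm (b (Suc n)) * exp (- ln (\<mu> (Suc n)) * 2))"
  have q: "summable q" "\<And>n. q n \<ge> 0" unfolding q_def by (rule \<psi>_summable) auto
  define S where "S = suminf q"
  define b0 where "b0 = norm (b (Suc m)) * exp (- u * 2)"
  have b0: "b0 > 0" using m by (simp add: b0_def)
  have S: "S \<ge> 0" unfolding S_def by (rule suminf_nonneg[OF q])
  \<comment> \<open>Makes \<open>(x - 2) * (v - u)\<close> at least \<open>S / b0 + 1\<close>, so
    that its exponential exceeds \<open>S / b0\<close>.\<close>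
  define x0 where "x0 = 2 + (S / b0 + 1) / (v - u)"
  have "\<exists>c>0. \<forall>t. c \<le> norm (\<psi> (Complex x t))" if x: "x \<ge> x0" for x
  proof (intro exI[of _ "b0 * exp (- u * (x - 2)) - exp (- v * (x - 2)) * S"] conjI allI)
    have x2: "x \<ge> 2"
    proof -
      have "0 \<le> (S / b0 + 1) / (v - u)" using S b0 uv by simp
      thus ?thesis using x by (simp add: x0_def)
    qed
    have "(S / b0 + 1) / (v - u) \<le> x - 2" using x by (simp add: x0_def)
    hence "S / b0 + 1 \<le> (x - 2) * (v - u)" using uv by (simp add: pos_divide_le_eq)
    hence "S / b0 < exp ((x - 2) * (v - u))" using exp_ge_add_one_self[of "(x - 2) * (v - u)"] by linarith
    hence "S < b0 * exp ((x - 2) * (v - u))" using b0 by (simp add: pos_divide_less_eq mult.commute)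
    hence "exp (- v * (x - 2)) * S < exp (- v * (x - 2)) * (b0 * exp ((x - 2) * (v - u)))"
      by (rule mult_strict_left_mono) simp
    also have "exp (- v * (x - 2)) * (b0 * exp ((x - 2) * (v - u))) = b0 * (exp (- v * (x - 2)) * exp ((x - 2) * (v - u)))" by simp
    also have "exp (- v * (x - 2)) * exp ((x - 2) * (v - u)) = exp (- u * (x - 2))"
      unfolding exp_add[symmetric] by (simp add: algebra_simps)
    finally show "0 < b0 * exp (- u * (x - 2)) - exp (- v * (x - 2)) * S" by simp
    fix t
    define f where "f = (\<lambda>n. b (Suc n) * exp (of_real (- ln (\<mu> (Suc n))) * Complex x t))"
    have nf: "norm (f n) = norm (b (Suc n)) * exp (- ln (\<mu> (Suc n)) * x)" for n by (simp add: f_def norm_mult)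
    have "summable (\<lambda>n. norm (f n))" unfolding nf by (rule \<psi>_summable) (use x2 in simp)
    hence "summable f" by (rule summable_norm_cancel)
    hence f: "f sums \<psi> (Complex x t)"
      using \<psi>_eq[of "Complex x t"] x2 by (simp add: gds_def f_def summable_sums)
    have "(\<lambda>n. f n - (if n = m then f n else 0)) sums (\<psi> (Complex x t) - f m)"
      by (intro sums_diff f) (rule sums_single)
    hence "norm (\<psi> (Complex x t) - f m) \<le> exp (- v * (x - 2)) * S"
    proof (rule norm_sums_le)
      fix N
      have "norm (f n - (if n = m then f n else 0)) \<le> exp (- v * (x - 2)) * q n" for n
      proof (cases "n \<le> m")
        case True
        hence "f n - (if n = m then f n else 0) = 0" using m(2)[of n] by (auto simp: f_def)
        thus ?thesis using q(2)[of n] by simp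
      next
        case False
        have "\<mu> (Suc (Suc m)) \<le> \<mu> (Suc n)"
          using strict_mono_onD[OF sm, of "Suc (Suc m)" "Suc n"] False by (cases "n = Suc m") auto
        hence "v \<le> ln (\<mu> (Suc n))" using \<mu>_pos by (simp add: v_def)
        hence "v * (x - 2) \<le> ln (\<mu> (Suc n)) * (x - 2)" using x2 by (intro mult_right_mono) auto
        hence "exp (- ln (\<mu> (Suc n)) * (x - 2)) \<le> exp (- v * (x - 2))" by simp
        hence "exp (- ln (\<mu> (Suc n)) * (x - 2)) * q n \<le> exp (- v * (x - 2)) * q n" by (rule mult_right_mono[OF _ q(2)])
        moreover have "exp (- ln (\<mu> (Suc n)) * (x - 2)) * q n = norm (f n)"
        proof -
          have "- ln (\<mu> (Suc n)) * x = - ln (\<mu> (Suc n)) * (x - 2) + - ln (\<mu> (Suc n)) * 2" by (simp add: algebra_simps)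
          thus ?thesis unfolding nf q_def by (simp only: exp_add mult_ac)
        qed
        ultimately show ?thesis using False by simp
      qed
      hence "(\<Sum>n<N. norm (f n - (if n = m then f n else 0))) \<le> (\<Sum>n<N. exp (- v * (x - 2)) * q n)" by (rule sum_mono)
      also have "\<dots> = exp (- v * (x - 2)) * sum q {..<N}" by (simp add: sum_distrib_left)
      also have "\<dots> \<le> exp (- v * (x - 2)) * S"
        unfolding S_def by (intro mult_left_mono sum_le_suminf q) (use q in auto)
      finally show "(\<Sum>n<N. norm (f n - (if n = m then f n else 0))) \<le> exp (- v * (x - 2)) * S" .
    qed
    moreover have "norm (f m) = b0 * exp (- u * (x - 2))"
    proof -
      have "- u * x = - u * 2 + - u * (x - 2)" by (simp add: algebra_simps)
      thus ?thesis unfolding nf u_def[symmetric] b0_def by (simp only: exp_add mult.assoc)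
    qed
    moreover have "norm (f m) \<le> norm (\<psi> (Complex x t)) + norm (\<psi> (Complex x t) - f m)"
      using norm_triangle_ineq4[of "\<psi> (Complex x t)" "\<psi> (Complex x t) - f m"] by simp
    ultimately show "b0 * exp (- u * (x - 2)) - exp (- v * (x - 2)) * S \<le> norm (\<psi> (Complex x t))" by linarith
  qed
  thus ?thesis by blast
qed

lemma b_zero_if_delta1_zero:
  assumes d: "d \<ge> 1" and \<delta>: "delta1 \<phi> = 0"
  shows "b (Suc n) = 0"
proof (rule ccontr)
  assume "b (Suc n) \<noteq> 0"
  define m where "m = (LEAST n. b (Suc n) \<noteq> 0)"
  have m: "b (Suc m) \<noteq> 0" unfolding m_def by (rule LeastI[of "\<lambda>n. b (Suc n) \<noteq> 0", OF \<open>b (Suc n) \<noteq> 0\<close>])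
  have m': "b (Suc i) = 0" if "i < m" for i using not_less_Least[of i "\<lambda>n. b (Suc n) \<noteq> 0"] that by (simp add: m_def)
  obtain x0 where x0: "\<And>x. x \<ge> x0 \<Longrightarrow> \<exists>c>0. \<forall>t. c \<le> norm (\<psi> (Complex x t))" using \<psi>_lower_bound[OF m m'] by blast
  \<comment> \<open>Large enough for the lower bound on \<open>\<psi>\<close> to hold at abscissa
    \<open>1 + B\<close>, and for the line \<open>Re s = - B\<close> to lie left of all poles of the
    Gamma quotient.\<close>
  define B where "B = max x0 (2 * (\<Sum>\<nu>=1..d. norm (\<beta> \<nu>))) + 1"
  have sn: "0 \<le> 2 * (\<Sum>\<nu>=1..d. norm (\<beta> \<nu>))" by (simp add: sum_nonneg)
  have B: "B > 0" "B > 2 * (\<Sum>\<nu>=1..d. norm (\<beta> \<nu>))" "x0 \<le> 1 + B" using sn by (auto simp: B_def)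
  obtain c where c: "c > 0" "\<And>t. c \<le> norm (\<psi> (Complex (1 + B) t))" using x0[OF B(3)] by blast
  have B2: "1 + 2 * B > 2 * (\<Sum>\<nu>=1..d. norm (\<beta> \<nu>))" using B by linarith
  obtain S where S: "\<And>t. norm (\<phi> (Complex (- B) t)) \<le> S" using \<phi>_bounded_left[OF \<delta> B(1) B2] by blast
  obtain M R where MR: "M \<ge> 1" "R \<ge> 2"
    "\<And>\<sigma> t. \<bar>\<sigma>\<bar> \<le> B \<Longrightarrow> \<bar>t\<bar> \<ge> R \<Longrightarrow> \<bar>t\<bar> powr (real d * (1/2 - \<sigma>)) \<le> M * norm (gamma_quot d \<beta> (Complex \<sigma> t))"
    using norm_gamma_quot_bounds[of B d \<beta>] by blast
  define \<alpha> where "\<alpha> = real d * (1/2 + B)"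
  have \<alpha>: "\<alpha> > 0" using d B by (simp add: \<alpha>_def)
  have bound: "c * t powr \<alpha> \<le> M * S" if t: "t \<ge> R" for t
  proof -
    define s where "s = Complex (- B) t"
    have "\<phi> s = gamma_quot d \<beta> s * \<psi> (1 - s)"
    proof (rule gamma_quot_functional_equation[OF FE p\<phi> p\<psi>])
      show "gamma_factor d \<beta> (1 - s) \<noteq> 0" by (rule gamma_factor_nonzero_right) (use B in \<open>simp add: s_def\<close>)
      have "Re s < 0" using B by (simp add: s_def)
      thus "s \<noteq> 0" "s \<noteq> 1" by auto
    qed
    moreover have "1 - s = Complex (1 + B) (- t)" by (simp add: s_def complex_eq_iff)
    ultimately have eq: "norm (\<phi> s) = norm (gamma_quot d \<beta> s) * norm (\<psi> (Complex (1 + B) (- t)))" by (simp add: norm_mult)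
    have "t powr \<alpha> \<le> M * norm (gamma_quot d \<beta> s)"
      using MR(3)[of "- B" t] t MR(2) B(1) by (simp add: \<alpha>_def s_def)
    hence "t powr \<alpha> * c \<le> (M * norm (gamma_quot d \<beta> s)) * norm (\<psi> (Complex (1 + B) (- t)))"
      using c MR(1) by (intro mult_mono) auto
    also have "\<dots> = M * norm (\<phi> s)" by (simp add: eq)
    also have "\<dots> \<le> M * S" using S[of t] MR(1) by (intro mult_left_mono) (auto simp: s_def)
    finally show ?thesis by (simp add: mult.commute)
  qed
  have "filterlim (\<lambda>t. t powr \<alpha>) at_top at_top"
  proof (rule filterlim_at_top_mono[OF filterlim_compose[OF exp_at_top filterlim_tendsto_pos_mult_at_top[OF tendsto_const \<alpha> ln_at_top]]])
    show "eventually (\<lambda>t. exp (\<alpha> * ln t) \<le> t powr \<alpha>) at_top"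
      using eventually_gt_at_top[of 0] by eventually_elim (simp add: powr_def)
  qed
  hence "eventually (\<lambda>t. t powr \<alpha> > M * S / c) at_top" by (simp add: filterlim_at_top_dense)
  from eventually_happens'[OF _ eventually_conj[OF this eventually_ge_at_top[of R]]]
  obtain t where t: "M * S / c < t powr \<alpha>" "t \<ge> R" by auto
  from t(1) have "M * S < c * t powr \<alpha>" using c by (simp add: pos_divide_less_eq mult.commute)
  with bound[OF t(2)] show False by simp
qed

text \<open>Both cases lead through the vanishing of \<open>b\<close>: directly if the means vanish,
  by the growth argument if the residue does.\<close>

theorem degenerate_case:
  assumes "d \<ge> 1" "delta1 \<phi> = 0 \<or> dhat = 0"
  shows "delta1 \<phi> = 0" "n \<ge> 1 \<Longrightarrow> a n = 0"
proof -
  have b: "b (Suc n) = 0" for n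
    using assms b_zero_if_dhat_zero b_zero_if_delta1_zero by blast
  show "delta1 \<phi> = 0" by (rule vanishing_if_b_zero(2)[OF b])
  show "a n = 0" if "n \<ge> 1" using vanishing_if_b_zero(1)[OF b, of "n - 1"] that by simp
qed

end

text \<open>The constants are fixed from d and \<beta> before any pair of series is introduced,
  first for positive residue and positive mean. For degenerate pairs the left-hand side is
  0.\<close>

theorem theorem2:
  fixes d :: nat and \<beta> :: "nat \<Rightarrow> complex" and \<sigma>\<^sub>\<psi> :: real
  assumes "d \<ge> 2"
  shows "\<exists>C>0. \<forall>(a :: nat \<Rightarrow> real) (b :: nat \<Rightarrow> complex) (l :: nat \<Rightarrow> real) (\<mu> :: nat \<Rightarrow> real)
           (\<phi> :: complex \<Rightarrow> complex) (\<psi> :: complex \<Rightarrow> complex).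
           frequencies l \<and> frequencies \<mu> \<and> (\<forall>n\<ge>1. 0 \<le> a n) \<and>
           abs_conv_dirichlet \<phi> (\<lambda>n. of_real (a n)) l 1 \<and>
           abs_conv_dirichlet \<psi> b \<mu> \<sigma>\<^sub>\<psi> \<and>
           functional_equation d \<beta> \<phi> \<psi> \<and>
           at_most_simple_pole_at_1 \<phi> \<and> at_most_simple_pole_at_1 \<psi> \<and>
           bdd_above (mean_abs b \<mu> ` {0<..})
           \<longrightarrow> (\<forall>X>0. error_term d (delta1 \<phi>) (delta_hat b \<mu>) X \<le> delta1 \<phi> * X \<longrightarrow>
                 \<bar>(\<Sum>n | 1 \<le> n \<and> l n < X. a n) - delta1 \<phi> * X\<bar>
                   \<le> C * error_term d (delta1 \<phi>) (delta_hat b \<mu>) X)"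
proof -
  have "\<exists>C\<ge>0. \<forall>a b l \<mu> \<phi> \<psi> X. dirichlet_pair d \<beta> \<sigma>\<^sub>\<psi> a b l \<mu> \<phi> \<psi> \<longrightarrow> delta1 \<phi> > 0 \<longrightarrow> delta_hat b \<mu> > 0 \<longrightarrow> X > 0 \<longrightarrow>
      error_term d (delta1 \<phi>) (delta_hat b \<mu>) X \<le> delta1 \<phi> * X \<longrightarrow>
      \<bar>(\<Sum>n | 1 \<le> n \<and> l n < X. a n) - delta1 \<phi> * X\<bar> \<le> C * error_term d (delta1 \<phi>) (delta_hat b \<mu>) X"
  proof (cases "(gamma_quot d \<beta> \<longlongrightarrow> 0) (at 0)")
    case False
    \<comment> \<open>If \<open>gamma_quot\<close> does not tend to 0 at 0, no pair has a positive
      residue, and any constant will do.\<close>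
    have "\<not> dirichlet_pair d \<beta> \<sigma>\<^sub>\<psi> a b l \<mu> \<phi> \<psi>" if "delta1 \<phi> > 0" for a b l \<mu> \<phi> \<psi>
    proof
      assume "dirichlet_pair d \<beta> \<sigma>\<^sub>\<psi> a b l \<mu> \<phi> \<psi>"
      from dirichlet_pair.gamma_quot_tendsto_0[OF this] that False show False by simp
    qed
    thus ?thesis by (intro exI[of _ 0] conjI allI impI order_refl) simp
  next
    case zero: True
    obtain \<eta>' where \<eta>': "\<eta>' > 0" and poles: "\<And>\<nu> s. \<nu> \<in> {1..d} \<Longrightarrow> (1 - s) / 2 + \<beta> \<nu> \<in> \<int>\<^sub>\<le>\<^sub>0 \<Longrightarrow> Re s = 0 \<or> \<bar>Re s\<bar> > \<eta>'"
      using gamma_quot_pole_free_strip[of d \<beta>] by blast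
    obtain C0 where near: "eventually (\<lambda>s. norm (gamma_quot d \<beta> s) \<le> C0 * norm s) (at 0)"
      using gamma_quot_near_0[OF zero] by blast
    \<comment> \<open>\<open>\<eta>' / 2\<close> stays strictly inside the pole-free strip;
      \<open>1 / (4 * d)\<close> is the bound required in
      \<open>twisted_kernel_bound\<close>.\<close>
    define \<eta> where "\<eta> = min (\<eta>' / 2) (1 / (4 * real d))"
    \<comment> \<open>Since \<open>1/2 + \<eta> \<le> 1\<close>, this is at least
      \<open>d * (1/2 + \<eta>) + 1\<close>, the decay that the kernel must have on the
      lines.\<close>
    define k where "k = d + 2"
    have \<eta>: "0 < \<eta>" "\<eta> < \<eta>'" "\<eta> \<le> 1 / (4 * real d)" using \<eta>' assms by (auto simp: \<eta>_def)
    have "1 / (4 * real d) \<le> 1 / 8" using assms by simp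
    hence \<eta>1: "\<eta> \<le> 1" "1/2 + \<eta> \<le> 1" using \<eta>(3) by linarith+
    have "real d * (1/2 + \<eta>) \<le> real d * 1" using \<eta>1 by (intro mult_left_mono) auto
    hence k: "real d * (1/2 + \<eta>) + 1 \<le> real k" "k \<ge> 1" by (auto simp: k_def)
    define N where "N = (\<lambda>T y. norm (LINT t|lborel. exp (of_real y * Complex (-\<eta>) t) * (exp_mult (twist_list \<beta> d) (Complex (-\<eta>) t) * (gamma_quot d \<beta> (Complex (-\<eta>) t) * (mexp (Complex (-\<eta>) t / of_real T) ^ k / Complex (-\<eta>) t)))))"
    have "\<exists>C\<ge>0. \<forall>T y. T \<ge> 1 \<longrightarrow> N T y
        \<le> C * T powr ((real d - 1) / 2) * min (exp (\<eta> * (y - real d * ln T))) (exp (- \<eta> * (y - real d * ln T)))"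
      unfolding N_def by (rule twisted_kernel_bound[OF assms \<eta> k(1) poles zero])
    then obtain C1 where C1: "C1 \<ge> 0" "\<And>T y. T \<ge> 1 \<Longrightarrow> N T y
        \<le> C1 * T powr ((real d - 1) / 2) * min (exp (\<eta> * (y - real d * ln T))) (exp (- \<eta> * (y - real d * ln T)))"
      by blast
    define \<tau>s where "\<tau>s = twist_list \<beta> d"
    define C where "C = 6 * C1 / (1 - 2 powr - \<eta>) + 24 * \<bar>C0\<bar> * 2 ^ length \<tau>s"
    define p where "p = (\<Prod>\<tau>\<leftarrow>\<tau>s. exp \<tau> + 1)"
    define C' where "C' = p * real k * exp (real k) + C"
    define \<kappa> where "\<kappa> = (real d - 1) / (real d + 1)"
    have "2 powr - \<eta> \<le> (1::real)" using powr_mono[of "-\<eta>" 0 "2::real"] \<eta> by simp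
    hence C: "C \<ge> 0" using C1(1) by (simp add: C_def)
    have p: "p \<ge> 0" unfolding p_def by (rule prod_list_nonneg) auto
    have "\<kappa> > 0" using assms by (simp add: \<kappa>_def)
    have "C' \<ge> 0" using p C by (simp add: C'_def)
    hence C': "C' \<ge> 0" "p + C' + 1 \<ge> 0" using p by auto
    have \<tau>pos: "\<forall>\<tau>\<in>set \<tau>s. \<tau> > 0" unfolding \<tau>s_def by (intro ballI twist_list_pos)
    from shift_sum_inversion[OF \<tau>pos \<open>\<kappa> > 0\<close> C'(2,1)] obtain K where K: "K \<ge> 0"
      "\<forall>(g :: real \<Rightarrow> real) y0 D. D \<ge> 0 \<longrightarrow> (\<forall>y\<ge>y0. \<bar>g y\<bar> \<le> (p + C' + 1) * D * exp (y - y0)) \<longrightarrow>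
        (\<forall>y\<ge>y0. \<bar>shift_sum \<tau>s g y\<bar> \<le> C' * (D * exp (\<kappa> * (y - y0)))) \<longrightarrow> (\<forall>y\<ge>y0. \<bar>g y\<bar> \<le> K * (D * exp (\<kappa> * (y - y0))))"
      by (elim exE conjE) (rule that, assumption+)
    show ?thesis
    proof (intro exI[of _ K] conjI K(1) allI impI)
      fix a b l \<mu> \<phi> \<psi> X
      assume "dirichlet_pair d \<beta> \<sigma>\<^sub>\<psi> a b l \<mu> \<phi> \<psi>" and pos: "delta1 \<phi> > 0" "delta_hat b \<mu> > 0"
        and X: "X > 0" "error_term d (delta1 \<phi>) (delta_hat b \<mu>) X \<le> delta1 \<phi> * X"
      then interpret dirichlet_pair d \<beta> \<sigma>\<^sub>\<psi> a b l \<mu> \<phi> \<psi> by blast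
      show "\<bar>(\<Sum>n | 1 \<le> n \<and> l n < X. a n) - delta1 \<phi> * X\<bar> \<le> K * error_term d (delta1 \<phi>) (delta_hat b \<mu>) X"
      proof (rule count_estimate[OF _ k(2) p_def C _ \<kappa>_def C'_def K(2) pos X])
        show "d \<ge> 1" using assms by simp
        show "\<bar>shift_sum \<tau>s (smooth_count (1 / T) k) y - delta1 \<phi> * exp y * p * ((exp (1 / T) - 1) * T) ^ k\<bar>
            \<le> C * delta_hat b \<mu> * T powr ((real d - 1) / 2)" if T: "T \<ge> 1" for T y
          unfolding C_def p_def \<tau>s_def by (rule smoothed_estimate[OF assms \<eta>(1,2) \<eta>1(1) k(1) poles zero near C1[unfolded N_def] T])
      qed
    qed
  qed
  then obtain C where C: "C \<ge> 0" "\<And>a b l \<mu> \<phi> \<psi> X. dirichlet_pair d \<beta> \<sigma>\<^sub>\<psi> a b l \<mu> \<phi> \<psi> \<Longrightarrow> delta1 \<phi> > 0 \<Longrightarrow> delta_hat b \<mu> > 0 \<Longrightarrow> X > 0 \<Longrightarrow>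
      error_term d (delta1 \<phi>) (delta_hat b \<mu>) X \<le> delta1 \<phi> * X \<Longrightarrow>
      \<bar>(\<Sum>n | 1 \<le> n \<and> l n < X. a n) - delta1 \<phi> * X\<bar> \<le> C * error_term d (delta1 \<phi>) (delta_hat b \<mu>) X"
    by blast
  show ?thesis
  \<comment> \<open>\<open>C\<close> may be 0, as in the vacuous case, while the constant of the
    statement has to be positive.\<close>
  proof (intro exI[of _ "C + 1"] conjI allI impI)
    show "C + 1 > 0" using C(1) by simp
  next
    fix a :: "nat \<Rightarrow> real" and b :: "nat \<Rightarrow> complex" and l \<mu> :: "nat \<Rightarrow> real" and \<phi> \<psi> :: "complex \<Rightarrow> complex" and X :: real
    assume H: "frequencies l \<and> frequencies \<mu> \<and> (\<forall>n\<ge>1. 0 \<le> a n) \<and>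
           abs_conv_dirichlet \<phi> (\<lambda>n. of_real (a n)) l 1 \<and>
           abs_conv_dirichlet \<psi> b \<mu> \<sigma>\<^sub>\<psi> \<and>
           functional_equation d \<beta> \<phi> \<psi> \<and>
           at_most_simple_pole_at_1 \<phi> \<and> at_most_simple_pole_at_1 \<psi> \<and>
           bdd_above (mean_abs b \<mu> ` {0<..})"
      and X: "X > 0" "error_term d (delta1 \<phi>) (delta_hat b \<mu>) X \<le> delta1 \<phi> * X"
    have dp: "dirichlet_pair d \<beta> \<sigma>\<^sub>\<psi> a b l \<mu> \<phi> \<psi>" by (rule dirichlet_pair.intro) (use H in \<open>blast | simp\<close>)+
    then interpret dirichlet_pair d \<beta> \<sigma>\<^sub>\<psi> a b l \<mu> \<phi> \<psi> .
    have err: "error_term d (delta1 \<phi>) (delta_hat b \<mu>) X \<ge> 0" by (simp add: error_term_def)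
    show "\<bar>(\<Sum>n | 1 \<le> n \<and> l n < X. a n) - delta1 \<phi> * X\<bar> \<le> (C + 1) * error_term d (delta1 \<phi>) (delta_hat b \<mu>) X"
    proof (cases "delta1 \<phi> = 0 \<or> delta_hat b \<mu> = 0")
      case True
      have "d \<ge> 1" using assms by simp
      note z = degenerate_case[OF this True]
      have "(\<Sum>n | 1 \<le> n \<and> l n < X. a n) = 0" by (rule sum.neutral) (use z(2) in auto)
      thus ?thesis using z(1) C(1) err by simp
    next
      case False
      have "\<bar>(\<Sum>n | 1 \<le> n \<and> l n < X. a n) - delta1 \<phi> * X\<bar> \<le> C * error_term d (delta1 \<phi>) (delta_hat b \<mu>) X"
        using False delta1_nonneg dhat_nonneg by (intro C(2)[OF dp _ _ X]) auto
      also have "\<dots> \<le> (C + 1) * error_term d (delta1 \<phi>) (delta_hat b \<mu>) X" using err by (intro mult_right_mono) auto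
      finally show ?thesis .
    qed
  qed
qed

end
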